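(* Let $T$ be any (fixed) tree with at least two edges. Then $T$-free Edge Deletion is NP-complete. Furthermore, $T$-free Edge Deletion is not solvable in time $2^{o(k)}\cdot |G|^{O(1)}$, unless the Exponential Time Hypothesis fails.
   Context: All graphs are simple, finite and undirected. For a fixed graph $H$, the problem $H$-free Edge Deletion is: given $(G,k)$ with $G$ a graph and $k$ a nonnegative integer (the parameter), decide whether there exists a set $F$ of at most $k$ edges of $G$ such that $G-F=(V(G),E(G)\setminus F)$ has no induced subgraph isomorphic to $H$. $|G|$ denotes $|V(G)|+|E(G)|$. The Exponential Time Hypothesis (ETH) is the assumption that 3-SAT cannot be solved in time $2^{o(n)}$, where $n$ is the number of variables. *)

theory Defs
  imports
    Complex_Main
    "HOL-Library.Landau_Symbols"
    "HOL-Computational_Algebra.Polynomial"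
begin

section \<open>Simple graphs\<close>

record 'a graph =
  verts :: "'a set"
  edges :: "'a set set"

definition simple_graph :: "'a graph \<Rightarrow> bool" where
  "simple_graph G \<longleftrightarrow> finite (verts G) \<and> (\<forall>e \<in> edges G. e \<subseteq> verts G \<and> card e = 2)"

definition graph_size :: "'a graph \<Rightarrow> nat" where
  "graph_size G = card (verts G) + card (edges G)"

definition adj :: "'a graph \<Rightarrow> 'a \<Rightarrow> 'a \<Rightarrow> bool" where
  "adj G u v \<longleftrightarrow> {u, v} \<in> edges G"

definition graph_iso :: "'a graph \<Rightarrow> 'b graph \<Rightarrow> bool" where
  "graph_iso G H \<longleftrightarrow>
     (\<exists>f. bij_betw f (verts G) (verts H) \<and>
          (\<forall>u \<in> verts G. \<forall>v \<in> verts G. adj G u v \<longleftrightarrow> adj H (f u) (f v)))"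

definition induced :: "'a graph \<Rightarrow> 'a set \<Rightarrow> 'a graph" where
  "induced G S = \<lparr>verts = S, edges = {e \<in> edges G. e \<subseteq> S}\<rparr>"

definition induced_free :: "'h graph \<Rightarrow> 'a graph \<Rightarrow> bool" where
  "induced_free H G \<longleftrightarrow> \<not> (\<exists>S \<subseteq> verts G. graph_iso H (induced G S))"

definition delete_edges :: "'a graph \<Rightarrow> 'a set set \<Rightarrow> 'a graph" where
  "delete_edges G F = \<lparr>verts = verts G, edges = edges G - F\<rparr>"

definition connected_graph :: "'a graph \<Rightarrow> bool" where
  "connected_graph G \<longleftrightarrow>
     verts G \<noteq> {} \<and> (\<forall>u \<in> verts G. \<forall>v \<in> verts G. (adj G)\<^sup>*\<^sup>* u v)"

definition is_cycle :: "'a graph \<Rightarrow> 'a list \<Rightarrow> bool" where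
  "is_cycle G c \<longleftrightarrow>
     3 \<le> length c \<and> distinct c \<and> set c \<subseteq> verts G \<and>
     successively (adj G) c \<and> adj G (last c) (hd c)"

definition is_tree :: "'a graph \<Rightarrow> bool" where
  "is_tree G \<longleftrightarrow> simple_graph G \<and> connected_graph G \<and> (\<nexists>c. is_cycle G c)"

text \<open>The question asked by the edge deletion problem for \<open>H\<close> on the instance \<open>(G, k)\<close>.\<close>

definition edge_deletable :: "'h graph \<Rightarrow> 'a graph \<Rightarrow> nat \<Rightarrow> bool" where
  "edge_deletable H G k \<longleftrightarrow>
     (\<exists>F \<subseteq> edges G. card F \<le> k \<and> induced_free H (delete_edges G F))"


section \<open>Machine model\<close>

text \<open>
  The random access machine of Cook and Reckhow (1973) over the natural numbers (so \<open>Sub\<close>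
  truncates), with unit cost per instruction.  Since there is no multiplication, numbers gain at
  most one bit per step, and the model is polynomially equivalent to multitape Turing machines.
  \<open>Jump i l\<close> jumps to \<open>l\<close> if register \<open>i\<close> is positive.
  \<open>Read\<close> consumes the next input bit and stores 0 or 1, or stores 2 when the input is exhausted.
  \<open>Print\<close> appends a bit to the output.  The machine halts when the program counter
  leaves the program.
\<close>

datatype instr =
    Const nat nat
  | Add nat nat nat
  | Sub nat nat nat
  | Load nat nat
  | Store nat nat
  | Jump nat nat
  | Read nat
  | Print nat

type_synonym program = "instr list"

record config =
  pc :: nat
  regs :: "nat \<Rightarrow> nat"
  inp :: "bool list"
  outp :: "bool list"

fun exec :: "instr \<Rightarrow> config \<Rightarrow> config" where
  "exec (Const i n) c = c\<lparr>pc := Suc (pc c), regs := (regs c)(i := n)\<rparr>"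
| "exec (Add i j k) c = c\<lparr>pc := Suc (pc c), regs := (regs c)(i := regs c j + regs c k)\<rparr>"
| "exec (Sub i j k) c = c\<lparr>pc := Suc (pc c), regs := (regs c)(i := regs c j - regs c k)\<rparr>"
| "exec (Load i j) c = c\<lparr>pc := Suc (pc c), regs := (regs c)(i := regs c (regs c j))\<rparr>"
| "exec (Store i j) c = c\<lparr>pc := Suc (pc c), regs := (regs c)(regs c i := regs c j)\<rparr>"
| "exec (Jump i l) c = c\<lparr>pc := (if regs c i > 0 then l else Suc (pc c))\<rparr>"
| "exec (Read i) c =
     (case inp c of
        [] \<Rightarrow> c\<lparr>pc := Suc (pc c), regs := (regs c)(i := 2)\<rparr>
      | b # bs \<Rightarrow> c\<lparr>pc := Suc (pc c), regs := (regs c)(i := of_bool b), inp := bs\<rparr>)"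
| "exec (Print i) c = c\<lparr>pc := Suc (pc c), outp := outp c @ [regs c i > 0]\<rparr>"

definition halted :: "program \<Rightarrow> config \<Rightarrow> bool" where
  "halted p c \<longleftrightarrow> length p \<le> pc c"

definition step :: "program \<Rightarrow> config \<Rightarrow> config" where
  "step p c = (if halted p c then c else exec (p ! pc c) c)"

definition init_config :: "bool list \<Rightarrow> config" where
  "init_config x = \<lparr>pc = 0, regs = (\<lambda>_. 0), inp = x, outp = []\<rparr>"

text \<open>Started on input \<open>x\<close>, program \<open>p\<close> halts with output \<open>y\<close> after at most \<open>t\<close> steps.\<close>

definition computes_in :: "program \<Rightarrow> bool list \<Rightarrow> nat \<Rightarrow> bool list \<Rightarrow> bool" where
  "computes_in p x t y \<longleftrightarrow>
     halted p ((step p ^^ t) (init_config x)) \<and> outp ((step p ^^ t) (init_config x)) = y"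


section \<open>NP-completeness\<close>

definition polytime_computable :: "(bool list \<Rightarrow> bool list) \<Rightarrow> bool" where
  "polytime_computable f \<longleftrightarrow>
     (\<exists>p (q :: nat poly). \<forall>x. computes_in p x (poly q (length x)) (f x))"

definition polytime_decidable :: "bool list set \<Rightarrow> bool" where
  "polytime_decidable L \<longleftrightarrow> polytime_computable (\<lambda>x. [x \<in> L])"

text \<open>Every bit of the first word is preceded by \<open>True\<close>; \<open>False\<close> separates the two words.\<close>

definition enc_pair :: "bool list \<Rightarrow> bool list \<Rightarrow> bool list" where
  "enc_pair x w = concat (map (\<lambda>b. [True, b]) x) @ [False] @ w"

definition in_NP :: "bool list set \<Rightarrow> bool" where
  "in_NP L \<longleftrightarrow>
     (\<exists>V (q :: nat poly). polytime_decidable V \<and>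
        (\<forall>x. x \<in> L \<longleftrightarrow> (\<exists>w. length w \<le> poly q (length x) \<and> enc_pair x w \<in> V)))"

definition polytime_reducible :: "bool list set \<Rightarrow> bool list set \<Rightarrow> bool" where
  "polytime_reducible A B \<longleftrightarrow> (\<exists>f. polytime_computable f \<and> (\<forall>x. x \<in> A \<longleftrightarrow> f x \<in> B))"

definition NP_complete :: "bool list set \<Rightarrow> bool" where
  "NP_complete L \<longleftrightarrow> in_NP L \<and> (\<forall>A. in_NP A \<longrightarrow> polytime_reducible A L)"


section \<open>Encoding of instances\<close>

text \<open>
  Binary, least significant bit first and self-delimiting: every bit is preceded by \<open>True\<close>, and
  \<open>False\<close> ends the number.
\<close>

fun enc_nat :: "nat \<Rightarrow> bool list" where
  "enc_nat n = (if n = 0 then [False] else True # odd n # enc_nat (n div 2))"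

declare enc_nat.simps [simp del]

text \<open>
  Instances are graphs whose vertices are numbered \<open>0, \<dots>, n - 1\<close>, given by \<open>n\<close> and the adjacency
  matrix.
\<close>

definition numbered_graph :: "nat graph \<Rightarrow> bool" where
  "numbered_graph G \<longleftrightarrow> simple_graph G \<and> (\<exists>n. verts G = {..<n})"

definition enc_graph :: "nat graph \<Rightarrow> bool list" where
  "enc_graph G =
     (let n = card (verts G)
      in enc_nat n @ concat (map (\<lambda>i. map (\<lambda>j. adj G i j) [0..<n]) [0..<n]))"

definition enc_instance :: "nat graph \<Rightarrow> nat \<Rightarrow> bool list" where
  "enc_instance G k = enc_graph G @ enc_nat k"

definition free_edge_deletion :: "'h graph \<Rightarrow> bool list set" where
  "free_edge_deletion H = {enc_instance G k | G k. numbered_graph G \<and> edge_deletable H G k}"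

lemma enc_nat_prefix_free:
  "enc_nat m @ xs = enc_nat n @ ys \<longleftrightarrow> m = n \<and> xs = ys"
proof (induction m arbitrary: n rule: less_induct)
  case (less m)
  show ?case
  proof (cases "m = 0 \<or> n = 0")
    case True
    then show ?thesis by (auto simp: enc_nat.simps[of m] enc_nat.simps[of n])
  next
    case False
    have "m = n \<longleftrightarrow> odd m = odd n \<and> m div 2 = n div 2"
      by presburger
    with False less.IH[of "m div 2" "n div 2"] show ?thesis
      by (auto simp: enc_nat.simps[of m] enc_nat.simps[of n])
  qed
qed

lemma concat_rows_eq:
  assumes "length is = length js" "\<And>i. length (f i) = n" "\<And>i. length (g i) = n"
    and "concat (map f is) @ xs = concat (map g js) @ ys"
  shows "map f is = map g js \<and> xs = ys"
  using assms by (induction "is" js rule: list_induct2) auto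

lemma enc_instance_inject:
  assumes G: "numbered_graph G" and H: "numbered_graph H"
    and eq: "enc_instance G k = enc_instance H l"
  shows "G = H \<and> k = l"
proof -
  obtain m where m: "verts G = {..<m}" using G by (auto simp: numbered_graph_def)
  obtain n where n: "verts H = {..<n}" using H by (auto simp: numbered_graph_def)
  have mn: "m = n"
    using eq by (simp add: enc_instance_def enc_graph_def m n enc_nat_prefix_free)
  have rows: "map (\<lambda>i. map (\<lambda>j. adj G i j) [0..<n]) [0..<n] =
              map (\<lambda>i. map (\<lambda>j. adj H i j) [0..<n]) [0..<n] \<and> enc_nat k = enc_nat l"
    using eq by (intro concat_rows_eq[where n = n])
      (simp_all add: enc_instance_def enc_graph_def m n mn enc_nat_prefix_free)
  have adj: "adj G i j = adj H i j" if "i < n" "j < n" for i j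
    using rows that by auto
  have sub: "edges A \<subseteq> edges B"
    if AB: "numbered_graph A" "verts A = {..<n}" "\<And>i j. i < n \<Longrightarrow> j < n \<Longrightarrow> adj A i j = adj B i j"
    for A B :: "nat graph"
  proof
    fix e assume e: "e \<in> edges A"
    then obtain i j where "e = {i, j}" "i < n" "j < n"
      using AB(1,2) by (force simp: numbered_graph_def simple_graph_def card_2_iff)
    then show "e \<in> edges B" using AB(3) e by (auto simp: adj_def)
  qed
  have "edges G = edges H"
    using sub[of G H] sub[of H G] adj G H m n mn by auto
  moreover have "k = l" using rows enc_nat_prefix_free[of k "[]" l "[]"] by simp
  ultimately show ?thesis using m n mn by simp
qed


section \<open>Subexponential time and the Exponential Time Hypothesis\<close>

definition subexp_solvable :: "'h graph \<Rightarrow> bool" where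
  "subexp_solvable H \<longleftrightarrow>
     (\<exists>p (f :: nat \<Rightarrow> real) (q :: nat poly).
        f \<in> o(\<lambda>k. real k) \<and>
        (\<forall>G k. numbered_graph G \<longrightarrow>
           (\<exists>t. real t \<le> 2 powr f k * real (poly q (graph_size G)) \<and>
                computes_in p (enc_instance G k) t [edge_deletable H G k])))"

text \<open>A literal is a variable together with the truth value that satisfies it.\<close>

type_synonym literal = "nat \<times> bool"
type_synonym clause = "literal list"

definition satisfiable :: "clause list \<Rightarrow> bool" where
  "satisfiable \<phi> \<longleftrightarrow> (\<exists>\<alpha> :: nat \<Rightarrow> bool. \<forall>C \<in> set \<phi>. \<exists>(x, b) \<in> set C. \<alpha> x = b)"

text \<open>
  Formulas over the variables \<open>0, \<dots>, n - 1\<close>.  Clauses must not be repeated: otherwise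
  the length of the input would not be bounded in terms of \<open>n\<close>, and no machine could meet a
  time bound in \<open>n\<close> alone.
\<close>

definition cnf3 :: "nat \<Rightarrow> clause list \<Rightarrow> bool" where
  "cnf3 n \<phi> \<longleftrightarrow> distinct \<phi> \<and> (\<forall>C \<in> set \<phi>. length C \<le> 3 \<and> fst ` set C \<subseteq> {..<n})"

definition enc_literal :: "literal \<Rightarrow> bool list" where
  "enc_literal = (\<lambda>(x, b). b # enc_nat x)"

definition enc_list :: "('a \<Rightarrow> bool list) \<Rightarrow> 'a list \<Rightarrow> bool list" where
  "enc_list e xs = concat (map (\<lambda>x. True # e x) xs) @ [False]"

definition enc_cnf :: "nat \<Rightarrow> clause list \<Rightarrow> bool list" where
  "enc_cnf n \<phi> = enc_nat n @ enc_list (enc_list enc_literal) \<phi>"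

definition ETH :: bool where
  "ETH \<longleftrightarrow>
     \<not> (\<exists>p (f :: nat \<Rightarrow> real).
          f \<in> o(\<lambda>n. real n) \<and>
          (\<forall>n \<phi>. cnf3 n \<phi> \<longrightarrow>
             (\<exists>t. real t \<le> 2 powr f n \<and> computes_in p (enc_cnf n \<phi>) t [satisfiable \<phi>])))"

end

theory Submission
  imports Defs "HOL-Real_Asymp.Real_Asymp"
begin

text \<open>
Membership in NP guesses the deleted edges.  For hardness, a tableau of a verifier on the random access
machine is turned into a 3-CNF formula.  Removing the leaves of \<open>T\<close> gives a smaller tree, and attaching cliques
to the vertices of an instance for the smaller tree gives an instance for \<open>T\<close>.  This reduces the problem to
stars, where the question becomes cluster edge deletion, and to double stars; for both there are gadgets built
from a formula in which every variable occurs at most \<open>L\<close> times, with \<open>k\<close> linear in the size of the formula for fixed \<open>L\<close>.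

For the lower bound, the sparsification lemma writes a 3-CNF formula on \<open>n\<close> variables as a disjunction
of \<open>2 powr O(n / i)\<close> formulas whose occurrences are bounded in terms of \<open>i\<close>.  An algorithm running in time \<open>2 powr o(k)\<close>
decides each of them in time \<open>2 powr o(n)\<close>.  Trying all levels \<open>i\<close> with increasing time budgets decides the formula
in time \<open>2 powr o(n)\<close>.
\<close>

section \<open>The random access machine\<close>

text \<open>The lower bound dictates the form of the reductions: the parameter may exceed the number
  of variables and clauses only by a factor depending on \<open>L\<close>. Stripping leaves respects
  this because it does not change the parameter at all: a clique with more than \<open>k\<close>
  vertices cannot be cut off, so nothing has to be paid for it. The recursion stops at one or two
  inner vertices, where stripping once more would leave at most one edge; there some leaves, but not
  all, are provided for free. Both gadgets are analysed through the kept edges. Every vertex pays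
  for the edges to one side of it, which gives a local upper bound, and the sum of these bounds can
  be reached only by graphs that spell out a satisfying assignment. \<open>ETH\<close> excludes
  every function \<open>f\<close> in o(n), computable or not, so the right level of sparsification
  cannot be computed from \<open>n\<close>. What helps is that an answer obtained within any budget
  is correct; one may simply wait for the first answer. Running times are never computed for machine
  programs by hand: a small language of combinators is compiled once, and polynomial time is handled
  by closure rules.\<close>

datatype val = Nl | Cn val val

fun vsize :: "val => nat" where
 "vsize Nl = 1"
| "vsize (Cn x y) = Suc (vsize x + vsize y)"

lemma vsize_pos [simp]: "0 < vsize v"
 by (cases v) auto

text \<open>The terms are point free, each denoting a function of one tree. The compiled code
  therefore needs no environment, only the register of its argument and scratch registers above
  it.\<close>

datatype comb = Cid | Cnil | Cfst | Csnd | Cpair comb comb | Cseq comb comb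
 | Cif comb comb comb | Cwhile comb comb

primrec clen :: "comb => nat" where
 "clen Cid = 0"
| "clen Cnil = 1"
| "clen Cfst = 1"
| "clen Csnd = 2"
| "clen (Cpair f g) = clen f + clen g + 7"
| "clen (Cseq f g) = clen f + clen g"
| "clen (Cif c f g) = clen c + clen f + clen g + 3"
| "clen (Cwhile c f) = clen c + clen f + 4"

text \<open>\<open>run\<close> demands \<open>k + width c \<le> lo\<close>, which keeps the scratch
  registers apart from the heap.\<close>

primrec width :: "comb => nat" where
 "width Cid = 1"
| "width Cnil = 1"
| "width Cfst = 1"
| "width Csnd = 1"
| "width (Cpair f g) = width f + width g + 2"
| "width (Cseq f g) = width f + width g"
| "width (Cif c f g) = width c + width f + width g + 1"
| "width (Cwhile c f) = width c + width f + 1"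

text \<open>
 Registers 0, 1, 2 hold the next free heap address, the constant 1 and the constant 0; the code
 at depth \<open>k\<close> replaces the pointer in register \<open>k\<close> and uses only registers from \<open>k\<close> on.
 The pointer 0 represents \<open>Nl\<close>.
\<close>

primrec comp :: "comb => nat => nat => instr list" where
 "comp Cid k b = []"
| "comp Cnil k b = [Const k 0]"
| "comp Cfst k b = [Load k k]"
| "comp Csnd k b = [Add k k 1, Load k k]"
| "comp (Cpair f g) k b =
   Add (Suc k) k 2 # comp f (Suc k) (Suc b) @
   Add (Suc (Suc k)) k 2 # comp g (Suc (Suc k)) (b + clen f + 2) @
   [Store 0 (Suc k), Add k 0 2, Add 0 0 1, Store 0 (Suc (Suc k)), Add 0 0 1]"
| "comp (Cseq f g) k b = comp f k b @ comp g k (b + clen f)"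
| "comp (Cif c f g) k b =
   Add (Suc k) k 2 # comp c (Suc k) (Suc b) @
   Jump (Suc k) (b + clen c + clen g + 3) # comp g k (b + clen c + 2) @
   Jump 1 (b + clen c + clen g + clen f + 3) # comp f k (b + clen c + clen g + 3)"
| "comp (Cwhile c f) k b =
   Add (Suc k) k 2 # comp c (Suc k) (Suc b) @
   Jump (Suc k) (b + clen c + 3) # Jump 1 (b + clen c + clen f + 4) #
   comp f k (b + clen c + 3) @ [Jump 1 b]"

lemma length_comp [simp]: "length (comp c k b) = clen c"
 by (induction c arbitrary: k b) auto

lemma width_pos [simp]: "0 < width c"
 by (induction c) auto

section \<open>Placement of code, memory layout and step-bounded execution\<close>

definition code_at :: "program => nat => instr list => bool" where
 "code_at p b cs \<longleftrightarrow> (\<exists>xs ys. p = xs @ cs @ ys & length xs = b)"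

lemma code_at_append: "code_at p b (cs @ ds) \<longleftrightarrow> code_at p b cs & code_at p (b + length cs) ds"
proof
 assume "code_at p b (cs @ ds)"
 then obtain xs ys where p: "p = xs @ (cs @ ds) @ ys" "length xs = b" by (auto simp: code_at_def)
 have "p = (xs @ cs) @ ds @ ys" "length (xs @ cs) = b + length cs" using p by auto
 moreover have "p = xs @ cs @ (ds @ ys)" using p by auto
 ultimately show "code_at p b cs & code_at p (b + length cs) ds" unfolding code_at_def using p(2) by metis
next
 assume a: "code_at p b cs & code_at p (b + length cs) ds"
 then obtain xs ys us vs where "p = xs @ cs @ ys" "length xs = b" "p = us @ ds @ vs"
  "length us = b + length cs" unfolding code_at_def by blast
 then have "(xs @ cs) @ ys = us @ ds @ vs" "length (xs @ cs) = length us" by auto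
 then have "ys = ds @ vs" by (metis append_eq_append_conv)
 then show "code_at p b (cs @ ds)" using \<open>p = xs @ cs @ ys\<close> \<open>length xs = b\<close> by (auto simp: code_at_def)
qed

lemma code_at_Cons:
 "code_at p b (i # cs) \<longleftrightarrow> b < length p & p ! b = i & code_at p (Suc b) cs"
proof -
 have "code_at p b [i] \<longleftrightarrow> b < length p & p ! b = i"
  unfolding code_at_def
  by (metis append_Cons append_Nil id_take_nth_drop length_append length_take less_add_Suc1
    list.size(4) min.absorb4 nth_append_length append_eq_conv_conj length_Cons add_Suc_right)
 then show ?thesis using code_at_append[of p b "[i]" cs] by simp
qed

abbreviation cfg :: "nat => (nat => nat) => bool list => bool list => config" where
 "cfg l M I Ou \<equiv> \<lparr>pc = l, regs = M, inp = I, outp = Ou\<rparr>"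

definition reach :: "program => config => nat => config => bool" where
 "reach p c t c' \<longleftrightarrow> (\<exists>s \<le> t. (step p ^^ s) c = c')"

lemma reach_refl: "reach p c t c"
 unfolding reach_def by (rule exI[of _ 0]) simp

lemma reach_trans:
 assumes "reach p a s b" "reach p b t c"
 shows "reach p a (s + t) c"
proof -
 from assms obtain s' t' where "s' \<le> s" "(step p ^^ s') a = b" "t' \<le> t" "(step p ^^ t') b = c"
  by (auto simp: reach_def)
 then have "(step p ^^ (t' + s')) a = c" "t' + s' \<le> s + t" by (auto simp: funpow_add)
 then show ?thesis unfolding reach_def by blast
qed

lemma reachI: "(step p ^^ t) c = c' ==> reach p c t c'"
 unfolding reach_def by blast

lemma reach1: "code_at p b (i # cs) ==> exec i (cfg b M I Ou) = c' ==> reach p (cfg b M I Ou) (Suc 0) c'"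
 by (rule reachI) (auto simp: code_at_Cons step_def halted_def)

lemma reach_mono: "reach p c s c' ==> s \<le> t ==> reach p c t c'"
 unfolding reach_def using le_trans by blast

text \<open>Cells are pairs of adjacent registers from \<open>lo\<close> on, so the address 0 is
  free for \<open>Nl\<close>. Cells need not be disjoint: subtrees may be shared, and copying a
  value costs one instruction.\<close>

fun repr :: "(nat => nat) => nat => nat => nat => val => bool" where
 "repr M lo h a Nl \<longleftrightarrow> a = 0"
| "repr M lo h a (Cn x y) \<longleftrightarrow> lo \<le> a & Suc a < h & repr M lo h (M a) x & repr M lo h (M (Suc a)) y"

lemma repr_mono:
 "repr M lo h a v ==> h \<le> h' ==> (\<And>i. lo \<le> i ==> i < h ==> M' i = M i) ==> repr M' lo h' a v"
proof (induction v arbitrary: a)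
 case (Cn x y)
 then have "M' a = M a" "M' (Suc a) = M (Suc a)" by auto
 with Cn show ?case by auto
qed auto

definition wf_mem :: "nat => (nat => nat) => bool" where
 "wf_mem lo M \<longleftrightarrow> 2 < lo & lo \<le> M 0 & M 1 = 1 & M 2 = 0"

text \<open>The frame condition: allocated cells are never overwritten and the heap only grows, so
  whatever was represented before stays represented (\<open>repr_ext\<close>), and pointers saved in
  lower registers survive.\<close>

definition ext_mem :: "nat => nat => (nat => nat) => (nat => nat) => bool" where
 "ext_mem lo k M M' \<longleftrightarrow> M 0 \<le> M' 0 & wf_mem lo M' & (\<forall>i. 2 < i & i < k --> M' i = M i) &
   (\<forall>i. lo \<le> i & i < M 0 --> M' i = M i)"

lemma ext_mem_trans:
 "ext_mem lo k M M' ==> ext_mem lo k' M' M'' ==> k \<le> k' ==> ext_mem lo k M M''"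
 by (auto simp: ext_mem_def)

lemma repr_ext: "repr M lo (M 0) a v ==> ext_mem lo k M M' ==> repr M' lo (M' 0) a v"
 by (erule repr_mono) (auto simp: ext_mem_def)

text \<open>\<open>M'\<close> is chosen before \<open>I\<close> and \<open>Ou\<close>, which
  expresses that compiled code neither reads nor prints. The quantification over all placements lets
  subterms be used at any depth and address.\<close>

definition run :: "comb => val => val => nat => bool" where
 "run c x y t \<longleftrightarrow> (\<forall>p k b lo M. code_at p b (comp c k b) & 2 < k & k + width c \<le> lo &
   wf_mem lo M & repr M lo (M 0) (M k) x -->
   (\<exists>M'. (\<forall>I Ou. reach p (cfg b M I Ou) t (cfg (b + clen c) M' I Ou)) & ext_mem lo k M M' &
    repr M' lo (M' 0) (M' k) y))"

lemma runD:
 assumes "run c x y t" "code_at p b (comp c k b)" "2 < k" "k + width c \<le> lo"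
  "wf_mem lo M" "repr M lo (M 0) (M k) x"
 obtains M' where "\<And>I Ou. reach p (cfg b M I Ou) t (cfg (b + clen c) M' I Ou)"
  "ext_mem lo k M M'" "repr M' lo (M' 0) (M' k) y"
 using assms unfolding run_def by blast

lemma runI:
 assumes "\<And>p k b lo M. code_at p b (comp c k b) ==> 2 < k ==> k + width c \<le> lo ==>
   wf_mem lo M ==> repr M lo (M 0) (M k) x ==>
   \<exists>M'. (\<forall>I Ou. reach p (cfg b M I Ou) t (cfg (b + clen c) M' I Ou)) & ext_mem lo k M M' &
    repr M' lo (M' 0) (M' k) y"
 shows "run c x y t"
 using assms unfolding run_def by blast

lemma run_mono: "run c x y s ==> s \<le> t ==> run c x y t"
 unfolding run_def by (meson reach_mono)

lemma reach_add2:
 assumes "code_at p b (Add i j 2 # cs)" "wf_mem lo M"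
 shows "reach p (cfg b M I Ou) 1 (cfg (Suc b) (M(i := M j)) I Ou)"
 using assms by (auto simp: wf_mem_def intro!: reach1)

lemma run_id: "run Cid x x 0"
 by (rule runI) (auto simp: ext_mem_def intro!: exI reach_refl)

lemma run_nil: "run Cnil x Nl 1"
proof (rule runI)
 fix p k b lo M
 assume a: "code_at p b (comp Cnil k b)" "2 < k" "k + width Cnil \<le> lo" "wf_mem lo M"
 have "reach p (cfg b M I Ou) 1 (cfg (b + clen Cnil) (M(k := 0)) I Ou)" for I Ou
  using a by (auto intro!: reach1)
 moreover have "ext_mem lo k M (M(k := 0))" using a by (auto simp: ext_mem_def wf_mem_def)
 ultimately show "\<exists>M'. (\<forall>I Ou. reach p (cfg b M I Ou) 1 (cfg (b + clen Cnil) M' I Ou)) &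
  ext_mem lo k M M' & repr M' lo (M' 0) (M' k) Nl" by (intro exI[of _ "M(k := 0)"]) auto
qed

lemma run_fst: "run Cfst (Cn x y) x 1"
proof (rule runI)
 fix p k b lo M
 assume a: "code_at p b (comp Cfst k b)" "2 < k" "k + width Cfst \<le> lo" "wf_mem lo M"
  "repr M lo (M 0) (M k) (Cn x y)"
 let ?M = "M(k := M (M k))"
 have "reach p (cfg b M I Ou) 1 (cfg (b + clen Cfst) ?M I Ou)" for I Ou
  using a by (auto intro!: reach1)
 moreover have e: "ext_mem lo k M ?M" using a by (auto simp: ext_mem_def wf_mem_def)
 moreover have "repr ?M lo (?M 0) (?M k) x" using repr_ext[OF _ e, of "M (M k)" x] a by simp
 ultimately show "\<exists>M'. (\<forall>I Ou. reach p (cfg b M I Ou) 1 (cfg (b + clen Cfst) M' I Ou)) &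
  ext_mem lo k M M' & repr M' lo (M' 0) (M' k) x" by blast
qed

lemma run_snd: "run Csnd (Cn x y) y 2"
proof (rule runI)
 fix p k b lo M
 assume a: "code_at p b (comp Csnd k b)" "2 < k" "k + width Csnd \<le> lo" "wf_mem lo M"
  "repr M lo (M 0) (M k) (Cn x y)"
 let ?M = "M(k := M (Suc (M k)))"
 have "reach p (cfg b M I Ou) 2 (cfg (b + clen Csnd) ?M I Ou)" for I Ou
  using a by (intro reachI) (simp add: eval_nat_numeral step_def halted_def code_at_Cons wf_mem_def)
 moreover have e: "ext_mem lo k M ?M" using a by (auto simp: ext_mem_def wf_mem_def)
 moreover have "repr ?M lo (?M 0) (?M k) y" using repr_ext[OF _ e, of "M (Suc (M k))" y] a by simp
 ultimately show "\<exists>M'. (\<forall>I Ou. reach p (cfg b M I Ou) 2 (cfg (b + clen Csnd) M' I Ou)) &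
  ext_mem lo k M M' & repr M' lo (M' 0) (M' k) y" by blast
qed

lemma run_seq:
 assumes "run f x y s" "run g y z t"
 shows "run (Cseq f g) x z (s + t)"
proof (rule runI)
 fix p k b lo M
 assume a: "code_at p b (comp (Cseq f g) k b)" "2 < k" "k + width (Cseq f g) \<le> lo" "wf_mem lo M"
  "repr M lo (M 0) (M k) x"
 from a have c: "code_at p b (comp f k b)" "code_at p (b + clen f) (comp g k (b + clen f))"
  by (auto simp: code_at_append)
 obtain M1 where 1: "\<And>I Ou. reach p (cfg b M I Ou) s (cfg (b + clen f) M1 I Ou)"
  "ext_mem lo k M M1" "repr M1 lo (M1 0) (M1 k) y"
  by (rule runD[OF assms(1) c(1), of lo M]) (use a in auto)
 obtain M2 where 2: "\<And>I Ou. reach p (cfg (b + clen f) M1 I Ou) t (cfg (b + clen f + clen g) M2 I Ou)"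
  "ext_mem lo k M1 M2" "repr M2 lo (M2 0) (M2 k) z"
  by (rule runD[OF assms(2) c(2), of lo M1]) (use a 1 in \<open>auto simp: ext_mem_def\<close>)
 show "\<exists>M'. (\<forall>I Ou. reach p (cfg b M I Ou) (s + t) (cfg (b + clen (Cseq f g)) M' I Ou)) &
  ext_mem lo k M M' & repr M' lo (M' 0) (M' k) z"
  using reach_trans[OF 1(1) 2(1)] ext_mem_trans[OF 1(2) 2(2)] 2(3)
  by (auto simp: add.assoc intro!: exI[of _ M2])
qed

text \<open>Pairing, branching and looping evaluate a subterm but still need their argument
  afterwards; their common prefix copies the pointer one or two registers up and works on the
  copy.\<close>

lemma run_copy:
 assumes r: "run f x y s" and c: "code_at p b (Add k' k 2 # comp f k' (Suc b) @ cs)"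
  and k: "2 < k" "k < k'" "k' + width f \<le> lo" and M: "wf_mem lo M" "repr M lo (M 0) (M k) x"
 obtains M' where "\<And>I Ou. reach p (cfg b M I Ou) (Suc s) (cfg (Suc (b + clen f)) M' I Ou)"
  "ext_mem lo k' M M'" "M' k = M k" "repr M' lo (M' 0) (M' k') y" "code_at p (Suc (b + clen f)) cs"
proof -
 let ?M = "M(k' := M k)"
 have klo: "k' < lo" using k width_pos[of f] by linarith
 have e: "ext_mem lo k' M ?M" using M klo k by (auto simp: ext_mem_def wf_mem_def)
 have c': "code_at p (Suc b) (comp f k' (Suc b))" using c by (auto simp: code_at_Cons code_at_append)
 have M': "wf_mem lo ?M" "repr ?M lo (?M 0) (?M k') x"
  using e repr_ext[OF M(2) e] by (auto simp: ext_mem_def)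
 obtain M1 where 1: "\<And>I Ou. reach p (cfg (Suc b) ?M I Ou) s (cfg (Suc b + clen f) M1 I Ou)"
  "ext_mem lo k' ?M M1" "repr M1 lo (M1 0) (M1 k') y"
  by (rule runD[OF r c' _ k(3) M']) (use k in auto)
 have "reach p (cfg b M I Ou) (Suc s) (cfg (Suc (b + clen f)) M1 I Ou)" for I Ou
  using reach_trans[OF reach_add2[OF c M(1)] 1(1)] by simp
 moreover have "ext_mem lo k' M M1" using ext_mem_trans[OF e 1(2)] by simp
 moreover have "M1 k = M k" using 1(2) k by (auto simp: ext_mem_def)
 ultimately show thesis using that 1(3) c by (auto simp: code_at_Cons code_at_append)
qed

lemma run_pair:
 assumes "run f x y s" "run g x z t"
 shows "run (Cpair f g) x (Cn y z) (s + t + 7)"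
proof (rule runI)
 fix p k b lo M
 let ?cs = "[Store 0 (Suc k), Add k 0 2, Add 0 0 1, Store 0 (Suc (Suc k)), Add 0 0 1]"
 assume a: "code_at p b (comp (Cpair f g) k b)" "2 < k" "k + width (Cpair f g) \<le> lo" "wf_mem lo M"
  "repr M lo (M 0) (M k) x"
 let ?k = "Suc k" let ?k2 = "Suc (Suc k)"
 have c: "code_at p b (Add ?k k 2 # comp f ?k (Suc b) @
   (Add ?k2 k 2 # comp g ?k2 (Suc (Suc (b + clen f))) @ ?cs))" using a(1) by simp
 obtain M1 where 1: "\<And>I Ou. reach p (cfg b M I Ou) (Suc s) (cfg (Suc (b + clen f)) M1 I Ou)"
  "ext_mem lo ?k M M1" "M1 k = M k" "repr M1 lo (M1 0) (M1 ?k) y" "code_at p (Suc (b + clen f))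
   (Add ?k2 k 2 # comp g ?k2 (Suc (Suc (b + clen f))) @ ?cs)"
  by (rule run_copy[OF assms(1) c, of lo M]) (use a in auto)
 have w1: "wf_mem lo M1" using 1(2) by (simp add: ext_mem_def)
 obtain M2 where 2: "\<And>I Ou. reach p (cfg (Suc (b + clen f)) M1 I Ou) (Suc t)
    (cfg (Suc (Suc (b + clen f) + clen g)) M2 I Ou)"
  "ext_mem lo ?k2 M1 M2" "M2 k = M1 k" "repr M2 lo (M2 0) (M2 ?k2) z"
  "code_at p (Suc (Suc (b + clen f) + clen g)) ?cs"
  by (rule run_copy[OF assms(2) 1(5), of lo M1]) (use a repr_ext[OF a(5) 1(2)] 1(3) w1 in auto)
 have w2: "wf_mem lo M2" using 2(2) by (simp add: ext_mem_def)
 have k1: "M2 ?k = M1 ?k" using 2(2) a(2) by (auto simp: ext_mem_def)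
 \<comment> \<open>The new cell is placed at the heap pointer. Register \<open>k\<close> receives
   its address before the pointer moves on.\<close>
 let ?h = "M2 0"
 let ?M = "M2(?h := M2 ?k, k := ?h, Suc ?h := M2 ?k2, 0 := Suc (Suc ?h))"
 have h: "lo \<le> ?h" using w2 by (auto simp: wf_mem_def)
 have k2: "Suc (Suc k) < ?h" using h a(3) width_pos[of f] width_pos[of g] unfolding width.simps by linarith
 have r: "reach p (cfg (Suc (Suc (b + clen f) + clen g)) M2 I Ou) 5
   (cfg (b + clen (Cpair f g)) ?M I Ou)" for I Ou
  using 2(5) w2 h a(2,3) k2 by (intro reachI)
   (auto simp: eval_nat_numeral step_def halted_def code_at_Cons wf_mem_def fun_eq_iff)
 have e2: "ext_mem lo k M2 ?M" using w2 h a(2,3) by (auto simp: ext_mem_def wf_mem_def)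
 have e: "ext_mem lo k M ?M"
 proof -
  have "ext_mem lo k M M1" "ext_mem lo k M1 M2" using 1(2) 2(2) by (auto simp: ext_mem_def)
  then show ?thesis using e2 ext_mem_trans by blast
 qed
 have "repr M2 lo (M2 0) (M2 ?k) y" using repr_ext[OF 1(4) 2(2)] k1 by simp
 then have "repr ?M lo (?M 0) (M2 ?k) y" using e2 repr_ext by blast
 moreover have "repr ?M lo (?M 0) (M2 ?k2) z" using e2 repr_ext 2(4) by blast
 moreover have "k < ?h" "0 < ?h" "0 < k" using h a by auto
 ultimately have "repr ?M lo (?M 0) (?M k) (Cn y z)" using h by simp
 moreover have "reach p (cfg b M I Ou) (s + t + 7) (cfg (b + clen (Cpair f g)) ?M I Ou)" for I Ou
  using reach_trans[OF reach_trans[OF 1(1) 2(1)] r] by (simp add: add_ac eval_nat_numeral)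
 ultimately show "\<exists>M'. (\<forall>I Ou. reach p (cfg b M I Ou) (s + t + 7) (cfg (b + clen (Cpair f g)) M' I Ou)) &
  ext_mem lo k M M' & repr M' lo (M' 0) (M' k) (Cn y z)" using e by blast
qed

lemma reach_jump:
 assumes "code_at p b (Jump i l # cs)"
 shows "reach p (cfg b M I Ou) 1 (cfg (if M i > 0 then l else Suc b) M I Ou)"
 using assms by (auto intro!: reach1)

lemma repr_pos: "repr M lo h a v ==> 0 < lo ==> a > 0 \<longleftrightarrow> v ~= Nl"
 by (cases v) auto

lemma run_if:
 assumes c: "run c x v s" and fg: "if v ~= Nl then run f x y t else run g x y t"
 shows "run (Cif c f g) x y (s + t + 4)"
proof (rule runI)
 fix p k b lo M
 assume a: "code_at p b (comp (Cif c f g) k b)" "2 < k" "k + width (Cif c f g) \<le> lo" "wf_mem lo M"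
  "repr M lo (M 0) (M k) x"
 let ?k = "Suc k" let ?b1 = "Suc (b + clen c)" let ?bf = "b + clen c + clen g + 3"
 let ?e = "b + clen c + clen g + clen f + 3"
 have c0: "code_at p b (Add ?k k 2 # comp c ?k (Suc b) @ (Jump ?k ?bf # comp g k (Suc ?b1) @
   Jump 1 ?e # comp f k ?bf))" using a(1) by simp
 obtain M1 where 1: "\<And>I Ou. reach p (cfg b M I Ou) (Suc s) (cfg ?b1 M1 I Ou)"
  "ext_mem lo ?k M M1" "M1 k = M k" "repr M1 lo (M1 0) (M1 ?k) v" "code_at p ?b1
   (Jump ?k ?bf # comp g k (Suc ?b1) @ Jump 1 ?e # comp f k ?bf)"
  by (rule run_copy[OF c c0, of lo M]) (use a in auto)
 have w1: "wf_mem lo M1" using 1(2) by (simp add: ext_mem_def)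
 have x1: "repr M1 lo (M1 0) (M1 k) x" using repr_ext[OF a(5) 1(2)] 1(3) by simp
 have e1: "ext_mem lo k M M1" using 1(2) by (auto simp: ext_mem_def)
 have p1: "M1 ?k > 0 \<longleftrightarrow> v ~= Nl" using repr_pos[OF 1(4)] w1 by (auto simp: wf_mem_def)
 have cg: "code_at p (Suc ?b1) (comp g k (Suc ?b1))"
  and cj: "code_at p (Suc ?b1 + clen g) (Jump 1 ?e # comp f k ?bf)"
  and cf: "code_at p ?bf (comp f k ?bf)"
  using 1(5) by (auto simp: code_at_append code_at_Cons eval_nat_numeral add_ac)
 have "\<exists>M2. (\<forall>I Ou. reach p (cfg ?b1 M1 I Ou) (t + 3) (cfg ?e M2 I Ou)) & ext_mem lo k M1 M2 &
  repr M2 lo (M2 0) (M2 k) y"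
 proof (cases "v ~= Nl")
  case True
  obtain M2 where 2: "\<And>I Ou. reach p (cfg ?bf M1 I Ou) t (cfg (?bf + clen f) M2 I Ou)"
   "ext_mem lo k M1 M2" "repr M2 lo (M2 0) (M2 k) y"
   by (rule runD[of f x y t p ?bf k lo M1]) (use a fg True cf w1 x1 in auto)
  have "reach p (cfg ?b1 M1 I Ou) (t + 3) (cfg ?e M2 I Ou)" for I Ou
  proof (rule reach_mono[OF reach_trans])
   show "reach p (cfg ?b1 M1 I Ou) 1 (cfg ?bf M1 I Ou)" using reach_jump[OF 1(5)] True p1 by metis
   show "reach p (cfg ?bf M1 I Ou) t (cfg ?e M2 I Ou)" using 2(1) by (simp add: add_ac)
  qed simp
  then show ?thesis using 2 by blast
 next
  case False
  obtain M2 where 2: "\<And>I Ou. reach p (cfg (Suc ?b1) M1 I Ou) t (cfg (Suc ?b1 + clen g) M2 I Ou)"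
   "ext_mem lo k M1 M2" "repr M2 lo (M2 0) (M2 k) y"
   by (rule runD[of g x y t p "Suc ?b1" k lo M1]) (use a fg False cg w1 x1 in auto)
  have j: "reach p (cfg ?b1 M1 I Ou) 1 (cfg (Suc ?b1) M1 I Ou)" for I Ou
   using reach_jump[OF 1(5)] False p1 by (metis (full_types))
  have "wf_mem lo M2" using 2(2) by (simp add: ext_mem_def)
  then have "reach p (cfg (Suc ?b1 + clen g) M2 I Ou) 1 (cfg ?e M2 I Ou)" for I Ou
   using reach_jump[OF cj, of M2] by (simp add: wf_mem_def)
  then have "reach p (cfg ?b1 M1 I Ou) (t + 3) (cfg ?e M2 I Ou)" for I Ou
   by (rule reach_mono[OF reach_trans[OF reach_trans[OF j 2(1)]]]) simp
  then show ?thesis using 2 by blast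
 qed
 then obtain M2 where 2: "\<And>I Ou. reach p (cfg ?b1 M1 I Ou) (t + 3) (cfg ?e M2 I Ou)"
  "ext_mem lo k M1 M2" "repr M2 lo (M2 0) (M2 k) y" by blast
 have "reach p (cfg b M I Ou) (s + t + 4) (cfg (b + clen (Cif c f g)) M2 I Ou)" for I Ou
  using reach_trans[OF 1(1) 2(1)] by (simp add: add_ac eval_nat_numeral)
 then show "\<exists>M'. (\<forall>I Ou. reach p (cfg b M I Ou) (s + t + 4) (cfg (b + clen (Cif c f g)) M' I Ou)) &
  ext_mem lo k M M' & repr M' lo (M' 0) (M' k) y" using 2 ext_mem_trans[OF e1 2(2)] by blast
qed

lemma run_while_exit:
 assumes c: "run c x Nl s"
 shows "run (Cwhile c f) x x (s + 3)"
proof (rule runI)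
 fix p k b lo M
 assume a: "code_at p b (comp (Cwhile c f) k b)" "2 < k" "k + width (Cwhile c f) \<le> lo" "wf_mem lo M"
  "repr M lo (M 0) (M k) x"
 let ?k = "Suc k" let ?b1 = "Suc (b + clen c)" let ?e = "b + clen c + clen f + 4"
 let ?cs = "Jump ?k (b + clen c + 3) # Jump 1 ?e # comp f k (b + clen c + 3) @ [Jump 1 b]"
 have c0: "code_at p b (Add ?k k 2 # comp c ?k (Suc b) @ ?cs)" using a(1) by simp
 obtain M1 where 1: "\<And>I Ou. reach p (cfg b M I Ou) (Suc s) (cfg ?b1 M1 I Ou)"
  "ext_mem lo ?k M M1" "M1 k = M k" "repr M1 lo (M1 0) (M1 ?k) Nl" "code_at p ?b1 ?cs"
  by (rule run_copy[OF c c0, of lo M]) (use a in auto)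
 have w1: "wf_mem lo M1" using 1(2) by (simp add: ext_mem_def)
 have x1: "repr M1 lo (M1 0) (M1 k) x" using repr_ext[OF a(5) 1(2)] 1(3) by simp
 have "reach p (cfg ?b1 M1 I Ou) 2 (cfg (b + clen (Cwhile c f)) M1 I Ou)" for I Ou
  using 1(4,5) w1 by (intro reachI)
   (simp add: eval_nat_numeral step_def halted_def code_at_Cons wf_mem_def)
 then have "reach p (cfg b M I Ou) (s + 3) (cfg (b + clen (Cwhile c f)) M1 I Ou)" for I Ou
  by (rule reach_mono[OF reach_trans[OF 1(1)]]) auto
 moreover have "ext_mem lo k M M1" using 1(2) by (auto simp: ext_mem_def)
 ultimately show "\<exists>M'. (\<forall>I Ou. reach p (cfg b M I Ou) (s + 3) (cfg (b + clen (Cwhile c f)) M' I Ou)) &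
  ext_mem lo k M M' & repr M' lo (M' 0) (M' k) x" using x1 by blast
qed

lemma run_while_step:
 assumes c: "run c x v s" "v ~= Nl" and f: "run f x y t" and w: "run (Cwhile c f) y z u"
 shows "run (Cwhile c f) x z (s + t + u + 3)"
proof (rule runI)
 fix p k b lo M
 assume a: "code_at p b (comp (Cwhile c f) k b)" "2 < k" "k + width (Cwhile c f) \<le> lo" "wf_mem lo M"
  "repr M lo (M 0) (M k) x"
 let ?k = "Suc k" let ?b1 = "Suc (b + clen c)" let ?e = "b + clen c + clen f + 4"
 let ?bf = "b + clen c + 3"
 let ?cs = "Jump ?k ?bf # Jump 1 ?e # comp f k ?bf @ [Jump 1 b]"
 have c0: "code_at p b (Add ?k k 2 # comp c ?k (Suc b) @ ?cs)" using a(1) by simp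
 obtain M1 where 1: "\<And>I Ou. reach p (cfg b M I Ou) (Suc s) (cfg ?b1 M1 I Ou)"
  "ext_mem lo ?k M M1" "M1 k = M k" "repr M1 lo (M1 0) (M1 ?k) v" "code_at p ?b1 ?cs"
  by (rule run_copy[OF c(1) c0, of lo M]) (use a in auto)
 have w1: "wf_mem lo M1" using 1(2) by (simp add: ext_mem_def)
 have e1: "ext_mem lo k M M1" using 1(2) by (auto simp: ext_mem_def)
 have x1: "repr M1 lo (M1 0) (M1 k) x" using repr_ext[OF a(5) 1(2)] 1(3) by simp
 have p1: "M1 ?k > 0" using repr_pos[OF 1(4)] w1 c(2) by (auto simp: wf_mem_def)
 have j1: "reach p (cfg ?b1 M1 I Ou) 1 (cfg ?bf M1 I Ou)" for I Ou
  using reach_jump[OF 1(5)] p1 by metis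
 have cf: "code_at p ?bf (comp f k ?bf @ [Jump 1 b])"
  using 1(5) by (simp add: code_at_Cons eval_nat_numeral)
 obtain M2 where 2: "\<And>I Ou. reach p (cfg ?bf M1 I Ou) t (cfg (?bf + clen f) M2 I Ou)"
  "ext_mem lo k M1 M2" "repr M2 lo (M2 0) (M2 k) y"
  by (rule runD[OF f, of p ?bf k lo M1]) (use a cf w1 x1 in \<open>auto simp: code_at_append\<close>)
 have w2: "wf_mem lo M2" using 2(2) by (simp add: ext_mem_def)
 have cj: "code_at p (?bf + clen f) [Jump 1 b]" using cf by (simp add: code_at_append)
 have j2: "reach p (cfg (?bf + clen f) M2 I Ou) 1 (cfg b M2 I Ou)" for I Ou
  using reach_jump[OF cj, of M2 I Ou] w2 by (simp add: wf_mem_def)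
 obtain M3 where 3: "\<And>I Ou. reach p (cfg b M2 I Ou) u (cfg (b + clen (Cwhile c f)) M3 I Ou)"
  "ext_mem lo k M2 M3" "repr M3 lo (M3 0) (M3 k) z"
  by (rule runD[OF w a(1,2,3) w2 2(3)]) auto
 have "reach p (cfg b M I Ou) (s + t + u + 3) (cfg (b + clen (Cwhile c f)) M3 I Ou)" for I Ou
  by (rule reach_mono[OF reach_trans[OF reach_trans[OF reach_trans[OF reach_trans[OF 1(1) j1] 2(1)] j2] 3(1)]]) simp
 then show "\<exists>M'. (\<forall>I Ou. reach p (cfg b M I Ou) (s + t + u + 3) (cfg (b + clen (Cwhile c f)) M' I Ou)) &
  ext_mem lo k M M' & repr M' lo (M' 0) (M' k) z"
  using 3 ext_mem_trans[OF ext_mem_trans[OF e1 2(2)] 3(2)] by blast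
qed

section \<open>Reading and printing words\<close>

fun bval :: "bool => val" where
 "bval True = Cn Nl Nl"
| "bval False = Nl"

fun blist :: "bool list => val" where
 "blist [] = Nl"
| "blist (b # bs) = Cn (bval b) (blist bs)"

text \<open>The first heap cell is the value \<open>True\<close>; both its components are initially zero.\<close>

definition io_prog :: "comb => program" where
 "io_prog c = (let lo = 10 + width c; e = 15 + clen c in
   [Const 1 1, Const 0 (lo + 2), Read 4, Sub 5 4 1, Jump 5 15, Jump 4 7, Jump 1 8, Const 4 lo,
   Store 0 4, Add 4 0 2, Add 0 0 1, Store 0 3, Add 0 0 1, Add 3 4 2, Jump 1 2] @ comp c 3 15 @
   [Jump 3 (e + 2), Jump 1 (e + 7), Load 4 3, Print 4, Add 3 3 1, Load 3 3, Jump 1 e])"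

lemma io_prog_nth:
 "i < 15 ==> io_prog c ! i = [Const 1 1, Const 0 (12 + width c), Read 4, Sub 5 4 1, Jump 5 15,
   Jump 4 7, Jump 1 8, Const 4 (10 + width c),
   Store 0 4, Add 4 0 2, Add 0 0 1, Store 0 3, Add 0 0 1, Add 3 4 2, Jump 1 2] ! i"
 "i < 7 ==> io_prog c ! (15 + clen c + i) = [Jump 3 (17 + clen c), Jump 1 (22 + clen c), Load 4 3,
   Print 4, Add 3 3 1, Load 3 3, Jump 1 (15 + clen c)] ! i"
 "length (io_prog c) = 22 + clen c"
 by (auto simp: io_prog_def Let_def nth_append simp del: append_Cons)

lemma code_at_io_prog: "code_at (io_prog c) 15 (comp c 3 15)"
 unfolding code_at_def io_prog_def Let_def
 by (intro exI conjI) (rule refl, simp)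

definition read_inv :: "comb => (nat => nat) => bool list => bool" where
 "read_inv c M xs \<longleftrightarrow> (let lo = 10 + width c in wf_mem lo M & lo + 2 \<le> M 0 & M lo = 0 &
   M (Suc lo) = 0 & repr M lo (M 0) (M 3) (blist xs))"

text \<open>\<open>Read\<close> yields 2 only when the input is exhausted, so the truncated
  difference with 1 is positive exactly then. A bit becomes the pointer \<open>lo\<close> or 0 and
  is put in front of the list.\<close>

lemma read_step:
 assumes "read_inv c M xs"
 obtains M' where "read_inv c M' (b # xs)"
  "\<And>I Ou. reach (io_prog c) (cfg 2 M (b # I) Ou) 12 (cfg 2 M' I Ou)"
proof -
 let ?lo = "10 + width c"
 let ?v = "if b then ?lo else 0"
 let ?M = "M(5 := 0, M 0 := ?v, 4 := M 0, Suc (M 0) := M 3, 0 := Suc (Suc (M 0)), 3 := M 0)"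
 have a: "wf_mem ?lo M" "?lo + 2 \<le> M 0" "M ?lo = 0" "M (Suc ?lo) = 0" "repr M ?lo (M 0) (M 3) (blist xs)"
  using assms by (auto simp: read_inv_def Let_def)
 have r: "repr ?M ?lo (?M 0) (M 3) (blist xs)" using a(2) by (intro repr_mono[OF a(5)]) auto
 have "read_inv c ?M (b # xs)"
  using a r by (cases b) (auto simp: read_inv_def Let_def wf_mem_def)
 moreover have "reach (io_prog c) (cfg 2 M (b # I) Ou) 12 (cfg 2 ?M I Ou)" for I Ou
 proof (cases b)
  case True
  then have "(step (io_prog c) ^^ 12) (cfg 2 M (b # I) Ou) = cfg 2 ?M I Ou" using a
   by (auto simp: eval_nat_numeral step_def halted_def io_prog_nth wf_mem_def fun_eq_iff)
  then show ?thesis by (rule reachI)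
 next
  case False
  then have "(step (io_prog c) ^^ 12) (cfg 2 M (b # I) Ou) = cfg 2 ?M I Ou" using a
   by (auto simp: eval_nat_numeral step_def halted_def io_prog_nth wf_mem_def fun_eq_iff)
  then show ?thesis by (rule reachI)
 qed
 ultimately show thesis using that by blast
qed

lemma read_all:
 "read_inv c M xs ==> \<exists>M'. read_inv c M' (rev bs @ xs) &
   (\<forall>Ou. reach (io_prog c) (cfg 2 M bs Ou) (12 * length bs + 3) (cfg 15 M' [] Ou))"
proof (induction bs arbitrary: M xs)
 case Nil
 let ?M = "M(4 := 2, 5 := 1)"
 have "read_inv c ?M xs" using Nil unfolding read_inv_def Let_def
  by (auto simp: wf_mem_def elim!: repr_mono)
 moreover have "reach (io_prog c) (cfg 2 M [] Ou) 3 (cfg 15 ?M [] Ou)" for Ou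
  using Nil by (intro reachI)
   (auto simp: eval_nat_numeral step_def halted_def io_prog_nth wf_mem_def fun_eq_iff read_inv_def Let_def)
 ultimately show ?case by (intro exI[of _ ?M]) (simp del: fun_upd_apply)
next
 case (Cons b bs)
 obtain M1 where 1: "read_inv c M1 (b # xs)"
  "\<And>I Ou. reach (io_prog c) (cfg 2 M (b # I) Ou) 12 (cfg 2 M1 I Ou)"
  using read_step[OF Cons.prems, of b] by blast
 from Cons.IH[OF 1(1)] obtain M' where M': "read_inv c M' (rev bs @ b # xs)"
  "\<And>Ou. reach (io_prog c) (cfg 2 M1 bs Ou) (12 * length bs + 3) (cfg 15 M' [] Ou)" by blast
 show ?case using M'(1) reach_trans[OF 1(2) M'(2)] by (intro exI[of _ M']) (auto simp: add_ac)
qed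

lemma print_all:
 "wf_mem lo M ==> 5 < lo ==> repr M lo (M 0) (M 3) (blist bs) ==>
   \<exists>M'. reach (io_prog c) (cfg (15 + clen c) M I Ou) (6 * length bs + 2) (cfg (22 + clen c) M' I (Ou @ bs))"
proof (induction bs arbitrary: M Ou)
 case Nil
 then have "reach (io_prog c) (cfg (15 + clen c) M I Ou) 2 (cfg (22 + clen c) M I (Ou @ []))"
  using io_prog_nth(2)[of 0 c] io_prog_nth(2)[of 1 c]
  by (intro reachI) (auto simp: eval_nat_numeral step_def halted_def io_prog_nth(3) wf_mem_def)
 then show ?case by (intro exI[of _ M]) (simp add: numeral_2_eq_2)
next
 case (Cons b bs)
 let ?a = "M 3"
 let ?M = "M(4 := M ?a, 3 := M (Suc ?a))"
 have a: "lo \<le> ?a" "repr M lo (M 0) (M ?a) (bval b)" "repr M lo (M 0) (M (Suc ?a)) (blist bs)"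
  using Cons.prems(3) by auto
 have b: "M ?a > 0 \<longleftrightarrow> b" using repr_pos[OF a(2)] Cons.prems(1) by (cases b) (auto simp: wf_mem_def)
 have M: "wf_mem lo ?M" using Cons.prems by (auto simp: wf_mem_def)
 have R: "repr ?M lo (?M 0) (?M 3) (blist bs)" using Cons.prems(2) by (auto intro: repr_mono[OF a(3)])
 obtain M' where M': "reach (io_prog c) (cfg (15 + clen c) ?M I (Ou @ [b])) (6 * length bs + 2)
  (cfg (22 + clen c) M' I ((Ou @ [b]) @ bs))" using Cons.IH[OF M Cons.prems(2) R] by blast
 have "reach (io_prog c) (cfg (15 + clen c) M I Ou) 6 (cfg (15 + clen c) ?M I (Ou @ [b]))"
  using io_prog_nth(2)[of 0 c] io_prog_nth(2)[of 2 c] io_prog_nth(2)[of 3 c]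
   io_prog_nth(2)[of 4 c] io_prog_nth(2)[of 5 c] io_prog_nth(2)[of 6 c] Cons.prems a(1) b
  by (intro reachI) (auto simp: eval_nat_numeral step_def halted_def io_prog_nth(3) wf_mem_def fun_eq_iff)
 from reach_trans[OF this M'] show ?case by (auto simp: add_ac)
qed

lemma halted_funpow: "halted p c ==> (step p ^^ n) c = c"
 by (induction n) (auto simp: step_def)

lemma computes_in_mono:
 assumes "computes_in p x s y" "s \<le> t"
 shows "computes_in p x t y"
proof -
 have "(step p ^^ t) (init_config x) = (step p ^^ (t - s)) ((step p ^^ s) (init_config x))"
  using assms(2) by (metis comp_apply funpow_add le_add_diff_inverse2)
 then show ?thesis using assms(1) halted_funpow by (auto simp: computes_in_def)
qed

text \<open>Each bit is put in front of the bits read before, so the term receives the word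
  reversed. The factors 12 and 6 are the costs of one round of the reading and of the printing
  loop.\<close>

theorem run_computes_in:
 assumes "run c (blist (rev x)) (blist y) t"
 shows "computes_in (io_prog c) x (t + 12 * length x + 6 * length y + 7) y"
proof -
 let ?lo = "10 + width c"
 let ?M0 = "(%_. 0)(1 := 1, 0 := 12 + width c) :: nat => nat"
 have "reach (io_prog c) (init_config x) 2 (cfg 2 ?M0 x [])"
  by (intro reachI) (auto simp: eval_nat_numeral step_def halted_def io_prog_nth init_config_def fun_eq_iff)
 moreover have i0: "read_inv c ?M0 []" by (auto simp: read_inv_def wf_mem_def Let_def)
 obtain M1 where 1: "read_inv c M1 (rev x)"
  "reach (io_prog c) (cfg 2 ?M0 x []) (12 * length x + 3) (cfg 15 M1 [] [])"
  using read_all[OF i0, of x] by auto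
 have w1: "wf_mem ?lo M1" "repr M1 ?lo (M1 0) (M1 3) (blist (rev x))"
  using 1(1) by (auto simp: read_inv_def Let_def)
 obtain M2 where 2: "\<And>I Ou. reach (io_prog c) (cfg 15 M1 I Ou) t (cfg (15 + clen c) M2 I Ou)"
  "ext_mem ?lo 3 M1 M2" "repr M2 ?lo (M2 0) (M2 3) (blist y)"
  by (rule runD[OF assms code_at_io_prog _ _ w1]) auto
 have "wf_mem ?lo M2" using 2(2) by (simp add: ext_mem_def)
 then obtain M3 where
  "reach (io_prog c) (cfg (15 + clen c) M2 [] []) (6 * length y + 2) (cfg (22 + clen c) M3 [] y)"
  using print_all[of ?lo M2 y c "[]" "[]"] 2(3) by auto
 ultimately have "reach (io_prog c) (init_config x) (2 + (12 * length x + 3) + t + (6 * length y + 2))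
  (cfg (22 + clen c) M3 [] y)" using 1(2) 2(1) by (blast intro: reach_trans)
 then obtain s where s: "s \<le> t + 12 * length x + 6 * length y + 7"
  "(step (io_prog c) ^^ s) (init_config x) = cfg (22 + clen c) M3 [] y"
  unfolding reach_def by (auto simp: add_ac)
 have "computes_in (io_prog c) x s y" using s(2) by (simp add: computes_in_def halted_def io_prog_nth)
 then show ?thesis using s(1) computes_in_mono by blast
qed

section \<open>Polynomial time on typed data\<close>

class encodable =
 fixes venc :: "'a => val"
 assumes venc_inject [simp]: "venc x = venc y \<longleftrightarrow> x = y"

abbreviation sz :: "'a::encodable => nat" where
 "sz x \<equiv> vsize (venc x)"

instantiation val :: encodable
begin
definition venc_val :: "val => val" where [simp]: "venc_val v = v"
instance by standard simp
end

instantiation unit :: encodable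
begin
definition venc_unit :: "unit => val" where [simp]: "venc_unit v = Nl"
instance by standard simp
end

instantiation bool :: encodable
begin
definition venc_bool :: "bool => val" where "venc_bool b = (if b then Cn Nl Nl else Nl)"
instance by standard (auto simp: venc_bool_def)
end

instantiation prod :: (encodable, encodable) encodable
begin
definition venc_prod :: "'a \<times> 'b => val" where "venc_prod p = Cn (venc (fst p)) (venc (snd p))"
instance by standard (auto simp: venc_prod_def prod_eq_iff)
end

lemma venc_Pair [simp]: "venc (a, b) = Cn (venc a) (venc b)"
 by (simp add: venc_prod_def)

instantiation list :: (encodable) encodable
begin
primrec venc_list :: "'a list => val" where
 "venc_list [] = Nl"
| "venc_list (a # l) = Cn (venc a) (venc_list l)"
instance
proof
 fix x y :: "'a list"
 show "venc x = venc y \<longleftrightarrow> x = y"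
 proof (induction x arbitrary: y)
  case Nil show ?case by (cases y) auto
 next
  case (Cons a x) then show ?case by (cases y) auto
 qed
qed
end

text \<open>The encoding is unary: lengths, indices and budgets enter the running time by their
  value anyway. Contents of simulated registers, which can double in every step, get the binary type
  \<open>bin\<close> later.\<close>

instantiation nat :: encodable
begin
primrec venc_nat :: "nat => val" where
 "venc_nat 0 = Nl"
| "venc_nat (Suc n) = Cn Nl (venc_nat n)"
instance
proof
 fix x y :: nat
 show "venc x = venc y \<longleftrightarrow> x = y"
 proof (induction x arbitrary: y)
  case 0 show ?case by (cases y) auto
 next
  case (Suc x) then show ?case by (cases y) auto
 qed
qed
end

lemma sz_nat [simp]: "sz (n::nat) = 2 * n + 1"
 by (induction n) auto

lemma sz_append: "Suc (sz (xs @ ys)) = sz xs + sz ys"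
 by (induction xs) auto

lemma sz_list: "sz xs = Suc (\<Sum>a\<leftarrow>xs. Suc (sz a))"
 by (induction xs) auto

lemma sz_rev [simp]: "sz (rev xs) = sz xs"
 by (simp add: sz_list rev_map[symmetric])

lemma sz_list_le:
 assumes "length xs \<le> n" "\<And>a. a \<in> set xs ==> sz a \<le> m"
 shows "sz xs \<le> Suc (n * Suc m)"
proof -
 have "(\<Sum>a\<leftarrow>xs. Suc (sz a)) \<le> (\<Sum>a\<leftarrow>xs. Suc m)" by (rule sum_list_mono) (use assms in auto)
 also have "\<dots> = length xs * Suc m" by (simp add: sum_list_triv)
 also have "\<dots> \<le> n * Suc m" using assms(1) by (rule mult_le_mono1)
 finally show ?thesis by (simp add: sz_list)
qed

lemma sz_mem: "a \<in> set xs ==> sz a < sz xs"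
 by (induction xs) auto

lemma length_less_sz: "length xs < sz xs"
 by (induction xs) auto

lemma sz_take: "sz (take k xs) \<le> sz xs"
 using sz_append[of "take k xs" "drop k xs"] vsize_pos[of "venc (drop k xs)"]
 by (simp del: vsize_pos)

text \<open>A power of \<open>sz x + 2\<close> stands for a polynomial: as the base is at least 2,
  constants, sums and products are absorbed by a larger exponent.\<close>

definition pb :: "('a::encodable => nat) => bool" where
 "pb g \<longleftrightarrow> (\<exists>a. \<forall>x. g x \<le> (sz x + 2) ^ a)"

lemma pb_mono: "pb h ==> (\<And>x. g x \<le> h x) ==> pb g"
 unfolding pb_def by (meson le_trans)

lemma pb_const [simp, intro]: "pb (%x. c)"
proof -
 have "c \<le> 2 ^ c" by (simp add: less_imp_le)
 also have "\<dots> \<le> (n + 2) ^ c" for n :: nat by (simp add: power_mono)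
 finally have "c \<le> (n + 2) ^ c" for n :: nat .
 then show ?thesis unfolding pb_def by blast
qed

lemma pb_sz [simp, intro]: "pb (%x. sz x)"
 unfolding pb_def by (rule exI[of _ 1]) simp

lemma pb_mult [intro]: "pb g ==> pb h ==> pb (%x. g x * h x)"
proof -
 assume "pb g" "pb h"
 then obtain a b where "\<And>x. g x \<le> (sz x + 2) ^ a" "\<And>x. h x \<le> (sz x + 2) ^ b" unfolding pb_def by blast
 then have "g x * h x \<le> (sz x + 2) ^ (a + b)" for x by (simp add: power_add mult_le_mono)
 then show ?thesis unfolding pb_def by blast
qed

lemma pb_add [intro]: "pb g ==> pb h ==> pb (%x. g x + h x)"
proof -
 assume "pb g" "pb h"
 then have "pb (%x. (g x + 1) * (h x + 1))"
 proof -
  have *: "pb (%x. f x + 1)" if f: "pb f" for f :: "'a => nat"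
  proof -
   from f obtain a where a: "\<And>x. f x \<le> (sz x + 2) ^ a" unfolding pb_def by blast
   have "f x + 1 \<le> (sz x + 2) ^ Suc a" for x
   proof -
    have "f x + 1 \<le> 2 * (sz x + 2) ^ a" using a[of x] one_le_power[of "sz x + 2" a] by linarith
    also have "\<dots> \<le> (sz x + 2) * (sz x + 2) ^ a" by (rule mult_le_mono) auto
    finally show ?thesis by simp
   qed
   then show ?thesis unfolding pb_def by blast
  qed
  show ?thesis using \<open>pb g\<close> \<open>pb h\<close> by (intro pb_mult *)
 qed
 then show ?thesis by (rule pb_mono) (simp add: algebra_simps)
qed

lemma pb_Suc [intro]: "pb g ==> pb (%x. Suc (g x))"
 using pb_add[of g "%x. 1"] by simp

lemma pb_power [intro]: "pb g ==> pb (%x. g x ^ (n::nat))"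
 by (induction n) auto

lemma pb_comp: "pb h ==> pb (%x. sz (f x)) ==> pb (%x. h (f x))"
proof -
 assume "pb h" and f: "pb (%x. sz (f x))"
 then obtain a where "\<And>x. h x \<le> (sz x + 2) ^ a" unfolding pb_def by blast
 moreover have "pb (%x. (sz (f x) + 2) ^ a)" using f by (intro pb_power pb_add pb_const)
 ultimately show ?thesis by (auto intro: pb_mono[of "%x. (sz (f x) + 2) ^ a"])
qed

text \<open>As values are shared on the heap, the output size has to be bounded separately from the running time.\<close>

definition PT :: "('a::encodable => 'b::encodable) => bool" where
 "PT f \<longleftrightarrow> (\<exists>c t. (\<forall>x. run c (venc x) (venc (f x)) (t x)) & pb t & pb (%x. sz (f x)))"

lemma PTI: "(\<And>x. run c (venc x) (venc (f x)) (t x)) ==> pb t ==> pb (%x. sz (f x)) ==> PT f"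
 unfolding PT_def by blast

lemma PTE:
 assumes "PT f"
 obtains c t where "\<And>x. run c (venc x) (venc (f x)) (t x)" "pb t" "pb (%x. sz (f x))"
 using assms unfolding PT_def by blast

lemma pb_PT: "PT f ==> pb (%x. sz (f x))"
 unfolding PT_def by blast

named_theorems pt

lemma PT_id [pt]: "PT (%x. x)"
 by (rule PTI[of Cid _ "%_. 0"]) (auto intro: run_id)

lemma PT_comp: "PT f ==> PT g ==> PT (%x. f (g x))"
proof -
 assume "PT f" "PT g"
 then obtain c t d u where *: "\<And>x. run c (venc x) (venc (f x)) (t x)" "pb t" "pb (%x. sz (f x))"
  "\<And>x. run d (venc x) (venc (g x)) (u x)" "pb u" "pb (%x. sz (g x))" by (metis PTE)
 show ?thesis
  by (rule PTI[of "Cseq d c" _ "%x. u x + t (g x)"])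
    (rule run_seq[OF *(4) *(1)], intro pb_add pb_comp[OF *(2)] *, rule pb_comp[OF *(3) *(6)])
qed

lemma PT_cons_val: "PT f ==> PT g ==> (\<And>x. venc (h x) = Cn (venc (f x)) (venc (g x))) ==> PT h"
proof -
 assume "PT f" "PT g" and h: "\<And>x. venc (h x) = Cn (venc (f x)) (venc (g x))"
 then obtain c t d u where *: "\<And>x. run c (venc x) (venc (f x)) (t x)" "pb t" "pb (%x. sz (f x))"
  "\<And>x. run d (venc x) (venc (g x)) (u x)" "pb u" "pb (%x. sz (g x))" by (metis PTE)
 show ?thesis
  by (rule PTI[of "Cpair c d" _ "%x. t x + u x + 7"]) (auto simp: h intro!: * run_pair)
qed

lemma PT_nil_val: "(\<And>x. venc (h x) = Nl) ==> PT h"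
 by (rule PTI[of Cnil _ "%_. 1"]) (use run_nil in auto)

lemma PT_val_const: "PT (%x. v :: val)"
 by (induction v) (auto intro: PT_nil_val PT_cons_val)

lemma PT_cast: "PT f ==> (\<And>x. venc (f x) = venc (g x)) ==> PT g"
 unfolding PT_def by simp

lemma PT_const [pt]: "PT (%x. c)"
 by (rule PT_cast[OF PT_val_const[of "venc c"]]) simp

lemma PT_Pair [pt]: "PT f ==> PT g ==> PT (%x. (f x, g x))"
 by (rule PT_cons_val[of f g]) auto

lemma PT_Cons [pt]: "PT f ==> PT g ==> PT (%x. f x # g x)"
 by (rule PT_cons_val[of f g]) auto

lemma PT_Suc [pt]: "PT g ==> PT (%x. Suc (g x))"
 by (rule PT_cons_val[of "%_. ()" g]) (auto intro: PT_const)

lemma PT_fst [pt]: "PT f ==> PT (%x. fst (f x))"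
 by (rule PT_comp[of fst]) (rule PTI[of Cfst _ "%_. 1"],
  use run_fst in \<open>auto simp: venc_prod_def intro: pb_mono[OF pb_sz]\<close>)

lemma PT_snd [pt]: "PT f ==> PT (%x. snd (f x))"
 by (rule PT_comp[of snd]) (rule PTI[of Csnd _ "%_. 2"],
  use run_snd in \<open>auto simp: venc_prod_def numeral_2_eq_2 intro: pb_mono[OF pb_sz]\<close>)

lemma PT_branch:
 assumes "PT c" "PT f" "PT g"
  and "\<And>x. venc (h x) = (if venc (c x) ~= Nl then venc (f x) else venc (g x))"
 shows "PT h"
proof -
 obtain c1 t1 where 1: "\<And>x. run c1 (venc x) (venc (c x)) (t1 x)" "pb t1" using assms(1) by (metis PTE)
 obtain c2 t2 where 2: "\<And>x. run c2 (venc x) (venc (f x)) (t2 x)" "pb t2" using assms(2) by (metis PTE)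
 obtain c3 t3 where 3: "\<And>x. run c3 (venc x) (venc (g x)) (t3 x)" "pb t3" using assms(3) by (metis PTE)
 show ?thesis
 proof (rule PTI[of "Cif c1 c2 c3" _ "%x. t1 x + (t2 x + t3 x) + 4"])
  show "run (Cif c1 c2 c3) (venc x) (venc (h x)) (t1 x + (t2 x + t3 x) + 4)" for x
   using assms(4)[of x] by (intro run_if[OF 1(1)]) (auto intro: run_mono[OF 2(1)] run_mono[OF 3(1)])
  show "pb (%x. sz (h x))"
   by (rule pb_mono[OF pb_add[OF pb_PT[OF assms(2)] pb_PT[OF assms(3)]]]) (simp add: assms(4))
 qed (use 1 2 3 in \<open>intro pb_add pb_const\<close>)
qed

lemma PT_if [pt]: "PT c ==> PT f ==> PT g ==> PT (%x. if c x then f x else g x)"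
 by (rule PT_branch[of c f g]) (auto simp: venc_bool_def)

text \<open>Lists, naturals and trees share the shape \<open>Nl\<close> or \<open>Cn\<close>, so one
  argument serves all their case distinctions. If \<open>l x\<close> is a node, then the pair of
  \<open>x\<close> and \<open>l x\<close> already is the encoding of
  \<open>(x, a, b)\<close>.\<close>

lemma PT_case_val:
 fixes l :: "'a::encodable => 'b::encodable" and g :: "'a \<times> 'd::encodable \<times> 'e::encodable => 'c::encodable"
 assumes l: "PT l" and f: "PT f" and g: "PT g"
  and h: "\<And>x. venc (l x) = Nl ==> h x = f x"
   "\<And>x a b. venc (l x) = Cn (venc a) (venc b) ==> h x = g (x, a, b)"
  and ex: "\<And>x. venc (l x) ~= Nl ==> \<exists>(a::'d) (b::'e). venc (l x) = Cn (venc a) (venc b)"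
 shows "PT h"
proof -
 obtain c1 t1 where 1: "\<And>x. run c1 (venc x) (venc (l x)) (t1 x)" "pb t1" using l by (metis PTE)
 obtain c2 t2 where 2: "\<And>x. run c2 (venc x) (venc (f x)) (t2 x)" "pb t2" using f by (metis PTE)
 obtain c3 t3 where 3: "\<And>x. run c3 (venc x) (venc (g x)) (t3 x)" "pb t3" "pb (%x. sz (g x))"
  using g by (metis PTE)
 let ?c = "Cif c1 (Cseq (Cpair Cid c1) c3) c2"
 obtain a1 where a1: "\<And>x. t3 x \<le> (sz x + 2) ^ a1" using 3(2) unfolding pb_def by blast
 obtain a2 where a2: "\<And>x. sz (g x) \<le> (sz x + 2) ^ a2" using 3(3) unfolding pb_def by blast
 let ?t = "%x. t1 x + (t2 x + (t1 x + 7 + (Suc (sz x + sz (l x)) + 2) ^ a1)) + 4"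
 show ?thesis
 proof (rule PTI[of ?c _ ?t])
  fix x
  show "run ?c (venc x) (venc (h x)) (?t x)"
  proof (cases "venc (l x) = Nl")
   case True
   then show ?thesis
    by (intro run_if[OF 1(1)]) (auto simp: h(1) intro: run_mono[OF 2(1)])
  next
   case False
   then obtain a :: 'd and b :: 'e where ab: "venc (l x) = Cn (venc a) (venc b)" using ex by blast
   have s: "sz (x, a, b) = Suc (sz x + sz (l x))" by (simp add: ab)
   have "run (Cseq (Cpair Cid c1) c3) (venc x) (venc (h x)) (0 + t1 x + 7 + t3 (x, a, b))"
   proof (rule run_seq[where y = "venc (x, a, b)"])
    show "run (Cpair Cid c1) (venc x) (venc (x, a, b)) (0 + t1 x + 7)"
     using run_pair[OF run_id 1(1), of x] by (simp add: ab)
    show "run c3 (venc (x, a, b)) (venc (h x)) (t3 (x, a, b))" using 3(1)[of "(x, a, b)"] h(2)[OF ab] by simp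
   qed
   moreover have "t3 (x, a, b) \<le> (Suc (sz x + sz (l x)) + 2) ^ a1" using a1[of "(x, a, b)"] unfolding s .
   ultimately show ?thesis using False
    by (intro run_if[OF 1(1)]) (auto elim!: run_mono)
  qed
 next
  show "pb ?t" using 1 2 pb_PT[OF l] by (intro pb_add pb_const pb_power pb_Suc pb_sz) auto
  have "pb (%x. sz (f x) + (Suc (sz x + sz (l x)) + 2) ^ a2)"
   using pb_PT[OF l] pb_PT[OF f] by (intro pb_add pb_const pb_power pb_Suc pb_sz) auto
  then show "pb (%x. sz (h x))"
  proof (rule pb_mono)
   fix x
   show "sz (h x) \<le> sz (f x) + (Suc (sz x + sz (l x)) + 2) ^ a2"
   proof (cases "venc (l x) = Nl")
    case False
    then obtain a :: 'd and b :: 'e where ab: "venc (l x) = Cn (venc a) (venc b)" using ex by blast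
    show ?thesis using a2[of "(x, a, b)"] h(2)[OF ab] ab by simp
   qed (simp add: h(1))
  qed
 qed
qed

lemma PT_case_list [pt]:
 fixes l :: "'a::encodable => 'c::encodable list"
 assumes "PT l" "PT f" "PT (%p. g (fst p) (fst (snd p)) (snd (snd p)))"
 shows "PT (%x. case l x of [] => f x | a # as => g x a as)"
proof (rule PT_case_val[OF assms])
 fix x and a :: 'c and as :: "'c list"
 assume "venc (l x) = Cn (venc a) (venc as)"
 then show "(case l x of [] => f x | a # as => g x a as) =
  g (fst (x, a, as)) (fst (snd (x, a, as))) (snd (snd (x, a, as)))" by (cases "l x") auto
next
 fix x assume "venc (l x) ~= Nl"
 then show "\<exists>(a::'c) (b::'c list). venc (l x) = Cn (venc a) (venc b)" by (cases "l x") auto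
next
 fix x assume "venc (l x) = Nl"
 then show "(case l x of [] => f x | a # as => g x a as) = f x" by (cases "l x") auto
qed

lemma PT_case_nat [pt]:
 assumes "PT l" "PT f" "PT (%p. g (fst p) (snd p))"
 shows "PT (%x. case l x of 0 => f x | Suc n => g x n)"
proof (rule PT_case_val[where g = "%p::_ \<times> unit \<times> nat. g (fst p) (snd (snd p))", OF assms(1,2)])
 show "PT (%p::_ \<times> unit \<times> nat. g (fst p) (snd (snd p)))"
  using PT_comp[OF assms(3), of "%p::_ \<times> unit \<times> nat. (fst p, snd (snd p))"]
  by (simp add: PT_Pair PT_fst PT_snd PT_id)
 fix x and a :: unit and n :: nat
 assume "venc (l x) = Cn (venc a) (venc n)"
 then show "(case l x of 0 => f x | Suc n => g x n) = g (fst (x, a, n)) (snd (snd (x, a, n)))"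
  by (cases "l x") auto
next
 fix x assume "venc (l x) ~= Nl"
 then show "\<exists>(a::unit) (b::nat). venc (l x) = Cn (venc a) (venc b)" by (cases "l x") auto
next
 fix x assume "venc (l x) = Nl"
 then show "(case l x of 0 => f x | Suc n => g x n) = f x" by (cases "l x") auto
qed

lemma PT_case_tree [pt]:
 assumes "PT l" "PT f" "PT (%p. g (fst p) (fst (snd p)) (snd (snd p)))"
 shows "PT (%x. case l x of Nl => f x | Cn u v => g x u v)"
proof (rule PT_case_val[OF assms])
 fix x assume "venc (l x) ~= Nl"
 then show "\<exists>(a::val) (b::val). venc (l x) = Cn (venc a) (venc b)" by (cases "l x") auto
qed auto

lemma PT_Let [pt]: "PT f ==> PT (%p. g (fst p) (snd p)) ==> PT (%x. let y = f x in g x y)"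
 using PT_comp[of "%p. g (fst p) (snd p)" "%x. (x, f x)"] by (simp add: Let_def PT_Pair PT_id)

lemma PT_case_prod [pt]:
 "PT p ==> PT (%q. f (fst q) (fst (snd q)) (snd (snd q))) ==> PT (%x. case p x of (a, b) => f x a b)"
 using PT_comp[of "%q. f (fst q) (fst (snd q)) (snd (snd q))" "%x. (x, p x)"]
 by (simp add: case_prod_beta PT_Pair PT_id)

lemma PT_comp2: "PT (%p. h (fst p) (snd p)) ==> PT f ==> PT g ==> PT (%x. h (f x) (g x))"
 using PT_comp[of "%p. h (fst p) (snd p)" "%x. (f x, g x)"] by (simp add: PT_Pair)

lemma PT_comp3: "PT (%p. h (fst p) (fst (snd p)) (snd (snd p))) ==> PT f ==> PT g ==> PT k ==>
  PT (%x. h (f x) (g x) (k x))"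
 using PT_comp[of "%p. h (fst p) (fst (snd p)) (snd (snd p))" "%x. (f x, g x, k x)"] by (simp add: PT_Pair)

section \<open>Loops, folds and iteration\<close>

lemma run_while:
 assumes "\<And>s. run c (venc s) (venc (b s)) (tc s)" "\<And>s. run f (venc s) (venc (g s)) (tf s)"
  and "\<And>k. k < n ==> b ((g ^^ k) s)" "\<not> b ((g ^^ n) s)"
  and "\<And>k. k \<le> n ==> tc ((g ^^ k) s) + tf ((g ^^ k) s) \<le> T"
 shows "run (Cwhile c f) (venc s) (venc ((g ^^ n) s)) (n * (T + 3) + T + 3)"
 using assms(3-5)
proof (induction n arbitrary: s)
 case 0
 have "venc (b s) = Nl" using 0 by (simp add: venc_bool_def)
 then have "run (Cwhile c f) (venc s) (venc s) (tc s + 3)"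
  using assms(1)[of s] run_while_exit[of c "venc s" "tc s" f] by simp
 then show ?case unfolding funpow_0 by (rule run_mono) (use 0(3)[of 0] in simp)
next
 case (Suc n)
 have b: "(venc (b s)) ~= Nl" using Suc.prems(1)[of 0] by (simp add: venc_bool_def)
 have f: "(g ^^ k) (g s) = (g ^^ Suc k) s" for k by (simp add: funpow_swap1)
 have "run (Cwhile c f) (venc (g s)) (venc ((g ^^ n) (g s))) (n * (T + 3) + T + 3)"
 proof (rule Suc.IH)
  show "b ((g ^^ k) (g s))" if "k < n" for k using Suc.prems(1)[of "Suc k"] that by (simp only: f Suc_less_eq)
  show "\<not> b ((g ^^ n) (g s))" using Suc.prems(2) unfolding f .
  show "tc ((g ^^ k) (g s)) + tf ((g ^^ k) (g s)) \<le> T" if "k \<le> n" for k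
   using Suc.prems(3)[of "Suc k"] that by (simp only: f Suc_le_mono)
 qed
 from run_while_step[OF assms(1) b assms(2) this] show ?case
  unfolding f by (rule run_mono) (use Suc.prems(3)[of 0] in simp)
qed

text \<open>Iterating a polynomial-time step may square the size in every round. Hence the bound
  \<open>B\<close> on all reachable states, besides the bound \<open>M\<close> on the measure that
  limits the number of rounds.\<close>

lemma PT_while:
 fixes i :: "'a::encodable => 's::encodable"
 assumes b: "PT b" and g: "PT g" and i: "PT i"
  and I: "\<And>x. I x (i x)" "\<And>x s. I x s ==> b s ==> I x (g s) & m (g s) < (m s :: nat)"
  and B: "\<And>x s. I x s ==> sz s \<le> B x" "pb B" and M: "\<And>x. m (i x) \<le> M x" "pb M"
  and h: "\<And>x s. I x s ==> \<not> b s ==> s = h x"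
 shows "PT h"
proof -
 obtain c1 t1 where 1: "\<And>s. run c1 (venc s) (venc (b s)) (t1 s)" "pb t1" using b by (metis PTE)
 obtain c2 t2 where 2: "\<And>s. run c2 (venc s) (venc (g s)) (t2 s)" "pb t2" using g by (metis PTE)
 obtain c3 t3 where 3: "\<And>x. run c3 (venc x) (venc (i x)) (t3 x)" "pb t3" using i by (metis PTE)
 obtain a where a: "\<And>s. t1 s + t2 s \<le> (sz s + 2) ^ a" using pb_add[OF 1(2) 2(2)] unfolding pb_def by blast
 have ex: "\<exists>n \<le> m s. (\<forall>k<n. b ((g ^^ k) s)) & \<not> b ((g ^^ n) s) & (\<forall>k\<le>n. I x ((g ^^ k) s))"
  if "I x s" for x s
  using that
 proof (induction "m s" arbitrary: s rule: less_induct)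
  case less
  show ?case
  proof (cases "b s")
   case True
   note s = I(2)[OF less.prems True]
   from less.hyps[of "g s"] s obtain n where n: "n \<le> m (g s)" "\<forall>k<n. b ((g ^^ k) (g s))"
    "\<not> b ((g ^^ n) (g s))" "\<forall>k\<le>n. I x ((g ^^ k) (g s))" by blast
   have f: "(g ^^ k) (g s) = (g ^^ Suc k) s" for k by (simp add: funpow_swap1)
   have "(\<forall>k<Suc n. b ((g ^^ k) s))" "(\<forall>k\<le>Suc n. I x ((g ^^ k) s))"
    using n(2,4) True less.prems unfolding f by (auto simp: All_less_Suc2 less_Suc_eq_le[symmetric])
   then show ?thesis using n(1,3) s unfolding f by (intro exI[of _ "Suc n"]) auto
  qed (use less.prems in auto)
 qed
 let ?T = "%x. (B x + 2) ^ a"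
 let ?t = "%x. t3 x + (M x * (?T x + 3) + ?T x + 3)"
 show ?thesis
 proof (rule PTI[of "Cseq c3 (Cwhile c1 c2)" _ ?t])
  fix x
  obtain n where n: "n \<le> m (i x)" "\<And>k. k<n ==> b ((g ^^ k) (i x))"
    "\<not> b ((g ^^ n) (i x))" "\<And>k. k\<le>n ==> I x ((g ^^ k) (i x))" using ex[OF I(1)] by metis
  have "t1 s + t2 s \<le> ?T x" if "I x s" for s
  proof -
   have "(sz s + 2) ^ a \<le> ?T x" using B(1)[OF that] by (intro power_mono) auto
   then show ?thesis using a[of s] by linarith
  qed
  then have r: "run (Cwhile c1 c2) (venc (i x)) (venc ((g ^^ n) (i x))) (n * (?T x + 3) + ?T x + 3)"
   by (intro run_while[OF 1(1) 2(1)] n(2,3)) (use n(4) in auto)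
  have e: "(g ^^ n) (i x) = h x" using n(3) n(4)[of n] h by blast
  have "n \<le> M x" using n(1) M(1)[of x] by simp
  then have "n * (?T x + 3) + ?T x + 3 \<le> M x * (?T x + 3) + ?T x + 3" by simp
  with r have "run (Cwhile c1 c2) (venc (i x)) (venc (h x)) (M x * (?T x + 3) + ?T x + 3)"
   unfolding e by (rule run_mono)
  then show "run (Cseq c3 (Cwhile c1 c2)) (venc x) (venc (h x)) (?t x)"
   by (rule run_seq[OF 3(1)])
 next
  show "pb ?t" using 3(2) B(2) M(2) by (intro pb_add pb_mult pb_power pb_const)
  have "sz (h x) \<le> B x" for x
  proof -
   obtain n where "\<not> b ((g ^^ n) (i x))" "I x ((g ^^ n) (i x))" using ex[OF I(1)] by blast
   then show ?thesis using h B(1) by metis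
  qed
  then show "pb (%x. sz (h x))" by (rule pb_mono[OF B(2)])
 qed
qed

text \<open>The bound \<open>B\<close> concerns the accumulator after every prefix and not just the
  result. The state of the loop carries \<open>x\<close> along because the folded function depends
  on it.\<close>

lemma PT_foldl:
 assumes l: "PT l" and i: "PT i" and g: "PT (%p. g (fst p) (fst (snd p)) (snd (snd p)))"
  and B: "\<And>x k. k \<le> length (l x) ==> sz (foldl (g x) (i x) (take k (l x))) \<le> B x" "pb B"
 shows "PT (%x. foldl (g x) (i x) (l x))"
proof -
 define b where "b = (%st::'a \<times> 'b list \<times> 'c. case fst (snd st) of [] => False | _ # _ => True)"
 define stp where "stp = (%st::'a \<times> 'b list \<times> 'c.
  case fst (snd st) of [] => st | a # l' => (fst st, l', g (fst st) (snd (snd st)) a))"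
 define I where "I = (%x st. \<exists>k \<le> length (l x). st = (x, drop k (l x), foldl (g x) (i x) (take k (l x))))"
 have "PT (%x. (x, [] :: 'b list, foldl (g x) (i x) (l x)))"
 proof (rule PT_while[where b = b and g = stp and i = "%x. (x, l x, i x)" and I = I
   and m = "%st. length (fst (snd st))" and M = "%x. sz (l x)"
   and B = "%x. Suc (sz x + Suc (sz (l x) + B x))"])
  show "PT b" unfolding b_def by (intro pt)
  have "PT (%p. g (fst (fst p)) (snd (snd (fst p))) (fst (snd p)))"
   using PT_comp3[OF g, of "%p. fst (fst p)" "%p. snd (snd (fst p))" "%p. fst (snd p)"] by (simp add: pt)
  then show "PT stp" unfolding stp_def by (intro pt)
  show "PT (%x. (x, l x, i x))" by (intro pt l i)
  show "I x (x, l x, i x)" for x unfolding I_def by (intro exI[of _ 0]) simp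
  show "I x (stp s) & length (fst (snd (stp s))) < length (fst (snd s))" if "I x s" "b s" for x s
  proof -
   from that(1) obtain k where k: "k \<le> length (l x)"
    "s = (x, drop k (l x), foldl (g x) (i x) (take k (l x)))" unfolding I_def by blast
   have "k < length (l x)" using that(2) k unfolding b_def by (cases "k < length (l x)") auto
   then show ?thesis unfolding I_def k(2) stp_def
    by (auto simp: Cons_nth_drop_Suc[symmetric] take_Suc_conv_app_nth intro!: exI[of _ "Suc k"])
  qed
  show "sz s \<le> Suc (sz x + Suc (sz (l x) + B x))" if "I x s" for x s
  proof -
   from that obtain k where k: "k \<le> length (l x)"
    "s = (x, drop k (l x), foldl (g x) (i x) (take k (l x)))" unfolding I_def by blast
   have "sz (drop k (l x)) \<le> sz (l x)"
    using sz_append[of "take k (l x)" "drop k (l x)"] vsize_pos[of "venc (take k (l x))"]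
    by (simp del: vsize_pos)
   then show ?thesis using B(1)[OF k(1)] by (simp add: k(2))
  qed
  show "pb (%x. Suc (sz x + Suc (sz (l x) + B x)))" by (intro pb_Suc pb_add pb_sz pb_PT[OF l] B(2))
  show "length (fst (snd (x, l x, i x))) \<le> sz (l x)" for x using length_less_sz[of "l x"] by simp
  show "pb (%x. sz (l x))" by (rule pb_PT[OF l])
  show "s = (x, [], foldl (g x) (i x) (l x))" if "I x s" "\<not> b s" for x s
   using that unfolding I_def b_def by (auto split: list.splits)
 qed
 from PT_snd[OF PT_snd[OF this]] show ?thesis by simp
qed

lemma PT_rev [pt]: "PT l ==> PT (%x. rev (l x))"
proof -
 assume l: "PT l"
 have r: "foldl (%s a. a # s) [] xs = rev xs" for xs :: "'b list"
  by (induction xs rule: rev_induct) auto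
 have "PT (%x. foldl (%s a. a # s) [] (l x))"
 proof (rule PT_foldl[where B = "%x. sz (l x)"])
  show "PT (%p :: 'a \<times> 'b list \<times> 'b. snd (snd p) # fst (snd p))" by (intro pt)
 qed (auto simp: r sz_take intro: l pb_PT pt)
 then show ?thesis by (simp add: r)
qed

lemma PT_map [pt]:
 assumes g: "PT (%p. g (fst p) (snd p))" and l: "PT l"
 shows "PT (%x. map (g x) (l x))"
proof -
 have r: "foldl (%s a. h a # s) [] xs = rev (map h xs)" for xs :: "'b list" and h :: "'b => 'c"
  by (induction xs rule: rev_induct) auto
 obtain a where a: "\<And>p. sz (g (fst p) (snd p)) \<le> (sz p + 2) ^ a" using pb_PT[OF g] unfolding pb_def by blast
 let ?m = "%x. (Suc (sz x + sz (l x)) + 2) ^ a"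
 have "PT (%x. foldl (%s a. g x a # s) [] (rev (l x)))"
 proof (rule PT_foldl[where B = "%x. Suc (sz (l x) * Suc (?m x))"])
  show "PT (%p :: 'a \<times> 'c list \<times> 'b. g (fst p) (snd (snd p)) # fst (snd p))"
   by (intro pt PT_comp2[OF g])
  show "pb (%x. Suc (sz (l x) * Suc (?m x)))"
   by (intro pb_Suc pb_mult pb_power pb_add pb_PT[OF l] pb_sz pb_const)
  fix x and k
  assume k: "k \<le> length (rev (l x))"
  show "sz (foldl (%s a. g x a # s) [] (take k (rev (l x)))) \<le> Suc (sz (l x) * Suc (?m x))"
   unfolding r sz_rev
  proof (rule sz_list_le)
   show "length (map (g x) (take k (rev (l x)))) \<le> sz (l x)" using length_less_sz[of "l x"] by simp
   fix y assume "y \<in> set (map (g x) (take k (rev (l x))))"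
   then obtain b where b: "b \<in> set (l x)" "y = g x b" by (auto dest: in_set_takeD)
   have "sz y \<le> (sz (x, b) + 2) ^ a" using a[of "(x, b)"] b(2) by simp
   also have "\<dots> \<le> ?m x" using sz_mem[OF b(1)] by (intro power_mono) auto
   finally show "sz y \<le> ?m x" .
  qed
 qed (intro pt l)+
 then show ?thesis by (simp add: r rev_map)
qed

lemma PT_append [pt]: "PT l ==> PT k ==> PT (%x. l x @ k x)"
proof -
 assume l: "PT l" and k: "PT k"
 have r: "foldl (%s a. a # s) ys xs = rev xs @ ys" for xs ys :: "'b list"
  by (induction xs rule: rev_induct) auto
 have "PT (%x. foldl (%s a. a # s) (k x) (rev (l x)))"
 proof (rule PT_foldl[where B = "%x. sz (l x) + sz (k x)"])
  show "PT (%p :: 'a \<times> 'b list \<times> 'b. snd (snd p) # fst (snd p))" by (intro pt)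
  show "sz (foldl (%s a. a # s) (k x) (take j (rev (l x)))) \<le> sz (l x) + sz (k x)" for x j
   using sz_append[of "rev (take j (rev (l x)))" "k x"] sz_take[of j "rev (l x)"] unfolding r
   by simp
 qed (intro pt l k pb_add pb_PT)+
 then show ?thesis by (simp add: r)
qed

lemma sz_concat: "sz (concat xss) \<le> sz xss"
proof (induction xss)
 case (Cons a xss)
 then show ?case using sz_append[of a "concat xss"] by simp
qed simp

lemma PT_concat [pt]: "PT l ==> PT (%x. concat (l x))"
proof -
 assume l: "PT l"
 have r: "foldl (%s a. a @ s) [] xs = concat (rev xs)" for xs :: "'b list list"
  by (induction xs rule: rev_induct) auto
 have "PT (%x. foldl (%s a. a @ s) [] (rev (l x)))"
 proof (rule PT_foldl[where B = "%x. sz (l x)"])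
  show "PT (%p :: 'a \<times> 'b list \<times> 'b list. snd (snd p) @ fst (snd p))" by (intro pt)
  show "sz (foldl (%s a. a @ s) [] (take j (rev (l x)))) \<le> sz (l x)" for x j
   using sz_concat[of "rev (take j (rev (l x)))"] sz_take[of j "rev (l x)"] unfolding r by simp
 qed (intro pt l pb_PT)+
 then show ?thesis by (simp add: r)
qed

lemma filter_conv_concat: "filter P xs = concat (map (%a. if P a then [a] else []) xs)"
 by (induction xs) auto

lemma PT_filter [pt]:
 assumes "PT (%p. g (fst p) (snd p))" "PT l"
 shows "PT (%x. filter (g x) (l x))"
 unfolding filter_conv_concat by (intro pt assms)

lemma PT_not [pt]: "PT f ==> PT (%x. \<not> f x)"
 by (rule PT_cast[OF PT_if[of f "%_. False" "%_. True"]]) (auto intro: PT_const)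

lemma PT_conj [pt]: "PT f ==> PT g ==> PT (%x. f x & g x)"
 by (rule PT_cast[OF PT_if[of f g "%_. False"]]) (auto intro: PT_const)

lemma PT_disj [pt]: "PT f ==> PT g ==> PT (%x. f x \<or> g x)"
 by (rule PT_cast[OF PT_if[of f "%_. True" g]]) (auto intro: PT_const)

lemma PT_imp [pt]: "PT f ==> PT g ==> PT (%x. f x --> g x)"
 by (rule PT_cast[OF PT_if[of f g "%_. True"]]) (auto intro: PT_const)

lemma PT_Ball [pt]:
 assumes "PT (%p. g (fst p) (snd p))" "PT l"
 shows "PT (%x. \<forall>a\<in>set (l x). g x a)"
proof -
 have "PT (%x. case filter (%a. \<not> g x a) (l x) of [] => True | _ # _ => False)"
  by (intro pt assms)
 moreover have "(case filter (%a. \<not> g x a) (l x) of [] => True | _ # _ => False) = (\<forall>a\<in>set (l x). g x a)" for x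
  by (auto split: list.splits simp: filter_empty_conv filter_eq_Cons_iff)
 ultimately show ?thesis by simp
qed

lemma PT_Bex [pt]:
 assumes "PT (%p. g (fst p) (snd p))" "PT l"
 shows "PT (%x. \<exists>a\<in>set (l x). g x a)"
proof -
 have "PT (%x. \<not> (\<forall>a\<in>set (l x). \<not> g x a))" by (intro pt assms)
 then show ?thesis by simp
qed

text \<open>Naturals and lists of units coincide as trees. Addition is therefore concatenation, and
  counting loops are folds.\<close>

lemma venc_units: "venc (replicate n ()) = venc n"
 by (induction n) auto

lemma PT_units [pt]: "PT f ==> PT (%x. replicate (f x) ())"
 by (erule PT_cast) (simp add: venc_units)

lemma foldl_units: "foldl (%s _. f s) i (replicate n ()) = (f ^^ n) i"
 by (induction n arbitrary: i) (auto simp: funpow_swap1)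

lemma PT_funpow:
 fixes g :: "'a::encodable => 'b::encodable => 'b"
 assumes n: "PT n" and i: "PT i" and g: "PT (%p. g (fst p) (snd p))"
  and B: "\<And>x k. k \<le> n x ==> sz ((g x ^^ k) (i x)) \<le> B x" "pb B"
 shows "PT (%x. (g x ^^ n x) (i x))"
proof (rule PT_cast)
 show "venc (foldl (%s _. g x s) (i x) (replicate (n x) ())) = venc ((g x ^^ n x) (i x))" for x
  by (simp add: foldl_units)
 show "PT (%x. foldl (%s _. g x s) (i x) (replicate (n x) ()))"
 proof (rule PT_foldl[OF PT_units[OF n] i _ _ B(2)])
 show "PT (%p :: 'a \<times> 'b \<times> unit. g (fst p) (fst (snd p)))" by (intro PT_comp2[OF g] pt)
 fix x k
 assume "k \<le> length (replicate (n x) ())"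
 then show "sz (foldl (%s _. g x s) (i x) (take k (replicate (n x) ()))) \<le> B x"
  using B(1)[of k x] by (simp add: foldl_units min_def)
 qed
qed

lemma PT_length [pt]: "PT l ==> PT (%x. length (l x))"
proof (rule PT_cast)
 show "PT l ==> PT (%x. map (%_. ()) (l x))" by (intro pt)
 show "venc (map (%_. ()) (l x)) = venc (length (l x))" for x
  by (simp add: map_replicate_const venc_units)
qed

lemma PT_add [pt]: "PT f ==> PT g ==> PT (%x. f x + g x :: nat)"
 using PT_length[OF PT_append[OF PT_units PT_units], of f g] by simp

lemma PT_mult [pt]: "PT f ==> PT g ==> PT (%x. f x * g x :: nat)"
proof -
 assume fg: "PT f" "PT g"
 have "PT (%x. length (concat (map (%_. replicate (f x) ()) (replicate (g x) ()))))"
  by (intro pt fg)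
   (rule PT_comp[OF fg(1) PT_fst[OF PT_id]])
 then show ?thesis by (simp add: length_concat map_replicate_const sum_list_replicate mult.commute)
qed

lemma PT_pred [pt]: "PT f ==> PT (%x. f x - Suc 0)"
proof -
 assume f: "PT f"
 have "PT (%x. case f x of 0 => 0 | Suc n => n)" by (intro pt f)
 moreover have "(case f x of 0 => 0 | Suc n => n) = f x - Suc 0" for x by (cases "f x") auto
 ultimately show ?thesis by simp
qed

lemma funpow_pred: "((%n. n - Suc 0) ^^ k) m = m - k"
 by (induction k) auto

lemma PT_minus [pt]: "PT f ==> PT g ==> PT (%x. f x - g x :: nat)"
proof -
 assume fg: "PT f" "PT g"
 have "PT (%x. ((%n. n - Suc 0) ^^ g x) (f x))"
  by (rule PT_funpow[OF fg(2,1) _ _ pb_PT[OF fg(1)]]) (intro pt, simp add: funpow_pred)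
 then show ?thesis by (simp add: funpow_pred)
qed

lemma PT_le [pt]: "PT f ==> PT g ==> PT (%x. f x \<le> (g x :: nat))"
proof -
 assume fg: "PT f" "PT g"
 have "PT (%x. case f x - g x of 0 => True | Suc _ => False)" by (intro pt fg)
 moreover have "(case f x - g x of 0 => True | Suc _ => False) = (f x \<le> g x)" for x
  by (cases "f x - g x") auto
 ultimately show ?thesis by simp
qed

lemma PT_less [pt]: "PT f ==> PT g ==> PT (%x. f x < (g x :: nat))"
 using PT_le[OF PT_Suc, of f g] by (simp add: Suc_le_eq)

lemma PT_power [pt]: "PT f ==> PT (%x. f x ^ k :: nat)"
 by (induction k) (auto intro: PT_const PT_mult)

lemma PT_upt [pt]: "PT f ==> PT (%x. [0..<f x])"
proof -
 assume f: "PT f"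
 have r: "((%l. l @ [length l]) ^^ k) [] = [0..<k]" for k by (induction k) auto
 have s: "sz [0..<k] \<le> Suc (k * Suc (2 * k + 1))" for k :: nat
  by (rule sz_list_le) auto
 have "PT (%x. ((%l. l @ [length l]) ^^ f x) [])"
 proof (rule PT_funpow[OF f, where B = "%x. Suc (sz (f x) * Suc (2 * sz (f x) + 1))"])
  show "PT (%p::'a \<times> nat list. snd p @ [length (snd p)])" by (intro pt)
  show "sz (((%l. l @ [length l]) ^^ k) []) \<le> Suc (sz (f x) * Suc (2 * sz (f x) + 1))" if "k \<le> f x" for x k
  proof -
   have "sz (((%l. l @ [length l]) ^^ k) []) \<le> Suc (k * Suc (2 * k + 1))" unfolding r by (rule s)
   also have "\<dots> \<le> Suc (sz (f x) * Suc (2 * sz (f x) + 1))"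
    using that by (intro Suc_le_mono[THEN iffD2] mult_le_mono) auto
   finally show ?thesis .
  qed
 qed (intro pt pb_Suc pb_mult pb_add pb_const pb_PT[OF f])+
 then show ?thesis by (simp add: r)
qed

lemma PT_tl [pt]: "PT l ==> PT (%x. tl (l x))"
proof -
 assume l: "PT l"
 have "PT (%x. case l x of [] => [] | _ # as => as)" by (intro pt l)
 moreover have "(case l x of [] => [] | _ # as => as) = tl (l x)" for x by (cases "l x") auto
 ultimately show ?thesis by simp
qed

lemma funpow_tl: "(tl ^^ k) xs = drop k xs"
 by (induction k) (auto simp: drop_Suc tl_drop)

lemma sz_drop: "sz (drop k xs) \<le> sz xs"
 using sz_append[of "take k xs" "drop k xs"] vsize_pos[of "venc (take k xs)"]
 by (simp del: vsize_pos)

lemma PT_drop [pt]: "PT f ==> PT l ==> PT (%x. drop (f x) (l x))"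
proof -
 assume fl: "PT f" "PT l"
 have "PT (%x. (tl ^^ f x) (l x))"
  by (rule PT_funpow[OF fl _ _ pb_PT[OF fl(2)]]) (intro pt, simp add: funpow_tl sz_drop)
 then show ?thesis by (simp add: funpow_tl)
qed

lemma PT_take [pt]: "PT f ==> PT l ==> PT (%x. take (f x) (l x))"
proof -
 assume fl: "PT f" "PT l"
 have "PT (%x. rev (drop (length (l x) - f x) (rev (l x))))" by (intro pt fl)
 moreover have "rev (drop (length (l x) - f x) (rev (l x))) = take (f x) (l x)" for x
  by (cases "f x \<le> length (l x)") (auto simp: rev_drop)
 ultimately show ?thesis by simp
qed

text \<open>Indexing with \<open>!\<close> is unspecified beyond the end of a list, whereas
  \<open>PT\<close> speaks of all arguments; the default value makes indexing total.\<close>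

definition nth_def0 :: "'a => 'a list => nat => 'a" where
 "nth_def0 d xs i = (case drop i xs of [] => d | a # _ => a)"

lemma nth_def0 [simp]: "i < length xs ==> nth_def0 d xs i = xs ! i"
 by (simp add: nth_def0_def Cons_nth_drop_Suc[symmetric])

lemma PT_nth_def0 [pt]: "PT d ==> PT l ==> PT f ==> PT (%x. nth_def0 (d x) (l x) (f x))"
 unfolding nth_def0_def by (rule PT_case_list) (intro pt | assumption)+

text \<open>Comparing two trees recursively would need a stack; it is made explicit as a list of
  pairs still to be compared. Replacing a pair of nodes by the two pairs of children preserves the
  encoded size exactly, so the list never grows.\<close>

definition eq_step :: "bool \<times> (val \<times> val) list => bool \<times> (val \<times> val) list" where
 "eq_step s = (case snd s of [] => s | p # w =>
   (case fst p of
    Nl => (case snd p of Nl => (fst s, w) | Cn _ _ => (False, []))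
   | Cn a b => (case snd p of Nl => (False, []) | Cn c d => (fst s, (a, c) # (b, d) # w))))"

lemma PT_val_eq: "PT (%p :: val \<times> val. fst p = snd p)"
proof -
 define m where "m = (%s :: bool \<times> (val \<times> val) list. \<Sum>p\<leftarrow>snd s. vsize (fst p))"
 \<comment> \<open>The constant 6 is the size that \<open>(True, [p])\<close> has in addition to
   \<open>p\<close>.\<close>
 define I where "I = (%(p :: val \<times> val) (s :: bool \<times> (val \<times> val) list).
  (fst s & (\<forall>q\<in>set (snd s). fst q = snd q) \<longleftrightarrow> fst p = snd p) & sz s \<le> sz p + 6)"
 have "PT (%p :: val \<times> val. (fst p = snd p, [] :: (val \<times> val) list))"
 proof (rule PT_while[where g = eq_step and i = "%p. (True, [p])" and b = "%s. snd s ~= []"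
   and m = m and I = I and B = "%p. sz p + 6" and M = "%p. sz p"])
  have "PT (%s :: bool \<times> (val \<times> val) list. case snd s of [] => False | _ # _ => True)" by (intro pt)
  then show "PT (%s :: bool \<times> (val \<times> val) list. snd s ~= [])"
   by (rule PT_cast) (auto split: list.splits)
  show "PT eq_step" unfolding eq_step_def by (intro pt)
  show "I p (eq_step s) & m (eq_step s) < m s" if I: "I p s" and "snd s ~= []" for p s
  proof -
   from that(2) obtain f u v w where s: "s = (f, (u, v) # w)"
    by (metis list.exhaust prod.collapse)
   show ?thesis using I unfolding s I_def m_def
    by (cases u; cases v) (auto simp: eq_step_def venc_bool_def)
  qed
  show "s = (fst p = snd p, [])" if "I p s" "\<not> snd s ~= []" for p s
   using that by (cases s) (auto simp: I_def)
  show "PT (%p. (True, [p]))" by (intro pt)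
  show "pb (%p :: val \<times> val. sz p + 6)" "pb (%p :: val \<times> val. sz p)" by (intro pb_add pb_sz pb_const)+
 qed (auto simp: m_def I_def venc_bool_def venc_prod_def)
 from PT_fst[OF this] show ?thesis by simp
qed

lemma PT_venc: "PT f ==> PT (%x. venc (f x))"
 by (erule PT_cast) simp

lemma PT_eq [pt]: "PT f ==> PT g ==> PT (%x. f x = g x)"
 using PT_comp[OF PT_val_eq, of "%x. (venc (f x), venc (g x))"] by (simp add: PT_Pair PT_venc)

lemma PT_mem [pt]: "PT a ==> PT l ==> PT (%x. a x \<in> set (l x))"
proof -
 assume "PT a" "PT l"
 then have "PT (%x. \<exists>b\<in>set (l x). a x = b)"
  by (intro pt) (rule PT_comp[OF _ PT_fst[OF PT_id]])
 then show ?thesis by simp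
qed

lemma PT_subset [pt]: "PT k ==> PT l ==> PT (%x. set (k x) \<subseteq> set (l x))"
proof -
 assume "PT k" "PT l"
 then have "PT (%x. \<forall>b\<in>set (k x). b \<in> set (l x))"
  by (intro pt) (rule PT_comp[OF _ PT_fst[OF PT_id]])
 then show ?thesis by (simp add: subset_iff Ball_def)
qed

lemma venc_blist: "venc bs = blist bs"
proof (induction bs)
 case (Cons b bs) then show ?case by (cases b) (auto simp: venc_bool_def)
qed simp

text \<open>Since the machine hands over the input reversed, the term to be compiled is the one for
  \<open>f\<close> after \<open>rev\<close>.\<close>

theorem PT_polytime:
 assumes "PT f"
 shows "polytime_computable f"
proof -
 have "PT (%x. f (rev x))" using PT_comp[OF assms PT_rev[OF PT_id]] .
 then obtain c t where c: "\<And>x. run c (venc x) (venc (f (rev x))) (t x)" "pb t" "pb (%x. sz (f (rev x)))"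
  by (rule PTE) blast
 have "pb (%x :: bool list. t x + 12 * sz x + 6 * sz (f (rev x)) + 7)"
  using c by (intro pb_add pb_mult pb_const pb_sz)
 then obtain a where a: "\<And>x. t x + 12 * sz x + 6 * sz (f (rev x)) + 7 \<le> (sz x + 2) ^ a"
  unfolding pb_def by blast
 have s: "sz x \<le> 4 * length x + 1" for x :: "bool list"
  by (induction x) (auto simp: venc_bool_def)
 define q :: "nat poly" where "q = [:3, 4:] ^ a"
 show ?thesis unfolding polytime_computable_def
 proof (intro exI allI)
  fix x
  have "run c (blist (rev x)) (blist (f x)) (t (rev x))" using c(1)[of "rev x"] by (simp add: venc_blist)
  from run_computes_in[OF this]
  have "computes_in (io_prog c) x (t (rev x) + 12 * length x + 6 * length (f x) + 7) (f x)" .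
  moreover have "t (rev x) + 12 * length x + 6 * length (f x) + 7 \<le> poly q (length x)"
  proof -
   have "t (rev x) + 12 * length x + 6 * length (f x) + 7 \<le>
    t (rev x) + 12 * sz (rev x) + 6 * sz (f (rev (rev x))) + 7"
    using length_less_sz[of x] length_less_sz[of "f x"] by simp
   also have "\<dots> \<le> (sz (rev x) + 2) ^ a" by (rule a)
   also have "\<dots> \<le> (4 * length x + 3) ^ a" using s[of x] by (intro power_mono) auto
   finally show ?thesis by (simp add: q_def poly_power algebra_simps)
  qed
  ultimately show "computes_in (io_prog c) x (poly q (length x)) (f x)" by (rule computes_in_mono)
 qed
qed

section \<open>Leaves and cliques\<close>

lemma adj_sym: "adj G u v \<longleftrightarrow> adj G v u"
 by (simp add: adj_def insert_commute)

lemma simple_graph_adj: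
 "simple_graph G ==> adj G u v ==> u \<in> verts G & v \<in> verts G & u ~= v"
 unfolding simple_graph_def adj_def by fastforce

lemma adj_delete: "adj (delete_edges G F) u v \<longleftrightarrow> adj G u v & {u, v} \<notin> F"
 by (simp add: adj_def delete_edges_def)

lemma verts_delete [simp]: "verts (delete_edges G F) = verts G"
 by (simp add: delete_edges_def)

definition embeds :: "'a graph => 'b graph => ('a => 'b) => bool" where
 "embeds H G f \<longleftrightarrow> inj_on f (verts H) & f ` verts H \<subseteq> verts G &
   (\<forall>u \<in> verts H. \<forall>v \<in> verts H. adj H u v \<longleftrightarrow> adj G (f u) (f v))"

lemma induced_free_iff: "induced_free H G \<longleftrightarrow> (\<nexists>f. embeds H G f)"
proof -
 have a: "adj (induced G S) x y \<longleftrightarrow> adj G x y" if "x \<in> S" "y \<in> S" for S x y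
  using that by (auto simp: adj_def induced_def)
 have "(\<exists>S \<subseteq> verts G. graph_iso H (induced G S)) \<longleftrightarrow> (\<exists>f. embeds H G f)"
 proof
  assume "\<exists>S \<subseteq> verts G. graph_iso H (induced G S)"
  then obtain S f where S: "S \<subseteq> verts G" "bij_betw f (verts H) S"
   "\<forall>u \<in> verts H. \<forall>v \<in> verts H. adj H u v \<longleftrightarrow> adj (induced G S) (f u) (f v)"
   by (auto simp: graph_iso_def induced_def)
  then have "embeds H G f" using a unfolding embeds_def bij_betw_def by (metis imageI)
  then show "\<exists>f. embeds H G f" by blast
 next
  assume "\<exists>f. embeds H G f"
  then obtain f where f: "embeds H G f" by blast
  have "bij_betw f (verts H) (verts (induced G (f ` verts H)))"
   using f by (simp add: embeds_def induced_def bij_betw_def)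
  moreover have "\<forall>u \<in> verts H. \<forall>v \<in> verts H. adj H u v \<longleftrightarrow> adj (induced G (f ` verts H)) (f u) (f v)"
   using f by (simp add: embeds_def a)
  ultimately have "graph_iso H (induced G (f ` verts H))" unfolding graph_iso_def by blast
  then show "\<exists>S \<subseteq> verts G. graph_iso H (induced G S)" using f unfolding embeds_def by blast
 qed
 then show ?thesis unfolding induced_free_def by simp
qed

text \<open>
 An induced copy of \<open>H\<close> up to leaves: \<open>W\<close> is embedded, every vertex outside \<open>W\<close> is a leaf
 attached to \<open>W\<close>, and \<open>s x\<close> leaves are available for free at the vertex \<open>x\<close>.
\<close>

definition leaf_emb :: "'a graph => ('b => nat) => 'b graph => 'a set => ('a => 'b) => bool" where
 "leaf_emb H s G W f \<longleftrightarrow> W \<subseteq> verts H & inj_on f W & f ` W \<subseteq> verts G &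
   (\<forall>u \<in> W. \<forall>v \<in> W. adj H u v \<longleftrightarrow> adj G (f u) (f v)) &
   (\<forall>u \<in> verts H - W. \<exists>w \<in> W. adj H u w & (\<forall>v. adj H u v --> v = w)) &
   (\<forall>w \<in> W. card {u \<in> verts H - W. adj H u w} \<le> s (f w))"

text \<open>Lists as names allow new vertices to be formed by prefixing a tag to old names, with no
  need for fresh numbers.\<close>

type_synonym name = "nat list"
type_synonym ngraph = "name list \<times> (name \<times> name) list"

text \<open>Loops, repetitions and pairs with a missing endpoint are ignored. So every value denotes
  a simple graph, and the constructions carry no invariant.\<close>

definition gr :: "'b list \<times> ('b \<times> 'b) list => 'b graph" where
 "gr g = \<lparr>verts = set (fst g), edges = {{u, v} | u v. (u, v) \<in> set (snd g) &
   u \<in> set (fst g) & v \<in> set (fst g) & u ~= v}\<rparr>"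

lemma verts_gr [simp]: "verts (gr g) = set (fst g)"
 by (simp add: gr_def)

lemma adj_gr: "adj (gr g) u v \<longleftrightarrow> u \<in> set (fst g) & v \<in> set (fst g) & u ~= v &
  ((u, v) \<in> set (snd g) \<or> (v, u) \<in> set (snd g))"
 unfolding adj_def gr_def by (auto simp: doubleton_eq_iff)

lemma simple_gr: "simple_graph (gr g)"
 unfolding simple_graph_def gr_def by auto

text \<open>
 Every vertex \<open>v\<close> gets \<open>s v\<close> private cliques on \<open>k + 1\<close> vertices, joined to \<open>v\<close>.  Deleting \<open>k\<close> edges cannot
 cut \<open>v\<close> off from any of them, so each still provides a leaf at \<open>v\<close>.
\<close>

definition attach :: "(name => nat) => nat => ngraph => ngraph" where
 "attach s k g =
   (map (%v. 0 # v) (fst g) @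
   concat (map (%v. concat (map (%i. map (%r. 1 # i # r # v) [0..<Suc k]) [0..<s v])) (fst g)),
   map (%e. (0 # fst e, 0 # snd e)) (snd g) @
   concat (map (%v. concat (map (%i. concat (map (%r. (0 # v, 1 # i # r # v) #
    map (%r'. (1 # i # r # v, 1 # i # r' # v)) [0..<Suc k]) [0..<Suc k])) [0..<s v])) (fst g)))"

lemma verts_attach: "set (fst (attach s k g)) = (%v. 0 # v) ` set (fst g) \<union>
  {1 # i # r # v | i r v. v \<in> set (fst g) & i < s v & r < Suc k}"
 unfolding attach_def by (auto simp: image_iff simp del: upt_Suc)

lemma edges_attach: "set (snd (attach s k g)) = (%e. (0 # fst e, 0 # snd e)) ` set (snd g) \<union>
  {(0 # v, 1 # i # r # v) | i r v. v \<in> set (fst g) & i < s v & r < Suc k} \<union>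
  {(1 # i # r # v, 1 # i # r' # v) | i r r' v. v \<in> set (fst g) & i < s v & r < Suc k & r' < Suc k}"
 unfolding attach_def by (simp add: image_Un Un_assoc) (auto simp: image_iff, fastforce+)?

lemma adj_attach:
 "adj (gr (attach s k g)) (0 # u) (0 # v) \<longleftrightarrow> adj (gr g) u v"
 "adj (gr (attach s k g)) (0 # u) (Suc 0 # i # r # v) \<longleftrightarrow> u = v & v \<in> set (fst g) & i < s v & r < Suc k"
 "adj (gr (attach s k g)) (Suc 0 # i # r # v) (0 # u) \<longleftrightarrow> u = v & v \<in> set (fst g) & i < s v & r < Suc k"
 "adj (gr (attach s k g)) (Suc 0 # i # r # v) (Suc 0 # i' # r' # v') \<longleftrightarrow> i = i' & v = v' & r ~= r' &
   v \<in> set (fst g) & i < s v & r < Suc k & r' < Suc k"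
proof -
 have *: "(0 # a, 0 # b) \<in> (%e. (0 # fst e, 0 # snd e)) ` S \<longleftrightarrow> (a, b) \<in> S" for a b :: name and S
  by force
 show "adj (gr (attach s k g)) (0 # u) (0 # v) \<longleftrightarrow> adj (gr g) u v"
  unfolding adj_gr verts_attach edges_attach by (auto simp: *)
qed (unfold adj_gr verts_attach edges_attach, auto)

text \<open>A triangle-free graph without isolated edges can use a clique only for a single leaf
  hanging at the owner \<open>v\<close> of the clique: two of its vertices inside the clique would
  be adjacent, and a further neighbour of either would complete a triangle. Conversely,
  \<open>k\<close> deletions leave at least one of the \<open>k + 1\<close> edges from
  \<open>v\<close> to each clique.\<close>

lemma attach_correct:
 fixes T :: "'a graph"
 assumes T: "simple_graph T" and tri: "\<And>a b c. adj T a b ==> adj T b c ==> adj T a c ==> False"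
  and nbr: "\<And>u. u \<in> verts T ==> \<exists>v. adj T u v"
  and leafy: "\<And>u v. adj T u v ==> (\<exists>w. w ~= v & adj T u w) \<or> (\<exists>w. w ~= u & adj T v w)"
 shows "edge_deletable T (gr (attach s k g)) k \<longleftrightarrow>
  (\<exists>F \<subseteq> edges (gr g). card F \<le> k & (\<nexists>W f. leaf_emb T s (delete_edges (gr g) F) W f))"
  (is "_ \<longleftrightarrow> (\<exists>F \<subseteq> edges ?G. _)")
proof -
 let ?A = "gr (attach s k g)"
 have fin: "finite (verts T)" using T by (simp add: simple_graph_def)
 have inj0: "inj (%e. (%v. 0 # v) ` e :: name set)" by (intro inj_onI) (metis inj_image_eq_iff inj_on_Cons1)
 show ?thesis
 proof
  assume "\<exists>F \<subseteq> edges ?G. card F \<le> k & (\<nexists>W f. leaf_emb T s (delete_edges ?G F) W f)"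
  then obtain F where F: "F \<subseteq> edges ?G" "card F \<le> k" "\<nexists>W f. leaf_emb T s (delete_edges ?G F) W f" by blast
  \<comment> \<open>Only the edges of the base graph are deleted; the cliques remain intact.\<close>
  define F' where "F' = (%e. (%v. 0 # v) ` e) ` F"
  have F'1: "{0 # u, 0 # v} \<in> F' \<longleftrightarrow> {u, v} \<in> F" for u v
   unfolding F'_def using inj_image_mem_iff[OF inj0, of "{u, v}" F] by simp
  have F'2: "{1 # x, y} \<notin> F'" for x y unfolding F'_def by auto
  let ?K = "delete_edges ?A F'"
  have "F' \<subseteq> edges ?A"
  proof
   fix e assume "e \<in> F'"
   then obtain e' where e': "e' \<in> edges ?G" "e = (%v. 0 # v) ` e'" using F(1) unfolding F'_def by blast
   then obtain u v where uv: "e' = {u, v}" unfolding gr_def by auto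
   then have "e = {0 # u, 0 # v}" "{u, v} \<in> edges ?G" using e' by auto
   then show "e \<in> edges ?A" using adj_attach(1)[of s k g u v] by (simp add: adj_def)
  qed
  moreover have "card F' \<le> k" using F(2) unfolding F'_def
   by (metis card_image inj0 inj_on_subset subset_UNIV)
  moreover have "induced_free T ?K"
  proof (rule ccontr)
   assume "\<not> induced_free T ?K"
   then obtain f where f: "embeds T ?K f" by (auto simp: induced_free_iff)
   have adjf: "adj T u v \<longleftrightarrow> adj ?K (f u) (f v)" if "u \<in> verts T" "v \<in> verts T" for u v
    using f that by (simp add: embeds_def)
   have injf: "u = v" if "f u = f v" "u \<in> verts T" "v \<in> verts T" for u v
    using f that by (auto simp: embeds_def inj_on_def)
   define W where "W = {u \<in> verts T. hd (f u) = 0}"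
   have W0: "f u = 0 # tl (f u)" "tl (f u) \<in> set (fst g)" if "u \<in> W" for u
   proof -
    have "f u \<in> set (fst (attach s k g))" using f that by (auto simp: embeds_def W_def)
    then show "f u = 0 # tl (f u)" "tl (f u) \<in> set (fst g)" using that unfolding verts_attach W_def by auto
   qed
   have W1: "\<exists>i r v. f u = 1 # i # r # v & v \<in> set (fst g) & i < s v & r < Suc k" if "u \<in> verts T - W" for u
   proof -
    have "f u \<in> set (fst (attach s k g))" using f that by (auto simp: embeds_def)
    then show ?thesis using that unfolding verts_attach W_def by auto
   qed
   have K1: "adj ?K (Suc 0 # x) y \<longleftrightarrow> adj ?A (Suc 0 # x) y" for x y
    using F'2[of x y] by (simp add: adj_delete)
   have K2: "adj ?K y (Suc 0 # x) \<longleftrightarrow> adj ?A y (Suc 0 # x)" for x y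
    using K1[of x y] by (simp add: adj_sym)
   \<comment> \<open>Neighbours of a clique vertex are in the same clique or are its owner.\<close>
   have cl: "f x = 0 # v \<or> (\<exists>r'. f x = 1 # i # r' # v)"
    if u: "u \<in> verts T" "f u = 1 # i # r # v" and ux: "adj T u x" for u x i r v
   proof -
    have x: "x \<in> verts T" using simple_graph_adj[OF T ux] by blast
    then have a: "adj ?A (1 # i # r # v) (f x)" using adjf[of u x] u ux K1 by simp
    show ?thesis
    proof (cases "x \<in> W")
     case True
     then show ?thesis using a W0(1)[OF True] adj_attach(3) by (metis One_nat_def)
    next
     case False
     then obtain i' r' v' where "f x = 1 # i' # r' # v'" using W1[of x] x by blast
     then show ?thesis using a adj_attach(4)[of s k g i r v i' r' v'] by auto
    qed
   qed
   \<comment> \<open>If \<open>w\<close> were in the clique of \<open>u\<close> as well, the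
     additional neighbour supplied by \<open>leafy\<close> would lie in the clique or be its owner,
     and would form a triangle with \<open>u\<close> and \<open>w\<close>.\<close>
   have nb: "w \<in> W & (\<forall>i r v. f u = 1 # i # r # v --> f w = 0 # v)"
    if u: "u \<in> verts T - W" and uw: "adj T u w" for u w
   proof -
    obtain i r v where fu: "f u = 1 # i # r # v" "v \<in> set (fst g)" "i < s v" "r < Suc k" using W1[OF u] by blast
    have w: "w \<in> verts T" using simple_graph_adj[OF T uw] by blast
    have "f w = 0 # v"
    proof (rule ccontr)
     assume "f w ~= 0 # v"
     then obtain r' where fw: "f w = 1 # i # r' # v" using cl[OF _ fu(1) uw] u by blast
     have wW: "w \<in> verts T - W" using fw w by (auto simp: W_def)
     have r': "r' < Suc k"
      using adjf[of u w] uw u w fu fw K1 adj_attach(4)[of s k g i r v i r' v] by simp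
     have cliq: "adj T x y" if xy: "x \<in> verts T" "y \<in> verts T" "x ~= y"
      "f x = 0 # v \<or> (\<exists>r'. f x = 1 # i # r' # v)" "\<exists>r'. f y = 1 # i # r' # v" for x y
     proof -
      obtain ry where y: "f y = 1 # i # ry # v" using xy(5) by blast
      have "y \<in> verts T - W" using y xy(2) by (auto simp: W_def)
      then have ry: "ry < Suc k" using W1[of y] y by auto
      have "f x ~= f y" using injf xy by blast
      show ?thesis using xy(4)
      proof
       assume "f x = 0 # v"
       then show ?thesis using adjf[OF xy(1,2)] y K2 adj_attach(2)[of s k g v i ry v] fu ry by simp
      next
       assume "\<exists>r'. f x = 1 # i # r' # v"
       then obtain rx where x: "f x = 1 # i # rx # v" by blast
       have "x \<in> verts T - W" using x xy(1) by (auto simp: W_def)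
       then have rx: "rx < Suc k" using W1[of x] x by auto
       show ?thesis using adjf[OF xy(1,2)] y x K2 adj_attach(4)[of s k g i rx v i ry v] fu ry rx
         \<open>f x ~= f y\<close> by simp
      qed
     qed
     show False using leafy[OF uw]
     proof
      assume "\<exists>x. x ~= w & adj T u x"
      then obtain x where x: "x ~= w" "adj T u x" by blast
      have "adj T x w" by (rule cliq) (use x cl[OF _ fu(1) x(2)] u fw w simple_graph_adj[OF T x(2)] in auto)
      then show False using tri[OF x(2) _ uw] by blast
     next
      assume "\<exists>x. x ~= u & adj T w x"
      then obtain x where x: "x ~= u" "adj T w x" by blast
      have "adj T x u" by (rule cliq) (use x cl[OF w fw x(2)] fu u simple_graph_adj[OF T x(2)] in auto)
      then show False using tri[OF x(2), of u] uw adj_sym by metis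
     qed
    qed
    then show ?thesis using w fu(1) by (auto simp: W_def)
   qed
   have "leaf_emb T s (delete_edges ?G F) W (%u. tl (f u))"
    unfolding leaf_emb_def
   proof (intro conjI ballI)
    show "W \<subseteq> verts T" by (auto simp: W_def)
    show "inj_on (%u. tl (f u)) W"
    proof (rule inj_onI)
     fix x y assume "x \<in> W" "y \<in> W" "tl (f x) = tl (f y)"
     then have "f x = f y" using W0(1) by metis
     then show "x = y" using injf \<open>x \<in> W\<close> \<open>y \<in> W\<close> by (auto simp: W_def)
    qed
    show "(%u. tl (f u)) ` W \<subseteq> verts (delete_edges ?G F)" using W0(2) by auto
    fix u v assume u: "u \<in> W" and v: "v \<in> W"
    have "adj T u v \<longleftrightarrow> adj ?K (0 # tl (f u)) (0 # tl (f v))"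
     using adjf[of u v] u v W0(1)[OF u] W0(1)[OF v] by (simp add: W_def)
    then show "adj T u v \<longleftrightarrow> adj (delete_edges ?G F) (tl (f u)) (tl (f v))"
     by (simp add: adj_delete adj_attach F'1)
   next
    fix u assume u: "u \<in> verts T - W"
    obtain w where w: "adj T u w" using nbr u by blast
    obtain i r v where fu: "f u = 1 # i # r # v" using W1[OF u] by blast
    have "x = w" if "adj T u x" for x
    proof -
     have "f x = f w" using nb[OF u that] nb[OF u w] fu by metis
     then show ?thesis using injf simple_graph_adj[OF T that] simple_graph_adj[OF T w] by blast
    qed
    then show "\<exists>w\<in>W. adj T u w & (\<forall>v. adj T u v --> v = w)" using nb[OF u w] w by blast
   next
    fix w assume w: "w \<in> W"
    let ?S = "{u \<in> verts T - W. adj T u w}"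
    have S: "\<exists>i r. f u = 1 # i # r # tl (f w) & i < s (tl (f w))" if uS: "u \<in> ?S" for u
    proof -
     obtain i r v where fu: "f u = 1 # i # r # v" "i < s v" using W1[of u] uS by blast
     then have "f w = 0 # v" using nb[of u w] uS by blast
     then show ?thesis using fu by auto
    qed
    \<comment> \<open>The entry at position 1 is the index of the clique. Two leaves in one clique
      would be adjacent and form a triangle with \<open>w\<close>, so different leaves use different
      cliques.\<close>
    have "inj_on (%u. f u ! 1) ?S"
    proof (rule inj_onI)
     fix x y assume x: "x \<in> ?S" and y: "y \<in> ?S" and e: "f x ! 1 = f y ! 1"
     obtain i r where fx: "f x = 1 # i # r # tl (f w)" "i < s (tl (f w))" using S[OF x] by blast
     obtain r' where fy: "f y = 1 # i # r' # tl (f w)" using S[OF y] e fx by auto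
     have rr: "r < Suc k" "r' < Suc k" using W1[of x] W1[of y] x y fx fy by auto
     show "x = y"
     proof (rule ccontr)
      assume "x ~= y"
      then have "r ~= r'" using injf[of x y] x y fx fy by auto
      then have "adj T x y" using adjf[of x y] x y fx fy rr W0(2)[OF w] K2 adj_attach(4) by simp
      then show False using tri[of x y w] x y by blast
     qed
    qed
    moreover have "(%u. f u ! 1) ` ?S \<subseteq> {..<s (tl (f w))}" using S by fastforce
    ultimately show "card ?S \<le> s (tl (f w))"
     by (metis card_inj_on_le card_lessThan finite_lessThan)
   qed
   then show False using F(3) by blast
  qed
  ultimately show "edge_deletable T ?A k" unfolding edge_deletable_def by blast
 next
  assume "edge_deletable T ?A k"
  then obtain F where F: "F \<subseteq> edges ?A" "card F \<le> k" "induced_free T (delete_edges ?A F)"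
   unfolding edge_deletable_def by blast
  have finA: "finite (edges ?A)"
   using finite_subset[of "edges ?A" "Pow (verts ?A)"] simple_gr[of "attach s k g"] unfolding simple_graph_def by auto
  have finF: "finite F" using F(1) finA finite_subset by blast
  \<comment> \<open>Deleted edges that touch a clique are dropped; there are too few of them to
    matter.\<close>
  define F0 where "F0 = {e \<in> edges ?G. (%v. 0 # v) ` e \<in> F}"
  let ?K = "delete_edges ?A F" let ?KG = "delete_edges ?G F0"
  have "card F0 \<le> card F"
   by (rule card_inj_on_le[of "%e. (%v. 0 # v) ` e"]) (use finF inj_on_subset[OF inj0] in \<open>auto simp: F0_def\<close>)
  then have "card F0 \<le> k" using F(2) by simp
  moreover have "F0 \<subseteq> edges ?G" by (auto simp: F0_def)
  moreover have "\<nexists>W f. leaf_emb T s ?KG W f"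
  proof
   assume "\<exists>W f. leaf_emb T s ?KG W f"
   then obtain W f where "leaf_emb T s ?KG W f" by blast
   then have e: "W \<subseteq> verts T" "inj_on f W" "f ` W \<subseteq> set (fst g)"
    "\<And>u v. u \<in> W ==> v \<in> W ==> adj T u v \<longleftrightarrow> adj ?KG (f u) (f v)"
    "\<And>u. u \<in> verts T - W ==> \<exists>w \<in> W. adj T u w & (\<forall>v. adj T u v --> v = w)"
    "\<And>w. w \<in> W ==> card {u \<in> verts T - W. adj T u w} \<le> s (f w)"
    unfolding leaf_emb_def by auto
   have "\<exists>r < Suc k. {0 # v, 1 # i # r # v} \<notin> F" for i v
   proof (rule ccontr)
    assume "\<not> ?thesis"
    then have "(%r. {0 # v, 1 # i # r # v}) ` {..<Suc k} \<subseteq> F" by auto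
    then have "card ((%r. {0 # v, 1 # i # r # v}) ` {..<Suc k}) \<le> card F" by (rule card_mono[OF finF])
    moreover have "inj_on (%r. {0 # v, 1 # i # r # v}) {..<Suc k}"
     by (auto simp: inj_on_def doubleton_eq_iff)
    ultimately show False using F(2) by (simp add: card_image)
   qed
   then obtain rr where rr: "\<And>v i. rr v i < Suc k" "\<And>v i. {0 # v, 1 # i # rr v i # v} \<notin> F" by metis
   \<comment> \<open>The leaves at \<open>w\<close> are distributed injectively over its cliques. In
     each clique the vertex \<open>rr\<close> whose edge to the owner has survived is used, so edges
     inside of a clique never play a part.\<close>
   have "\<forall>w\<in>W. \<exists>h. h ` {u \<in> verts T - W. adj T u w} \<subseteq> {..<s (f w)} & inj_on h {u \<in> verts T - W. adj T u w}"
   proof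
    fix w assume w: "w \<in> W"
    show "\<exists>h. h ` {u \<in> verts T - W. adj T u w} \<subseteq> {..<s (f w)} & inj_on h {u \<in> verts T - W. adj T u w}"
     by (rule card_le_inj) (use e(6)[OF w] fin in auto)
   qed
   from bchoice[OF this] obtain h where h: "\<And>w. w \<in> W ==> inj_on (h w) {u \<in> verts T - W. adj T u w}"
    "\<And>w u. w \<in> W ==> u \<in> verts T - W ==> adj T u w ==> h w u < s (f w)" by blast
   obtain p where p: "\<And>u. u \<in> verts T - W ==> p u \<in> W & adj T u (p u) & (\<forall>v. adj T u v --> v = p u)"
    using e(5) by metis
   define F2 where "F2 = (%u. if u \<in> W then 0 # f u else
    1 # h (p u) u # rr (f (p u)) (h (p u) u) # f (p u))"
   have W: "F2 u = 0 # f u" if "u \<in> W" for u using that by (simp add: F2_def)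
   have N: "F2 u = 1 # h (p u) u # rr (f (p u)) (h (p u) u) # f (p u)" if "u \<in> verts T - W" for u
    using that by (simp add: F2_def)
   have "embeds T ?K F2"
    unfolding embeds_def
   proof (intro conjI ballI)
    have pinj: "p u = p v ==> h (p u) u = h (p v) v ==> u = v" if "u \<in> verts T - W" "v \<in> verts T - W" for u v
     using h(1)[of "p u"] p[OF that(1)] p[OF that(2)] that by (auto simp: inj_on_def)
    have fe: "f u = f v \<longleftrightarrow> u = v" if "u \<in> W" "v \<in> W" for u v using e(2) that by (auto simp: inj_on_def)
    show "inj_on F2 (verts T)"
    proof (rule inj_onI)
     fix u v assume uv: "u \<in> verts T" "v \<in> verts T" "F2 u = F2 v"
     show "u = v"
     proof (cases "u \<in> W")
      case True
      then have "v \<in> W" using uv by (auto simp: F2_def split: if_splits)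
      then show ?thesis using True uv fe by (simp add: F2_def)
     next
      case False
      then have "v \<notin> W" using uv by (auto simp: F2_def split: if_splits)
      have eq: "h (p u) u = h (p v) v" "f (p u) = f (p v)"
       using uv N[of u] N[of v] False \<open>v \<notin> W\<close> by auto
      then have "p u = p v" using False \<open>v \<notin> W\<close> uv p[of u] p[of v] fe by blast
      then show ?thesis using eq(1) False \<open>v \<notin> W\<close> uv pinj by blast
     qed
    qed
    show "F2 ` verts T \<subseteq> verts ?K"
    proof
     fix x assume "x \<in> F2 ` verts T"
     then obtain u where u: "u \<in> verts T" "x = F2 u" by blast
     show "x \<in> verts ?K"
     proof (cases "u \<in> W")
      case True
      then have "f u \<in> set (fst g)" "x = 0 # f u" using e(3) u W by auto
      then show ?thesis unfolding verts_delete verts_gr verts_attach by blast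
     next
      case False
      then have uW: "u \<in> verts T - W" using u by blast
      have "f (p u) \<in> set (fst g)" "h (p u) u < s (f (p u))" using p[OF uW] e(3) h(2) uW by auto
      then show ?thesis unfolding verts_delete verts_gr verts_attach u(2) N[OF uW] using rr(1) by blast
     qed
    qed
    have mixed: "adj T u v \<longleftrightarrow> adj ?K (F2 u) (F2 v)" if u: "u \<in> W" and v: "v \<in> verts T - W" for u v
    proof -
     have "f (p v) \<in> set (fst g)" "h (p v) v < s (f (p v))" using p[OF v] e(3) h(2) v by auto
     then have A: "adj ?A (0 # f u) (F2 v) \<longleftrightarrow> f u = f (p v)"
      unfolding N[OF v] One_nat_def adj_attach(2) using rr(1) by blast
     have "{0 # f u, F2 v} \<notin> F" if "f u = f (p v)" using rr(2) N[OF v] that by simp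
     then have "adj ?K (F2 u) (F2 v) \<longleftrightarrow> f u = f (p v)" unfolding adj_delete W[OF u] A by blast
     also have "\<dots> \<longleftrightarrow> u = p v" using fe[OF u, of "p v"] p[OF v] by blast
     also have "\<dots> \<longleftrightarrow> adj T v u" using p[OF v] by blast
     finally show ?thesis by (simp add: adj_sym)
    qed
    fix u v assume uv: "u \<in> verts T" "v \<in> verts T"
    show "adj T u v \<longleftrightarrow> adj ?K (F2 u) (F2 v)"
    proof (cases "u \<in> W"; cases "v \<in> W")
     assume "u \<in> W" "v \<in> W"
     then have *: "adj T u v \<longleftrightarrow> adj ?G (f u) (f v) & {f u, f v} \<notin> F0" using e(4) by (simp add: adj_delete)
     show ?thesis unfolding * W[OF \<open>u \<in> W\<close>] W[OF \<open>v \<in> W\<close>] adj_delete adj_attach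
      by (auto simp: F0_def adj_def)
    next
     assume "u \<notin> W" "v \<notin> W"
     then have u: "u \<in> verts T - W" and v: "v \<in> verts T - W" using uv by auto
     have "\<not> adj T u v" using p[OF u] v by auto
     moreover have "\<not> adj ?K (F2 u) (F2 v)"
     proof
      assume "adj ?K (F2 u) (F2 v)"
      then have "adj ?A (F2 u) (F2 v)" by (simp add: adj_delete)
      then have "h (p u) u = h (p v) v" "f (p u) = f (p v)"
       "rr (f (p u)) (h (p u) u) ~= rr (f (p v)) (h (p v) v)"
       unfolding N[OF u] N[OF v] by (auto simp: adj_attach)
      then show False by simp
     qed
     ultimately show ?thesis by blast
    next
     assume "u \<in> W" "v \<notin> W"
     then show ?thesis using mixed uv by blast
    next
     assume "u \<notin> W" "v \<in> W"
     then have "adj T v u \<longleftrightarrow> adj ?K (F2 v) (F2 u)" using mixed uv by blast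
     then show ?thesis by (simp add: adj_sym)
    qed
   qed
   then show False using F(3) induced_free_iff by blast
  qed
  ultimately show "\<exists>F \<subseteq> edges ?G. card F \<le> k & (\<nexists>W f. leaf_emb T s (delete_edges ?G F) W f)" by blast
 qed
qed

section \<open>Trees\<close>

definition inner :: "'a graph => 'a set" where
 "inner T = {u \<in> verts T. \<exists>v w. v ~= w & adj T u v & adj T u w}"

locale tree =
 fixes T :: "'a graph"
 assumes tree: "is_tree T" and two: "2 \<le> card (edges T)"
begin

lemma simple: "simple_graph T"
 using tree by (simp add: is_tree_def)

lemma fin: "finite (verts T)"
 using simple by (simp add: simple_graph_def)

lemma conn: "u \<in> verts T ==> v \<in> verts T ==> (adj T)\<^sup>*\<^sup>* u v"
 using tree by (simp add: is_tree_def connected_graph_def)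

lemma adjD: "adj T u v ==> u \<in> verts T & v \<in> verts T & u ~= v"
 using simple_graph_adj[OF simple] .

lemma tri: "adj T a b ==> adj T b c ==> adj T a c ==> False"
proof -
 assume a: "adj T a b" "adj T b c" "adj T a c"
 then have "is_cycle T [a, b, c]" using adjD by (auto simp: is_cycle_def adj_sym)
 then show False using tree by (auto simp: is_tree_def)
qed

text \<open>Otherwise \<open>u\<close> and \<open>v\<close> would form a component, hence the whole
  tree, which would then have only one edge.\<close>

lemma leafy:
 assumes uv: "adj T u v"
 shows "(\<exists>w. w ~= v & adj T u w) \<or> (\<exists>w. w ~= u & adj T v w)"
proof (rule ccontr)
 assume n: "\<not> ?thesis"
 have "x \<in> {u, v}" if "(adj T)\<^sup>*\<^sup>* u x" for x
  using that by induction (use n adj_sym in auto)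
 then have V: "verts T \<subseteq> {u, v}" using conn adjD[OF uv] by blast
 have "edges T \<subseteq> {{u, v}}"
 proof
  fix e assume "e \<in> edges T"
  then have "e \<subseteq> {u, v}" "card e = 2" using simple V unfolding simple_graph_def by auto
  then have "e = {u, v}" by (metis card_2_iff card_subset_eq finite.emptyI finite_insert adjD[OF uv])
  then show "e \<in> {{u, v}}" by simp
 qed
 then have "card (edges T) \<le> card {{u, v}}" by (intro card_mono) auto
 then show False using two by simp
qed

lemma nbr:
 assumes "u \<in> verts T"
 shows "\<exists>v. adj T u v"
proof -
 have "edges T ~= {}" using two by auto
 then obtain e where e: "e \<in> edges T" by blast
 then obtain a b where ab: "e = {a, b}" "a ~= b" using simple unfolding simple_graph_def by (metis card_2_iff)
 then have "adj T a b" using e by (simp add: adj_def)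
 then obtain w where w: "w \<in> verts T" "w ~= u" using adjD ab(2) by metis
 show ?thesis using conn[OF assms w(1)] w(2) by (metis converse_rtranclpE)
qed

lemma inner_of_leaf: "adj T u v ==> u \<notin> inner T ==> v \<in> inner T"
proof -
 assume a: "adj T u v" "u \<notin> inner T"
 then have "\<not> (\<exists>w. w ~= v & adj T u w)" using adjD unfolding inner_def by blast
 then obtain w where "w ~= u" "adj T v w" using leafy[OF a(1)] by blast
 then show ?thesis using a(1) adjD adj_sym unfolding inner_def by (smt (verit) mem_Collect_eq)
qed

lemma leaf_unique: "u \<notin> inner T ==> adj T u v ==> adj T u w ==> v = w"
 using adjD unfolding inner_def by blast

lemma inner_nonempty: "inner T ~= {}"
proof -
 have "edges T ~= {}" using two by auto
 then obtain e where e: "e \<in> edges T" by blast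
 then obtain a b where ab: "e = {a, b}" "a ~= b" using simple unfolding simple_graph_def by (metis card_2_iff)
 then have "adj T a b" using e by (simp add: adj_def)
 then show ?thesis using inner_of_leaf by blast
qed

lemma finite_inner: "finite (inner T)"
 using fin by (simp add: inner_def)

text \<open>A longest path ends in a leaf.\<close>

lemma leaf_exists: "\<exists>u \<in> verts T. u \<notin> inner T"
proof (rule ccontr)
 assume n: "\<not> ?thesis"
 define P where "P = {c. distinct c & c ~= [] & set c \<subseteq> verts T & successively (adj T) c}"
 have len: "length c \<le> card (verts T)" if "c \<in> P" for c
  using that fin by (metis (mono_tags, lifting) P_def card_mono distinct_card mem_Collect_eq)
 obtain u0 where "u0 \<in> inner T" using inner_nonempty by blast
 then have "[u0] \<in> P" by (auto simp: P_def inner_def)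
 then have "\<exists>c. c \<in> P & (\<forall>d. d \<in> P --> length d \<le> length c)"
  by (rule ex_has_greatest_nat[where b = "Suc (card (verts T))"]) (use len in \<open>simp add: less_Suc_eq_le\<close>)
 then obtain c where c: "c \<in> P" "\<And>d. d \<in> P ==> length d \<le> length c" by blast
 then obtain x c' where xc: "c = x # c'" by (cases c) (auto simp: P_def)
 have "x \<in> inner T" using c n xc by (auto simp: P_def)
 then obtain v w where vw: "v ~= w" "adj T x v" "adj T x w" by (auto simp: inner_def)
 \<comment> \<open>A neighbour outside of the path would extend it at its front.\<close>
 have *: "y \<in> set c'" if "adj T x y" for y
 proof (rule ccontr)
  assume "y \<notin> set c'"
  moreover have "y ~= x" "y \<in> verts T" "adj T y x" using adjD[OF that] that adj_sym[of T x y] by auto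
  ultimately have "y # c \<in> P" using c(1) unfolding P_def xc by auto
  then show False using c(2) by fastforce
 qed
 \<comment> \<open>Of the two neighbours of \<open>x\<close>, one is not the second vertex of the
   path; its edge to \<open>x\<close> closes a cycle.\<close>
 obtain y where y: "adj T x y" "c' ~= []" "y ~= hd c'" using vw * by (metis empty_iff empty_set)
 obtain as bs where s: "c' = as @ y # bs" using *[OF y(1)] by (metis split_list)
 have "as ~= []" using s y by auto
 then have "is_cycle T (x # as @ [y])"
  using c(1) y(1) unfolding is_cycle_def P_def xc s
  by (auto simp: successively_append_iff successively_Cons adj_sym Suc_le_eq)
 then show False using tree by (auto simp: is_tree_def)
qed

lemma inner_psubset: "inner T \<subset> verts T"
 using leaf_exists unfolding inner_def by blast

lemma adj_strip: "adj (induced T (inner T)) u v \<longleftrightarrow> adj T u v & u \<in> inner T & v \<in> inner T"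
 by (auto simp: induced_def adj_def)

text \<open>A walk that enters a leaf has to leave it towards the vertex it came from. While the
  walk is at a leaf, the induction therefore speaks of the neighbour of that leaf.\<close>

lemma strip_reach:
 assumes "u \<in> inner T" "(adj T)\<^sup>*\<^sup>* u z"
 shows "if z \<in> inner T then (adj (induced T (inner T)))\<^sup>*\<^sup>* u z
  else \<exists>z'. adj T z z' & (adj (induced T (inner T)))\<^sup>*\<^sup>* u z'"
 using assms(2)
proof induction
 case base
 then show ?case using assms(1) by simp
next
 case (step y z)
 show ?case
 proof (cases "y \<in> inner T")
  case True
  then have uy: "(adj (induced T (inner T)))\<^sup>*\<^sup>* u y" using step.IH by simp
  show ?thesis
  proof (cases "z \<in> inner T")
   case z: True
   then have "adj (induced T (inner T)) y z" using step.hyps True by (simp add: adj_strip)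
   then show ?thesis using uy z by (simp add: rtranclp.rtrancl_into_rtrancl)
  next
   case False
   then show ?thesis using uy step.hyps(2) adj_sym by metis
  qed
 next
  case False
  then obtain z' where z': "adj T y z'" "(adj (induced T (inner T)))\<^sup>*\<^sup>* u z'" using step.IH by auto
  then have "z' = z" using leaf_unique[OF False] step.hyps(2) by blast
  moreover have "z \<in> inner T" using inner_of_leaf[OF step.hyps(2) False] .
  ultimately show ?thesis using z' by simp
 qed
qed

lemma strip_tree: "is_tree (induced T (inner T))"
 unfolding is_tree_def
proof (intro conjI)
 show "simple_graph (induced T (inner T))"
  using simple finite_inner unfolding simple_graph_def induced_def by auto
 show "connected_graph (induced T (inner T))"
  unfolding connected_graph_def
 proof (intro conjI ballI)
  show "verts (induced T (inner T)) ~= {}" using inner_nonempty by (simp add: induced_def)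
  fix u v assume "u \<in> verts (induced T (inner T))" "v \<in> verts (induced T (inner T))"
  then have uv: "u \<in> inner T" "v \<in> inner T" by (auto simp: induced_def)
  then show "(adj (induced T (inner T)))\<^sup>*\<^sup>* u v"
   using strip_reach[OF uv(1) conn[of u v]] by (auto simp: inner_def)
 qed
 show "\<nexists>c. is_cycle (induced T (inner T)) c"
 proof
  assume "\<exists>c. is_cycle (induced T (inner T)) c"
  then obtain c where c: "is_cycle (induced T (inner T)) c" ..
  have "successively (adj T) c"
   using c unfolding is_cycle_def by (auto intro: successively_mono simp: adj_strip)
  moreover have "verts (induced T (inner T)) \<subseteq> verts T" by (auto simp: induced_def inner_def)
  ultimately have "is_cycle T c" using c unfolding is_cycle_def by (auto simp: adj_strip)
  then show False using tree by (auto simp: is_tree_def)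
 qed
qed

lemma inner_connected:
 assumes "u \<in> inner T" "v \<in> inner T" "u ~= v"
 shows "\<exists>w \<in> inner T. adj T u w"
proof -
 have "(adj (induced T (inner T)))\<^sup>*\<^sup>* u v"
  using strip_reach[OF assms(1) conn[of u v]] assms by (auto simp: inner_def)
 then obtain w where "adj (induced T (inner T)) u w" using assms(3) by (metis converse_rtranclpE)
 then show ?thesis by (auto simp: adj_strip)
qed

text \<open>By connectedness every inner vertex lies on an edge between inner vertices, and a single
  edge covers just two vertices.\<close>

lemma strip_edges:
 assumes "3 \<le> card (inner T)"
 shows "2 \<le> card (edges (induced T (inner T)))"
proof (rule ccontr)
 let ?S = "induced T (inner T)"
 assume "\<not> ?thesis"
 then have c: "card (edges ?S) \<le> 1" by simp
 have finE: "finite (edges ?S)"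
  by (rule finite_subset[of _ "Pow (verts T)"]) (use simple fin in \<open>auto simp: simple_graph_def induced_def\<close>)
 have "inner T \<subseteq> \<Union> (edges ?S)"
 proof
  fix u assume u: "u \<in> inner T"
  have "inner T ~= {u}" using assms by auto
  then obtain v where "v \<in> inner T" "v ~= u" using u by blast
  then obtain w where "w \<in> inner T" "adj T u w" using inner_connected[OF u, of v] by blast
  then have "{u, w} \<in> edges ?S" using u adj_strip[of u w] by (simp add: adj_def)
  then show "u \<in> \<Union> (edges ?S)" by blast
 qed
 then have "card (inner T) \<le> card (\<Union> (edges ?S))"
  using finE by (intro card_mono finite_Union) (auto simp: induced_def intro: finite_subset[OF _ finite_inner])
 also have "\<dots> \<le> (\<Sum>e\<in>edges ?S. card e)" by (rule card_Union_le_sum_card)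
 also have "\<dots> = (\<Sum>e\<in>edges ?S. 2)" by (rule sum.cong) (use simple in \<open>auto simp: simple_graph_def induced_def\<close>)
 also have "\<dots> \<le> 2" using c by simp
 finally show False using assms by simp
qed

lemma attach_tree:
 "edge_deletable T (gr (attach s k g)) k \<longleftrightarrow>
  (\<exists>F \<subseteq> edges (gr g). card F \<le> k & (\<nexists>W f. leaf_emb T s (delete_edges (gr g) F) W f))"
 by (rule attach_correct[OF simple tri nbr leafy])

lemma leaf_embD:
 assumes "leaf_emb T s K W f"
 shows "inner T \<subseteq> W"
proof
 fix u assume "u \<in> inner T"
 then obtain v w where u: "u \<in> verts T" "v ~= w" "adj T u v" "adj T u w" unfolding inner_def by blast
 have l: "\<forall>u \<in> verts T - W. \<exists>w \<in> W. adj T u w & (\<forall>v. adj T u v --> v = w)"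
  using assms by (simp add: leaf_emb_def)
 show "u \<in> W"
 proof (rule ccontr)
  assume "u \<notin> W"
  then have "\<exists>w \<in> W. adj T u w & (\<forall>v. adj T u v --> v = w)" using l u(1) by simp
  then obtain a where "\<forall>v. adj T u v --> v = a" by blast
  then show False using u by metis
 qed
qed

text \<open>With \<open>card (verts T)\<close> free leaves at every vertex, the supply is never
  exhausted, so only the inner vertices have to be embedded.\<close>

lemma leaf_emb_strip:
 "(\<exists>W f. leaf_emb T (%_. card (verts T)) K W f) \<longleftrightarrow> \<not> induced_free (induced T (inner T)) K"
proof -
 have v: "verts (induced T (inner T)) = inner T" by (simp add: induced_def)
 have "(\<exists>W f. leaf_emb T (%_. card (verts T)) K W f) \<longleftrightarrow> (\<exists>f. embeds (induced T (inner T)) K f)"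
 proof
  assume "\<exists>W f. leaf_emb T (%_. card (verts T)) K W f"
  then obtain W f where e: "leaf_emb T (%_. card (verts T)) K W f" by blast
  have sub: "inner T \<subseteq> W" using leaf_embD[OF e] .
  have "embeds (induced T (inner T)) K f"
   unfolding embeds_def v
  proof (intro conjI ballI)
   show "inj_on f (inner T)" "f ` inner T \<subseteq> verts K"
    using e sub inj_on_subset[of f W "inner T"] unfolding leaf_emb_def by auto
   fix u v assume uv: "u \<in> inner T" "v \<in> inner T"
   then have "u \<in> W" "v \<in> W" using sub by auto
   then have "adj T u v \<longleftrightarrow> adj K (f u) (f v)" using e by (simp add: leaf_emb_def)
   then show "adj (induced T (inner T)) u v \<longleftrightarrow> adj K (f u) (f v)" using uv by (simp add: adj_strip)
  qed
  then show "\<exists>f. embeds (induced T (inner T)) K f" by blast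
 next
  assume "\<exists>f. embeds (induced T (inner T)) K f"
  then obtain f where f: "embeds (induced T (inner T)) K f" by blast
  have "leaf_emb T (%_. card (verts T)) K (inner T) f"
   unfolding leaf_emb_def
  proof (intro conjI ballI)
   fix u assume u: "u \<in> verts T - inner T"
   then obtain w where "adj T u w" using nbr by blast
   then show "\<exists>w\<in>inner T. adj T u w & (\<forall>v. adj T u v --> v = w)"
    using inner_of_leaf u leaf_unique by blast
  next
   show "inner T \<subseteq> verts T" by (auto simp: inner_def)
   show "inj_on f (inner T)" "f ` inner T \<subseteq> verts K" using f by (auto simp: embeds_def v)
   show "adj T a b \<longleftrightarrow> adj K (f a) (f b)" if "a \<in> inner T" "b \<in> inner T" for a b
    using f that unfolding embeds_def v by (simp add: adj_strip)
   show "card {u \<in> verts T - inner T. adj T u w} \<le> card (verts T)" for w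
    by (rule card_mono[OF fin]) auto
  qed
  then show "\<exists>W f. leaf_emb T (%_. card (verts T)) K W f" by blast
 qed
 then show ?thesis by (simp add: induced_free_iff)
qed

section \<open>Embeddings of stars and double stars\<close>

lemma finite_nbrs: "finite {u. adj T z u}"
 by (rule finite_subset[OF _ fin]) (use adjD in auto)

text \<open>The supply is two short of the degree of the centre, so exactly two leaves have to be
  found in \<open>K\<close> at least: an induced path on three vertices. Graphs without such a path
  are the cluster graphs.\<close>

lemma leaf_emb_star:
 assumes z: "inner T = {z}" and K: "simple_graph K"
 shows "(\<exists>W f. leaf_emb T (%_. card {u. adj T z u} - 2) K W f) \<longleftrightarrow>
  (\<exists>u v w. u ~= w & adj K u v & adj K v w & \<not> adj K u w)"
proof
 let ?N = "{u. adj T z u}"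
 have two: "\<exists>u\<in>?N. \<exists>w\<in>?N. u ~= w" using z unfolding inner_def by blast
 {
  assume "\<exists>W f. leaf_emb T (%_. card ?N - 2) K W f"
  then obtain W f where e: "leaf_emb T (%_. card ?N - 2) K W f" by blast
  have zW: "z \<in> W" using leaf_embD[OF e] z by auto
  have c2: "2 \<le> card ?N"
  proof -
   obtain u w where "{u, w} \<subseteq> ?N" "u ~= w" using two by blast
   then show ?thesis using card_mono[OF finite_nbrs, of "{u, w}" z] by simp
  qed
  have "{u \<in> verts T - W. adj T u z} = ?N - W" using adjD adj_sym[of T z] by auto
  then have "card (?N - W) \<le> card ?N - 2" using e zW unfolding leaf_emb_def by metis
  then have "2 \<le> card (?N \<inter> W)" using c2 card_Int_Diff[OF finite_nbrs, of z W] by simp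
  then obtain S where S: "S \<subseteq> ?N \<inter> W" "card S = 2" using obtain_subset_with_card_n by metis
  then obtain u w where "S = {u, w}" "u ~= w" by (metis card_2_iff)
  then have uw: "u ~= w" "u \<in> ?N \<inter> W" "w \<in> ?N \<inter> W" using S by auto
  then have "\<not> adj T u w" using tri adj_sym by (metis IntD1 mem_Collect_eq)
  then have "f u ~= f w & adj K (f u) (f z) & adj K (f z) (f w) & \<not> adj K (f u) (f w)"
   using e uw zW unfolding leaf_emb_def inj_on_def by (auto simp: adj_sym[of T u z] adj_sym[of K "f u" "f z"])
  then show "\<exists>u v w. u ~= w & adj K u v & adj K v w & \<not> adj K u w" by blast
 next
  assume "\<exists>u v w. u ~= w & adj K u v & adj K v w & \<not> adj K u w"
  then obtain u v w where p: "u ~= w" "adj K u v" "adj K v w" "\<not> adj K u w" by blast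
  obtain a b where ab: "a \<in> ?N" "b \<in> ?N" "a ~= b" using two by blast
  then have abz: "a ~= z" "b ~= z" "a \<in> verts T" "b \<in> verts T" "z \<in> verts T" using adjD by auto
  have nab: "\<not> adj T a b" using tri ab by blast
  have uv: "u ~= v" "v ~= w" "u \<in> verts K" "v \<in> verts K" "w \<in> verts K"
   using p simple_graph_adj[OF K] by blast+
  define f where "f = (%x. if x = z then v else if x = a then u else w)"
  have irr: "\<not> adj T x x" "\<not> adj K y y" for x y using adjD simple_graph_adj[OF K] by blast+
  have "leaf_emb T (%_. card ?N - 2) K {z, a, b} f"
   unfolding leaf_emb_def
  proof (intro conjI ballI)
   show "{z, a, b} \<subseteq> verts T" "inj_on f {z, a, b}" "f ` {z, a, b} \<subseteq> verts K"
    using abz uv p ab by (auto simp: f_def inj_on_def)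
   fix x y assume "x \<in> {z, a, b}" "y \<in> {z, a, b}"
   then show "adj T x y \<longleftrightarrow> adj K (f x) (f y)"
    using ab abz p nab irr adj_sym[of T] adj_sym[of K] by (auto simp: f_def)
  next
   fix x assume x: "x \<in> verts T - {z, a, b}"
   then obtain y where "adj T x y" using nbr by blast
   then show "\<exists>w\<in>{z, a, b}. adj T x w & (\<forall>v. adj T x v --> v = w)"
    using inner_of_leaf[of x y] x leaf_unique[of x] z by blast
  next
   fix x assume x: "x \<in> {z, a, b}"
   show "card {u \<in> verts T - {z, a, b}. adj T u x} \<le> card ?N - 2"
   proof (cases "x = z")
    case True
    then have "{u \<in> verts T - {z, a, b}. adj T u x} = ?N - {a, b}"
     using adjD adj_sym[of T z] by auto
    then show ?thesis using ab card_Diff_subset[of "{a, b}" ?N] by simp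
   next
    case False
    have "{u \<in> verts T - {z, a, b}. adj T u x} = {}"
    proof (rule ccontr)
     assume "\<not> ?thesis"
     then obtain u where u: "u ~= z" "adj T x u" using adj_sym by fastforce
     have "adj T x z" using x False ab adj_sym[of T z] by auto
     then show False using leaf_unique[of x u z] u False z by blast
    qed
    then show ?thesis by (metis card.empty le0)
   qed
  qed
  then show "\<exists>W f. leaf_emb T (%_. card ?N - 2) K W f" by blast
 }
qed

text \<open>The centre \<open>y\<close> of larger degree goes to the tip \<open>u\<close>, where all
  its leaves are free. At \<open>v\<close> the centre \<open>x\<close> lacks one leaf, and
  \<open>w\<close> supplies it. If \<open>v\<close> is a tip too, its supply is no smaller, by the
  assumption on the degrees.\<close>

lemma leaf_emb_dstar_if:
 assumes xy: "inner T = {x, y}" "x ~= y" "card {u. adj T x u} \<le> card {u. adj T y u}"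
  and K: "simple_graph K"
  and s: "\<And>v. s v = (if tip v then card {u. adj T y u} - 1 else card {u. adj T x u} - 2)"
  and p: "tip u" "u ~= w" "adj K u v" "adj K v w" "\<not> adj K u w"
 shows "\<exists>W f. leaf_emb T s K W f"
proof -
 have adjxy: "adj T x y"
  using inner_connected[of x y] xy adjD by auto
 obtain l where l: "adj T x l" "l ~= y" using xy(1) unfolding inner_def by blast
 have lx: "l ~= x" "l \<in> verts T" "x \<in> verts T" "y \<in> verts T" using adjD l adjxy by blast+
 have nly: "\<not> adj T l y" using tri[of y x l] l adjxy adj_sym by metis
 have uv: "u ~= v" "v ~= w" "u \<in> verts K" "v \<in> verts K" "w \<in> verts K"
  using p simple_graph_adj[OF K] by blast+
 define f where "f = (%a. if a = y then u else if a = x then v else w)"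
 have irr: "\<not> adj T a a" "\<not> adj K b b" for a b using adjD simple_graph_adj[OF K] by blast+
 have "leaf_emb T s K {x, y, l} f"
  unfolding leaf_emb_def
 proof (intro conjI ballI)
  show "{x, y, l} \<subseteq> verts T" "inj_on f {x, y, l}" "f ` {x, y, l} \<subseteq> verts K"
   using lx uv p l xy(2) by (auto simp: f_def inj_on_def)
  fix a b assume "a \<in> {x, y, l}" "b \<in> {x, y, l}"
  then show "adj T a b \<longleftrightarrow> adj K (f a) (f b)"
   using l lx p nly irr adjxy xy(2) adj_sym[of T] adj_sym[of K] by (auto simp: f_def)
 next
  fix a assume a: "a \<in> verts T - {x, y, l}"
  then obtain b where "adj T a b" using nbr by blast
  then show "\<exists>w\<in>{x, y, l}. adj T a w & (\<forall>v. adj T a v --> v = w)"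
   using inner_of_leaf[of a b] a leaf_unique[of a] xy by blast
 next
  fix a assume a: "a \<in> {x, y, l}"
  have sy: "{u \<in> verts T - {x, y, l}. adj T u y} \<subseteq> {u. adj T y u} - {x}"
   using adj_sym[of T y] by auto
  have sx: "{u \<in> verts T - {x, y, l}. adj T u x} \<subseteq> {u. adj T x u} - {y, l}"
   using adj_sym[of T x] by auto
  have cy: "card ({u. adj T y u} - {x}) = card {u. adj T y u} - 1"
   using adjxy adj_sym[of T x y] by simp
  have cx: "card ({u. adj T x u} - {y, l}) = card {u. adj T x u} - 2"
   using adjxy l card_Diff_subset[of "{y, l}" "{u. adj T x u}"] by simp
  consider "a = x" | "a = y" | "a = l" "a ~= x" "a ~= y" using a by blast
  then show "card {u \<in> verts T - {x, y, l}. adj T u a} \<le> s (f a)"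
  proof cases
   case 1
   have "card {u \<in> verts T - {x, y, l}. adj T u x} \<le> card {u. adj T x u} - 2"
    using card_mono[OF _ sx] finite_nbrs cx by simp
   also have "\<dots> \<le> s (f x)" unfolding s using xy(3) by (auto intro: diff_le_mono2 le_trans[OF diff_le_mono])
   finally show ?thesis using 1 by simp
  next
   case 2
   have "card {u \<in> verts T - {x, y, l}. adj T u y} \<le> card {u. adj T y u} - 1"
    using card_mono[OF _ sy] finite_nbrs cy by simp
   then show ?thesis using 2 p(1) by (simp add: s f_def)
  next
   case 3
   have "{u \<in> verts T - {x, y, l}. adj T u a} = {}"
   proof (rule ccontr)
    assume "\<not> ?thesis"
    then obtain u where u: "u ~= x" "adj T l u" using adj_sym 3(1) by fastforce
    have "adj T l x" using l adj_sym by metis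
    then show False using leaf_unique[of l u x] u 3 xy by blast
   qed
   then show ?thesis by (metis card.empty le0)
  qed
 qed
 then show ?thesis by blast
qed

text \<open>A centre placed outside the tips needs one more real neighbour besides the other centre.
  With one centre on a tip this gives an induced path on three vertices starting in a tip, with none
  on a tip an induced path on four vertices; two tips are never adjacent.\<close>

lemma leaf_emb_dstar_free:
 assumes xy: "inner T = {x, y}" "x ~= y" "card {u. adj T x u} \<le> card {u. adj T y u}"
  and s: "\<And>v. s v = (if tip v then card {u. adj T y u} - 1 else card {u. adj T x u} - 2)"
  and K: "\<And>u v. tip u ==> tip v ==> \<not> adj K u v"
  and D: "\<And>u v w. tip u ==> adj K u v ==> adj K v w ==> w ~= u ==> adj K u w"
  and P4: "\<And>a b c d. adj K a b ==> adj K b c ==> adj K c d ==> \<not> adj K a c ==> \<not> adj K b d ==>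
   \<not> adj K a d ==> a ~= c ==> b ~= d ==> a ~= d ==> False"
 shows "\<not> leaf_emb T s K W f"
proof
 assume e: "leaf_emb T s K W f"
 have W: "x \<in> W" "y \<in> W" using leaf_embD[OF e] xy by auto
 have adjxy: "adj T x y" using inner_connected[of x y] xy adjD by auto
 then have adjxy: "adj T x y" "adj T y x" using adj_sym[of T x y] by auto
 have adjf: "adj T u v \<longleftrightarrow> adj K (f u) (f v)" if "u \<in> W" "v \<in> W" for u v
  using e that by (simp add: leaf_emb_def)
 have injf: "u ~= v ==> f u ~= f v" if "u \<in> W" "v \<in> W" for u v
  using e that by (auto simp: leaf_emb_def inj_on_def)
 \<comment> \<open>The supply \<open>deg x - 2\<close> falls short of the \<open>deg c - 1\<close>
   neighbours other than \<open>d\<close>, so one of those belongs to \<open>W\<close>.\<close>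
 have ex: "\<exists>z \<in> W. adj T c z & z ~= d"
  if c: "c \<in> W" "\<not> tip (f c)" and cd: "adj T c d" and le: "card {u. adj T x u} \<le> card {u. adj T c u}" for c d
 proof (rule ccontr)
  assume n: "\<not> ?thesis"
  have "{u. adj T c u} - {d} \<subseteq> {u \<in> verts T - W. adj T u c}"
   using n adjD adj_sym[of T c] by auto
  then have "card ({u. adj T c u} - {d}) \<le> card {u \<in> verts T - W. adj T u c}"
   using fin by (intro card_mono) auto
  also have "\<dots> \<le> s (f c)" using e c(1) by (simp add: leaf_emb_def)
  also have "\<dots> = card {u. adj T x u} - 2" using c(2) by (simp add: s)
  finally have "card {u. adj T c u} - 1 \<le> card {u. adj T x u} - 2" using cd by simp
  moreover have "2 \<le> card {u. adj T x u}"
  proof -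
   obtain l where l: "adj T x l" "l ~= y" using xy(1) unfolding inner_def by blast
   then show ?thesis using card_mono[OF finite_nbrs, of "{y, l}" x] adjxy by simp
  qed
  ultimately show False using le by simp
 qed
 have X: "\<exists>z \<in> W. adj T x z & z ~= y" if "\<not> tip (f x)" using ex[OF W(1) that adjxy(1)] by simp
 have Y: "\<exists>z \<in> W. adj T y z & z ~= x" if "\<not> tip (f y)" using ex[OF W(2) that adjxy(2) xy(3)] .
 have aK: "adj K (f x) (f y)" "adj K (f y) (f x)" using adjf W adjxy by auto
 show False
 proof (cases "tip (f x)"; cases "tip (f y)")
  assume "tip (f x)" "tip (f y)"
  then show False using K aK by blast
 next
  assume t: "tip (f x)" "\<not> tip (f y)"
  then obtain z where z: "z \<in> W" "adj T y z" "z ~= x" using Y by blast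
  then have "adj K (f x) (f z)" using D[OF t(1) aK(1), of "f z"] adjf W injf by metis
  then show False using adjf W z tri[OF adjxy(1) z(2)] by blast
 next
  assume t: "\<not> tip (f x)" "tip (f y)"
  then obtain z where z: "z \<in> W" "adj T x z" "z ~= y" using X by blast
  then have "adj K (f y) (f z)" using D[OF t(2) aK(2), of "f z"] adjf W injf by metis
  then show False using adjf W z tri[OF adjxy(2) z(2)] by blast
 next
  assume t: "\<not> tip (f x)" "\<not> tip (f y)"
  obtain z where z: "z \<in> W" "adj T x z" "z ~= y" using X t by blast
  obtain w where w: "w \<in> W" "adj T y w" "w ~= x" using Y t by blast
  have zx: "z ~= x" "w ~= y" using adjD z w by blast+
  have n: "\<not> adj T z y" "\<not> adj T x w" using tri[of y x z] tri[of x y w] adjxy z w adj_sym by metis+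
  have "z \<notin> inner T" using xy z zx by auto
  then have nzw: "\<not> adj T z w" using leaf_unique[of z w x] z(2) w(3) adj_sym by metis
  have "z ~= w" using n(2) z(2) by blast
  then show False
   using P4[of "f z" "f x" "f y" "f w"] adjf W z w n nzw adjxy adj_sym[of T x z] injf by metis
 qed
qed

end

section \<open>Gadgets\<close>

definition nbrs :: "'a graph => 'a => 'a set" where
 "nbrs K v = {u. adj K u v}"

lemma finite_nbrs: "simple_graph K ==> finite (nbrs K v)"
 by (rule finite_subset[of _ "verts K"]) (auto simp: nbrs_def simple_graph_def dest: simple_graph_adj[rotated])

lemma finite_edges: "simple_graph K ==> finite (edges K)"
 by (rule finite_subset[of _ "Pow (verts K)"]) (auto simp: simple_graph_def)

lemma simple_edgeE:
 assumes "simple_graph K" "e \<in> edges K"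
 obtains a b where "e = {a, b}" "a ~= b"
proof -
 have "card e = 2" using assms by (simp add: simple_graph_def)
 then show thesis using that by (auto simp: card_2_iff)
qed

lemma handshake:
 assumes K: "simple_graph K"
 shows "(\<Sum>v\<in>verts K. card (nbrs K v)) = 2 * card (edges K)"
proof -
 have fin: "finite (verts K)" using K by (simp add: simple_graph_def)
 let ?P = "SIGMA v:verts K. nbrs K v"
 let ?Q = "%e. {(u, v). {u, v} = e}"
 have P: "?P = (\<Union>e\<in>edges K. ?Q e)"
  using simple_graph_adj[OF K] by (auto simp: nbrs_def adj_def insert_commute)
 have Q: "finite (?Q e) & card (?Q e) = 2" if e: "e \<in> edges K" for e
 proof -
  obtain a b where ab: "e = {a, b}" "a ~= b" using simple_edgeE[OF K e] .
  have "?Q e = {(a, b), (b, a)}" using ab by (auto simp: doubleton_eq_iff)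
  then show ?thesis using ab by simp
 qed
 have "(\<Sum>v\<in>verts K. card (nbrs K v)) = card ?P"
  by (subst card_SigmaI) (use fin finite_nbrs[OF K] in auto)
 also have "\<dots> = (\<Sum>e\<in>edges K. card (?Q e))"
  unfolding P by (rule card_UN_disjoint) (use Q finite_edges[OF K] in auto)
 also have "\<dots> = 2 * card (edges K)" using Q by simp
 finally show ?thesis .
qed

text \<open>An edge with an end in \<open>A\<close> has only one end outside and is charged to it
  twice; the other edges are charged once to either end. The count becomes a sum over vertices
  outside \<open>A\<close>, so it can be bounded locally.\<close>

lemma handshake_indep:
 assumes K: "simple_graph K" and A: "A \<subseteq> verts K" "\<And>u v. u \<in> A ==> v \<in> A ==> \<not> adj K u v"
 shows "2 * card (edges K) = (\<Sum>h\<in>verts K - A. 2 * card (nbrs K h \<inter> A) + card (nbrs K h - A))"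
proof -
 have fin: "finite (verts K)" "finite A" using K A(1) by (auto simp: simple_graph_def intro: finite_subset)
 have "(\<Sum>a\<in>A. card (nbrs K a)) = (\<Sum>a\<in>A. card {h \<in> verts K - A. adj K h a})"
  using A simple_graph_adj[OF K] by (intro sum.cong arg_cong[where f = card]) (auto simp: nbrs_def)
 also have "\<dots> = (\<Sum>h\<in>verts K - A. card {a \<in> A. adj K h a})"
  by (rule sum_multicount_gen[symmetric]) (use fin in auto)
 also have "\<dots> = (\<Sum>h\<in>verts K - A. card (nbrs K h \<inter> A))"
  by (intro sum.cong arg_cong[where f = card]) (auto simp: nbrs_def adj_sym)
 finally have 1: "(\<Sum>a\<in>A. card (nbrs K a)) = (\<Sum>h\<in>verts K - A. card (nbrs K h \<inter> A))" .
 have "(\<Sum>h\<in>verts K - A. card (nbrs K h)) =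
   (\<Sum>h\<in>verts K - A. card (nbrs K h \<inter> A) + card (nbrs K h - A))"
  by (intro sum.cong refl card_Int_Diff finite_nbrs[OF K])
 moreover have "2 * card (edges K) = (\<Sum>v\<in>A. card (nbrs K v)) + (\<Sum>v\<in>verts K - A. card (nbrs K v))"
  unfolding handshake[OF K, symmetric] using A(1) fin by (metis add.commute sum.subset_diff)
 ultimately show ?thesis using 1 by (simp add: sum.distrib sum_distrib_left[symmetric])
qed

text \<open>Each edge is charged to its end of higher rank.\<close>

lemma card_edges_rank:
 fixes r :: "'a => nat"
 assumes K: "simple_graph K" and r: "\<And>u v. adj K u v ==> r u ~= r v"
 shows "card (edges K) = (\<Sum>v\<in>verts K. card {u \<in> nbrs K v. r u < r v})"
proof -
 have fin: "finite (verts K)" using K by (simp add: simple_graph_def)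
 let ?P = "SIGMA v:verts K. {u \<in> nbrs K v. r u < r v}"
 have "inj_on (%(v, u). {u, v}) ?P" by (auto simp: inj_on_def doubleton_eq_iff)
 moreover have "(%(v, u). {u, v}) ` ?P = edges K"
 proof
  show "(%(v, u). {u, v}) ` ?P \<subseteq> edges K" by (auto simp: nbrs_def adj_def)
  show "edges K \<subseteq> (%(v, u). {u, v}) ` ?P"
  proof
   fix e assume e: "e \<in> edges K"
   then obtain a b where ab: "e = {a, b}" "a ~= b" using simple_edgeE[OF K] by blast
   then have adj: "adj K a b" "adj K b a" using e by (auto simp: adj_def insert_commute)
   then have "r a ~= r b" "a \<in> verts K" "b \<in> verts K" using r simple_graph_adj[OF K] by blast+
   then have "(a, b) \<in> ?P \<or> (b, a) \<in> ?P" using adj by (auto simp: nbrs_def)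
   then show "e \<in> (%(v, u). {u, v}) ` ?P" using ab(1) by (auto simp: image_iff)
  qed
 qed
 ultimately have "card (edges K) = card ?P" using card_image by fastforce
 also have "\<dots> = (\<Sum>v\<in>verts K. card {u \<in> nbrs K v. r u < r v})"
  by (subst card_SigmaI) (use fin finite_nbrs[OF K] in auto)
 finally show ?thesis .
qed

text \<open>The condition \<open>2 \<le> L\<close> makes the cycles of the wheels, of length
  \<open>2 * L\<close>, long enough that two steps forward never lead back.\<close>

definition valid :: "nat => nat => clause list => bool" where
 "valid n L \<phi> \<longleftrightarrow> (\<forall>C\<in>set \<phi>. length C \<le> 3 & fst ` set C \<subseteq> {..<n}) & 2 \<le> L &
   (\<forall>x. length (filter (%C. \<exists>l\<in>set C. fst l = x) \<phi>) \<le> L)"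

lemma satisfiable_choice:
 assumes "satisfiable \<phi>"
 shows "\<exists>\<alpha> ch. \<forall>c<length \<phi>. ch c \<in> set (\<phi> ! c) & \<alpha> (fst (ch c)) = snd (ch c)"
proof -
 obtain \<alpha> where \<alpha>: "\<forall>C\<in>set \<phi>. \<exists>(x, b)\<in>set C. \<alpha> x = b" using assms by (auto simp: satisfiable_def)
 have "\<exists>l. c < length \<phi> --> l \<in> set (\<phi> ! c) & \<alpha> (fst l) = snd l" for c
 proof (cases "c < length \<phi>")
  case True
  then have "\<exists>(x, b)\<in>set (\<phi> ! c). \<alpha> x = b" using \<alpha> by simp
  then show ?thesis by auto
 qed simp
 then show ?thesis by metis
qed

lemma simple_delete: "simple_graph G ==> simple_graph (delete_edges G F)"
 by (auto simp: simple_graph_def delete_edges_def)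

text \<open>Solutions are described by labellings: exactly the edges between different labels are
  deleted.\<close>

lemma cut_classes: "\<exists>F \<subseteq> edges G. \<forall>u v. adj (delete_edges G F) u v \<longleftrightarrow> adj G u v & lab u = lab v"
 by (rule exI[of _ "{e \<in> edges G. \<exists>u v. e = {u, v} & lab u ~= lab v}"])
  (auto simp: adj_delete, auto simp: adj_def doubleton_eq_iff)

text \<open>Serial number of clause \<open>c\<close> among the clauses that mention
  \<open>x\<close>. It reserves for every clause its own two tips of the wheel of \<open>x\<close>,
  one per sign.\<close>

definition occ :: "clause list => nat => nat => nat" where
 "occ \<phi> c x = length (filter (%C. \<exists>l\<in>set C. fst l = x) (take c \<phi>))"

lemma occ_mono: "c \<le> d ==> occ \<phi> c x \<le> occ \<phi> d x"
 by (auto simp: occ_def take_add dest!: le_Suc_ex)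

lemma occ_Suc: "c < length \<phi> ==> l \<in> set (\<phi> ! c) ==> occ \<phi> (Suc c) (fst l) = Suc (occ \<phi> c (fst l))"
 by (auto simp: occ_def take_Suc_conv_app_nth)

lemma occ_less:
 assumes "valid n L \<phi>" "c < length \<phi>" "l \<in> set (\<phi> ! c)"
 shows "occ \<phi> c (fst l) < L"
proof -
 have "Suc (occ \<phi> c (fst l)) \<le> occ \<phi> (length \<phi>) (fst l)"
  using occ_mono[of "Suc c" "length \<phi>" \<phi> "fst l"] assms(2) occ_Suc[OF assms(2,3)] by simp
 also have "\<dots> \<le> L" using assms(1) by (simp add: valid_def occ_def)
 finally show ?thesis by simp
qed

lemma occ_inj:
 assumes "c < length \<phi>" "d < length \<phi>" "l \<in> set (\<phi> ! c)" "l' \<in> set (\<phi> ! d)" "fst l = fst l'"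
  "occ \<phi> c (fst l) = occ \<phi> d (fst l)"
 shows "c = d"
proof (rule ccontr)
 assume "c ~= d"
 then consider "Suc c \<le> d" | "Suc d \<le> c" by linarith
 then show False
 proof cases
  case 1
  then show False using occ_mono[OF 1, of \<phi> "fst l"] occ_Suc[OF assms(1,3)] assms(6) by simp
 next
  case 2
  then show False using occ_mono[OF 2, of \<phi> "fst l"] occ_Suc[OF assms(2,4)] assms(5,6) by simp
 qed
qed

definition nx :: "nat => nat => nat" where
 "nx L j = (if Suc j = 2 * L then 0 else Suc j)"

section \<open>The wheel gadget, for stars\<close>

text \<open>
 \<open>[0, x, j]\<close> and \<open>[1, x, j]\<close> are the core vertices and the tips of the wheel of the variable \<open>x\<close>;
 the clause number \<open>c\<close> has the vertices \<open>[2, c]\<close> and \<open>[3, c]\<close>.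
 A cluster graph that keeps enough edges selects every other triangle of a wheel: its parity is the truth value.
\<close>

definition slot :: "clause list => nat => literal => name" where
 "slot \<phi> c l = [1, fst l, 2 * occ \<phi> c (fst l) + (if snd l then 1 else 0)]"

definition wheel :: "nat => nat => clause list => ngraph" where
 "wheel n L \<phi> =
   (concat (map (%x. concat (map (%j. [[0, x, j], [1, x, j]]) [0..<2 * L])) [0..<n]) @
    concat (map (%c. [[2, c], [3, c]]) [0..<length \<phi>]),
   concat (map (%x. concat (map (%j. [([0, x, j], [0, x, nx L j]), ([1, x, j], [0, x, j]),
    ([1, x, j], [0, x, nx L j])]) [0..<2 * L])) [0..<n]) @
   concat (map (%c. ([2, c], [3, c]) # concat (map (%l. [([2, c], slot \<phi> c l), ([3, c], slot \<phi> c l)])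
    (nth_def0 [] \<phi> c))) [0..<length \<phi>]))"

locale wheel_gadget =
 fixes n L :: nat and \<phi> :: "clause list" and G
 assumes valid: "valid n L \<phi>"
 defines "G \<equiv> gr (wheel n L \<phi>)"
begin

lemma L: "2 \<le> L"
 using valid by (simp add: valid_def)

lemma slot_in:
 assumes "c < length \<phi>" "l \<in> set (\<phi> ! c)"
 shows "\<exists>x j. slot \<phi> c l = [Suc 0, x, j] & x < n & j < 2 * L"
proof -
 have "\<phi> ! c \<in> set \<phi>" using assms(1) by simp
 then have "fst ` set (\<phi> ! c) \<subseteq> {..<n}" using valid by (simp add: valid_def)
 then have "fst l < n" using assms(2) by auto
 then show ?thesis using occ_less[OF valid assms] by (auto simp: slot_def)
qed

lemma vertsG: "verts G = {[t, x, j] | t x j. t \<le> 1 & x < n & j < 2 * L} \<union> {[t, c] | t c. (t = 2 \<or> t = 3) & c < length \<phi>}"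
 unfolding G_def wheel_def by (auto simp: le_Suc_eq)

lemma nx_less: "j < 2 * L ==> nx L j < 2 * L"
 using L by (auto simp: nx_def)

lemma nx_neq: "j < 2 * L ==> nx L j ~= j & nx L (nx L j) ~= j"
 using L by (auto simp: nx_def)

lemma nx_inj: "i < 2 * L ==> j < 2 * L ==> nx L i = nx L j ==> i = j"
 by (auto simp: nx_def split: if_splits)

lemma adjG:
 "adj G [0, x, j] [0, y, i] \<longleftrightarrow> x = y & x < n & i < 2 * L & j < 2 * L & (i = nx L j \<or> j = nx L i)"
 "adj G [0, x, j] [Suc 0, y, i] \<longleftrightarrow> x = y & x < n & i < 2 * L & (j = i \<or> j = nx L i)"
 "adj G [Suc 0, y, i] [0, x, j] \<longleftrightarrow> x = y & x < n & i < 2 * L & (j = i \<or> j = nx L i)"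
 "\<not> adj G [Suc 0, x, j] [Suc 0, y, i]"
 "\<not> adj G [0, x, j] [c, d]" "\<not> adj G [c, d] [0, x, j]"
 "adj G [c, d] [c', d'] \<longleftrightarrow> d = d' & d < length \<phi> & (c = 2 & c' = 3 \<or> c = 3 & c' = 2)"
 "adj G [c, d] [Suc 0, x, j] \<longleftrightarrow> d < length \<phi> & (c = 2 \<or> c = 3) & (\<exists>l\<in>set (\<phi> ! d). [Suc 0, x, j] = slot \<phi> d l)"
 "adj G [Suc 0, x, j] [c, d] \<longleftrightarrow> d < length \<phi> & (c = 2 \<or> c = 3) & (\<exists>l\<in>set (\<phi> ! d). [Suc 0, x, j] = slot \<phi> d l)"
proof -
 have E: "set (snd (wheel n L \<phi>)) =
  {([0, x, j], [0, x, nx L j]) | x j. x < n & j < 2 * L} \<union> {([1, x, j], [0, x, j]) | x j. x < n & j < 2 * L} \<union>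
  {([1, x, j], [0, x, nx L j]) | x j. x < n & j < 2 * L} \<union> {([2, c], [3, c]) | c. c < length \<phi>} \<union>
  {([t, c], slot \<phi> c l) | t c l. (t = 2 \<or> t = 3) & c < length \<phi> & l \<in> set (\<phi> ! c)}"
  unfolding wheel_def by (auto; force)
 have V: "set (fst (wheel n L \<phi>)) = verts G" by (simp add: G_def)
 note a = adj_gr[of "wheel n L \<phi>", folded G_def, unfolded E V vertsG]
 show "adj G [0, x, j] [0, y, i] \<longleftrightarrow> x = y & x < n & i < 2 * L & j < 2 * L & (i = nx L j \<or> j = nx L i)"
  unfolding a using nx_neq[of i] nx_neq[of j] nx_less[of i] nx_less[of j] by (auto simp: slot_def)
 show t: "adj G [0, x, j] [Suc 0, y, i] \<longleftrightarrow> x = y & x < n & i < 2 * L & (j = i \<or> j = nx L i)" for x j y i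
  unfolding a using nx_less[of i] by (auto simp: slot_def)
 show "adj G [Suc 0, y, i] [0, x, j] \<longleftrightarrow> x = y & x < n & i < 2 * L & (j = i \<or> j = nx L i)"
  using t adj_sym by metis
 show "\<not> adj G [Suc 0, x, j] [Suc 0, y, i]" unfolding a by (auto simp: slot_def)
 show z: "\<not> adj G [0, x, j] [c, d]" for x j c d unfolding a by (auto simp: slot_def)
 show "\<not> adj G [c, d] [0, x, j]" using z adj_sym by metis
 show "adj G [c, d] [c', d'] \<longleftrightarrow> d = d' & d < length \<phi> & (c = 2 & c' = 3 \<or> c = 3 & c' = 2)"
  unfolding a by (auto simp: slot_def)
 show t: "adj G [c, d] [Suc 0, x, j] \<longleftrightarrow> d < length \<phi> & (c = 2 \<or> c = 3) &
   (\<exists>l\<in>set (\<phi> ! d). [Suc 0, x, j] = slot \<phi> d l)" for c d x j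
 proof
  assume "adj G [c, d] [Suc 0, x, j]"
  then show "d < length \<phi> & (c = 2 \<or> c = 3) & (\<exists>l\<in>set (\<phi> ! d). [Suc 0, x, j] = slot \<phi> d l)"
   unfolding a by auto
 next
  assume "d < length \<phi> & (c = 2 \<or> c = 3) & (\<exists>l\<in>set (\<phi> ! d). [Suc 0, x, j] = slot \<phi> d l)"
  then obtain l where l: "d < length \<phi>" "c = 2 \<or> c = 3" "l \<in> set (\<phi> ! d)" "[Suc 0, x, j] = slot \<phi> d l" by blast
  then have "x < n" "j < 2 * L" using slot_in[OF l(1,3)] by auto
  have e: "([c, d], [Suc 0, x, j]) \<in> {([t, c], slot \<phi> c l) | t c l. (t = 2 \<or> t = 3) & c < length \<phi> & l \<in> set (\<phi> ! c)}"
   unfolding l(4) using l(1-3) by blast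
  have m: "[c, d] \<in> verts G" "[Suc 0, x, j] \<in> verts G" "[c, d] ~= [Suc 0, x, j]"
   unfolding vertsG using \<open>x < n\<close> \<open>j < 2 * L\<close> l(1,2) by auto
  show "adj G [c, d] [Suc 0, x, j]" unfolding a
   by (rule conjI[OF m(1)[unfolded vertsG] conjI[OF m(2)[unfolded vertsG] conjI[OF m(3) disjI1[OF UnI2[OF e]]]]])
 qed
 show "adj G [Suc 0, x, j] [c, d] \<longleftrightarrow> d < length \<phi> & (c = 2 \<or> c = 3) & (\<exists>l\<in>set (\<phi> ! d). [Suc 0, x, j] = slot \<phi> d l)"
  using t adj_sym by metis
qed

lemma simpleG: "simple_graph G"
 unfolding G_def by (rule simple_gr)

definition tips :: "name set" where
 "tips = {[Suc 0, x, j] | x j. x < n & j < 2 * L}"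

definition heavy :: "name set" where
 "heavy = {[0, x, j] | x j. x < n & j < 2 * L} \<union> {[t, c] | t c. (t = 2 \<or> t = 3) & c < length \<phi>}"

lemma verts_split: "verts G - tips = heavy" "tips \<subseteq> verts G" "tips \<inter> heavy = {}"
 unfolding vertsG tips_def heavy_def by (auto simp: le_Suc_eq)

lemma tips_indep: "u \<in> tips ==> v \<in> tips ==> \<not> adj G u v"
 using adjG(4) by (auto simp: tips_def)

lemma card_heavy: "card heavy = 2 * n * L + 2 * length \<phi>" "finite heavy"
proof -
 let ?A = "(%(x, j). [0, x, j]) ` ({..<n} \<times> {..<2 * L})"
 let ?B = "(%(t, c). [t, c]) ` ({2, 3} \<times> {..<length \<phi>})"
 have h: "heavy = ?A \<union> ?B" by (auto simp: heavy_def image_iff)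
 have "card ?A = 2 * n * L" by (subst card_image) (auto simp: inj_on_def)
 moreover have "card ?B = 2 * length \<phi>" by (subst card_image) (auto simp: inj_on_def)
 moreover have "?A \<inter> ?B = {}" by auto
 ultimately show "card heavy = 2 * n * L + 2 * length \<phi>" unfolding h by (subst card_Un_disjoint) auto
 show "finite heavy" unfolding h by auto
qed

lemma count:
 assumes K: "simple_graph K" "verts K = verts G" "\<And>u v. adj K u v ==> adj G u v"
 shows "2 * card (edges K) = (\<Sum>h\<in>heavy. 2 * card (nbrs K h \<inter> tips) + card (nbrs K h - tips))"
proof -
 have "\<not> adj K u v" if "u \<in> tips" "v \<in> tips" for u v
  using tips_indep[OF that] K(3) by blast
 then show ?thesis using handshake_indep[OF K(1), of tips] verts_split K(2) by simp
qed

text \<open>The selected triangles of a wheel occupy the tips of one parity; the free tips are those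
  in the slots of true literals. Each clause pair takes the free tip of a literal that satisfies it.
  So every heavy vertex keeps one tip and one heavy neighbour and contributes 3 to twice the number
  of edges.\<close>

lemma sat_imp_cluster:
 assumes "satisfiable \<phi>"
 shows "\<exists>F \<subseteq> edges G. 3 * n * L + 3 * length \<phi> \<le> card (edges G - F) &
  (\<forall>u v w. u ~= w --> adj (delete_edges G F) u v --> adj (delete_edges G F) v w --> adj (delete_edges G F) u w)"
proof -
 obtain \<alpha> ch where ch: "\<And>c. c < length \<phi> ==> ch c \<in> set (\<phi> ! c) & \<alpha> (fst (ch c)) = snd (ch c)"
  using satisfiable_choice[OF assms] by blast
 \<comment> \<open>\<open>D x j\<close> means that triangle \<open>j\<close> of the wheel of
   \<open>x\<close> is selected. The slot of a positive literal has an odd index, hence is free when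
   the variable is true.\<close>
 define D where "D x j \<longleftrightarrow> (even j \<longleftrightarrow> \<alpha> x)" for x and j :: nat
 \<comment> \<open>The cycle has even length, so the alternation also holds across its closing
   edge.\<close>
 have Dnx: "D x (nx L j) \<longleftrightarrow> \<not> D x j" if "j < 2 * L" for x j
  using that by (auto simp: D_def nx_def) presburger+
 define pv where "pv j = (if j = 0 then 2 * L - 1 else j - 1)" for j
 have pv: "pv j < 2 * L & nx L (pv j) = j" if "j < 2 * L" for j
  using that L by (auto simp: pv_def nx_def)
 \<comment> \<open>A cluster is labelled with its tip; a core vertex belongs to whichever of its two
   triangles is selected.\<close>
 define lab where "lab v = (case v of [t, x] => slot \<phi> x (ch x) | [t, x, j] =>
   (if t = 0 then [Suc 0, x, if D x j then j else pv j] else v) | _ => v)" for v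
 have lab: "lab [0, x, j] = [Suc 0, x, if D x j then j else pv j]" "lab [Suc 0, x, j] = [Suc 0, x, j]"
  "lab [t, c] = slot \<phi> c (ch c)" for x j t c by (auto simp: lab_def)
 have Dslot: "\<not> D (fst (ch c)) (slot \<phi> c (ch c) ! 2)" if "c < length \<phi>" for c
  using ch[OF that] by (auto simp: slot_def D_def)
 have same: "adj G u v" if uv: "u \<in> verts G" "v \<in> verts G" "u ~= v" "lab u = lab v" for u v
 proof -
  have core: "lab [0, x, j] ~= slot \<phi> c (ch c)" if "x < n" "j < 2 * L" "c < length \<phi>" for x j c
  proof
   assume e: "lab [0, x, j] = slot \<phi> c (ch c)"
   then have "x = fst (ch c)" "slot \<phi> c (ch c) ! 2 = (if D x j then j else pv j)" by (auto simp: lab slot_def)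
   moreover have "D x (if D x j then j else pv j)" using Dnx[of "pv j" x] pv[OF that(2)] by auto
   ultimately show False using Dslot[OF that(3)] by simp
  qed
  have cores: "adj G [0, x, j] [0, y, i]"
   if "x < n" "y < n" "j < 2 * L" "i < 2 * L" "lab [0, x, j] = lab [0, y, i]" "[0, x, j] ~= [0, y, i]" for x y i j
   using that pv[of i] pv[of j] unfolding adjG(1) lab by (auto split: if_splits)
  have ct: "adj G [0, x, j] [Suc 0, y, i]"
   if "x < n" "j < 2 * L" "i < 2 * L" "lab [0, x, j] = lab [Suc 0, y, i]" for x y i j
   using that pv[of j] unfolding adjG(2) lab by (auto split: if_splits)
  have cl: "c = d" if "c < length \<phi>" "d < length \<phi>" "slot \<phi> c (ch c) = slot \<phi> d (ch d)" for c d
  proof -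
   have f: "fst (ch c) = fst (ch d)" using that(3) by (simp add: slot_def)
   moreover have "occ \<phi> c (fst (ch c)) = occ \<phi> d (fst (ch c))"
    using that(3) f by (auto simp: slot_def split: if_splits)
   ultimately show ?thesis using occ_inj[OF that(1,2)] ch that by blast
  qed
  have cs: "adj G [t, c] [Suc 0, y, i]" if "c < length \<phi>" "t = 2 \<or> t = 3" "[Suc 0, y, i] = slot \<phi> c (ch c)" for t c y i
   unfolding adjG(8) using that ch by blast
  from uv(1) consider (c1) x j where "u = [0, x, j]" "x < n" "j < 2 * L" | (t1) x j where "u = [Suc 0, x, j]" "x < n" "j < 2 * L"
   | (d1) t c where "u = [t, c]" "t = 2 \<or> t = 3" "c < length \<phi>" unfolding vertsG by (auto simp: le_Suc_eq)
  note u = this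
  from uv(2) consider (c2) x j where "v = [0, x, j]" "x < n" "j < 2 * L" | (t2) x j where "v = [Suc 0, x, j]" "x < n" "j < 2 * L"
   | (d2) t c where "v = [t, c]" "t = 2 \<or> t = 3" "c < length \<phi>" unfolding vertsG by (auto simp: le_Suc_eq)
  note v = this
  show ?thesis
  proof (cases rule: u)
   case u: c1
   show ?thesis
   proof (cases rule: v)
    case c2 then show ?thesis using cores u uv by blast
   next
    case t2 then show ?thesis using ct u uv by blast
   next
    case d2 then show ?thesis using core u uv lab(3) by metis
   qed
  next
   case u: t1
   show ?thesis
   proof (cases rule: v)
    case c2 then show ?thesis using ct u uv adj_sym by metis
   next
    case t2 then show ?thesis using u uv by (simp add: lab)
   next
    case d2 then show ?thesis using cs[of _ _ _ _] u uv lab adj_sym by metis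
   qed
  next
   case u: d1
   show ?thesis
   proof (cases rule: v)
    case c2 then show ?thesis using core u uv lab(3) by metis
   next
    case t2 then show ?thesis using cs u uv lab by metis
   next
    case d2
    then have "c = ca" if "u = [t, c]" "v = [ta, ca]" for t c ta ca using that u uv cl by (simp add: lab)
    then show ?thesis using d2 u uv(3) unfolding u(1) d2(1) adjG(7) by auto
   qed
  qed
 qed
 obtain F where F: "F \<subseteq> edges G" and adjK: "\<And>u v. adj (delete_edges G F) u v \<longleftrightarrow> adj G u v & lab u = lab v"
  using cut_classes[of G lab] by blast
 let ?K = "delete_edges G F"
 have "adj ?K u w" if "u ~= w" "adj ?K u v" "adj ?K v w" for u v w
  using that same[of u w] simple_graph_adj[OF simpleG] unfolding adjK by metis
 moreover have "3 * n * L + 3 * length \<phi> \<le> card (edges G - F)"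
 proof -
  have K: "simple_graph ?K" by (rule simple_delete[OF simpleG])
  have "3 \<le> 2 * card (nbrs ?K h \<inter> tips) + card (nbrs ?K h - tips)" if h: "h \<in> heavy" for h
  proof -
   have "\<exists>t p. t \<in> tips & p \<in> heavy & adj ?K h t & adj ?K h p"
   proof (cases "\<exists>x j. h = [0, x, j]")
    case True
    then obtain x j where x: "h = [0, x, j]" "x < n" "j < 2 * L" using h by (auto simp: heavy_def)
    let ?p = "if D x j then nx L j else pv j"
    have p: "?p < 2 * L" using pv[OF x(3)] nx_less[OF x(3)] by simp
    have "lab [0, x, ?p] = lab h"
     using Dnx[OF x(3), of x] Dnx[of "pv j" x] pv[OF x(3)] nx_inj pv[OF nx_less[OF x(3)]] x(3) unfolding x(1) lab
     by auto
    then have "adj ?K h [0, x, ?p]" unfolding adjK x(1) adjG(1) using x p pv[OF x(3)] by auto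
    moreover have "adj ?K h (lab h)" unfolding adjK x(1) lab adjG(2) using x pv[OF x(3)] by auto
    moreover have "lab h \<in> tips" using x pv[OF x(3)] by (auto simp: lab tips_def)
    ultimately show ?thesis using x p unfolding heavy_def by blast
   next
    case False
    then obtain t c where t: "h = [t, c]" "t = 2 \<or> t = 3" "c < length \<phi>" using h by (auto simp: heavy_def)
    have "ch c \<in> set (\<phi> ! c)" using ch t by blast
    then obtain x j where s: "slot \<phi> c (ch c) = [Suc 0, x, j]" "x < n" "j < 2 * L" using slot_in t(3) by blast
    have "\<exists>l\<in>set (\<phi> ! c). [Suc 0, x, j] = slot \<phi> c l" using \<open>ch c \<in> _\<close> s(1)[symmetric] by (rule bexI[rotated])
    then have "adj ?K h [Suc 0, x, j]" unfolding adjK t(1) adjG(8) lab using t s by auto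
    \<comment> \<open>The two vertices of a clause have the tags 2 and 3, so \<open>5 - t\<close> is
      the tag of the other one.\<close>
    moreover have "adj ?K h [5 - t, c]" unfolding adjK t(1) adjG(7) lab using t by auto
    moreover have "[5 - t, c] \<in> heavy" using t by (auto simp: heavy_def)
    ultimately show ?thesis using s unfolding tips_def by blast
   qed
   then obtain t p where "t \<in> tips" "p \<in> heavy" "adj ?K h t" "adj ?K h p" by blast
   then have tp: "t \<in> nbrs ?K h \<inter> tips" "p \<in> nbrs ?K h - tips"
    using verts_split(3) adj_sym[of ?K h] by (auto simp: nbrs_def)
   then have "0 < card (nbrs ?K h \<inter> tips)" "0 < card (nbrs ?K h - tips)"
    using finite_nbrs[OF K, of h] by (auto simp: card_gt_0_iff)
   then show ?thesis by linarith
  qed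
  then have "(\<Sum>h\<in>heavy. 3) \<le> (\<Sum>h\<in>heavy. 2 * card (nbrs ?K h \<inter> tips) + card (nbrs ?K h - tips))"
   by (rule sum_mono)
  then have "3 * card heavy \<le> 2 * card (edges ?K)" using count[OF K] by (simp add: adj_delete)
  then show ?thesis by (simp add: card_heavy delete_edges_def)
 qed
 ultimately show ?thesis using F by blast
qed

text \<open>In a cluster graph a heavy vertex has at most one tip and one heavy neighbour, since
  there are neither adjacent tips nor triangles of heavy vertices. It contributes at most 3, and the
  assumed number of edges forces 3 everywhere: every heavy vertex lies in a triangle with a
  tip.\<close>

lemma cluster_imp_sat:
 assumes F: "F \<subseteq> edges G" "3 * n * L + 3 * length \<phi> \<le> card (edges G - F)"
  and cl: "\<And>u v w. u ~= w ==> adj (delete_edges G F) u v ==> adj (delete_edges G F) v w ==> adj (delete_edges G F) u w"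
 shows "satisfiable \<phi>"
proof -
 let ?K = "delete_edges G F"
 have K: "simple_graph ?K" by (rule simple_delete[OF simpleG])
 have KG: "adj ?K u v ==> adj G u v" for u v by (simp add: adj_delete)
 have clG: "adj G u w" if "adj ?K v u" "adj ?K v w" "u ~= w" for u v w
  using cl[of u w v] that KG adj_sym by metis
 have one: "card (nbrs ?K h \<inter> tips) \<le> 1 & card (nbrs ?K h - tips) \<le> 1" if h: "h \<in> heavy" for h
 proof
  have "u = v" if "u \<in> nbrs ?K h \<inter> tips" "v \<in> nbrs ?K h \<inter> tips" for u v
   using clG[of h u v] that tips_indep[of u v] adj_sym[of ?K h] by (auto simp: nbrs_def)
  then show "card (nbrs ?K h \<inter> tips) \<le> 1" by (simp add: card_le_Suc0_iff_eq finite_nbrs[OF K])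
  have "u = v" if uv: "u \<in> nbrs ?K h - tips" "v \<in> nbrs ?K h - tips" for u v
  proof (rule ccontr)
   assume "u ~= v"
   then have a: "adj G u v" "adj G h u" "adj G h v" using clG[of h u v] KG uv adj_sym[of ?K h] by (auto simp: nbrs_def)
   have "u \<in> heavy" "v \<in> heavy" using a uv verts_split simple_graph_adj[OF simpleG] by blast+
   \<comment> \<open>Three core vertices could form a triangle only on a cycle of length 3, but the
     length is even.\<close>
   moreover have "Suc (Suc (Suc 0)) ~= 2 * L" by presburger
   ultimately show False using a h unfolding heavy_def
    by (auto simp: adjG nx_def split: if_splits)
  qed
  then show "card (nbrs ?K h - tips) \<le> 1" by (simp add: card_le_Suc0_iff_eq finite_nbrs[OF K])
 qed
 have full: "card (nbrs ?K h \<inter> tips) = 1 & card (nbrs ?K h - tips) = 1" if h: "h \<in> heavy" for h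
 proof (rule ccontr)
  let ?w = "%h. 2 * card (nbrs ?K h \<inter> tips) + card (nbrs ?K h - tips)"
  assume "\<not> ?thesis"
  then have "?w h < 3" using one[OF h] by linarith
  moreover have "?w g \<le> 3" if "g \<in> heavy" for g using one[OF that] by linarith
  ultimately have "(\<Sum>h\<in>heavy. ?w h) < (\<Sum>h\<in>heavy. 3)"
   by (intro sum_strict_mono_ex1) (use h card_heavy in auto)
  then have "2 * card (edges ?K) < 3 * card heavy" using count[OF K] by (simp add: adj_delete)
  then show False using F(2) by (simp add: card_heavy delete_edges_def)
 qed
 have ex: "\<exists>t p. t \<in> tips & p \<in> heavy & adj ?K h t & adj ?K h p & adj ?K p t" if h: "h \<in> heavy" for h
 proof -
  obtain t p where tp: "t \<in> nbrs ?K h \<inter> tips" "p \<in> nbrs ?K h - tips"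
   using full[OF h] by (metis One_nat_def card_1_singletonE singletonI)
  then have "p \<in> heavy" using verts_split simple_graph_adj[OF K] by (auto simp: nbrs_def)
  moreover have "p ~= t" using tp by blast
  moreover have "adj ?K h t" "adj ?K h p" "adj ?K p h" using tp adj_sym[of ?K h] by (auto simp: nbrs_def)
  ultimately show ?thesis using tp(1) cl[of p t h] by blast
 qed
 define D where "D x j \<longleftrightarrow> adj ?K [0, x, j] [Suc 0, x, j]" for x j
 \<comment> \<open>The triangle at core vertex \<open>j\<close> is triangle \<open>j\<close> or its
   predecessor, as only these contain \<open>j\<close>.\<close>
 have core: "(D x j & adj ?K [0, x, nx L j] [Suc 0, x, j]) \<or>
   (\<exists>i < 2 * L. nx L i = j & D x i & adj ?K [0, x, j] [Suc 0, x, i])" if x: "x < n" "j < 2 * L" for x j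
 proof -
  have "[0, x, j] \<in> heavy" using x by (auto simp: heavy_def)
  from ex[OF this] obtain t p where tp: "t \<in> tips" "p \<in> heavy" "adj ?K [0, x, j] t" "adj ?K [0, x, j] p" "adj ?K p t" by blast
  obtain y i where t: "t = [Suc 0, y, i]" "i < 2 * L" using tp(1) by (auto simp: tips_def)
  have yi: "y = x" "j = i \<or> j = nx L i" using KG[OF tp(3)] unfolding t adjG(2) by auto
  have jp: "adj G [0, x, j] p" using KG[OF tp(4)] .
  obtain k where p: "p = [0, x, k]" "k = nx L j \<or> j = nx L k" "k < 2 * L"
   using tp(2) jp unfolding heavy_def by (auto simp: adjG)
  have k: "k = i \<or> k = nx L i" using KG[OF tp(5)] unfolding t p(1) adjG(2) by auto
  have kj: "k ~= j" using p(2) nx_neq[OF x(2)] nx_neq[OF p(3)] by auto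
  show ?thesis
  proof (cases "j = i")
   case True
   then show ?thesis using tp k kj unfolding t p yi D_def by auto
  next
   case False
   then have "j = nx L i" "k = i" using yi k kj by auto
   then show ?thesis using tp t(2) unfolding t p yi D_def by auto
  qed
 qed
 have uniq: "i = j" if "adj ?K [0, x, k] [Suc 0, x, i]" "adj ?K [0, x, k] [Suc 0, x, j]" for x i j k
  using clG[OF that] adjG(4) by auto
 \<comment> \<open>Consecutive triangles share a core vertex, which has one tip only: not both are
   selected, and not neither.\<close>
 have alt: "D x (Suc j) \<longleftrightarrow> \<not> D x j" if x: "x < n" "Suc j < 2 * L" for x j
 proof
  have nxj: "nx L j = Suc j" using x by (simp add: nx_def)
  show "\<not> D x j" if "D x (Suc j)"
  proof
   assume d: "D x j"
   have "adj ?K [0, x, Suc j] [Suc 0, x, j]"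
   proof -
    have "\<not> (\<exists>i < 2 * L. nx L i = j & D x i & adj ?K [0, x, j] [Suc 0, x, i])"
    proof
     assume "\<exists>i < 2 * L. nx L i = j & D x i & adj ?K [0, x, j] [Suc 0, x, i]"
     then obtain i where i: "i < 2 * L" "nx L i = j" "adj ?K [0, x, j] [Suc 0, x, i]" by blast
     then have "i = j" using d uniq unfolding D_def by blast
     then show False using i nx_neq by blast
    qed
    then show ?thesis using core[of x j] x nxj by auto
   qed
   then show False using uniq[of x "Suc j" j "Suc j"] that unfolding D_def by simp
  qed
  show "D x (Suc j)" if "\<not> D x j"
  proof -
   have "\<not> (\<exists>i < 2 * L. nx L i = Suc j & D x i & adj ?K [0, x, Suc j] [Suc 0, x, i])"
    using that nx_inj[of _ j] nxj x(2) by (metis Suc_lessD)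
   then show ?thesis using core[OF x] by blast
  qed
 qed
 have par: "D x j \<longleftrightarrow> (even j \<longleftrightarrow> D x 0)" if "x < n" "j < 2 * L" for x j
  using that(2)
 proof (induction j)
  case (Suc j)
  then show ?case using alt[OF that(1), of j] by auto
 qed simp
 define \<alpha> where "\<alpha> x = D x 0" for x
 have "\<exists>(x, b)\<in>set C. \<alpha> x = b" if "C \<in> set \<phi>" for C
 proof -
  obtain c where c: "c < length \<phi>" "C = \<phi> ! c" using \<open>C \<in> set \<phi>\<close> by (metis in_set_conv_nth)
  have "[2, c] \<in> heavy" using c by (auto simp: heavy_def)
  from ex[OF this] obtain t where t: "t \<in> tips" "adj ?K [2, c] t" by blast
  obtain x j where x: "t = [Suc 0, x, j]" "x < n" "j < 2 * L" using t(1) by (auto simp: tips_def)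
  obtain l where l: "l \<in> set (\<phi> ! c)" "[Suc 0, x, j] = slot \<phi> c l"
   using KG[OF t(2)] unfolding x(1) adjG(8) by blast
  \<comment> \<open>A selected triangle would put the tip, a core vertex and the clause into one
    cluster, but clauses and core vertices are not adjacent.\<close>
  have "\<not> D x j"
  proof
   assume "D x j"
   then have "adj G [2, c] [0, x, j]"
    using clG[of t "[2, c]" "[0, x, j]"] t(2) x(1) adj_sym unfolding D_def by (metis list.inject numeral_eq_iff zero_neq_numeral)
   then show False using adjG(6) by blast
  qed
  moreover have "even j \<longleftrightarrow> \<not> snd l" "x = fst l" using l(2) by (auto simp: slot_def)
  ultimately have "\<alpha> (fst l) = snd l" using par[OF x(2,3)] unfolding \<alpha>_def by auto
  then show ?thesis using l(1) c(2) by (intro bexI[of _ l]) auto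
 qed
 then show ?thesis unfolding satisfiable_def by blast
qed

end

section \<open>The labelling gadget, for double stars\<close>

text \<open>
 Tips \<open>[0, x, b]\<close> (one per literal), variables \<open>[1, x]\<close> with satellites \<open>[2, x, i]\<close>, and
 clauses \<open>[3, c]\<close>.  If no induced path on three vertices starts in a tip, then a tip is adjacent to its
 whole component, and so it labels the other vertices of the component with a literal.
\<close>

definition tip :: "name => bool" where
 "tip v = (case v of [] => False | t # _ => t = 0)"

definition ltip :: "literal => name" where
 "ltip l = [0, fst l, if snd l then 1 else 0]"

definition lab_graph :: "nat => nat => clause list => ngraph" where
 "lab_graph n L \<phi> =
   (concat (map (%x. [0, x, 0] # [0, x, 1] # [1, x] # map (%i. [2, x, i]) [0..<L]) [0..<n]) @
    map (%c. [3, c]) [0..<length \<phi>],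
   concat (map (%x. ([1, x], [0, x, 0]) # ([1, x], [0, x, 1]) # concat (map (%i.
    [([2, x, i], [0, x, 0]), ([2, x, i], [0, x, 1]), ([2, x, i], [1, x])]) [0..<L])) [0..<n]) @
   concat (map (%c. concat (map (%l. [([3, c], ltip l), ([3, c], [1, fst l])])
    (nth_def0 [] \<phi> c))) [0..<length \<phi>]))"

locale lab_gadget =
 fixes n L :: nat and \<phi> :: "clause list" and G
 assumes valid: "valid n L \<phi>"
 defines "G \<equiv> gr (lab_graph n L \<phi>)"
begin

lemma var_less: "c < length \<phi> ==> l \<in> set (\<phi> ! c) ==> fst l < n"
proof -
 assume a: "c < length \<phi>" "l \<in> set (\<phi> ! c)"
 then have "\<phi> ! c \<in> set \<phi>" by simp
 then have "fst ` set (\<phi> ! c) \<subseteq> {..<n}" using valid by (simp add: valid_def)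
 then show ?thesis using a(2) by auto
qed

lemma vertsG: "verts G = {[0, x, b] | x b. x < n & b \<le> 1} \<union> {[1, x] | x. x < n} \<union>
  {[2, x, i] | x i. x < n & i < L} \<union> {[3, c] | c. c < length \<phi>}"
 unfolding G_def lab_graph_def by (auto simp: le_Suc_eq)

lemma edgesG: "set (snd (lab_graph n L \<phi>)) =
  {([1, x], [0, x, b]) | x b. x < n & b \<le> 1} \<union> {([2, x, i], [0, x, b]) | x i b. x < n & i < L & b \<le> 1} \<union>
  {([2, x, i], [1, x]) | x i. x < n & i < L} \<union>
  {([3, c], ltip l) | c l. c < length \<phi> & l \<in> set (\<phi> ! c)} \<union>
  {([3, c], [1, fst l]) | c l. c < length \<phi> & l \<in> set (\<phi> ! c)}"
 unfolding lab_graph_def by (auto simp: le_Suc_eq; force)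

lemma simpleG: "simple_graph G"
 unfolding G_def by (rule simple_gr)

text \<open>Edges are oriented from the larger to the smaller first entry.\<close>

lemma adjG: "adj G u v \<longleftrightarrow> (u, v) \<in> set (snd (lab_graph n L \<phi>)) \<or> (v, u) \<in> set (snd (lab_graph n L \<phi>))"
proof -
 have "u \<in> verts G & v \<in> verts G & u ~= v" if "(u, v) \<in> set (snd (lab_graph n L \<phi>))" for u v
  using that var_less unfolding edgesG vertsG ltip_def by (auto split: if_split_asm)
 then show ?thesis unfolding G_def adj_gr by (auto simp: G_def)
qed

lemma adj1: "adj G [Suc 0, x] u \<longleftrightarrow> (\<exists>b \<le> 1. u = [0, x, b] & x < n) \<or> (\<exists>i. u = [2, x, i] & x < n & i < L) \<or>
  (\<exists>c l. u = [3, c] & c < length \<phi> & l \<in> set (\<phi> ! c) & fst l = x)"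
 unfolding adjG edgesG ltip_def by auto

lemma adj2: "adj G [2, x, i] u \<longleftrightarrow> x < n & i < L & ((\<exists>b \<le> 1. u = [0, x, b]) \<or> u = [1, x])"
 unfolding adjG edgesG ltip_def by auto

lemma ltip_neq [simp]: "ltip l ~= [a, b]" "[a, b] ~= ltip l"
 by (auto simp: ltip_def)

lemma adj3: "adj G [3, c] u \<longleftrightarrow> c < length \<phi> & (\<exists>l \<in> set (\<phi> ! c). u = ltip l \<or> u = [1, fst l])"
proof
 assume "adj G [3, c] u"
 then show "c < length \<phi> & (\<exists>l \<in> set (\<phi> ! c). u = ltip l \<or> u = [1, fst l])"
  unfolding adjG edgesG by (elim disjE UnE CollectE exE conjE; simp; blast)
next
 assume "c < length \<phi> & (\<exists>l \<in> set (\<phi> ! c). u = ltip l \<or> u = [1, fst l])"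
 then show "adj G [3, c] u" unfolding adjG edgesG by blast
qed

lemma tip_nonadj: "tip u ==> tip v ==> \<not> adj G u v"
 unfolding adjG edgesG by (auto simp: tip_def ltip_def)

definition rank :: "name => nat" where
 "rank v = (case v of [] => 0 | t # _ => t)"

lemma rank_adj: "adj G u v ==> rank u ~= rank v"
 unfolding adjG edgesG by (auto simp: rank_def ltip_def)

lemma sum_verts:
 "(\<Sum>v\<in>verts G. g v) = (\<Sum>x<n. (\<Sum>b\<le>1. g [0, x, b]) + g [1, x] + (\<Sum>i<L. g [2, x, i])) + (\<Sum>c<length \<phi>. g [3, c])"
 for g :: "name => nat"
proof -
 let ?A = "(%(x, b). [0, x, b]) ` ({..<n} \<times> {..1})" and ?B = "(%x. [1, x]) ` {..<n}"
 let ?C = "(%(x, i). [2, x, i]) ` ({..<n} \<times> {..<L})" and ?D = "(%c. [3, c]) ` {..<length \<phi>}"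
 have v: "verts G = ?A \<union> ?B \<union> ?C \<union> ?D" unfolding vertsG by (auto simp: image_iff)
 have d: "?A \<inter> ?B = {}" "(?A \<union> ?B) \<inter> ?C = {}" "(?A \<union> ?B \<union> ?C) \<inter> ?D = {}" by auto
 have "(\<Sum>v\<in>verts G. g v) = (\<Sum>v\<in>?A. g v) + (\<Sum>v\<in>?B. g v) + (\<Sum>v\<in>?C. g v) + (\<Sum>v\<in>?D. g v)"
  unfolding v by (subst sum.union_disjoint[OF _ _ d(3)], simp, simp, subst sum.union_disjoint[OF _ _ d(2)],
   simp, simp, subst sum.union_disjoint[OF _ _ d(1)], simp, simp, rule refl)
 also have "(\<Sum>v\<in>?A. g v) = (\<Sum>x<n. \<Sum>b\<le>1. g [0, x, b])"
  by (subst sum.reindex) (auto simp: inj_on_def sum.cartesian_product case_prod_beta simp del: sum.atMost_Suc)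
 also have "(\<Sum>v\<in>?B. g v) = (\<Sum>x<n. g [1, x])" by (subst sum.reindex) (auto simp: inj_on_def)
 also have "(\<Sum>v\<in>?C. g v) = (\<Sum>x<n. \<Sum>i<L. g [2, x, i])"
  by (subst sum.reindex) (auto simp: inj_on_def sum.cartesian_product case_prod_beta)
 also have "(\<Sum>v\<in>?D. g v) = (\<Sum>c<length \<phi>. g [3, c])" by (subst sum.reindex) (auto simp: inj_on_def)
 finally show ?thesis by (simp add: sum.distrib)
qed

text \<open>Variables and satellites are labelled with the true literal, clauses with a literal that
  satisfies them. Charging edges to the higher rank, a variable keeps its tip, and satellites and
  clauses keep a tip and a variable: 1, 2 and 2 edges.\<close>

lemma sat_imp_label:
 assumes "satisfiable \<phi>"
 shows "\<exists>F \<subseteq> edges G. n * (1 + 2 * L) + 2 * length \<phi> \<le> card (edges G - F) &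
  (\<forall>t v w. tip t --> adj (delete_edges G F) t v --> adj (delete_edges G F) v w --> w ~= t --> adj (delete_edges G F) t w) &
  (\<forall>a b c d. adj (delete_edges G F) a b --> adj (delete_edges G F) b c --> adj (delete_edges G F) c d -->
   \<not> adj (delete_edges G F) a c --> \<not> adj (delete_edges G F) b d --> a ~= c --> b ~= d --> a ~= d --> False)"
proof -
 obtain \<alpha> ch where ch: "\<And>c. c < length \<phi> ==> ch c \<in> set (\<phi> ! c) & \<alpha> (fst (ch c)) = snd (ch c)"
  using satisfiable_choice[OF assms] by blast
 define lab where "lab v = (case v of [] => v | t # w =>
   (if t = 0 then v else if t = 3 then ltip (ch (hd w)) else ltip (hd w, \<alpha> (hd w))))" for v
 have lab: "lab [0, x, b] = [0, x, b]" "lab [Suc 0, x] = ltip (x, \<alpha> x)" "lab [2, x, i] = ltip (x, \<alpha> x)"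
  "lab [3, c] = ltip (ch c)" "lab (ltip l) = ltip l" for x b i c l by (auto simp: lab_def ltip_def)
 have labt: "lab t = t" if "tip t" for t using that by (auto simp: lab_def tip_def split: list.splits)
 obtain F where F: "F \<subseteq> edges G" and adjK: "\<And>u v. adj (delete_edges G F) u v \<longleftrightarrow> adj G u v & lab u = lab v"
  using cut_classes[of G lab] by blast
 let ?K = "delete_edges G F"
 have ltip_inj: "ltip l = ltip l' ==> l = l'" for l l' by (auto simp: ltip_def prod_eq_iff split: if_splits)
 \<comment> \<open>The tip that serves as label is adjacent to all other vertices of its class, so
   no induced path can start there.\<close>
 have dom: "adj G (lab v) v" if "v \<in> verts G" "\<not> tip v" for v
 proof -
  from that consider x where "v = [1, x]" "x < n" | x i where "v = [2, x, i]" "x < n" "i < L" | c where "v = [3, c]" "c < length \<phi>"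
   unfolding vertsG by (auto simp: tip_def)
  then show ?thesis
   unfolding adj_sym[of G "lab v"]
  proof cases
   case 3
   then show "adj G v (lab v)" using ch[of c] by (auto simp: lab adj3)
  qed (auto simp: lab adj1 adj2 ltip_def)
 qed
 have D: "adj ?K t w" if "tip t" "adj ?K t v" "adj ?K v w" "w ~= t" for t v w
 proof -
  have w: "lab w = t" "w \<in> verts G" using that labt simple_graph_adj[OF simpleG] unfolding adjK by metis+
  then have "\<not> tip w" using that(4) labt by metis
  then show ?thesis unfolding adjK using dom[OF w(2)] w(1) labt that(1) by simp
 qed
 have K: "simple_graph ?K" by (rule simple_delete[OF simpleG])
 \<comment> \<open>Without its tip, a class is a star around the vertex of the variable of its
   label.\<close>
 have star: "u = [1, x] \<or> v = [1, x]" if "adj ?K u v" "\<not> tip u" "\<not> tip v" "hd (tl (lab u)) = x" for u v x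
 proof -
  have *: "v = [1, x]" if e: "(u, v) \<in> set (snd (lab_graph n L \<phi>))" "lab u = lab v" "\<not> tip v" "hd (tl (lab u)) = x"
   for u v x using e unfolding edgesG by (auto simp: tip_def ltip_def lab)
  show ?thesis using that *[of u v x] *[of v u x] unfolding adjK adjG by auto
 qed
 \<comment> \<open>Tips dominate their classes and cannot lie on such a path; the remaining vertices
   form a star, where no path has three edges.\<close>
 have P4: False if p: "adj ?K a b" "adj ?K b c" "adj ?K c d" "\<not> adj ?K a c" "\<not> adj ?K b d" "a ~= c" "b ~= d" "a ~= d"
  for a b c d
 proof -
  have s: "adj ?K b a" "adj ?K c b" "adj ?K d c" using p adj_sym by metis+
  have "\<not> tip a" using D[of a b c] p by blast
  moreover have "\<not> tip b" using D[of b c d] p by blast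
  moreover have "\<not> tip c" using D[of c b a] s p adj_sym by metis
  moreover have "\<not> tip d" using D[of d c b] s p adj_sym by metis
  moreover have "lab a = lab b" "lab b = lab c" "lab c = lab d" using p unfolding adjK by auto
  ultimately show False using star[OF p(1)] star[OF p(2)] star[OF p(3)] p(6-8) simple_graph_adj[OF K p(2)]
   by metis
 qed
 have "n * (1 + 2 * L) + 2 * length \<phi> \<le> card (edges ?K)"
 proof -
  let ?g = "%v. card {u \<in> nbrs ?K v. rank u < rank v}"
  have two: "card S \<le> ?g v" if "S \<subseteq> {u. adj ?K v u & rank u < rank v}" for S v
   using that finite_nbrs[OF K, of v] by (intro card_mono) (auto simp: nbrs_def adj_sym[of ?K v])
  have 1: "1 \<le> ?g [1, x]" if "x < n" for x
   using two[of "{lab [1, x]}" "[1, x]"] that dom[of "[1, x]"]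
   by (auto simp: adjK vertsG tip_def lab labt rank_def ltip_def adj_sym[of G "[Suc 0, x]"])
  have 2: "2 \<le> ?g [2, x, i]" if "x < n" "i < L" for x i
  proof -
   have "{ltip (x, \<alpha> x), [1, x]} \<subseteq> {u. adj ?K [2, x, i] u & rank u < rank [2, x, i]}"
    using that by (auto simp: adjK adj2 lab rank_def ltip_def)
   from two[OF this] show ?thesis by (simp add: ltip_def)
  qed
  have 3: "2 \<le> ?g [3, c]" if "c < length \<phi>" for c
  proof -
   have "{ltip (ch c), [1, fst (ch c)]} \<subseteq> {u. adj ?K [3, c] u & rank u < rank [3, c]}"
    using ch[OF that] that by (auto simp: adjK adj3 lab rank_def) (auto simp: ltip_def)
   from two[OF this] show ?thesis by (simp add: ltip_def)
  qed
  have "card (edges ?K) = (\<Sum>v\<in>verts G. ?g v)"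
   using card_edges_rank[OF K, of rank] rank_adj by (simp add: adj_delete)
  also have "\<dots> = (\<Sum>x<n. (\<Sum>b\<le>1. ?g [0, x, b]) + ?g [1, x] + (\<Sum>i<L. ?g [2, x, i])) + (\<Sum>c<length \<phi>. ?g [3, c])"
   by (rule sum_verts)
  also have "\<dots> \<ge> (\<Sum>x<n. 0 + 1 + (\<Sum>i<L. 2)) + (\<Sum>c<length \<phi>. 2)"
   by (intro add_mono sum_mono 1 2 3) auto
  finally show ?thesis by (simp add: algebra_simps)
 qed
 moreover have "edges ?K = edges G - F" by (simp add: delete_edges_def)
 ultimately show ?thesis using F D P4 by (intro exI[of _ F]) metis
qed

text \<open>A graph might gain by leaving a variable without a tip, because clauses without a tip
  may keep edges to several variables. The \<open>L\<close> satellites make this a loss: each such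
  variable costs 1 edge itself and 1 per satellite, whereas the at most \<open>L\<close> clauses
  that mention it gain at most 1 each.\<close>

lemma label_imp_sat:
 assumes F: "F \<subseteq> edges G" "n * (1 + 2 * L) + 2 * length \<phi> \<le> card (edges G - F)"
  and D: "\<And>t v w. tip t ==> adj (delete_edges G F) t v ==> adj (delete_edges G F) v w ==> w ~= t ==>
   adj (delete_edges G F) t w"
 shows "satisfiable \<phi>"
proof -
 let ?K = "delete_edges G F"
 have K: "simple_graph ?K" by (rule simple_delete[OF simpleG])
 have KG: "adj ?K u v ==> adj G u v" for u v by (simp add: adj_delete)
 let ?g = "%v. card {u \<in> nbrs ?K v. rank u < rank v}"
 have gset: "{u \<in> nbrs ?K v. rank u < rank v} = {u. adj ?K v u & rank u < rank v}" for v
  by (auto simp: nbrs_def adj_sym)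
 have DS: "adj ?K w t" if "tip t" "adj ?K v t" "adj ?K v w" "w ~= t" for t v w
  using D[of t v w] that adj_sym[of ?K] by blast
 have one_tip: "s = t" if "adj ?K v s" "adj ?K v t" "tip s" "tip t" for v s t
  using DS[of s v t] that tip_nonadj[of t s] KG by blast
 have ntip: "\<not> tip [1, x]" "\<not> tip [2, x, i]" "\<not> tip [3, x]" for x i by (auto simp: tip_def)
 \<comment> \<open>The variables that carry no label.\<close>
 define U where "U = {x. x < n & \<not> (\<exists>t. tip t & adj ?K [1, x] t)}"
 have finU: "finite U" by (simp add: U_def)
 have fing: "finite {u. adj ?K v u & rank u < rank v}" for v
  using finite_nbrs[OF K, of v] unfolding gset[symmetric] by auto
 have le1: "card S \<le> 1" if S: "\<And>s t. s \<in> S ==> t \<in> S ==> s = t" for S :: "name set"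
 proof (cases "S = {}")
  case False
  then obtain s where "S = {s}" using S by blast
  then show ?thesis by simp
 qed simp
 have g0: "?g [0, x, b] = 0" for x b by (simp add: rank_def)
 have g1: "?g [1, x] = (if x \<in> U then 0 else 1)" if x: "x < n" for x
 proof -
  have s: "{u. adj ?K [1, x] u & rank u < rank [1, x]} = {t. tip t & adj ?K [1, x] t}"
   using KG adj1 by (auto simp: rank_def tip_def split: list.splits)
  show ?thesis
  proof (cases "x \<in> U")
   case True
   then have e: "{t. tip t & adj ?K [1, x] t} = {}" by (auto simp: U_def)
   show ?thesis unfolding gset s e using True by simp
  next
   case False
   then obtain t where t: "tip t" "adj ?K [1, x] t" using x by (auto simp: U_def)
   then have "{t. tip t & adj ?K [1, x] t} = {t}" using one_tip by blast
   then show ?thesis unfolding gset s using False by simp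
  qed
 qed
 have g2: "?g [2, x, i] \<le> (if x \<in> U then 1 else 2)" if x: "x < n" for x i
 proof -
  let ?T = "{t. tip t & adj ?K [2, x, i] t}"
  have s: "{u. adj ?K [2, x, i] u & rank u < rank [2, x, i]} \<subseteq> ?T \<union> {[1, x]}"
  proof
   fix u assume "u \<in> {u. adj ?K [2, x, i] u & rank u < rank [2, x, i]}"
   then have u: "adj ?K [2, x, i] u" by simp
   from KG[OF this] have "(\<exists>b \<le> 1. u = [0, x, b]) \<or> u = [1, x]" by (simp add: adj2)
   then show "u \<in> ?T \<union> {[1, x]}" using u by (auto simp: tip_def)
  qed
  have T: "card ?T \<le> 1" by (rule le1) (use one_tip in blast)
  have finT: "finite ?T" by (rule finite_subset[OF _ finite_nbrs[OF K, of "[2, x, i]"]]) (auto simp: nbrs_def adj_sym)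
  show ?thesis
  proof (cases "x \<in> U & adj ?K [2, x, i] [1, x]")
   case True
   have "?T = {}"
   proof (rule ccontr)
    assume "?T ~= {}"
    then obtain t where t: "tip t" "adj ?K [2, x, i] t" by blast
    then have "adj ?K [1, x] t" using DS[OF t] True ntip(1) by metis
    then show False using True t(1) unfolding U_def by blast
   qed
   then have "{u. adj ?K [2, x, i] u & rank u < rank [2, x, i]} \<subseteq> {[1, x]}" using s by blast
   then have "?g [2, x, i] \<le> card {[Suc 0, x]}" unfolding gset by (intro card_mono) auto
   then show ?thesis using True by simp
  next
   case False
   show ?thesis
   proof (cases "x \<in> U")
    case True
    then have "{u. adj ?K [2, x, i] u & rank u < rank [2, x, i]} \<subseteq> ?T" using s False by auto
    then have "?g [2, x, i] \<le> card ?T" unfolding gset using finT by (intro card_mono)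
    then show ?thesis using T True by simp
   next
    case 2: False
    have "?g [2, x, i] \<le> card (?T \<union> {[1, x]})" unfolding gset using finT s by (intro card_mono) auto
    also have "\<dots> \<le> card ?T + 1" using card_Un_le[of ?T "{[1, x]}"] by simp
    finally show ?thesis using T 2 by simp
   qed
  qed
 qed
 define B where "B c \<longleftrightarrow> (\<exists>l\<in>set (\<phi> ! c). fst l \<in> U)" for c
 define good where "good c \<longleftrightarrow> (\<exists>l\<in>set (\<phi> ! c). adj ?K [3, c] (ltip l) & adj ?K (ltip l) [1, fst l])" for c
 \<comment> \<open>A clause with a tip has at most one further neighbour, the variable of that
   literal. Without a tip it has at most three, and then only variables in \<open>U\<close>, because
   the tip of a labelled variable would be adjacent to the clause as well.\<close>
 have g3: "?g [3, c] \<le> 2 + (if B c then 1 else 0) & (\<not> good c --> \<not> B c --> ?g [3, c] < 2)" if c: "c < length \<phi>" for c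
 proof -
  let ?T = "{t. tip t & adj ?K [3, c] t}" and ?V = "{v. adj ?K [3, c] v & \<not> tip v}"
  have s: "{u. adj ?K [3, c] u & rank u < rank [3, c]} \<subseteq> ?T \<union> ?V" by auto
  have V: "\<exists>l\<in>set (\<phi> ! c). v = [1, fst l]" if "v \<in> ?V" for v
  proof -
   have "adj G [3, c] v" "\<not> tip v" using that KG by blast+
   then show ?thesis by (auto simp: adj3) (auto simp: tip_def ltip_def)
  qed
  have T: "card ?T \<le> 1" by (rule le1) (use one_tip in blast)
  have fin: "finite ?T" "finite ?V"
   by (rule finite_subset[OF _ finite_nbrs[OF K, of "[3, c]"]], auto simp: nbrs_def adj_sym)+
  have g: "?g [3, c] \<le> card ?T + card ?V"
   unfolding gset using card_mono[OF _ s] fin card_Un_le[of ?T ?V] by (meson finite_UnI le_trans)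
  show ?thesis
  proof (cases "?T = {}")
   case True
   have "?V \<subseteq> (%l. [1, fst l]) ` set (\<phi> ! c)" using V by blast
   then have "card ?V \<le> card ((%l. [1, fst l]) ` set (\<phi> ! c))" by (intro card_mono) auto
   also have "\<dots> \<le> length (\<phi> ! c)" using card_image_le[of "set (\<phi> ! c)"] card_length[of "\<phi> ! c"] by (meson finite_set le_trans)
   also have "\<dots> \<le> 3" using valid c by (auto simp: valid_def)
   finally have V3: "card ?V \<le> 3" .
   have "B c" if V0: "?V ~= {}"
   proof -
    obtain v where v: "v \<in> ?V" using V0 by blast
    then obtain l where l: "l \<in> set (\<phi> ! c)" "v = [1, fst l]" using V by blast
    have "fst l \<in> U"
    proof (rule ccontr)
     assume "fst l \<notin> U"
     then obtain t where t: "tip t" "adj ?K [1, fst l] t" using var_less[OF c l(1)] by (auto simp: U_def)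
     have "adj ?K v [3, c]" using v adj_sym[of ?K] by blast
     then have "adj ?K [3, c] t" using DS[OF t(1), of v "[3, c]"] t l(2) ntip(3)[of c] by metis
     then show False using True t(1) by blast
    qed
    then show ?thesis using l(1) by (auto simp: B_def)
   qed
   then show ?thesis using g V3 True by (cases "?V = {}") auto
  next
   case False
   then obtain t where t: "tip t" "adj ?K [3, c] t" by blast
   have Vt: "adj ?K t v" if "v \<in> ?V" for v
   proof -
    have v: "adj ?K [3, c] v" "v ~= t" using that t by blast+
    have "adj ?K v t" by (rule DS[OF t v])
    then show ?thesis by (simp add: adj_sym)
   qed
   obtain l where l: "l \<in> set (\<phi> ! c)" "t = ltip l" using KG[OF t(2)] t(1) unfolding adj3 by (auto simp: tip_def)
   have vl: "v = [1, fst l]" if v: "v \<in> ?V" for v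
   proof -
    obtain l' :: literal where l': "v = [1, fst l']" using V[OF v] by blast
    have "adj G [1, fst l'] (ltip l)" using KG[OF Vt[OF v]] unfolding l(2) l' by (simp add: adj_sym)
    then show ?thesis using l' by (auto simp: adj1 ltip_def)
   qed
   have V1: "card ?V \<le> 1" by (rule le1) (use vl in blast)
   have V0: "?V = {}" if "\<not> good c"
   proof (rule ccontr)
    assume "?V ~= {}"
    then obtain v where v: "v \<in> ?V" by blast
    then have "adj ?K (ltip l) [1, fst l]" using Vt vl l(2) by blast
    then show False using that t(2) l unfolding good_def by blast
   qed
   show ?thesis
   proof (cases "good c")
    case True
    have "?g [3, c] \<le> 2" using g T V1 by linarith
    then show ?thesis using True by simp
   next
    case False
    have "card ?V = 0" unfolding V0[OF False] by simp
    then have "?g [3, c] \<le> 1" using g T by linarith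
    then show ?thesis by simp
   qed
  qed
 qed
 have BU: "card {c. c < length \<phi> & B c} \<le> L * card U"
 proof -
  have "{c. c < length \<phi> & B c} \<subseteq> (\<Union>x\<in>U. {c. c < length \<phi> & (\<exists>l\<in>set (\<phi> ! c). fst l = x)})"
   by (auto simp: B_def)
  then have "card {c. c < length \<phi> & B c} \<le> card (\<Union>x\<in>U. {c. c < length \<phi> & (\<exists>l\<in>set (\<phi> ! c). fst l = x)})"
   using finU by (intro card_mono) auto
  also have "\<dots> \<le> (\<Sum>x\<in>U. card {c. c < length \<phi> & (\<exists>l\<in>set (\<phi> ! c). fst l = x)})"
   by (rule card_UN_le[OF finU])
  also have "\<dots> \<le> (\<Sum>x\<in>U. L)"
  proof (rule sum_mono)
   fix x
   have "card {c. c < length \<phi> & (\<exists>l\<in>set (\<phi> ! c). fst l = x)} = length (filter (%C. \<exists>l\<in>set C. fst l = x) \<phi>)"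
    by (simp add: length_filter_conv_card)
   then show "card {c. c < length \<phi> & (\<exists>l\<in>set (\<phi> ! c). fst l = x)} \<le> L" using valid by (simp add: valid_def)
  qed
  finally show ?thesis by (simp add: mult.commute)
 qed
 let ?b = "%c. if B c then 1 else 0 :: nat"
 have tot: "card (edges ?K) = (\<Sum>x<n. (\<Sum>b\<le>1. ?g [0, x, b]) + ?g [1, x] + (\<Sum>i<L. ?g [2, x, i])) + (\<Sum>c<length \<phi>. ?g [3, c])"
  using card_edges_rank[OF K, of rank] rank_adj sum_verts[of ?g] by (simp add: adj_delete)
 have x1: "(\<Sum>b\<le>1. ?g [0, x, b]) + ?g [1, x] + (\<Sum>i<L. ?g [2, x, i]) + (if x \<in> U then L + 1 else 0) \<le> 1 + 2 * L"
  if "x < n" for x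
 proof -
  have "(\<Sum>i<L. ?g [2, x, i]) \<le> (\<Sum>i<L. if x \<in> U then 1 else 2)" by (intro sum_mono g2 that)
  then have "(\<Sum>i<L. ?g [2, x, i]) \<le> (if x \<in> U then L else 2 * L)" by (cases "x \<in> U") auto
  moreover have "(\<Sum>b\<le>1. ?g [0, x, b]) = 0" using g0 by simp
  ultimately show ?thesis using g1[OF that] by (cases "x \<in> U") auto
 qed
 have "(\<Sum>x<n. (\<Sum>b\<le>1. ?g [0, x, b]) + ?g [1, x] + (\<Sum>i<L. ?g [2, x, i])) + (\<Sum>x<n. if x \<in> U then L + 1 else 0) \<le> (\<Sum>x<n. 1 + 2 * L)"
  unfolding sum.distrib[symmetric] by (intro sum_mono x1) simp
 moreover have "(\<Sum>x<n. if x \<in> U then L + 1 else 0) = (L + 1) * card U"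
 proof -
  have "{x. x < n & x \<in> U} = U" by (auto simp: U_def)
  then show ?thesis by (simp add: sum.If_cases Int_def)
 qed
 ultimately have X: "(\<Sum>x<n. (\<Sum>b\<le>1. ?g [0, x, b]) + ?g [1, x] + (\<Sum>i<L. ?g [2, x, i])) + (L + 1) * card U \<le> n * (1 + 2 * L)"
  by (simp add: mult.commute)
 have "(\<Sum>c<length \<phi>. 2 + ?b c) = 2 * length \<phi> + card {c. c < length \<phi> & B c}"
  unfolding sum.distrib by (simp add: sum.If_cases Int_def)
 then have C2: "(\<Sum>c<length \<phi>. 2 + ?b c) \<le> 2 * length \<phi> + L * card U" using BU by simp
 have C1: "(\<Sum>c<length \<phi>. ?g [3, c]) \<le> (\<Sum>c<length \<phi>. 2 + ?b c)" by (intro sum_mono) (use g3 in auto)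
 have E: "n * (1 + 2 * L) + 2 * length \<phi> \<le> card (edges ?K)" using F(2) by (simp add: delete_edges_def)
 \<comment> \<open>Each element of \<open>U\<close> loses \<open>L + 1\<close> and is compensated by
   at most \<open>L\<close>, so the required total leaves none.\<close>
 have "card U = 0" using X C1 C2 E tot by simp
 then have U: "U = {}" using finU by simp
 then have nB: "\<not> B c" for c by (simp add: B_def)
 have good: "good c" if c: "c < length \<phi>" for c
 proof (rule ccontr)
  assume "\<not> good c"
  then have "?g [3, c] < 2" using g3[OF c] nB by blast
  then have "(\<Sum>c<length \<phi>. ?g [3, c]) < (\<Sum>c<length \<phi>. 2)"
   using g3 nB c by (intro sum_strict_mono_ex1) auto
  then show False using X E tot by simp
 qed
 define \<alpha> where "\<alpha> x = adj ?K [1, x] (ltip (x, True))" for x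
 have "\<exists>(x, b)\<in>set C. \<alpha> x = b" if C: "C \<in> set \<phi>" for C
 proof -
  obtain c where c: "c < length \<phi>" "C = \<phi> ! c" using C by (metis in_set_conv_nth)
  obtain x b where l: "(x, b) \<in> set C" "adj ?K (ltip (x, b)) [1, x]"
   using good[OF c(1)] c(2) unfolding good_def by auto
  have "b" if "\<alpha> x"
  proof (rule ccontr)
   assume "\<not> b"
   have "ltip (x, b) = ltip (x, True)"
   proof (rule one_tip[of "[1, x]"])
    show "adj ?K [1, x] (ltip (x, b))" using l(2) by (simp add: adj_sym)
    show "adj ?K [1, x] (ltip (x, True))" using that by (simp add: \<alpha>_def)
   qed (auto simp: tip_def ltip_def)
   then show False using \<open>\<not> b\<close> by (simp add: ltip_def)
  qed
  moreover have "\<alpha> x" if "b" using l(2) that unfolding \<alpha>_def by (simp add: adj_sym)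
  ultimately have "\<alpha> x = b" by blast
  then show ?thesis using l(1) by (intro bexI[of _ "(x, b)"]) auto
 qed
 then show ?thesis unfolding satisfiable_def by blast
qed

end

section \<open>Hardness for trees\<close>

text \<open>The parameter is a difference with the exact number of edges, whereas the lists may
  contain an edge twice or in both directions.\<close>

definition add_edge :: "name list => (name \<times> name) list => name \<times> name => (name \<times> name) list" where
 "add_edge vs acc e = (if fst e = snd e \<or> fst e \<notin> set vs \<or> snd e \<notin> set vs \<or> e \<in> set acc \<or>
   (snd e, fst e) \<in> set acc then acc else e # acc)"

definition ecount :: "ngraph => nat" where
 "ecount g = length (foldl (add_edge (fst g)) [] (snd g))"

lemma add_edge_inv:
 "let acc = foldl (add_edge vs) [] es in
   (%(u, v). {u, v}) ` set acc = edges (gr (vs, es)) & length acc = card (edges (gr (vs, es))) &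
   set acc \<subseteq> set es & length acc \<le> length es"
proof (induction es rule: rev_induct)
 case Nil
 then show ?case by (simp add: gr_def)
next
 case (snoc e es)
 let ?acc = "foldl (add_edge vs) [] es"
 obtain u v where e: "e = (u, v)" by (cases e)
 have E: "edges (gr (vs, es @ [e])) = edges (gr (vs, es)) \<union> (if u ~= v & u \<in> set vs & v \<in> set vs then {{u, v}} else {})"
  by (auto simp: gr_def e)
 have fin: "finite (edges (gr (vs, es)))" using finite_edges[OF simple_gr] .
 have m: "{u, v} \<in> edges (gr (vs, es)) \<longleftrightarrow> (u, v) \<in> set ?acc \<or> (v, u) \<in> set ?acc"
 proof -
  have "{u, v} \<in> edges (gr (vs, es)) \<longleftrightarrow> {u, v} \<in> (%(u, v). {u, v}) ` set ?acc" using snoc by (simp add: Let_def)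
  then show ?thesis by (auto simp: image_iff doubleton_eq_iff)
 qed
 show ?case
 proof (cases "u ~= v & u \<in> set vs & v \<in> set vs & {u, v} \<notin> edges (gr (vs, es))")
  case True
  then have "add_edge vs ?acc e = e # ?acc" using m by (simp add: add_edge_def e)
  then show ?thesis using snoc True fin unfolding E by (auto simp: Let_def e)
 next
  case False
  then have a: "add_edge vs ?acc e = ?acc" using m by (auto simp: add_edge_def e)
  have "edges (gr (vs, es @ [e])) = edges (gr (vs, es))" using False unfolding E by auto
  then show ?thesis using snoc a by (auto simp: Let_def)
 qed
qed

lemma ecount: "ecount g = card (edges (gr g))"
 using add_edge_inv[of "fst g" "snd g"] by (simp add: ecount_def Let_def)

lemma ecount_le: "ecount g \<le> length (snd g)"
 using add_edge_inv[of "fst g" "snd g"] by (simp add: ecount_def Let_def)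

lemma PT_ecount [pt]: "PT g ==> PT (%x. ecount (g x))"
proof -
 assume g: "PT g"
 have "PT (%x. foldl (add_edge (fst (g x))) [] (snd (g x)))"
 proof (rule PT_foldl[where B = "%x. Suc (sz (snd (g x)) * Suc (sz (snd (g x))))"])
  show "PT (%p. add_edge (fst (g (fst p))) (fst (snd p)) (snd (snd p)))"
   unfolding add_edge_def by (intro pt PT_comp[OF g])
  fix x k
  assume k: "k \<le> length (snd (g x))"
  let ?acc = "foldl (add_edge (fst (g x))) [] (take k (snd (g x)))"
  have a: "set ?acc \<subseteq> set (take k (snd (g x)))" "length ?acc \<le> length (take k (snd (g x)))"
   using add_edge_inv[of "fst (g x)" "take k (snd (g x))"] by (auto simp: Let_def)
  show "sz ?acc \<le> Suc (sz (snd (g x)) * Suc (sz (snd (g x))))"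
  proof (rule sz_list_le)
   show "length ?acc \<le> sz (snd (g x))" using a(2) length_less_sz[of "snd (g x)"] by simp
   fix e assume "e \<in> set ?acc"
   then have "e \<in> set (snd (g x))" using a(1) by (auto dest: in_set_takeD)
   then show "sz e \<le> sz (snd (g x))" using sz_mem less_imp_le by blast
  qed
 next
  have "pb (%x. sz (snd (g x)))" by (intro pb_PT pt g)
  then show "pb (%x. Suc (sz (snd (g x)) * Suc (sz (snd (g x)))))" by (intro pb_Suc pb_mult)
 qed (intro pt g)+
 then show ?thesis unfolding ecount_def by (rule PT_length)
qed

lemma PT_attach:
 assumes "PT s" "PT k" "PT g"
 shows "PT (%x. attach s (k x) (g x))"
 unfolding attach_def by (intro pt PT_comp[OF assms(1)] PT_comp[OF assms(2)] PT_comp[OF assms(3)] assms)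

text \<open>The same reduction serves both claims. For the lower bound \<open>L\<close> is a
  constant, and what matters is that the parameter is linear in
  \<open>n + length \<phi>\<close>.\<close>

definition hard_red :: "'a graph => (nat \<times> nat \<times> clause list => ngraph \<times> nat) => bool" where
 "hard_red T R \<longleftrightarrow> PT R &
   (\<forall>n L \<phi>. valid n L \<phi> --> (satisfiable \<phi> \<longleftrightarrow> edge_deletable T (gr (fst (R (n, L, \<phi>)))) (snd (R (n, L, \<phi>))))) &
   (\<exists>c. \<forall>n L \<phi>. valid n L \<phi> --> snd (R (n, L, \<phi>)) \<le> c * (L + 1) * (n + length \<phi> + 1))"

text \<open>A copy of \<open>T\<close> itself with nothing to delete.\<close>

lemma (in tree) no_instance: "\<exists>g :: ngraph. \<not> edge_deletable T (gr g) 0"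
proof -
 obtain vs where vs: "set vs = verts T" using finite_list[OF fin] by blast
 obtain ix :: "'a => nat" where ix: "inj_on ix (verts T)" using finite_imp_inj_to_nat_seg[OF fin] by blast
 define g :: ngraph where "g = (map (%u. [ix u]) vs,
  concat (map (%u. map (%v. ([ix u], [ix v])) (filter (adj T u) vs)) vs))"
 have V: "set (fst g) = (%u. [ix u]) ` verts T" by (simp add: g_def vs)
 have E: "set (snd g) = {([ix u], [ix v]) | u v. adj T u v}" using adjD by (auto simp: g_def vs)
 have "embeds T (gr g) (%u. [ix u])"
  unfolding embeds_def
 proof (intro conjI ballI)
  show "inj_on (%u. [ix u]) (verts T)" using ix by (auto simp: inj_on_def)
  show "(%u. [ix u]) ` verts T \<subseteq> verts (gr g)" by (simp add: V)
  fix u v assume uv: "u \<in> verts T" "v \<in> verts T"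
  have i: "ix a = ix b \<longleftrightarrow> a = b" if "a \<in> verts T" "b \<in> verts T" for a b
   using ix that by (auto simp: inj_on_def)
  show "adj T u v \<longleftrightarrow> adj (gr g) [ix u] [ix v]"
  proof
   assume "adj T u v"
   then show "adj (gr g) [ix u] [ix v]" unfolding adj_gr V E using uv i adjD by auto
  next
   assume "adj (gr g) [ix u] [ix v]"
   then obtain a b where ab: "adj T a b" "ix u = ix a & ix v = ix b \<or> ix v = ix a & ix u = ix b"
    unfolding adj_gr E by auto
   then have "u = a & v = b \<or> v = a & u = b" using i uv adjD[OF ab(1)] by blast
   then show "adj T u v" using ab(1) adj_sym by metis
  qed
 qed
 moreover have "edge_deletable T (gr g) 0 ==> induced_free T (gr g)"
 proof -
  assume "edge_deletable T (gr g) 0"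
  then obtain F where F: "F \<subseteq> edges (gr g)" "card F \<le> 0" "induced_free T (delete_edges (gr g) F)"
   unfolding edge_deletable_def by blast
  then have "F = {}" using finite_edges[OF simple_gr[of g]] finite_subset by fastforce
  then show ?thesis using F(3) by (simp add: delete_edges_def gr_def)
 qed
 ultimately show ?thesis using induced_free_iff by blast
qed

text \<open>Keeping at least \<open>Q\<close> edges means deleting at most
  \<open>ecount - Q\<close>, which becomes the parameter.\<close>

lemma (in tree) gadget_hard:
 fixes g :: "nat \<times> nat \<times> clause list => ngraph"
 assumes g: "PT g" and Q: "PT Q" and s: "PT s"
  and sat: "\<And>n L \<phi>. valid n L \<phi> ==> satisfiable \<phi> ==> \<exists>F \<subseteq> edges (gr (g (n, L, \<phi>))).
   Q (n, L, \<phi>) \<le> card (edges (gr (g (n, L, \<phi>))) - F) & (\<nexists>W f. leaf_emb T s (delete_edges (gr (g (n, L, \<phi>))) F) W f)"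
  and unsat: "\<And>n L \<phi> F. valid n L \<phi> ==> F \<subseteq> edges (gr (g (n, L, \<phi>))) ==>
   Q (n, L, \<phi>) \<le> card (edges (gr (g (n, L, \<phi>))) - F) ==>
   \<nexists>W f. leaf_emb T s (delete_edges (gr (g (n, L, \<phi>))) F) W f ==> satisfiable \<phi>"
  and len: "\<And>n L \<phi>. valid n L \<phi> ==> length (snd (g (n, L, \<phi>))) \<le> c * (L + 1) * (n + length \<phi> + 1)"
 shows "\<exists>R. hard_red T R"
proof -
 obtain g0 :: ngraph where g0: "\<not> edge_deletable T (gr g0) 0" using no_instance by blast
 \<comment> \<open>If the gadget has fewer than \<open>Q\<close> edges, the subtraction would
   truncate to 0. The formula is unsatisfiable in this case, so a fixed negative instance is
   returned.\<close>
 define R where "R x = (if ecount (g x) < Q x then (g0, 0) else (attach s (ecount (g x) - Q x) (g x), ecount (g x) - Q x))" for x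
 have "PT R" unfolding R_def by (intro pt g Q PT_attach s)
 moreover have "satisfiable \<phi> \<longleftrightarrow> edge_deletable T (gr (fst (R (n, L, \<phi>)))) (snd (R (n, L, \<phi>)))"
  if v: "valid n L \<phi>" for n L \<phi>
 proof -
  let ?x = "(n, L, \<phi>)"
  let ?G = "gr (g ?x)"
  have fin: "finite (edges ?G)" by (rule finite_edges[OF simple_gr])
  have c: "card (edges ?G - F) = card (edges ?G) - card F & card F \<le> card (edges ?G)" if "F \<subseteq> edges ?G" for F
   using that fin by (simp add: card_Diff_subset card_mono finite_subset)
  show ?thesis
  proof (cases "ecount (g ?x) < Q ?x")
   case True
   have "\<not> satisfiable \<phi>"
   proof
    assume "satisfiable \<phi>"
    then obtain F where "F \<subseteq> edges ?G" "Q ?x \<le> card (edges ?G - F)" using sat[OF v] by blast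
    then show False using True c by (auto simp: ecount)
   qed
   then show ?thesis using True g0 by (simp add: R_def)
  next
   case False
   have "edge_deletable T (gr (attach s (ecount (g ?x) - Q ?x) (g ?x))) (ecount (g ?x) - Q ?x) \<longleftrightarrow> satisfiable \<phi>"
    unfolding attach_tree
   proof
    assume "\<exists>F\<subseteq>edges ?G. card F \<le> ecount (g ?x) - Q ?x & (\<nexists>W f. leaf_emb T s (delete_edges ?G F) W f)"
    then obtain F where F: "F \<subseteq> edges ?G" "card F \<le> ecount (g ?x) - Q ?x"
     "\<nexists>W f. leaf_emb T s (delete_edges ?G F) W f" by blast
    have "Q ?x \<le> card (edges ?G - F)" using F(2) False c[OF F(1)] by (auto simp: ecount)
    then show "satisfiable \<phi>" by (rule unsat[OF v F(1) _ F(3)])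
   next
    assume "satisfiable \<phi>"
    then obtain F where F: "F \<subseteq> edges ?G" "Q ?x \<le> card (edges ?G - F)"
     "\<nexists>W f. leaf_emb T s (delete_edges ?G F) W f" using sat[OF v] by blast
    have "card F \<le> ecount (g ?x) - Q ?x" using F(2) False c[OF F(1)] by (auto simp: ecount)
    then show "\<exists>F\<subseteq>edges ?G. card F \<le> ecount (g ?x) - Q ?x & (\<nexists>W f. leaf_emb T s (delete_edges ?G F) W f)"
     using F by blast
   qed
   then show ?thesis using False by (simp add: R_def)
  qed
 qed
 moreover have "snd (R (n, L, \<phi>)) \<le> c * (L + 1) * (n + length \<phi> + 1)" if v: "valid n L \<phi>" for n L \<phi>
 proof -
  have "snd (R (n, L, \<phi>)) \<le> ecount (g (n, L, \<phi>))" by (simp add: R_def)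
  also have "\<dots> \<le> length (snd (g (n, L, \<phi>)))" by (rule ecount_le)
  also have "\<dots> \<le> c * (L + 1) * (n + length \<phi> + 1)" by (rule len[OF v])
  finally show ?thesis .
 qed
 ultimately have "hard_red T R" unfolding hard_red_def by blast
 then show ?thesis by blast
qed

lemma length_concat_map_le:
 "(\<And>x. x \<in> set xs ==> length (f x) \<le> b) ==> length (concat (map f xs)) \<le> length xs * b"
 by (induction xs) (auto intro: add_mono)

lemma PT_wheel: "PT (%x. wheel (fst x) (fst (snd x)) (snd (snd x)))"
 unfolding wheel_def slot_def occ_def nx_def by (intro pt)

lemma PT_lab_graph: "PT (%x. lab_graph (fst x) (fst (snd x)) (snd (snd x)))"
 unfolding lab_graph_def ltip_def by (intro pt)

lemma length_wheel:
 assumes "valid n L \<phi>"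
 shows "length (snd (wheel n L \<phi>)) \<le> 7 * (L + 1) * (n + length \<phi> + 1)"
proof -
 have "length (snd (wheel n L \<phi>)) \<le> n * (2 * L * 3) + length \<phi> * Suc (3 * 2)"
  unfolding wheel_def snd_conv length_append
 proof (rule add_mono; rule order_trans[OF length_concat_map_le])
  show "length (concat (map (%j. [([0, x, j], [0, x, nx L j]), ([1, x, j], [0, x, j]), ([1, x, j], [0, x, nx L j])])
   [0..<2 * L])) \<le> 2 * L * 3" for x
   by (rule order_trans[OF length_concat_map_le[where b = 3]]) auto
  fix c assume "c \<in> set [0..<length \<phi>]"
  then have "length (\<phi> ! c) \<le> 3" "c < length \<phi>" using assms by (auto simp: valid_def)
  then show "length (([2, c], [3, c]) # concat (map (%l. [([2, c], slot \<phi> c l), ([3, c], slot \<phi> c l)])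
   (nth_def0 [] \<phi> c))) \<le> Suc (3 * 2)"
   using length_concat_map_le[of "\<phi> ! c" "%l. [([2, c], slot \<phi> c l), ([3, c], slot \<phi> c l)]" 2] by simp
 qed auto
 also have "\<dots> \<le> 7 * (L + 1) * (n + length \<phi> + 1)" by (simp add: algebra_simps)
 finally show ?thesis .
qed

lemma length_lab_graph:
 assumes "valid n L \<phi>"
 shows "length (snd (lab_graph n L \<phi>)) \<le> 6 * (L + 1) * (n + length \<phi> + 1)"
proof -
 have "length (snd (lab_graph n L \<phi>)) \<le> n * Suc (Suc (L * 3)) + length \<phi> * (3 * 2)"
  unfolding lab_graph_def snd_conv length_append
 proof (rule add_mono; rule order_trans[OF length_concat_map_le])
  show "length (([1, x], [0, x, 0]) # ([1, x], [0, x, 1]) # concat (map (%i.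
    [([2, x, i], [0, x, 0]), ([2, x, i], [0, x, 1]), ([2, x, i], [1, x])]) [0..<L])) \<le> Suc (Suc (L * 3))" for x
   using length_concat_map_le[of "[0..<L]" "%i. [([2, x, i], [0, x, 0]), ([2, x, i], [0, x, 1]), ([2, x, i], [1, x])]" 3] by simp
  fix c assume "c \<in> set [0..<length \<phi>]"
  then have "length (\<phi> ! c) \<le> 3" "c < length \<phi>" using assms by (auto simp: valid_def)
  then show "length (concat (map (%l. [([3, c], ltip l), ([3, c], [1, fst l])]) (nth_def0 [] \<phi> c))) \<le> 3 * 2"
   using length_concat_map_le[of "\<phi> ! c" "%l. [([3, c], ltip l), ([3, c], [1, fst l])]" 2] by simp
 qed auto
 also have "\<dots> \<le> 6 * (L + 1) * (n + length \<phi> + 1)" by (simp add: algebra_simps)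
 finally show ?thesis .
qed

context tree
begin

lemma star_hard:
 assumes z: "inner T = {z}"
 shows "\<exists>R. hard_red T R"
proof (rule gadget_hard[where s = "%_. card {u. adj T z u} - 2", OF PT_wheel])
 show "PT (%x :: nat \<times> nat \<times> clause list. 3 * fst x * fst (snd x) + 3 * length (snd (snd x)))" by (intro pt)
 show "PT (%_ :: name. card {u. adj T z u} - 2)" by (rule PT_const)
 have le: "(\<exists>W f. leaf_emb T (%_. card {u. adj T z u} - 2) (delete_edges (gr g) F) W f) \<longleftrightarrow>
  (\<exists>u v w. u ~= w & adj (delete_edges (gr g) F) u v & adj (delete_edges (gr g) F) v w & \<not> adj (delete_edges (gr g) F) u w)"
  for g :: ngraph and F
  by (rule leaf_emb_star[OF z]) (use simple_gr[of g] in \<open>auto simp: simple_graph_def delete_edges_def\<close>)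
 fix n L \<phi>
 assume "valid n L \<phi>"
 then interpret wheel_gadget n L \<phi> "gr (wheel n L \<phi>)" by unfold_locales simp_all
 let ?g = "wheel (fst (n, L, \<phi>)) (fst (snd (n, L, \<phi>))) (snd (snd (n, L, \<phi>)))"
 let ?Q = "3 * fst (n, L, \<phi>) * fst (snd (n, L, \<phi>)) + 3 * length (snd (snd (n, L, \<phi>)))"
 show "\<exists>F\<subseteq>edges (gr ?g). ?Q \<le> card (edges (gr ?g) - F) &
   (\<nexists>W f. leaf_emb T (%_. card {u. adj T z u} - 2) (delete_edges (gr ?g) F) W f)" if "satisfiable \<phi>"
  using sat_imp_cluster[OF that] unfolding le by (simp; blast)
 show "satisfiable \<phi>" if "F \<subseteq> edges (gr ?g)" "?Q \<le> card (edges (gr ?g) - F)"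
  "\<nexists>W f. leaf_emb T (%_. card {u. adj T z u} - 2) (delete_edges (gr ?g) F) W f" for F
  using cluster_imp_sat[of F] that unfolding le by (simp; blast)
 show "length (snd ?g) \<le> 7 * (L + 1) * (n + length \<phi> + 1)" using length_wheel[OF \<open>valid n L \<phi>\<close>] by simp
qed

lemma dstar_hard:
 assumes xy: "inner T = {x, y}" "x ~= y" "card {u. adj T x u} \<le> card {u. adj T y u}"
 shows "\<exists>R. hard_red T R"
proof -
 define s where "s v = (if tip v then card {u. adj T y u} - 1 else card {u. adj T x u} - 2)" for v
 show ?thesis
 proof (rule gadget_hard[where s = s, OF PT_lab_graph])
  show "PT (%x :: nat \<times> nat \<times> clause list. fst x * (1 + 2 * fst (snd x)) + 2 * length (snd (snd x)))" by (intro pt)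
  show "PT s" unfolding s_def tip_def by (intro pt)
  fix n L \<phi>
  assume v: "valid n L \<phi>"
  then interpret lab_gadget n L \<phi> "gr (lab_graph n L \<phi>)" by unfold_locales simp_all
  let ?g = "lab_graph (fst (n, L, \<phi>)) (fst (snd (n, L, \<phi>))) (snd (snd (n, L, \<phi>)))"
  let ?Q = "fst (n, L, \<phi>) * (1 + 2 * fst (snd (n, L, \<phi>))) + 2 * length (snd (snd (n, L, \<phi>)))"
  show "\<exists>F\<subseteq>edges (gr ?g). ?Q \<le> card (edges (gr ?g) - F) &
    (\<nexists>W f. leaf_emb T s (delete_edges (gr ?g) F) W f)" if "satisfiable \<phi>"
  proof -
   obtain F where F: "F \<subseteq> edges (gr ?g)" "?Q \<le> card (edges (gr ?g) - F)"
    and D: "\<And>t v w. tip t ==> adj (delete_edges (gr ?g) F) t v ==> adj (delete_edges (gr ?g) F) v w ==> w ~= t ==>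
     adj (delete_edges (gr ?g) F) t w"
    and P4: "\<And>a b c d. adj (delete_edges (gr ?g) F) a b ==> adj (delete_edges (gr ?g) F) b c ==>
     adj (delete_edges (gr ?g) F) c d ==> \<not> adj (delete_edges (gr ?g) F) a c ==>
     \<not> adj (delete_edges (gr ?g) F) b d ==> a ~= c ==> b ~= d ==> a ~= d ==> False"
    using sat_imp_label[OF \<open>satisfiable \<phi>\<close>] unfolding fst_conv snd_conv by blast
   have "\<not> leaf_emb T s (delete_edges (gr ?g) F) W f" for W f
   proof (rule leaf_emb_dstar_free[OF xy, where tip = tip])
    show "s v = (if tip v then card {u. adj T y u} - 1 else card {u. adj T x u} - 2)" for v by (simp add: s_def)
    show "tip u ==> tip v ==> \<not> adj (delete_edges (gr ?g) F) u v" for u v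
     using tip_nonadj[of u v] by (simp add: adj_delete)
   qed (use D P4 in blast)+
   then show ?thesis using F by blast
  qed
  show "satisfiable \<phi>" if F: "F \<subseteq> edges (gr ?g)" "?Q \<le> card (edges (gr ?g) - F)"
   "\<nexists>W f. leaf_emb T s (delete_edges (gr ?g) F) W f" for F
  proof (rule label_imp_sat[of F])
   show "adj (delete_edges (gr (lab_graph n L \<phi>)) F) t w"
    if t: "tip t" "adj (delete_edges (gr (lab_graph n L \<phi>)) F) t v" "adj (delete_edges (gr (lab_graph n L \<phi>)) F) v w" "w ~= t" for t v w
   proof (rule ccontr)
    assume n: "\<not> ?thesis"
    have K: "simple_graph (delete_edges (gr (lab_graph n L \<phi>)) F)"
     using simple_gr[of "lab_graph n L \<phi>"] by (auto simp: simple_graph_def delete_edges_def)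
    have "\<exists>W f. leaf_emb T s (delete_edges (gr (lab_graph n L \<phi>)) F) W f"
     by (rule leaf_emb_dstar_if[OF xy K, of s tip t w v]) (use t n in \<open>auto simp: s_def\<close>)
    then show False using F(3) by simp
   qed
  qed (use F in simp_all)
  show "length (snd ?g) \<le> 6 * (L + 1) * (n + length \<phi> + 1)" using length_lab_graph[OF v] by simp
 qed
qed

text \<open>The parameter is passed on unchanged, so its linear bound survives any number of
  strippings.\<close>

lemma strip_hard:
 assumes "hard_red (induced T (inner T)) R"
 shows "\<exists>R. hard_red T R"
proof -
 define R' where "R' x = (attach (%_. card (verts T)) (snd (R x)) (fst (R x)), snd (R x))" for x
 have R: "PT R" using assms by (simp add: hard_red_def)
 have "PT R'" unfolding R'_def by (intro pt PT_attach R)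
 moreover have "edge_deletable T (gr (fst (R' x))) (snd (R' x)) \<longleftrightarrow>
   edge_deletable (induced T (inner T)) (gr (fst (R x))) (snd (R x))" for x
  unfolding R'_def fst_conv snd_conv attach_tree leaf_emb_strip
  by (simp add: edge_deletable_def)
 moreover have "snd (R' x) = snd (R x)" for x by (simp add: R'_def)
 ultimately have "hard_red T R'" using assms unfolding hard_red_def by simp
 then show ?thesis by blast
qed

end

text \<open>With three inner vertices the inner tree again has two edges, and it is smaller because
  every tree has a leaf. One inner vertex means a star, two a double star.\<close>

theorem tree_hard:
 assumes "is_tree T" "2 \<le> card (edges T)"
 shows "\<exists>R. hard_red T R"
 using assms
proof (induction "card (verts T)" arbitrary: T rule: less_induct)
 case less
 interpret tree T using less.prems by unfold_locales
 consider "card (inner T) = 1" | "card (inner T) = 2" | "3 \<le> card (inner T)"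
  using inner_nonempty finite_inner by (metis One_nat_def Suc_1 card_0_eq eval_nat_numeral(3) less_2_cases not_less_eq_eq less_Suc_eq_le nat_less_le)
 then show ?case
 proof cases
  case 1
  then show ?thesis using star_hard by (metis card_1_singletonE)
 next
  case 2
  then obtain x y where xy: "inner T = {x, y}" "x ~= y" by (metis card_2_iff)
  show ?thesis
  proof (cases "card {u. adj T x u} \<le> card {u. adj T y u}")
   case True
   then show ?thesis using dstar_hard[OF xy] by blast
  next
   case False
   then show ?thesis using dstar_hard[of y x] xy by (simp add: insert_commute)
  qed
 next
  case 3
  have "card (verts (induced T (inner T))) < card (verts T)"
   using inner_psubset fin by (simp add: induced_def psubset_card_mono)
  then obtain R where "hard_red (induced T (inner T)) R"
   using less.hyps strip_tree strip_edges[OF 3] by blast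
  then show ?thesis by (rule strip_hard)
 qed
qed

section \<open>Membership in NP\<close>

lemma edge_deletable_iso:
 assumes f: "bij_betw f (verts G) (verts H)" and G: "simple_graph G" and H: "simple_graph H"
  and adj: "\<And>u v. u \<in> verts G ==> v \<in> verts G ==> adj G u v \<longleftrightarrow> adj H (f u) (f v)"
  and d: "edge_deletable T G k"
 shows "edge_deletable T H k"
proof -
 obtain F where F: "F \<subseteq> edges G" "card F \<le> k" "induced_free T (delete_edges G F)"
  using d unfolding edge_deletable_def by blast
 have inj: "inj_on f (verts G)" and img: "f ` verts G = verts H" using f by (auto simp: bij_betw_def)
 have EG: "e \<in> edges G ==> e \<subseteq> verts G" for e using G by (auto simp: simple_graph_def)
 let ?F = "(`) f ` F"
 have "?F \<subseteq> edges H"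
 proof
  fix e assume "e \<in> ?F"
  then obtain d where d: "d \<in> F" "e = f ` d" by blast
  then obtain a b where ab: "d = {a, b}" using simple_edgeE[OF G] F(1) by (metis subsetD)
  then have "adj G a b" "a \<in> verts G" "b \<in> verts G" using d F(1) EG by (auto simp: adj_def)
  then have "adj H (f a) (f b)" using adj by blast
  then show "e \<in> edges H" using d ab by (simp add: adj_def)
 qed
 moreover have "card ?F \<le> k"
  using card_image_le[of F "(`) f"] F(1,2) finite_edges[OF G] finite_subset by (metis le_trans)
 moreover have "induced_free T (delete_edges H ?F)"
  unfolding induced_free_iff
 proof
  assume "\<exists>g. embeds T (delete_edges H ?F) g"
  then obtain g where g: "embeds T (delete_edges H ?F) g" by blast
  let ?i = "the_inv_into (verts G) f"
  have i: "?i y \<in> verts G & f (?i y) = y" if "y \<in> verts H" for y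
   using that img inj by (metis f_the_inv_into_f the_inv_into_into subset_refl)
  have gv: "g u \<in> verts H" if "u \<in> verts T" for u using g that by (auto simp: embeds_def)
  have "embeds T (delete_edges G F) (%u. ?i (g u))"
   unfolding embeds_def
  proof (intro conjI ballI)
   show "inj_on (%u. ?i (g u)) (verts T)"
   proof (rule inj_onI)
    fix x y assume "x \<in> verts T" "y \<in> verts T" "?i (g x) = ?i (g y)"
    then have "g x = g y" using i gv by metis
    then show "x = y" using g \<open>x \<in> verts T\<close> \<open>y \<in> verts T\<close> by (auto simp: embeds_def inj_on_def)
   qed
   show "(%u. ?i (g u)) ` verts T \<subseteq> verts (delete_edges G F)" using i gv by auto
   fix u v assume uv: "u \<in> verts T" "v \<in> verts T"
   let ?a = "?i (g u)" and ?b = "?i (g v)"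
   have ab: "?a \<in> verts G" "?b \<in> verts G" "f ?a = g u" "f ?b = g v" using i gv uv by auto
   have "f ` {?a, ?b} \<in> ?F \<longleftrightarrow> {?a, ?b} \<in> F"
   proof
    assume "f ` {?a, ?b} \<in> ?F"
    then obtain d where d: "d \<in> F" "f ` {?a, ?b} = f ` d" by blast
    then have "{?a, ?b} = d" using inj_on_image_eq_iff[OF inj, of "{?a, ?b}" d] ab EG F(1) by blast
    then show "{?a, ?b} \<in> F" using d by simp
   qed blast
   then have "{g u, g v} \<in> ?F \<longleftrightarrow> {?a, ?b} \<in> F" using ab by simp
   then have "adj (delete_edges H ?F) (g u) (g v) \<longleftrightarrow> adj (delete_edges G F) ?a ?b"
    using adj[OF ab(1,2)] ab by (simp add: adj_delete)
   then show "adj T u v \<longleftrightarrow> adj (delete_edges G F) ?a ?b"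
    using g uv by (simp add: embeds_def)
  qed
  then show False using F(3) induced_free_iff by blast
 qed
 ultimately show ?thesis unfolding edge_deletable_def by blast
qed

definition uniq :: "'a list => 'a list" where
 "uniq xs = foldl (%acc v. if v \<in> set acc then acc else v # acc) [] xs"

lemma uniq: "set (uniq xs) = set xs" "distinct (uniq xs)" "length (uniq xs) \<le> length xs"
 unfolding uniq_def by (induction xs rule: rev_induct) auto

lemma PT_uniq [pt]: "PT l ==> PT (%x. uniq (l x))"
proof -
 assume l: "PT l"
 show ?thesis unfolding uniq_def
 proof (rule PT_foldl[where B = "%x. Suc (sz (l x) * Suc (sz (l x)))"])
  show "PT (%p :: 'a \<times> 'b list \<times> 'b. if snd (snd p) \<in> set (fst (snd p)) then fst (snd p) else snd (snd p) # fst (snd p))"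
   by (intro pt)
  fix x k
  let ?u = "uniq (take k (l x))"
  have "sz ?u \<le> Suc (sz (l x) * Suc (sz (l x)))"
  proof (rule sz_list_le)
   show "length ?u \<le> sz (l x)" using uniq(3)[of "take k (l x)"] length_less_sz[of "l x"] by simp
   fix e assume "e \<in> set ?u"
   then have "e \<in> set (l x)" by (auto simp: uniq(1) dest: in_set_takeD)
   then show "sz e \<le> sz (l x)" using sz_mem less_imp_le by blast
  qed
  then show "sz (foldl (%acc v. if v \<in> set acc then acc else v # acc) [] (take k (l x))) \<le> Suc (sz (l x) * Suc (sz (l x)))"
   by (simp add: uniq_def)
 next
  have "pb (%x. sz (l x))" by (intro pb_PT l)
  then show "pb (%x. Suc (sz (l x) * Suc (sz (l x))))" by (intro pb_Suc pb_mult)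
 qed (intro pt l)+
qed

section \<open>Numerals, pairs and lists of numbers as words\<close>

definition half_step :: "nat \<times> bool list => nat \<times> bool list" where
 "half_step s = (if fst s = 0 then s else (fst s div 2, snd s @ [True, odd (fst s)]))"

text \<open>Numbers are unary, so halving amounts to counting up with a counter that advances at
  every other step.\<close>

lemma half_conv:
 "((%p :: nat \<times> bool. if snd p then (Suc (fst p), False) else (fst p, True)) ^^ n) (0, False) = (n div 2, odd n)"
 by (induction n) auto

lemma PT_half: "PT f ==> PT (%x. (f x div 2 :: nat, odd (f x)))"
proof -
 assume f: "PT f"
 have "PT (%x. ((%p :: nat \<times> bool. if snd p then (Suc (fst p), False) else (fst p, True)) ^^ f x) (0, False))"
 proof (rule PT_funpow[OF f])
  show "PT (%p :: 'a \<times> nat \<times> bool. if snd (snd p) then (Suc (fst (snd p)), False) else (fst (snd p), True))"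
   by (intro pt)
  show "sz (((%p :: nat \<times> bool. if snd p then (Suc (fst p), False) else (fst p, True)) ^^ k) (0, False)) \<le> 5 + 2 * sz (f x)"
   if "k \<le> f x" for x k unfolding half_conv using that by (auto simp: venc_bool_def)
 qed (intro pt pb_add pb_mult pb_const pb_PT f)+
 then show ?thesis by (simp add: half_conv)
qed

lemma PT_div2 [pt]: "PT f ==> PT (%x. f x div 2 :: nat)"
 using PT_fst[OF PT_half, of f] by simp

lemma PT_odd [pt]: "PT f ==> PT (%x. odd (f x :: nat))"
 using PT_snd[OF PT_half, of f] by simp

text \<open>Digits emitted so far, followed by the code of the rest, always give the code of
  \<open>n\<close>. The rest drops by at least one per round, so \<open>n\<close> rounds are
  enough.\<close>

lemma half_step_inv:
 "let s = (half_step ^^ k) (n, []) in snd s @ enc_nat (fst s) = enc_nat n & fst s \<le> n - k"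
proof (induction k)
 case (Suc k)
 obtain m bs where s: "(half_step ^^ k) (n, []) = (m, bs)" by (cases "(half_step ^^ k) (n, [])")
 then have s': "(half_step ^^ Suc k) (n, []) = half_step (m, bs)" by simp
 have IH: "bs @ enc_nat m = enc_nat n" "m \<le> n - k" using Suc by (auto simp: s Let_def)
 show ?case
 proof (cases "m = 0")
  case False
  have "m div 2 \<le> n - Suc k" using IH(2) False by linarith
  then show ?thesis using IH(1) False enc_nat.simps[of m] unfolding s' by (simp add: Let_def half_step_def)
 next
  case True
  then show ?thesis using IH unfolding s' by (simp add: Let_def half_step_def)
 qed
qed simp

lemma enc_nat_0 [simp]: "enc_nat 0 = [False]"
 by (simp add: enc_nat.simps)

lemma length_half_step: "length (snd ((half_step ^^ k) (n, []))) = 2 * k \<or>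
  length (snd ((half_step ^^ k) (n, []))) \<le> 2 * k"
 by (induction k) (auto simp: half_step_def)

lemma sz_bools: "sz (bs :: bool list) \<le> 4 * length bs + 1"
 by (induction bs) (auto simp: venc_bool_def)

lemma PT_enc_nat [pt]: "PT f ==> PT (%x. enc_nat (f x))"
proof -
 assume f: "PT f"
 have "PT (%x. (half_step ^^ f x) (f x, []))"
 proof (rule PT_funpow[OF f])
  show "PT (%p :: 'a \<times> nat \<times> bool list. half_step (snd p))" unfolding half_step_def by (intro pt)
  fix x k assume k: "k \<le> f x"
  let ?s = "(half_step ^^ k) (f x, [])"
  have "fst ?s \<le> f x - k" using half_step_inv[of k "f x"] by (simp add: Let_def)
  then have "fst ?s \<le> f x" by simp
  moreover have "length (snd ?s) \<le> 2 * f x" using length_half_step[of k "f x"] k by auto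
  ultimately show "sz ?s \<le> 10 * sz (f x) + 10"
   using sz_bools[of "snd ?s"] by (simp add: venc_prod_def)
 qed (intro pt f pb_add pb_mult pb_const pb_PT)+
 then have "PT (%x. snd ((half_step ^^ f x) (f x, [])) @ [False])" by (intro pt)
 moreover have "snd ((half_step ^^ n) (n, [])) @ [False] = enc_nat n" for n
  using half_step_inv[of n n] by (cases "(half_step ^^ n) (n, [])") (simp add: Let_def)
 ultimately show ?thesis by simp
qed

definition number :: "ngraph => nat graph" where
 "number g = (let ws = uniq (fst g) in
   \<lparr>verts = {..<length ws}, edges = {{i, j} | i j. i < length ws & j < length ws & adj (gr g) (ws ! i) (ws ! j)}\<rparr>)"

lemma adj_number:
 "i < length (uniq (fst g)) ==> j < length (uniq (fst g)) ==>
   adj (number g) i j \<longleftrightarrow> adj (gr g) (uniq (fst g) ! i) (uniq (fst g) ! j)"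
 unfolding number_def Let_def adj_def[of "\<lparr>verts = _, edges = _\<rparr>"] by (auto simp: doubleton_eq_iff adj_sym)

lemma numbered: "numbered_graph (number g)"
proof -
 have "card e = 2 & e \<subseteq> verts (number g)" if e: "e \<in> edges (number g)" for e
 proof -
  obtain i j where ij: "e = {i, j}" "i < length (uniq (fst g))" "j < length (uniq (fst g))"
   "adj (gr g) (uniq (fst g) ! i) (uniq (fst g) ! j)" using e by (auto simp: number_def Let_def)
  then have "i ~= j" by (auto simp: adj_gr)
  then show ?thesis using ij by (auto simp: number_def Let_def)
 qed
 then show ?thesis unfolding numbered_graph_def simple_graph_def by (auto simp: number_def Let_def)
qed

lemma number_deletable: "edge_deletable T (number g) k \<longleftrightarrow> edge_deletable T (gr g) k"
proof -
 let ?ws = "uniq (fst g)"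
 have v: "verts (number g) = {..<length ?ws}" by (simp add: number_def Let_def)
 have b: "bij_betw (%i. ?ws ! i) (verts (number g)) (verts (gr g))"
  unfolding v using bij_betw_nth[OF uniq(2), of "{..<length ?ws}" "fst g" "set (fst g)"] by (simp add: uniq(1))
 have sn: "simple_graph (number g)" using numbered by (simp add: numbered_graph_def)
 have a: "adj (number g) i j \<longleftrightarrow> adj (gr g) (?ws ! i) (?ws ! j)" if "i \<in> verts (number g)" "j \<in> verts (number g)" for i j
  using adj_number that by (simp add: v)
 show ?thesis
 proof
  show "edge_deletable T (number g) k ==> edge_deletable T (gr g) k"
   by (rule edge_deletable_iso[OF b sn simple_gr a])
  let ?i = "the_inv_into (verts (number g)) (%i. ?ws ! i)"
  have bi: "bij_betw ?i (verts (gr g)) (verts (number g))" by (rule bij_betw_the_inv_into[OF b])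
  show "edge_deletable T (gr g) k ==> edge_deletable T (number g) k"
  proof (rule edge_deletable_iso[OF bi simple_gr sn])
   fix u v assume uv: "u \<in> verts (gr g)" "v \<in> verts (gr g)"
   have i: "?i u \<in> verts (number g)" "?i v \<in> verts (number g)" using bij_betw_apply[OF bi] uv by auto
   have w: "?ws ! ?i u = u" "?ws ! ?i v = v" using f_the_inv_into_f_bij_betw[OF b] uv by auto
   show "adj (gr g) u v \<longleftrightarrow> adj (number g) (?i u) (?i v)" using a[OF i] unfolding w by simp
  qed
 qed
qed

definition enc_ngraph :: "ngraph \<times> nat => bool list" where
 "enc_ngraph r = enc_instance (number (fst r)) (snd r)"

lemma PT_enc_ngraph [pt]: "PT r ==> PT (%x. enc_ngraph (r x))"
proof -
 assume r: "PT r"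
 have "enc_ngraph q = (let ws = uniq (fst (fst q)) in enc_nat (length ws) @
   concat (map (%i. map (%j. (let u = nth_def0 [] ws i; v = nth_def0 [] ws j in
     u ~= v & ((u, v) \<in> set (snd (fst q)) \<or> (v, u) \<in> set (snd (fst q))))) [0..<length ws]) [0..<length ws]) @
   enc_nat (snd q))" for q
 proof -
  let ?ws = "uniq (fst (fst q))"
  have c: "card (verts (number (fst q))) = length ?ws" by (simp add: number_def Let_def)
  have "adj (number (fst q)) i j = (?ws ! i ~= ?ws ! j & ((?ws ! i, ?ws ! j) \<in> set (snd (fst q)) \<or>
    (?ws ! j, ?ws ! i) \<in> set (snd (fst q))))" if "i < length ?ws" "j < length ?ws" for i j
   using adj_number[OF that] that nth_mem[of i ?ws] nth_mem[of j ?ws] by (auto simp: adj_gr uniq(1))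
  then show ?thesis unfolding enc_ngraph_def enc_instance_def enc_graph_def c
   by (auto simp: Let_def intro!: arg_cong[where f = concat])
 qed
 then have e: "enc_ngraph = (%q. let ws = uniq (fst (fst q)) in enc_nat (length ws) @
   concat (map (%i. map (%j. (let u = nth_def0 [] ws i; v = nth_def0 [] ws j in
     u ~= v & ((u, v) \<in> set (snd (fst q)) \<or> (v, u) \<in> set (snd (fst q))))) [0..<length ws]) [0..<length ws]) @
   enc_nat (snd q))" by blast
 have "PT enc_ngraph" unfolding e by (intro pt)
 then show ?thesis using PT_comp r by blast
qed

lemma enc_ngraph_mem: "enc_ngraph (g, k) \<in> free_edge_deletion T \<longleftrightarrow> edge_deletable T (gr g) k"
proof
 assume "enc_ngraph (g, k) \<in> free_edge_deletion T"
 then obtain G l where "enc_instance (number g) k = enc_instance G l" "numbered_graph G" "edge_deletable T G l"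
  by (auto simp: free_edge_deletion_def enc_ngraph_def)
 then have "edge_deletable T (number g) k" using enc_instance_inject[OF numbered] by metis
 then show "edge_deletable T (gr g) k" by (simp add: number_deletable)
next
 assume "edge_deletable T (gr g) k"
 then have "edge_deletable T (number g) k" by (simp add: number_deletable)
 then show "enc_ngraph (g, k) \<in> free_edge_deletion T"
  using numbered[of g] unfolding free_edge_deletion_def enc_ngraph_def fst_conv snd_conv by blast
qed

text \<open>State 0 expects a marker, state 1 a bit of the first word, and state 2 is inside the
  second word.\<close>

definition dec_step :: "nat \<times> bool list \<times> bool list => bool => nat \<times> bool list \<times> bool list" where
 "dec_step s b = (if fst s = 0 then (if b then 1 else 2, snd s)
   else if fst s = 1 then (0, b # fst (snd s), snd (snd s))
   else (fst s, fst (snd s), b # snd (snd s)))"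

definition dec_pair :: "bool list => bool list \<times> bool list" where
 "dec_pair z = (let s = foldl dec_step (0, [], []) z in (rev (fst (snd s)), rev (snd (snd s))))"

lemma dec_pair: "dec_pair (enc_pair x w) = (x, w)"
proof -
 have 1: "foldl dec_step (0, y, []) (concat (map (%b. [True, b]) x)) = (0, rev x @ y, [])" for y
  by (induction x arbitrary: y) (auto simp: dec_step_def)
 have 2: "foldl dec_step (2, y, v) w = (2, y, rev w @ v)" for y v
  by (induction w arbitrary: v) (auto simp: dec_step_def)
 show ?thesis using 2 by (simp add: dec_pair_def enc_pair_def 1) (simp add: dec_step_def)
qed

lemma PT_dec_pair [pt]: "PT f ==> PT (%x. dec_pair (f x))"
proof -
 assume f: "PT f"
 have len: "length (fst (snd s)) + length (snd (snd s)) \<le> length z & fst s \<le> 2"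
  if "s = foldl dec_step (0, [], []) z" for s z
  using that by (induction z arbitrary: s rule: rev_induct) (auto simp: dec_step_def Let_def)
 have "PT (%x. foldl dec_step (0, [], []) (f x))"
 proof (rule PT_foldl[where B = "%x. 4 * sz (f x) + 20"])
  show "PT (%p :: 'a \<times> (nat \<times> bool list \<times> bool list) \<times> bool. dec_step (fst (snd p)) (snd (snd p)))"
   unfolding dec_step_def by (intro pt)
  fix x k
  let ?s = "foldl dec_step (0, [], []) (take k (f x))"
  have "length (fst (snd ?s)) + length (snd (snd ?s)) \<le> length (f x) & fst ?s \<le> 2"
   using len[OF refl, of "take k (f x)"] by simp
  then show "sz ?s \<le> 4 * sz (f x) + 20"
   using sz_bools[of "fst (snd ?s)"] sz_bools[of "snd (snd ?s)"] length_less_sz[of "f x"]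
   by (simp add: venc_prod_def)
 qed (intro pt f pb_add pb_mult pb_const pb_PT)+
 then show ?thesis unfolding dec_pair_def by (intro pt)
qed

definition nats_step :: "nat \<times> nat list => bool => nat \<times> nat list" where
 "nats_step s b = (if b then (Suc (fst s), snd s) else (0, fst s # snd s))"

definition nats :: "bool list => nat list" where
 "nats w = rev (snd (foldl nats_step (0, []) w))"

definition unats :: "nat list => bool list" where
 "unats ns = concat (map (%m. replicate m True @ [False]) ns)"

lemma nats_unats: "nats (unats ns) = ns"
proof -
 have 1: "foldl nats_step (c, y) (replicate m True) = (c + m, y)" for c y m
  by (induction m arbitrary: c) (auto simp: nats_step_def)
 have "foldl nats_step (0, y) (unats ns) = (0, rev ns @ y)" for y
  by (induction ns arbitrary: y) (auto simp: unats_def 1 nats_step_def)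
 then show ?thesis by (simp add: nats_def)
qed

lemma PT_nats [pt]: "PT f ==> PT (%x. nats (f x))"
proof -
 assume f: "PT f"
 have b: "sz s \<le> 4 * length z + 3" if "s = foldl nats_step (0, []) z" for s z
 proof -
  have "2 * fst s + sz (snd s) \<le> 2 * length z + 1 + length z" using that
   by (induction z arbitrary: s rule: rev_induct) (auto simp: nats_step_def Let_def)
  then show ?thesis by (simp add: venc_prod_def)
 qed
 have "PT (%x. foldl nats_step (0, []) (f x))"
 proof (rule PT_foldl[where B = "%x. 4 * sz (f x) + 20"])
  show "PT (%p :: 'a \<times> (nat \<times> nat list) \<times> bool. nats_step (fst (snd p)) (snd (snd p)))"
   unfolding nats_step_def by (intro pt)
  fix x k
  show "sz (foldl nats_step (0, []) (take k (f x))) \<le> 4 * sz (f x) + 20"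
   using b[OF refl, of "take k (f x)"] length_less_sz[of "f x"] by (auto simp: min_def split: if_splits)
 qed (intro pt f pb_add pb_mult pb_const pb_PT)+
 then show ?thesis unfolding nats_def by (intro pt)
qed

text \<open>A finite automaton for the binary encodings of numbers; the second component is the last digit.\<close>

definition num_step :: "nat \<times> bool => bool => nat \<times> bool" where
 "num_step s b = (if fst s = 0 then (if b then 1 else 2, snd s) else if fst s = 1 then (0, b) else (3, snd s))"

definition is_num :: "bool list => bool" where
 "is_num r \<longleftrightarrow> foldl num_step (0, True) r = (2, True)"

text \<open>With the least significant bit in front, a word is canonical iff its last digit is 1.
  The initial value \<open>True\<close> of the last digit admits the numeral of 0; the induction
  generalises it to \<open>l\<close>.\<close>

lemma is_num: "is_num r \<longleftrightarrow> (\<exists>n. r = enc_nat n)"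
proof -
 have 3: "foldl num_step (3, l) r = (3, l)" for l r by (induction r) (auto simp: num_step_def)
 have "foldl num_step (0, l) r = (2, True) \<longleftrightarrow> (\<exists>n. r = enc_nat n & (n = 0 --> l))" for l
 proof (induction "length r" arbitrary: r l rule: less_induct)
  case less
  have e: "enc_nat n = [False] & n = 0 \<or> (\<exists>b q. enc_nat n = True # b # q)" for n
   by (cases "n = 0") (auto simp: enc_nat.simps[of n])
  consider "r = []" | "r = [False]" | b r' where "r = False # b # r'" | "r = [True]" | b r' where "r = True # b # r'"
  proof (cases r)
   case (Cons a q)
   then show ?thesis using that by (cases a; cases q) auto
  qed (use that in blast)
  then show ?case
  proof cases
   case 1
   then have "r ~= enc_nat n" for n using e[of n] by auto
   then show ?thesis using 1 by simp
  next
   case 2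
   then have "(\<exists>n. r = enc_nat n & (n = 0 --> l)) \<longleftrightarrow> l" using e
    by (metis enc_nat_0 list.inject)
   then show ?thesis using 2 by (simp add: num_step_def)
  next
   case 3
   then have "r ~= enc_nat n" for n using e[of n] by auto
   then show ?thesis using 3 \<open>\<And>r l. foldl num_step (3, l) r = (3, l)\<close> by (simp add: num_step_def)
  next
   case 4
   then have "r ~= enc_nat n" for n using e[of n] by auto
   then show ?thesis using 4 by (simp add: num_step_def)
  next
   case 5
   have "foldl num_step (0, l) r = foldl num_step (0, b) r'" using 5 by (simp add: num_step_def)
   also have "\<dots> = (2, True) \<longleftrightarrow> (\<exists>n. r' = enc_nat n & (n = 0 --> b))" using less.hyps[of r' b] 5 by simp
   also have "\<dots> \<longleftrightarrow> (\<exists>n. r = enc_nat n & (n = 0 --> l))"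
   proof
    assume "\<exists>n. r' = enc_nat n & (n = 0 --> b)"
    then obtain n where n: "r' = enc_nat n" "n = 0 --> b" by blast
    have "enc_nat (2 * n + of_bool b) = r" using n enc_nat.simps[of "2 * n + of_bool b"] 5
     by (cases b) auto
    then show "\<exists>n. r = enc_nat n & (n = 0 --> l)" using n(2)
     by (intro exI[of _ "2 * n + of_bool b"]) auto
   next
    assume "\<exists>n. r = enc_nat n & (n = 0 --> l)"
    then obtain n where n: "r = enc_nat n" by blast
    then have "n ~= 0" using 5 by (metis enc_nat_0 list.inject)
    then have "b = odd n" "r' = enc_nat (n div 2)" using n 5 enc_nat.simps[of n] by auto
    moreover have "n div 2 = 0 --> odd n" using \<open>n ~= 0\<close> by presburger
    ultimately show "\<exists>n. r' = enc_nat n & (n = 0 --> b)" by (intro exI[of _ "n div 2"]) simp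
   qed
   finally show ?thesis .
  qed
 qed
 then show ?thesis by (simp add: is_num_def)
qed

lemma PT_is_num [pt]: "PT f ==> PT (%x. is_num (f x))"
proof -
 assume f: "PT f"
 have "PT (%x. foldl num_step (0, True) (f x))"
 proof (rule PT_foldl[where B = "%x. 20"])
  show "PT (%p :: 'a \<times> (nat \<times> bool) \<times> bool. num_step (fst (snd p)) (snd (snd p)))"
   unfolding num_step_def by (intro pt)
  have "fst (foldl num_step (0, True) z) \<le> 3" for z
   by (induction z rule: rev_induct) (auto simp: num_step_def)
  then have "fst (foldl num_step (0, True) (take k (f x))) \<le> 3" for x k .
  then show "sz (foldl num_step (0, True) (take k (f x))) \<le> 20" for x k
   using le_trans[of "2 * fst (foldl num_step (0, True) (take k (f x)))" 6 15]
   by (simp add: venc_prod_def venc_bool_def)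
 qed (intro pt f pb_const)+
 then show ?thesis unfolding is_num_def by (intro pt)
qed

section \<open>Enumeration of tuples and verification of certificates\<close>

lemma PT_n_lists [pt]: "PT l ==> PT (%x. List.n_lists h (l x))"
proof (induction h)
 case (Suc h)
 have "PT (%x. concat (map (%ys. map (%y. y # ys) (l x)) (List.n_lists h (l x))))"
  by (intro pt Suc PT_comp[OF Suc.prems])
 then show ?case by simp
qed (simp add: PT_const)

lemma PT_distinct [pt]: "PT l ==> PT (%x. distinct (l x))"
proof -
 assume l: "PT l"
 have "PT (%x. length (uniq (l x)) = length (l x))" by (intro pt l)
 moreover have "length (uniq xs) = length xs \<longleftrightarrow> distinct xs" for xs :: "'b list"
  using distinct_card[OF uniq(2), of xs] uniq(1)[of xs] by (metis card_distinct distinct_card)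
 ultimately show ?thesis by simp
qed

text \<open>A certificate lists the number of vertices and the codes \<open>i * n + j\<close> of the deleted edges.\<close>

definition mat :: "bool list => nat => nat => nat => bool" where
 "mat x n i j = nth_def0 False x (length (enc_nat n) + i * n + j)"

text \<open>The parameter is given in binary and may be exponentially large, so it is never
  converted to a unary number: that it is at least the number of codes is tested by comparing its
  numeral with those of all smaller numbers. The graph \<open>T\<close> is fixed, hence all
  \<open>h\<close>-tuples of vertices can be tried.\<close>

definition verify :: "(nat \<times> nat) list => nat => bool list => nat list => bool" where
 "verify E h x ns = (let n = nth_def0 0 ns 0; ms = tl ns; e = enc_nat n; r = drop (length e + n * n) x in
   take (length e) x = e & length e + n * n \<le> length x &
   (\<forall>i\<in>set [0..<n]. \<not> mat x n i i & (\<forall>j\<in>set [0..<n]. mat x n i j = mat x n j i)) &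
   is_num r & (\<forall>k\<in>set [0..<length ms]. r ~= enc_nat k) &
   (\<forall>t\<in>set (List.n_lists h [0..<n]). \<not> (distinct t & (\<forall>a\<in>set [0..<h]. \<forall>b\<in>set [0..<h].
    (a, b) \<in> set E \<longleftrightarrow> (let u = nth_def0 0 t a; v = nth_def0 0 t b in
     mat x n u v & u * n + v \<notin> set ms & v * n + u \<notin> set ms)))))"

lemma PT_verify: "PT x ==> PT ns ==> PT (%y. verify E h (x y) (ns y))"
proof -
 assume *: "PT x" "PT ns"
 have "PT (%p. verify E h (fst p) (snd p))" unfolding verify_def mat_def by (intro pt)
 from PT_comp2[OF this *] show ?thesis .
qed

lemma row_index: "i < n ==> j < m ==> i * m + j < n * (m :: nat)"
 using mult_le_mono1[of "Suc i" n m] by simp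

lemma length_rows: "length (concat (map (%i. map (f i) [0..<m]) [0..<n])) = n * m"
 by (induction n) auto

lemma concat_nth:
 "length M = n * m ==> concat (map (%i. map (%j. M ! (i * m + j)) [0..<m]) [0..<n]) = M"
proof (induction n arbitrary: M)
 case (Suc n)
 have "concat (map (%i. map (%j. M ! (i * m + j)) [0..<m]) [0..<n]) =
  concat (map (%i. map (%j. take (n * m) M ! (i * m + j)) [0..<m]) [0..<n])"
 proof (intro arg_cong[where f = concat] map_cong refl)
  fix i j assume "i \<in> set [0..<n]" "j \<in> set [0..<m]"
  then have "i * m + j < n * m" by (intro row_index) auto
  then show "M ! (i * m + j) = take (n * m) M ! (i * m + j)" by simp
 qed
 also have "\<dots> = take (n * m) M" using Suc.prems by (intro Suc.IH) simp
 finally have "concat (map (%i. map (%j. M ! (i * m + j)) [0..<m]) [0..<Suc n]) =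
  take (n * m) M @ map (%j. M ! (n * m + j)) [0..<m]" by simp
 also have "map (%j. M ! (n * m + j)) [0..<m] = drop (n * m) M"
  using Suc.prems by (intro nth_equalityI) auto
 finally show ?case by simp
qed simp

lemma nth_concat_rows:
 "i < n ==> j < m ==> concat (map (%i. map (f i) [0..<m]) [0..<n]) ! (i * m + j) = f i j"
proof (induction n arbitrary: i)
 case (Suc n)
 have l: "length (concat (map (%i. map (f i) [0..<m]) [0..<n])) = n * m"
  by (rule length_rows)
 show ?case
 proof (cases "i < n")
  case True
  then have "i * m + j < n * m" using Suc.prems by (intro row_index) auto
  then show ?thesis using Suc.IH[OF True Suc.prems(2)] l by (simp add: nth_append)
 next
  case False
  then have "i = n" using Suc.prems by simp
  then show ?thesis using l Suc.prems by (simp add: nth_append)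
 qed
qed simp

context
 fixes T :: "'a graph" and ts :: "'a list" and h :: nat and E :: "(nat \<times> nat) list"
 assumes ts: "set ts = verts T" "distinct ts" and h: "h = length ts"
  and E: "\<And>a b. a < h ==> b < h ==> (a, b) \<in> set E \<longleftrightarrow> adj T (ts ! a) (ts ! b)"
begin

lemma tuple_embeds:
 assumes K: "verts K = {..<n}"
 shows "(\<exists>f. embeds T K f) \<longleftrightarrow> (\<exists>t \<in> set (List.n_lists h [0..<n]). distinct t &
  (\<forall>a<h. \<forall>b<h. (a, b) \<in> set E \<longleftrightarrow> adj K (t ! a) (t ! b)))"
proof
 assume "\<exists>f. embeds T K f"
 then obtain f where f: "embeds T K f" by blast
 have v: "ts ! a \<in> verts T" if "a < h" for a using that ts(1) h nth_mem by metis
 have "adj T (ts ! a) (ts ! b) \<longleftrightarrow> adj K (f (ts ! a)) (f (ts ! b))" if "a < h" "b < h" for a b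
  using f v that by (simp add: embeds_def)
 moreover have "distinct (map f ts)" "map f ts \<in> set (List.n_lists h [0..<n])"
  using f ts h K by (auto simp: embeds_def distinct_map set_n_lists)
 ultimately show "\<exists>t \<in> set (List.n_lists h [0..<n]). distinct t &
  (\<forall>a<h. \<forall>b<h. (a, b) \<in> set E \<longleftrightarrow> adj K (t ! a) (t ! b))"
  using E h by (intro bexI[of _ "map f ts"]) auto
next
 assume "\<exists>t \<in> set (List.n_lists h [0..<n]). distinct t &
  (\<forall>a<h. \<forall>b<h. (a, b) \<in> set E \<longleftrightarrow> adj K (t ! a) (t ! b))"
 then obtain t where "t \<in> set (List.n_lists h [0..<n])" "distinct t"
  "\<forall>a<h. \<forall>b<h. (a, b) \<in> set E \<longleftrightarrow> adj K (t ! a) (t ! b)" by blast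
 then have t: "length t = h" "set t \<subseteq> {..<n}" "distinct t"
  "\<And>a b. a < h ==> b < h ==> (a, b) \<in> set E \<longleftrightarrow> adj K (t ! a) (t ! b)" by (auto simp: set_n_lists)
 have "\<exists>i. \<forall>a<h. i (ts ! a) = a"
  using ts(2) h by (intro exI[of _ "the_inv_into {..<h} ((!) ts)"] allI impI the_inv_into_f_f)
   (auto simp: inj_on_def nth_eq_iff_index_eq)
 then obtain i where i: "\<And>a. a < h ==> i (ts ! a) = a" by blast
 have nth: "\<exists>a<h. u = ts ! a" if "u \<in> verts T" for u using that ts(1) h by (metis in_set_conv_nth)
 have "embeds T K (%u. t ! i u)"
  unfolding embeds_def
 proof (intro conjI ballI)
  show "inj_on (%u. t ! i u) (verts T)"
  proof (rule inj_onI)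
   fix u v assume uv: "u \<in> verts T" "v \<in> verts T" "t ! i u = t ! i v"
   obtain a b where ab: "a < h" "b < h" "u = ts ! a" "v = ts ! b" using nth uv by metis
   then have "a = b" using uv(3) i t(1,3) nth_eq_iff_index_eq by metis
   then show "u = v" using ab by simp
  qed
  show "(%u. t ! i u) ` verts T \<subseteq> verts K"
  proof
   fix y assume "y \<in> (%u. t ! i u) ` verts T"
   then obtain u where u: "u \<in> verts T" "y = t ! i u" by blast
   obtain a where "a < h" "u = ts ! a" using nth[OF u(1)] by blast
   then have "y \<in> set t" using u(2) i t(1) by simp
   then show "y \<in> verts K" using t(2) K by blast
  qed
  fix u v assume uv: "u \<in> verts T" "v \<in> verts T"
  obtain a b where ab: "a < h" "b < h" "u = ts ! a" "v = ts ! b" using nth uv by metis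
  then show "adj T u v \<longleftrightarrow> adj K (t ! i u) (t ! i v)" using E[OF ab(1,2)] t(4)[OF ab(1,2)] i by simp
 qed
 then show "\<exists>f. embeds T K f" by blast
qed

lemma code_eq: "j < n ==> i * n + j = m \<longleftrightarrow> i = m div n & j = m mod (n::nat)"
 by (metis add.commute div_mult_self3 div_less mod_less mod_mult_self1 add_cancel_left_left
   div_mod_decomp gr_implies_not0 mult.commute)

lemma verify_sound:
 assumes "verify E h x ns"
 shows "x \<in> free_edge_deletion T"
proof -
 define n where "n = nth_def0 0 ns 0"
 define ms where "ms = tl ns"
 define e where "e = enc_nat n"
 define r where "r = drop (length e + n * n) x"
 have V: "take (length e) x = e" "length e + n * n \<le> length x"
  "\<And>i j. i < n ==> j < n ==> \<not> mat x n i i & mat x n i j = mat x n j i"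
  "is_num r" "\<And>k. k < length ms ==> r ~= enc_nat k"
  "\<And>t. t \<in> set (List.n_lists h [0..<n]) ==> \<not> (distinct t & (\<forall>a\<in>set [0..<h]. \<forall>b\<in>set [0..<h].
    (a, b) \<in> set E \<longleftrightarrow> (let u = nth_def0 0 t a; v = nth_def0 0 t b in
     mat x n u v & u * n + v \<notin> set ms & v * n + u \<notin> set ms)))"
  using assms unfolding verify_def Let_def n_def ms_def e_def r_def atLeastLessThan_upt[symmetric]
  by (simp_all add: Ball_def)
 define G :: "nat graph" where "G = \<lparr>verts = {..<n}, edges = {{i, j} | i j. i < n & j < n & mat x n i j}\<rparr>"
 have adjG: "adj G i j \<longleftrightarrow> mat x n i j" if "i < n" "j < n" for i j
  using that V(3)[of i j] unfolding G_def adj_def by (auto simp: doubleton_eq_iff)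
 have "card d = 2" if "d \<in> edges G" for d using that V(3) by (auto simp: G_def card_insert_if)
 then have num: "numbered_graph G" unfolding numbered_graph_def simple_graph_def by (auto simp: G_def)
 obtain k where k: "r = enc_nat k" using V(4) is_num by blast
 let ?M = "take (n * n) (drop (length e) x)"
 have lM: "length ?M = n * n" using V(2) by simp
 have M: "?M ! (i * n + j) = mat x n i j" if "i < n" "j < n" for i j
 proof -
  have l: "i * n + j < n * n" using that by (rule row_index)
  then show ?thesis using V(2) by (simp add: mat_def e_def add.assoc)
 qed
 have "x = e @ ?M @ r" using V(1) by (metis append_take_drop_id drop_drop add.commute r_def)
 also have "?M = concat (map (%i. map (%j. adj G i j) [0..<n]) [0..<n])"
 proof -
  have "concat (map (%i. map (%j. adj G i j) [0..<n]) [0..<n]) =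
    concat (map (%i. map (%j. ?M ! (i * n + j)) [0..<n]) [0..<n])"
   by (intro arg_cong[where f = concat] map_cong refl) (use M adjG in simp)
  then show ?thesis using concat_nth[OF lM] by simp
 qed
 finally have x: "x = enc_instance G k"
  by (simp add: enc_instance_def enc_graph_def e_def k G_def[THEN arg_cong[of _ _ verts]])
 \<comment> \<open>Codes that belong to no edge are discarded, which only decreases the number of
   deletions.\<close>
 define F where "F = (%m. {m div n, m mod n}) ` set ms \<inter> edges G"
 have "card F \<le> card ((%m. {m div n, m mod n}) ` set ms)" unfolding F_def by (intro card_mono) auto
 also have "\<dots> \<le> length ms" using card_image_le[of "set ms"] card_length[of ms] le_trans by blast
 also have "\<dots> \<le> k" using V(5)[of k] k by (meson not_le)
 finally have cF: "card F \<le> k" .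
 have FI: "{i, j} \<in> F \<longleftrightarrow> (i * n + j \<in> set ms \<or> j * n + i \<in> set ms)" if "mat x n i j" "i < n" "j < n" for i j
 proof -
  have "{i, j} \<in> edges G" using adjG[OF that(2,3)] that(1) by (simp add: adj_def)
  then have "{i, j} \<in> F \<longleftrightarrow> (\<exists>m\<in>set ms. {i, j} = {m div n, m mod n})" by (auto simp: F_def)
  also have "\<dots> \<longleftrightarrow> (\<exists>m\<in>set ms. i * n + j = m \<or> j * n + i = m)"
   using code_eq[OF that(3)] code_eq[OF that(2)] by (auto simp: doubleton_eq_iff)
  finally show ?thesis by blast
 qed
 have "induced_free T (delete_edges G F)"
  unfolding induced_free_iff
 proof
  assume "\<exists>f. embeds T (delete_edges G F) f"
  then obtain t where t: "t \<in> set (List.n_lists h [0..<n])" "distinct t"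
   "\<And>a b. a < h ==> b < h ==> (a, b) \<in> set E \<longleftrightarrow> adj (delete_edges G F) (t ! a) (t ! b)"
   using tuple_embeds[of "delete_edges G F" n] by (auto simp: G_def)
  have tn: "length t = h" "\<And>a. a < h ==> t ! a < n" using t(1) by (auto simp: set_n_lists dest: nth_mem)
  have "adj (delete_edges G F) (t ! a) (t ! b) \<longleftrightarrow> mat x n (t ! a) (t ! b) & t ! a * n + t ! b \<notin> set ms &
    t ! b * n + t ! a \<notin> set ms" if "a < h" "b < h" for a b
   using adjG[of "t ! a" "t ! b"] FI[of "t ! a" "t ! b"] tn that by (auto simp: adj_delete)
  then show False using V(6)[OF t(1)] t(2,3) tn by (simp add: Let_def)
 qed
 then have "edge_deletable T G k" using cF unfolding edge_deletable_def by (auto simp: F_def)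
 then show ?thesis using x num by (auto simp: free_edge_deletion_def)
qed

lemma verify_complete:
 assumes "x \<in> free_edge_deletion T"
 shows "\<exists>ns. verify E h x ns & length (unats ns) \<le> (length x + 1) ^ 2"
proof -
 obtain G k where G: "x = enc_instance G k" "numbered_graph G" "edge_deletable T G k"
  using assms by (auto simp: free_edge_deletion_def)
 then obtain F where F: "F \<subseteq> edges G" "card F \<le> k" "induced_free T (delete_edges G F)"
  by (auto simp: edge_deletable_def)
 obtain n where n: "verts G = {..<n}" and sG: "simple_graph G" using G(2) by (auto simp: numbered_graph_def)
 define e where "e = enc_nat n"
 define M where "M = concat (map (%i. map (%j. adj G i j) [0..<n]) [0..<n])"
 have x: "x = e @ M @ enc_nat k" using G(1) by (simp add: enc_instance_def enc_graph_def n e_def M_def)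
 have lM: "length M = n * n" unfolding M_def by (rule length_rows)
 have mat: "mat x n i j = adj G i j" if "i < n" "j < n" for i j
 proof -
  have l: "i * n + j < n * n" using that by (rule row_index)
  have "mat x n i j = M ! (i * n + j)"
   using l lM unfolding mat_def x e_def[symmetric] by (simp add: nth_append add.assoc)
  then show ?thesis using nth_concat_rows[OF that] by (simp add: M_def)
 qed
 have finF: "finite F" using F(1) finite_edges[OF sG] finite_subset by blast
 \<comment> \<open>Ordering the ends by \<open>Min\<close> and \<open>Max\<close> gives every edge
   exactly one code, so there are no more codes than deleted edges.\<close>
 obtain ms where ms: "set ms = (%d. Min d * n + Max d) ` F" "distinct ms"
  using finite_distinct_list[of "(%d. Min d * n + Max d) ` F"] finF by blast
 have dF: "\<exists>i j. d = {i, j} & i < j & j < n & Min d = i & Max d = j" if d: "d \<in> F" for d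
 proof -
  obtain a b where ab: "d = {a, b}" "a ~= b" using simple_edgeE[OF sG] F(1) d by blast
  have "d \<subseteq> {..<n}" using sG F(1) d n unfolding simple_graph_def by auto
  then show ?thesis using ab by (cases "a < b") (auto simp: insert_commute)
 qed
 have mF: "(i * n + j \<in> set ms \<or> j * n + i \<in> set ms) \<longleftrightarrow> {i, j} \<in> F" if ij: "i < n" "j < n" for i j
 proof
  assume "i * n + j \<in> set ms \<or> j * n + i \<in> set ms"
  then have "\<exists>d\<in>F. Min d * n + Max d = i * n + j \<or> Min d * n + Max d = j * n + i"
   unfolding ms(1) by (elim disjE imageE; intro bexI; simp)
  then obtain d where d: "d \<in> F" "Min d * n + Max d = i * n + j \<or> Min d * n + Max d = j * n + i" by blast
  obtain a b where ab: "d = {a, b}" "b < n" "Min d = a" "Max d = b" using dF[OF d(1)] by blast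
  have "a * n + b = i * n + j ==> a = i & b = j" "a * n + b = j * n + i ==> a = j & b = i"
   using code_eq[OF ab(2), of a "i * n + j"] code_eq[of j n i "i * n + j"]
    code_eq[OF ab(2), of a "j * n + i"] code_eq[of i n j "j * n + i"] ij by simp_all
  then show "{i, j} \<in> F" using d ab by (auto simp: insert_commute)
 next
  assume f: "{i, j} \<in> F"
  have "Min {i, j} * n + Max {i, j} \<in> set ms" unfolding ms(1) using f by (rule imageI)
  then show "i * n + j \<in> set ms \<or> j * n + i \<in> set ms" by (cases "i \<le> j") (auto simp: min_def max_def)
 qed
 have lms: "length ms \<le> card F"
  using ms distinct_card[OF ms(2)] card_image_le[OF finF, of "%d. Min d * n + Max d"] by simp
 have msn: "m < n * n" if m: "m \<in> set ms" for m
 proof -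
  obtain d where d: "d \<in> F" "m = Min d * n + Max d" using m unfolding ms(1) by blast
  obtain i j where "i < j" "j < n" "Min d = i" "Max d = j" using dF[OF d(1)] by blast
  then show ?thesis using d(2) row_index[of i n j n] by simp
 qed
 have "verify E h x (n # ms)"
  unfolding verify_def Let_def
 proof (intro conjI ballI)
  let ?n = "nth_def0 0 (n # ms) 0"
  have nn: "?n = n" by simp
  show "take (length (enc_nat ?n)) x = enc_nat ?n" unfolding nn x e_def by simp
  show "length (enc_nat ?n) + ?n * ?n \<le> length x" unfolding nn x e_def using lM by simp
  show "\<not> mat x ?n i i" if "i \<in> set [0..<?n]" for i
   using that mat[of i i] simple_graph_adj[OF sG, of i i] unfolding nn by auto
  show "mat x ?n i j = mat x ?n j i" if "i \<in> set [0..<?n]" "j \<in> set [0..<?n]" for i j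
   using that mat[of i j] mat[of j i] unfolding nn by (auto simp: adj_sym)
  have r: "drop (length (enc_nat ?n) + ?n * ?n) x = enc_nat k"
   unfolding nn x e_def using lM by simp
  show "is_num (drop (length (enc_nat ?n) + ?n * ?n) x)" unfolding r is_num by blast
  show "drop (length (enc_nat ?n) + ?n * ?n) x ~= enc_nat l" if "l \<in> set [0..<length (tl (n # ms))]" for l
   using that lms F(2) enc_nat_prefix_free[of k "[]" l "[]"] unfolding r by auto
  fix t assume t: "t \<in> set (List.n_lists h [0..<?n])"
  show "\<not> (distinct t & (\<forall>a\<in>set [0..<h]. \<forall>b\<in>set [0..<h]. ((a, b) \<in> set E) =
    (mat x ?n (nth_def0 0 t a) (nth_def0 0 t b) & nth_def0 0 t a * ?n + nth_def0 0 t b \<notin> set (tl (n # ms)) &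
     nth_def0 0 t b * ?n + nth_def0 0 t a \<notin> set (tl (n # ms)))))"
  proof
   assume a: "distinct t & (\<forall>a\<in>set [0..<h]. \<forall>b\<in>set [0..<h]. ((a, b) \<in> set E) =
    (mat x ?n (nth_def0 0 t a) (nth_def0 0 t b) & nth_def0 0 t a * ?n + nth_def0 0 t b \<notin> set (tl (n # ms)) &
     nth_def0 0 t b * ?n + nth_def0 0 t a \<notin> set (tl (n # ms))))"
   have tn: "length t = h" "\<And>a. a < h ==> t ! a < n" using t by (auto simp: set_n_lists dest: nth_mem)
   have "(a, b) \<in> set E \<longleftrightarrow> adj (delete_edges G F) (t ! a) (t ! b)" if "a < h" "b < h" for a b
    using a that tn mat[of "t ! a" "t ! b"] mF[of "t ! a" "t ! b"] by (auto simp: adj_delete)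
   then have "\<exists>f. embeds T (delete_edges G F) f"
    using tuple_embeds[of "delete_edges G F" n] n t a by auto
   then show False using F(3) induced_free_iff by blast
  qed
 qed
 moreover have "length (unats (n # ms)) \<le> (length x + 1) ^ 2"
 proof -
  have "length (unats ms) = (\<Sum>m\<leftarrow>ms. Suc m)" unfolding unats_def by (induction ms) auto
  also have "\<dots> \<le> (\<Sum>m\<leftarrow>ms. n * n)" by (rule sum_list_mono) (use msn in \<open>auto simp: Suc_le_eq\<close>)
  also have "\<dots> = length ms * (n * n)" by (simp add: sum_list_triv)
  \<comment> \<open>The parameter says nothing about the length of the certificate if it is huge;
    the codes are distinct and below \<open>n * n\<close>.\<close>
  also have "\<dots> \<le> (n * n) * (n * n)"
  proof (rule mult_le_mono1)
   have "length ms = card (set ms)" using ms(2) by (simp add: distinct_card)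
   also have "\<dots> \<le> card {..<n * n}" by (rule card_mono) (use msn in auto)
   finally show "length ms \<le> n * n" by simp
  qed
  also have "\<dots> \<le> length x * length x" using x lM by (intro mult_le_mono) auto
  finally have "length (unats ms) \<le> length x * length x" .
  moreover have "n \<le> length x" using x lM by (cases n) auto
  ultimately show ?thesis by (simp add: unats_def power2_eq_square)
 qed
 ultimately show ?thesis by blast
qed

end

theorem free_edge_deletion_in_NP:
 assumes T: "simple_graph T"
 shows "in_NP (free_edge_deletion T)"
proof -
 obtain ts where ts: "set ts = verts T" "distinct ts"
  using finite_distinct_list[of "verts T"] T unfolding simple_graph_def by blast
 define h where "h = length ts"
 define E where "E = filter (%(a, b). adj T (ts ! a) (ts ! b)) (List.product [0..<h] [0..<h])"
 have E: "(a, b) \<in> set E \<longleftrightarrow> adj T (ts ! a) (ts ! b)" if "a < h" "b < h" for a b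
  using that by (auto simp: E_def)
 define ver where "ver z = verify E h (fst (dec_pair z)) (nats (snd (dec_pair z)))" for z
 have "PT (%z. [ver z])" unfolding ver_def by (intro pt PT_verify)
 then have V: "polytime_decidable {z. ver z}"
  unfolding polytime_decidable_def by (simp add: PT_polytime)
 have ve: "ver (enc_pair x w) \<longleftrightarrow> verify E h x (nats w)" for x w by (simp add: ver_def dec_pair)
 show ?thesis
  unfolding in_NP_def
 proof (intro exI conjI allI)
  show "polytime_decidable {z. ver z}" by (rule V)
  fix x
  show "x \<in> free_edge_deletion T \<longleftrightarrow> (\<exists>w. length w \<le> poly ([:1, 1:] ^ 2) (length x) & enc_pair x w \<in> {z. ver z})"
  proof
   assume "x \<in> free_edge_deletion T"
   then obtain ns where "verify E h x ns" "length (unats ns) \<le> (length x + 1) ^ 2"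
    using verify_complete[OF ts h_def E] by blast
   then show "\<exists>w. length w \<le> poly ([:1, 1:] ^ 2) (length x) & enc_pair x w \<in> {z. ver z}"
    by (intro exI[of _ "unats ns"]) (simp add: ve nats_unats poly_power add.commute)
  next
   assume "\<exists>w. length w \<le> poly ([:1, 1:] ^ 2) (length x) & enc_pair x w \<in> {z. ver z}"
   then show "x \<in> free_edge_deletion T" using verify_sound[OF ts h_def E] ve by auto
  qed
 qed
qed

section \<open>The theorem of Cook and Levin\<close>

type_synonym nclause = "(name \<times> bool) list"

definition models :: "(name => bool) => nclause list => bool" where
 "models \<alpha> \<phi> \<longleftrightarrow> (\<forall>C\<in>set \<phi>. \<exists>l\<in>set C. \<alpha> (fst l) = snd l)"

lemma models_append [simp]: "models \<alpha> (\<phi> @ \<psi>) \<longleftrightarrow> models \<alpha> \<phi> & models \<alpha> \<psi>"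
 by (auto simp: models_def)

lemma models_concat: "models \<alpha> (concat \<phi>s) \<longleftrightarrow> (\<forall>\<phi>\<in>set \<phi>s. models \<alpha> \<phi>)"
 by (auto simp: models_def)

text \<open>In \<open>split3\<close>, the fresh variable \<open>[1, c, i]\<close> says that the clause number \<open>c\<close> is satisfied by its literals from
 position \<open>i\<close> on.\<close>

definition split3 :: "nclause list => nclause list" where
 "split3 \<phi> = concat (map (%c. let C = nth_def0 [] \<phi> c in
   [([1, c, 0], True)] # [([1, c, length C], False)] #
   map (%i. let l = nth_def0 ([], False) C i in
    [([1, c, i], False), (0 # fst l, snd l), ([1, c, Suc i], True)]) [0..<length C]) [0..<length \<phi>])"

lemma PT_split3: "PT f ==> PT (%x. split3 (f x))"
 by (rule PT_comp[of split3]) (unfold split3_def, intro pt)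

lemma split3_sat: "(\<exists>\<alpha>. models \<alpha> (split3 \<phi>)) \<longleftrightarrow> (\<exists>\<alpha>. models \<alpha> \<phi>)"
proof
 assume "\<exists>\<alpha>. models \<alpha> (split3 \<phi>)"
 then obtain \<alpha> where \<alpha>: "models \<alpha> (split3 \<phi>)" ..
 have "\<exists>l\<in>set C. \<alpha> (0 # fst l) = snd l" if "C \<in> set \<phi>" for C
 proof (rule ccontr)
  assume n: "\<not> ?thesis"
  obtain c where c: "c < length \<phi>" "C = \<phi> ! c" using \<open>C \<in> set \<phi>\<close> by (metis in_set_conv_nth)
  have 0: "\<alpha> [1, c, 0]" "\<not> \<alpha> [1, c, length C]"
   using \<alpha> c unfolding split3_def models_concat by (auto simp: models_def Let_def)
  have step: "\<alpha> [1, c, i] ==> \<alpha> [1, c, Suc i]" if "i < length C" for i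
  proof -
   have "\<alpha> [1, c, i] = False \<or> \<alpha> (0 # fst (C ! i)) = snd (C ! i) \<or> \<alpha> [1, c, Suc i] = True"
    using \<alpha> c that unfolding split3_def models_concat by (auto simp: models_def Let_def)
   then show "\<alpha> [1, c, i] ==> \<alpha> [1, c, Suc i]" using n that by auto
  qed
  have "i \<le> length C ==> \<alpha> [1, c, i]" for i
   by (induction i) (use 0 step in auto)
  then show False using 0 by blast
 qed
 then show "\<exists>\<alpha>. models \<alpha> \<phi>" unfolding models_def by (intro exI[of _ "%v. \<alpha> (0 # v)"]) blast
next
 assume "\<exists>\<alpha>. models \<alpha> \<phi>"
 then obtain \<alpha> where \<alpha>: "models \<alpha> \<phi>" ..
 define \<beta> where "\<beta> v = (if hd v = 0 then \<alpha> (tl v) else \<exists>l\<in>set (drop (v ! 2) (\<phi> ! (v ! 1))). \<alpha> (fst l) = snd l)" for v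
 have \<beta>: "\<beta> (0 # v) = \<alpha> v" "\<beta> [Suc 0, c, i] = (\<exists>l\<in>set (drop i (\<phi> ! c)). \<alpha> (fst l) = snd l)" for v c i
  by (auto simp: \<beta>_def)
 have "models \<beta> (split3 \<phi>)"
  unfolding split3_def models_concat
 proof
  fix \<psi> assume "\<psi> \<in> set (map (%c. let C = nth_def0 [] \<phi> c in
   [([1, c, 0], True)] # [([1, c, length C], False)] #
   map (%i. let l = nth_def0 ([], False) C i in
    [([1, c, i], False), (0 # fst l, snd l), ([1, c, Suc i], True)]) [0..<length C]) [0..<length \<phi>])"
  then obtain c where c: "c < length \<phi>" and \<psi>: "\<psi> = [([1, c, 0], True)] # [([1, c, length (\<phi> ! c)], False)] #
   map (%i. let l = nth_def0 ([], False) (\<phi> ! c) i in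
    [([1, c, i], False), (0 # fst l, snd l), ([1, c, Suc i], True)]) [0..<length (\<phi> ! c)]"
   by (auto simp: Let_def)
  have "\<phi> ! c \<in> set \<phi>" using c by simp
  then have "\<beta> [Suc 0, c, 0]" using \<alpha> by (simp add: \<beta> models_def)
  moreover have "\<not> \<beta> [Suc 0, c, length (\<phi> ! c)]" by (simp add: \<beta>)
  moreover have "\<beta> [Suc 0, c, i] ==> \<beta> (0 # fst (\<phi> ! c ! i)) = snd (\<phi> ! c ! i) \<or> \<beta> [Suc 0, c, Suc i]"
   if "i < length (\<phi> ! c)" for i using that by (auto simp: \<beta> Cons_nth_drop_Suc[symmetric])
  ultimately show "models \<beta> \<psi>" unfolding \<psi> by (auto simp: models_def Let_def)
 qed
 then show "\<exists>\<alpha>. models \<alpha> (split3 \<phi>)" by (rule exI[of _ \<beta>])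
qed

definition vindex :: "name list => name => nat" where
 "vindex vs v = length (filter (%i. \<forall>j\<in>set [0..<Suc i]. nth_def0 [] vs j ~= v) [0..<length vs])"

lemma vindex:
 assumes "i < length vs" "distinct vs"
 shows "vindex vs (vs ! i) = i"
proof -
 have "filter (%k. \<forall>j\<in>set [0..<Suc k]. nth_def0 [] vs j ~= vs ! i) [0..<length vs] = filter (%k. k < i) [0..<length vs]"
 proof (rule filter_cong[OF refl])
  fix k assume "k \<in> set [0..<length vs]"
  then have k: "k < length vs" by simp
  then show "(\<forall>j\<in>set [0..<Suc k]. nth_def0 [] vs j ~= vs ! i) \<longleftrightarrow> k < i"
   using assms by (auto simp: nth_eq_iff_index_eq less_Suc_eq_le)
 qed
 also have "length \<dots> = i"
 proof -
  have "{k. k < length vs & [0..<length vs] ! k < i} = {..<i}" using assms(1) by auto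
  then show ?thesis by (simp add: length_filter_conv_card cong: conj_cong)
 qed
 finally show ?thesis by (simp add: vindex_def)
qed

definition cnf_vars :: "nclause list => name list" where
 "cnf_vars \<phi> = uniq (map fst (concat \<phi>))"

definition to_cnf :: "nclause list => clause list" where
 "to_cnf \<phi> = (let vs = cnf_vars \<phi> in map (%C. map (%l. (vindex vs (fst l), snd l)) C) \<phi>)"

lemma PT_cnf_vars: "PT f ==> PT (%x. cnf_vars (f x))"
 by (rule PT_comp[of cnf_vars]) (unfold cnf_vars_def, intro pt)

lemma PT_to_cnf: "PT f ==> PT (%x. to_cnf (f x))"
 by (rule PT_comp[of to_cnf]) (unfold to_cnf_def vindex_def, intro pt PT_cnf_vars)

lemma vindex_less:
 "C \<in> set \<phi> ==> l \<in> set C ==> vindex (cnf_vars \<phi>) (fst l) < length (cnf_vars \<phi>) &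
  cnf_vars \<phi> ! vindex (cnf_vars \<phi>) (fst l) = fst l"
proof -
 assume "C \<in> set \<phi>" "l \<in> set C"
 then have "fst l \<in> set (cnf_vars \<phi>)" by (auto simp: cnf_vars_def uniq(1))
 then obtain i where i: "i < length (cnf_vars \<phi>)" "fst l = cnf_vars \<phi> ! i" by (metis in_set_conv_nth)
 moreover have "distinct (cnf_vars \<phi>)" by (simp add: cnf_vars_def uniq(2))
 ultimately show ?thesis using vindex by simp
qed

lemma to_cnf_sat: "satisfiable (to_cnf \<phi>) \<longleftrightarrow> (\<exists>\<alpha>. models \<alpha> \<phi>)"
proof -
 let ?vs = "cnf_vars \<phi>"
 have s: "satisfiable (to_cnf \<phi>) \<longleftrightarrow> (\<exists>\<beta>. \<forall>C\<in>set \<phi>. \<exists>l\<in>set C. \<beta> (vindex ?vs (fst l)) = snd l)"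
  by (simp add: satisfiable_def to_cnf_def Let_def case_prod_beta)
 show ?thesis unfolding s
 proof
  assume "\<exists>\<beta>. \<forall>C\<in>set \<phi>. \<exists>l\<in>set C. \<beta> (vindex ?vs (fst l)) = snd l"
  then obtain \<beta> where "\<forall>C\<in>set \<phi>. \<exists>l\<in>set C. \<beta> (vindex ?vs (fst l)) = snd l" ..
  then show "\<exists>\<alpha>. models \<alpha> \<phi>" unfolding models_def by (intro exI[of _ "%v. \<beta> (vindex ?vs v)"])
 next
  assume "\<exists>\<alpha>. models \<alpha> \<phi>"
  then obtain \<alpha> where \<alpha>: "models \<alpha> \<phi>" ..
  show "\<exists>\<beta>. \<forall>C\<in>set \<phi>. \<exists>l\<in>set C. \<beta> (vindex ?vs (fst l)) = snd l"
  proof (intro exI[of _ "%i. \<alpha> (?vs ! i)"] ballI)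
   fix C assume C: "C \<in> set \<phi>"
   then obtain l where "l \<in> set C" "\<alpha> (fst l) = snd l" using \<alpha> by (auto simp: models_def)
   then show "\<exists>l\<in>set C. \<alpha> (?vs ! vindex ?vs (fst l)) = snd l" using vindex_less[OF C] by metis
  qed
 qed
qed

lemma to_cnf_valid:
 assumes "\<And>C. C \<in> set \<phi> ==> length C \<le> 3"
 shows "valid (length (cnf_vars \<phi>)) (length \<phi> + 2) (to_cnf \<phi>)"
proof -
 let ?vs = "cnf_vars \<phi>"
 have "length (filter (%C. \<exists>l\<in>set C. fst l = x) (to_cnf \<phi>)) \<le> length \<phi> + 2" for x
  using length_filter_le[of _ "to_cnf \<phi>"] by (simp add: to_cnf_def Let_def le_SucI)
 then show ?thesis using assms vindex_less unfolding valid_def by (auto simp: to_cnf_def Let_def)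
qed

lemma split3_length: "C \<in> set (split3 \<phi>) ==> length C \<le> 3"
 by (auto simp: split3_def Let_def)

text \<open>Guards, target, inputs and operation; the gate constrains its target only if all guards hold.\<close>

type_synonym gate = "name list \<times> name \<times> name list \<times> nat"

text \<open>Code 6 extends the agreement of two addresses by one bit, 7 is a multiplexer, 8 the
  majority (carry) and 10 the borrow. \<open>a = (b = c)\<close> is the exclusive or of three bits:
  code 9 is a bit of a sum, and 11 a bit of a difference that is forced to 0 when \<open>d\<close>
  reports an overall borrow.\<close>

definition opr :: "nat => bool list => bool" where
 "opr k bs = (let a = nth_def0 False bs 0; b = nth_def0 False bs 1; c = nth_def0 False bs 2; d = nth_def0 False bs 3 in
   if k = 0 then False else if k = 1 then True else if k = 2 then a else if k = 3 then \<not> a else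
   if k = 4 then a & b else if k = 5 then a \<or> b else if k = 6 then a & b = c else
   if k = 7 then (if a then b else c) else if k = 8 then a & b \<or> a & c \<or> b & c else
   if k = 9 then a = (b = c) else if k = 10 then \<not> a & (b \<or> c) \<or> b & c else \<not> d & a = (b = c))"

definition holds :: "(name => bool) => gate => bool" where
 "holds \<alpha> = (%(gs, v, is, k). (\<forall>g\<in>set gs. \<alpha> g) --> \<alpha> v = opr k (map \<alpha> is))"

definition rows :: "bool list list" where
 "rows = concat (map (%h. List.n_lists h [False, True]) [0, 1, 2, 3, 4])"

text \<open>One clause per row of the truth table; a false guard satisfies all of them. With at most
  four inputs, the number of rows is constant.\<close>

definition gate_clauses :: "gate => nclause list" where
 "gate_clauses = (%(gs, v, is, k). map (%row. map (%g. (g, False)) gs @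
   map (%i. (nth_def0 [] is i, \<not> nth_def0 False row i)) [0..<length is] @ [(v, opr k row)])
   (filter (%row. length row = length is) rows))"

lemma PT_gate_clauses: "PT f ==> PT (%x. gate_clauses (f x))"
 by (rule PT_comp[of gate_clauses]) (unfold gate_clauses_def opr_def case_prod_beta, intro pt)

lemma set_rows: "row \<in> set rows \<longleftrightarrow> length row \<le> 4"
proof -
 have "row \<in> set rows \<longleftrightarrow> length row \<in> {0, 1, 2, 3, 4}" unfolding rows_def by (auto simp: set_n_lists length_Suc_conv)
 also have "\<dots> \<longleftrightarrow> length row \<le> 4" unfolding insert_iff empty_iff by arith
 finally show ?thesis .
qed

lemma gate_clauses:
 assumes "length (fst (snd (snd g))) \<le> 4"
 shows "models \<alpha> (gate_clauses g) \<longleftrightarrow> holds \<alpha> g"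
proof -
 obtain gs v "is" k where g: "g = (gs, v, is, k)" by (cases g)
 let ?C = "%row. map (%g. (g, False)) gs @
  map (%i. (nth_def0 [] is i, \<not> nth_def0 False row i)) [0..<length is] @ [(v, opr k row)]"
 have "set (gate_clauses g) = ?C ` {row. length row = length is}"
  using assms by (auto simp: gate_clauses_def g set_rows)
 then have "models \<alpha> (gate_clauses g) \<longleftrightarrow> (\<forall>row. length row = length is --> (\<exists>l\<in>set (?C row). \<alpha> (fst l) = snd l))"
  unfolding models_def by simp
 also have "\<dots> \<longleftrightarrow> (\<forall>row. length row = length is -->
   (\<exists>g\<in>set gs. \<not> \<alpha> g) \<or> (\<exists>i<length is. \<alpha> (is ! i) ~= row ! i) \<or> \<alpha> v = opr k row)"
 proof (intro arg_cong[where f = All] ext imp_cong refl)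
  fix row :: "bool list" assume r: "length row = length is"
  show "(\<exists>l\<in>set (?C row). \<alpha> (fst l) = snd l) \<longleftrightarrow>
   (\<exists>g\<in>set gs. \<not> \<alpha> g) \<or> (\<exists>i<length is. \<alpha> (is ! i) ~= row ! i) \<or> \<alpha> v = opr k row"
  proof -
   have "(\<exists>l\<in>set (?C row). \<alpha> (fst l) = snd l) \<longleftrightarrow> (\<exists>g\<in>set gs. \<alpha> g = False) \<or>
     (\<exists>i\<in>{0..<length is}. \<alpha> (nth_def0 [] is i) = (\<not> nth_def0 False row i)) \<or> \<alpha> v = opr k row"
    unfolding set_append bex_Un set_map bex_simps fst_conv snd_conv set_upt by simp
   also have "(\<exists>i\<in>{0..<length is}. \<alpha> (nth_def0 [] is i) = (\<not> nth_def0 False row i)) \<longleftrightarrow>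
     (\<exists>i<length is. \<alpha> (is ! i) ~= row ! i)"
    using r by (auto simp: Bex_def)
   finally show ?thesis by simp
  qed
 qed
 also have "\<dots> \<longleftrightarrow> ((\<forall>g\<in>set gs. \<alpha> g) --> \<alpha> v = opr k (map \<alpha> is))"
 proof
  assume "\<forall>row. length row = length is -->
   (\<exists>g\<in>set gs. \<not> \<alpha> g) \<or> (\<exists>i<length is. \<alpha> (is ! i) ~= row ! i) \<or> \<alpha> v = opr k row"
  from this[rule_format, of "map \<alpha> is"] show "(\<forall>g\<in>set gs. \<alpha> g) --> \<alpha> v = opr k (map \<alpha> is)" by auto
 next
  assume a: "(\<forall>g\<in>set gs. \<alpha> g) --> \<alpha> v = opr k (map \<alpha> is)"
  have "row = map \<alpha> is" if "length row = length is" "\<forall>i<length is. \<alpha> (is ! i) = row ! i" for row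
   using that by (intro nth_equalityI) auto
  then show "\<forall>row. length row = length is -->
   (\<exists>g\<in>set gs. \<not> \<alpha> g) \<or> (\<exists>i<length is. \<alpha> (is ! i) ~= row ! i) \<or> \<alpha> v = opr k row" using a by blast
 qed
 finally show ?thesis by (simp add: holds_def g)
qed

section \<open>Addition and subtraction bit by bit\<close>

definition carry :: "nat => nat => nat => bool" where
 "carry j a b \<longleftrightarrow> 2 ^ j \<le> take_bit j a + take_bit j b"

definition borrow :: "nat => nat => nat => bool" where
 "borrow j a b \<longleftrightarrow> take_bit j a < take_bit j b"

lemma take_bit_Suc': "take_bit (Suc j) a = (if bit a j then 2 ^ j else 0) + take_bit j (a :: nat)"
 by (simp add: take_bit_Suc_from_most)

lemma carry_Suc: "carry (Suc j) a b \<longleftrightarrow> bit a j & bit b j \<or> bit a j & carry j a b \<or> bit b j & carry j a b"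
proof -
 have "2 * P \<le> ((if p then P else 0) + x) + ((if q then P else 0) + y) \<longleftrightarrow> p & q \<or> p & P \<le> x + y \<or> q & P \<le> x + y"
  if "x < P" "y < P" for p q and P x y :: nat using that by auto
 from this[OF take_bit_nat_less_exp take_bit_nat_less_exp] show ?thesis
  by (simp add: carry_def take_bit_Suc')
qed

lemma borrow_Suc: "borrow (Suc j) a b \<longleftrightarrow> \<not> bit a j & (bit b j \<or> borrow j a b) \<or> bit b j & borrow j a b"
proof -
 have "((if p then P else 0) + x) < ((if q then P else 0) + y) \<longleftrightarrow> \<not> p & (q \<or> x < y) \<or> q & x < y"
  if "x < P" "y < P" for p q and P x y :: nat using that by auto
 from this[OF take_bit_nat_less_exp take_bit_nat_less_exp] show ?thesis
  by (simp add: borrow_def take_bit_Suc')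
qed

lemma bit_split: "(a :: nat) = 2 ^ Suc j * (a div 2 ^ Suc j) + (if bit a j then 2 ^ j else 0) + take_bit j a"
 using mult_div_mod_eq[of "2 ^ Suc j" a] take_bit_Suc'[of j a] unfolding take_bit_eq_mod by linarith

lemma bit_unsplit: "(c :: nat) < 2 ^ j ==> bit (2 ^ Suc j * q + (if b then 2 ^ j else 0) + c) j = b"
proof -
 assume c: "c < 2 ^ j"
 have "2 ^ Suc j * q + (if b then 2 ^ j else 0) + c = (2 * q + of_bool b) * 2 ^ j + c" by (simp add: algebra_simps)
 then have "(2 ^ Suc j * q + (if b then 2 ^ j else 0) + c) div 2 ^ j = 2 * q + of_bool b"
  using c by (simp only: div_mult_self3) simp
 then show ?thesis by (cases b) (auto simp: bit_iff_odd)
qed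

text \<open>Both numbers are split into the part above bit \<open>j\<close>, the bit and the part
  below. The lower parts add up to the carry times \<open>2 ^ j\<close> plus a remainder below
  \<open>2 ^ j\<close>, which cannot influence bit \<open>j\<close>.\<close>

lemma bit_add: "bit (a + b) j \<longleftrightarrow> bit a j = (bit b j = carry j a b)" for a b :: nat
proof -
 let ?ta = "take_bit j a" and ?tb = "take_bit j b" and ?qa = "a div 2 ^ Suc j" and ?qb = "b div 2 ^ Suc j"
 let ?c = "if carry j a b then 2 ^ j else 0 :: nat"
 have c: "?ta + ?tb - ?c < 2 ^ j" "?c \<le> ?ta + ?tb"
 proof -
  have "x + y - (if P \<le> x + y then P else 0) < P" "(if P \<le> x + y then P else 0) \<le> x + y"
   if "x < P" "y < P" for P x y :: nat using that by auto
  from this[OF take_bit_nat_less_exp take_bit_nat_less_exp] show "?ta + ?tb - ?c < 2 ^ j" "?c \<le> ?ta + ?tb"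
   unfolding carry_def by blast+
 qed
 let ?x = "bit a j = (bit b j = carry j a b)"
 let ?k = "if bit a j & bit b j \<or> bit a j & carry j a b \<or> bit b j & carry j a b then 1 else 0 :: nat"
 have "(if bit a j then 2 ^ j else 0) + (if bit b j then 2 ^ j else 0) + ?c = 2 ^ Suc j * ?k + (if ?x then 2 ^ j else (0::nat))"
  by auto
 then have "a + b = 2 ^ Suc j * (?qa + ?qb + ?k) + (if ?x then 2 ^ j else 0) + (?ta + ?tb - ?c)"
  using bit_split[of a j] bit_split[of b j] c(2) by (simp only: distrib_left)
 then show ?thesis using bit_unsplit[OF c(1), of "?qa + ?qb + ?k" ?x] by (simp only:)
qed

text \<open>Reduced to addition through \<open>a = d + b\<close>: borrowing in the difference is
  carrying in that sum.\<close>

lemma bit_sub: "b \<le> a ==> bit (a - b) j \<longleftrightarrow> bit a j = (bit b j = borrow j a b)" for a b :: nat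
proof -
 assume "b \<le> a"
 define d where "d = a - b"
 have a: "a = d + b" using \<open>b \<le> a\<close> by (simp add: d_def)
 have "borrow j a b = carry j d b"
 proof -
  have m: "take_bit j a = (take_bit j d + take_bit j b) mod 2 ^ j" by (simp add: a take_bit_eq_mod mod_simps)
  have "(x + y) mod P < y \<longleftrightarrow> P \<le> x + y" if "x < P" "y < P" for x y P :: nat
   using that by (cases "P \<le> x + y") (simp_all add: le_mod_geq)
  from this[OF take_bit_nat_less_exp take_bit_nat_less_exp] show ?thesis
   unfolding borrow_def carry_def m by blast
 qed
 then show ?thesis using bit_add[of d b j] unfolding a[symmetric] d_def[symmetric] by auto
qed

lemma PT_concat_const:
 "(\<And>a. a \<in> set as ==> PT (f a)) ==> PT (%x. concat (map (%a. f a x) as))"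
 by (induction as) (auto intro: PT_const PT_append)

lemma PT_poly [pt]: "PT f ==> PT (%x. poly q (f x) :: nat)"
 by (induction q) (auto intro: PT_const PT_add PT_mult)

lemma poly_nat_mono: "a \<le> b ==> poly q a \<le> poly q (b :: nat)"
 by (induction q) (auto intro: add_mono mult_mono)

lemma bit_less: "bit n j ==> j < (n :: nat)"
proof -
 assume "bit n j"
 then have "odd (n div 2 ^ j)" by (simp add: bit_iff_odd)
 then have "2 ^ j \<le> n" by (metis div_less even_zero not_le)
 then show ?thesis using less_exp[of j] by linarith
qed

text \<open>For fixed \<open>n\<close> only finitely many positions matter, so the bit can be looked
  up in a constant list even though \<open>j\<close> is part of the input.\<close>

definition cbit :: "nat => nat => nat" where
 "cbit n j = (if j \<in> set (filter (bit n) [0..<n]) then 1 else 0)"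

lemma PT_cbit [pt]: "PT f ==> PT (%x. cbit n (f x))"
 unfolding cbit_def by (intro pt)

lemma opr_cbit [simp]: "opr (cbit n j) bs = bit n j"
 by (auto simp: cbit_def opr_def Let_def dest: bit_less)

fun fst_arg :: "instr => nat" where
 "fst_arg (Add i j k) = j"
| "fst_arg (Sub i j k) = j"
| "fst_arg (Load i j) = j"
| "fst_arg (Store i j) = i"
| "fst_arg (Jump i l) = i"
| "fst_arg (Print i) = i"
| "fst_arg (Const i n) = 0"
| "fst_arg (Read i) = 0"

fun snd_arg :: "instr => nat" where
 "snd_arg (Add i j k) = k"
| "snd_arg (Sub i j k) = k"
| "snd_arg (Store i j) = j"
| "snd_arg _ = 0"

fun dest :: "instr => nat" where
 "dest (Add i j k) = i"
| "dest (Sub i j k) = i"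
| "dest (Load i j) = i"
| "dest (Const i n) = i"
| "dest (Read i) = i"
| "dest _ = 0"

definition "writes q \<longleftrightarrow> (case q of Jump _ _ => False | Print _ => False | _ => True)"
definition "is_load q \<longleftrightarrow> (case q of Load _ _ => True | _ => False)"
definition "is_store q \<longleftrightarrow> (case q of Store _ _ => True | _ => False)"
definition "is_read q \<longleftrightarrow> (case q of Read _ => True | _ => False)"
definition "is_print q \<longleftrightarrow> (case q of Print _ => True | _ => False)"
lemmas kinds = writes_def is_load_def is_store_def is_read_def is_print_def

text \<open>Outside of the program, a jump to its end makes halting a step like any other.\<close>

definition ins :: "program => nat => instr" where
 "ins p l = (if l < length p then p ! l else Jump 0 (length p))"

section \<open>A run of the machine as values of tableau variables\<close>

locale machine =
 fixes p :: program and z :: "bool list"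
begin

definition "cf s = (step p ^^ s) (init_config z)"
definition "pos s = min (length p) (pc (cf s))"
definition "q s = ins p (pos s)"
text \<open>Operand 2 of \<open>Load\<close> is the register whose address is stored in operand 0.
  In this way, indirect reading is an ordinary operand with a computed address.\<close>

definition "ad r s = (if r = (0::nat) then fst_arg (q s)
 else if is_load (q s) then regs (cf s) (fst_arg (q s)) else snd_arg (q s))"
definition "vl r s = regs (cf s) (ad r s)"
definition "wa s = (if is_store (q s) then vl 0 s else dest (q s))"
definition "rdv s = (case inp (cf s) of [] => 2 | b # _ => (of_bool b :: nat))"
definition "wv s = (case q s of Const _ n => n | Add _ _ _ => vl 0 s + vl 2 s | Sub _ _ _ => vl 0 s - vl 2 s
 | Load _ _ => vl 2 s | Store _ _ => vl 2 s | Read _ => rdv s | _ => 0)"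
definition "ip s = length (filter (%s'. is_read (q s')) [0..<s])"

lemma cf_0: "cf 0 = init_config z"
 by (simp add: cf_def)

lemma cf_Suc: "cf (Suc s) = step p (cf s)"
 by (simp add: cf_def)

lemma
 shows regs_Suc: "regs (cf (Suc s)) a = (if writes (q s) & a = wa s then wv s else regs (cf s) a)"
  and inp_Suc: "inp (cf (Suc s)) = (if is_read (q s) then tl (inp (cf s)) else inp (cf s))"
  and outp_Suc: "outp (cf (Suc s)) = outp (cf s) @ (if is_print (q s) then [0 < vl 0 s] else [])"
  and pos_Suc: "pos (Suc s) = min (length p)
   (case q s of Jump _ l => if 0 < vl 0 s then l else Suc (pos s) | _ => Suc (pos s))"
proof -
 have "regs (cf (Suc s)) a = (if writes (q s) & a = wa s then wv s else regs (cf s) a) &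
  inp (cf (Suc s)) = (if is_read (q s) then tl (inp (cf s)) else inp (cf s)) &
  outp (cf (Suc s)) = outp (cf s) @ (if is_print (q s) then [0 < vl 0 s] else []) &
  pos (Suc s) = min (length p) (case q s of Jump _ l => if 0 < vl 0 s then l else Suc (pos s) | _ => Suc (pos s))"
 proof (cases "halted p (cf s)")
  case True
  then have "q s = Jump 0 (length p)" "pos s = length p" by (auto simp: q_def pos_def ins_def halted_def)
  then show ?thesis using True by (simp add: cf_Suc step_def kinds pos_def)
 next
  case False
  then have "pos s = pc (cf s)" "q s = p ! pc (cf s)" by (auto simp: q_def pos_def ins_def halted_def)
  then show ?thesis using False
   by (cases "p ! pc (cf s)") (auto simp: cf_Suc step_def kinds wa_def wv_def vl_def ad_def rdv_def pos_def[of "Suc s"]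
     split: list.splits)
 qed
 then show "regs (cf (Suc s)) a = (if writes (q s) & a = wa s then wv s else regs (cf s) a)"
  "inp (cf (Suc s)) = (if is_read (q s) then tl (inp (cf s)) else inp (cf s))"
  "outp (cf (Suc s)) = outp (cf s) @ (if is_print (q s) then [0 < vl 0 s] else [])"
  "pos (Suc s) = min (length p) (case q s of Jump _ l => if 0 < vl 0 s then l else Suc (pos s) | _ => Suc (pos s))"
  by blast+
qed

lemma ip_Suc: "ip (Suc s) = (if is_read (q s) then Suc (ip s) else ip s)"
 by (simp add: ip_def)

lemma ip_le: "ip s \<le> s"
 unfolding ip_def by (metis diff_zero length_filter_le length_upt)

lemma inp_cf: "inp (cf s) = drop (ip s) z"
 by (induction s) (auto simp: inp_Suc ip_Suc cf_0 ip_def[of 0] init_config_def drop_Suc tl_drop)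

lemma rdv: "rdv s = (if ip s < length z then of_bool (z ! ip s) else 2)"
 by (auto simp: rdv_def inp_cf Cons_nth_drop_Suc[symmetric])

text \<open>
 The value of each variable of the tableau in the run on \<open>z\<close>.  The code \<open>v ! 0\<close> stands for: 2 input bit, 3 input bit
 present, 4 program position, 5 number of bits read, 6 accepted, 7 operand address (operand \<open>0\<close> or \<open>2\<close> of step \<open>a\<close>),
 8 the step \<open>c\<close> wrote to an address with the same low bits, 9 content of that address before step \<open>c\<close>, 10 operand nonzero,
 11 carry, 12 borrow, 13 bit being read, 14 to 16 writing, its address and its value.
\<close>

definition actual :: "name => bool" where
 "actual v = (let k = v ! 0; a = v ! 1; b = v ! 2; c = v ! 3; d = v ! 4 in
   if k = 2 then a < length z & z ! a
   else if k = 3 then a < length z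
   else if k = 4 then pos a = b
   else if k = 5 then ip a = b
   else if k = 6 then True \<in> set (outp (cf a))
   else if k = 7 then bit (ad a b) c
   else if k = 8 then writes (q c) & take_bit d (ad a b) = take_bit d (wa c)
   else if k = 9 then bit (regs (cf c) (ad a b)) d
   else if k = 10 then 0 < take_bit b (vl 0 a)
   else if k = 11 then carry b (vl 0 a) (vl 2 a)
   else if k = 12 then borrow b (vl 0 a) (vl 2 a)
   else if k = 13 then (if b = 0 then ip a < length z & z ! ip a else \<not> ip a < length z)
   else if k = 14 then writes (q a)
   else if k = 15 then bit (wa a) b
   else bit (wv a) b)"

lemma actual [simp]:
 "actual [2, i] = (i < length z & z ! i)"
 "actual [3, i] = (i < length z)"
 "actual [4, s, l] = (pos s = l)"
 "actual [5, s, i] = (ip s = i)"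
 "actual [6, s] = (True \<in> set (outp (cf s)))"
 "actual [7, r, s, j] = bit (ad r s) j"
 "actual [8, r, s, s', j] = (writes (q s') & take_bit j (ad r s) = take_bit j (wa s'))"
 "actual [9, r, s, s', j] = bit (regs (cf s') (ad r s)) j"
 "actual [10, s, j] = (0 < take_bit j (vl 0 s))"
 "actual [11, s, j] = carry j (vl 0 s) (vl 2 s)"
 "actual [12, s, j] = borrow j (vl 0 s) (vl 2 s)"
 "actual [13, s, i] = (if i = 0 then ip s < length z & z ! ip s else \<not> ip s < length z)"
 "actual [14, s] = writes (q s)"
 "actual [15, s, j] = bit (wa s) j"
 "actual [16, s, j] = bit (wv s) j"
 by (simp_all add: actual_def Let_def)

end

text \<open>Addresses can be exponentially large, so there are no variables for the memory. The
  content of an operand at step \<open>s\<close> is obtained by replaying all earlier steps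
  \<open>s'\<close>: it starts with 0 and is replaced by the value written whenever the addresses
  agree in all \<open>W\<close> bits.\<close>

definition mem_gates :: "nat => nat => gate list" where
 "mem_gates W s = concat (map (%r.
   concat (map (%s'. ([], [8, r, s, s', 0], [[14, s']], 2) #
    map (%j. ([], [8, r, s, s', Suc j], [[8, r, s, s', j], [7, r, s, j], [15, s', j]], 6)) [0..<W]) [0..<s]) @
   map (%j. ([], [9, r, s, 0, j], [], 0)) [0..<W] @
   concat (map (%s'. map (%j. ([], [9, r, s, Suc s', j], [[8, r, s, s', W], [16, s', j], [9, r, s, s', j]], 7)) [0..<W]) [0..<s]))
   [0, 2])"

definition arith_gates :: "nat => nat => gate list" where
 "arith_gates W s = ([], [10, s, 0], [], 0) # ([], [11, s, 0], [], 0) # ([], [12, s, 0], [], 0) #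
   concat (map (%j.
   [([], [10, s, Suc j], [[10, s, j], [9, 0, s, s, j]], 5),
    ([], [11, s, Suc j], [[9, 0, s, s, j], [9, 2, s, s, j], [11, s, j]], 8),
    ([], [12, s, Suc j], [[9, 0, s, s, j], [9, 2, s, s, j], [12, s, j]], 10)]) [0..<W])"

definition read_gates :: "nat => nat => gate list" where
 "read_gates t s = concat (map (%i. [([[5, s, i]], [13, s, 0], [[2, i]], 2), ([[5, s, i]], [13, s, 2], [[3, i]], 3)]) [0..<t])"

definition value_gate :: "nat => instr => nat => nat => name list \<times> nat" where
 "value_gate W q s j = (case q of Const _ n => ([], cbit n j)
   | Add _ _ _ => ([[9, 0, s, s, j], [9, 2, s, s, j], [11, s, j]], 9)
   | Sub _ _ _ => ([[9, 0, s, s, j], [9, 2, s, s, j], [12, s, j], [12, s, W]], 11)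
   | Load _ _ => ([[9, 2, s, s, j]], 2)
   | Store _ _ => ([[9, 2, s, s, j]], 2)
   | Read _ => (if j = 0 then ([[13, s, 0]], 2) else if j = 1 then ([[13, s, 2]], 2) else ([], 0))
   | _ => ([], 0))"

text \<open>Positions are capped at the end of the program; if both successors coincide after this,
  no test of the register is needed.\<close>

definition jump_gate :: "nat => nat => nat => instr => nat => nat => name list \<times> nat" where
 "jump_gate L W l q s l' = (case q of
    Jump _ m =>
     if min L m = min L (Suc l) then ([], if l' = min L m then 1 else 0)
     else if l' = min L m then ([[10, s, W]], 2)
     else if l' = min L (Suc l) then ([[10, s, W]], 3) else ([], 0)
   | _ => ([], if l' = min L (Suc l) then 1 else 0))"

definition instr_gates :: "nat => nat => nat => nat => instr => nat => gate list" where
 "instr_gates L W t l q s =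
   ([[4, s, l]], [14, s], [], if writes q then 1 else 0) #
   ([[4, s, l]], [6, Suc s], if is_print q then [[6, s], [10, s, W]] else [[6, s]], if is_print q then 5 else 2) #
   concat (map (%j.
    [([[4, s, l]], [7, 0, s, j], [], cbit (fst_arg q) j),
    ([[4, s, l]], [7, 2, s, j], if is_load q then [[9, 0, s, s, j]] else [], if is_load q then 2 else cbit (snd_arg q) j),
    ([[4, s, l]], [15, s, j], if is_store q then [[9, 0, s, s, j]] else [], if is_store q then 2 else cbit (dest q) j),
    ([[4, s, l]], [16, s, j], value_gate W q s j)]) [0..<W]) @
   map (%l'. ([[4, s, l]], [4, Suc s, l'], jump_gate L W l q s l')) [0..<Suc L] @
   map (%i. ([[4, s, l]], [5, Suc s, i], if is_read q then if i = 0 then [] else [[5, s, i - Suc 0]] else [[5, s, i]],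
    if is_read q & i = 0 then 0 else 2)) [0..<Suc t]"

definition init_gates :: "nat => nat => gate list" where
 "init_gates L t = ([], [6, 0], [], 0) # map (%l. ([], [4, 0, l], [], if l = 0 then 1 else 0)) [0..<Suc L] @
   map (%i. ([], [5, 0, i], [], if i = 0 then 1 else 0)) [0..<Suc t]"

definition gates :: "program => nat => nat => gate list" where
 "gates p W t = init_gates (length p) t @ concat (map (%s. mem_gates W s @ arith_gates W s @ read_gates t s @
   concat (map (%l. instr_gates (length p) W t l (ins p l) s) [0..<Suc (length p)])) [0..<t])"

lemma PT_value_gate [pt]: "PT W ==> PT s ==> PT j ==> PT (%x. value_gate (W x) q (s x) (j x))"
 by (cases q) (simp_all add: value_gate_def, (intro pt | assumption)+)

lemma PT_jump_gate [pt]: "PT W ==> PT s ==> PT j ==> PT (%x. jump_gate L (W x) l q (s x) (j x))"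
 unfolding jump_gate_def by (cases q) (simp_all del: One_nat_def, (intro pt | assumption)+)

lemma PT_instr_gates [pt]: "PT W ==> PT t ==> PT s ==> PT (%x. instr_gates L (W x) (t x) l q (s x))"
 by (rule PT_comp3[of "%W t s. instr_gates L W t l q s"]) (unfold instr_gates_def, (intro pt | assumption)+)

lemma PT_init_gates [pt]: "PT t ==> PT (%x. init_gates L (t x))"
 by (rule PT_comp[of "init_gates L"]) (unfold init_gates_def, (intro pt | assumption)+)

lemma PT_mem_gates [pt]: "PT W ==> PT s ==> PT (%x. mem_gates (W x) (s x))"
 by (rule PT_comp2[of mem_gates]) (unfold mem_gates_def, (intro pt | assumption)+)

lemma PT_arith_gates [pt]: "PT W ==> PT s ==> PT (%x. arith_gates (W x) (s x))"
 by (rule PT_comp2[of arith_gates]) (unfold arith_gates_def, (intro pt | assumption)+)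

lemma PT_read_gates [pt]: "PT W ==> PT s ==> PT (%x. read_gates (W x) (s x))"
 by (rule PT_comp2[of read_gates]) (unfold read_gates_def, (intro pt | assumption)+)

lemma PT_gates: "PT W ==> PT t ==> PT (%x. gates p (W x) (t x))"
proof (rule PT_comp2[of "%W t. gates p W t"])
 have i: "PT (%y. concat (map (%l. instr_gates (length p) (fst (fst y)) (snd (fst y)) l (ins p l) (snd y)) [0..<Suc (length p)]))"
  by (rule PT_concat_const) (intro pt)
 have "PT (%y. concat (map (%s. mem_gates (fst y) s @ arith_gates (fst y) s @ read_gates (snd y) s @
   concat (map (%l. instr_gates (length p) (fst y) (snd y) l (ins p l) s) [0..<Suc (length p)])) [0..<snd y]))"
  by (intro PT_concat PT_map PT_append i) (intro pt)+
 then show "PT (%y. gates p (fst y) (snd y))"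
  unfolding gates_def by (intro PT_append PT_init_gates PT_snd PT_id)
qed

lemma models_gate_clauses:
 assumes "\<And>g. g \<in> set gs ==> length (fst (snd (snd g))) \<le> 4"
 shows "models \<alpha> (concat (map gate_clauses gs)) \<longleftrightarrow> (\<forall>g\<in>set gs. holds \<alpha> g)"
 using assms by (auto simp: models_concat gate_clauses)

lemma gates_inputs: "\<forall>g\<in>set (gates p W t). length (fst (snd (snd g))) \<le> 4"
proof -
 have v: "length (fst (value_gate W q s j)) \<le> 4" for q s j
  by (cases q) (simp_all add: value_gate_def)
 have j: "length (fst (jump_gate L W l q s j)) \<le> 4" for L l q s j
  by (cases q) (simp_all add: jump_gate_def)
 have "\<forall>g\<in>set (instr_gates L W t l q s). length (fst (snd (snd g))) \<le> 4" for L l q s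
  by (simp add: instr_gates_def v j ball_Un)
 then show ?thesis by (simp add: gates_def init_gates_def mem_gates_def arith_gates_def read_gates_def ball_Un)
qed

lemma take_bit_Suc_eq: "take_bit (Suc j) a = take_bit (Suc j) b \<longleftrightarrow> take_bit j a = take_bit j b & bit a j = bit b j"
 for a b :: nat
proof -
 have "(if p then P else 0) + x = (if q then P else 0) + y \<longleftrightarrow> x = y & p = q" if "x < P" "y < P" for p q and x y P :: nat
  using that by auto
 from this[OF take_bit_nat_less_exp take_bit_nat_less_exp] show ?thesis by (simp add: take_bit_Suc')
qed

lemma take_bit_Suc_pos: "0 < take_bit (Suc j) a \<longleftrightarrow> 0 < take_bit j a \<or> bit a j" for a :: nat
 by (simp add: take_bit_Suc')

lemma opr_simps [simp]: "opr (if c then Suc 0 else 0) bs = c" "opr 0 bs = False" "opr (Suc 0) bs = True" "opr 2 [a] = a" "opr 3 [a] = (\<not> a)"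
 "opr 5 [a, b] = (a \<or> b)" "opr 6 [a, b, c] = (a & b = c)" "opr 7 [a, b, c] = (if a then b else c)"
 "opr 8 [a, b, c] = (a & b \<or> a & c \<or> b & c)" "opr 9 [a, b, c] = (a = (b = c))"
 "opr 10 [a, b, c] = (\<not> a & (b \<or> c) \<or> b & c)" "opr 11 [a, b, c, d] = (\<not> d & a = (b = c))"
 by (auto simp: opr_def Let_def nth_def0_def numeral_eq_Suc)


lemma mem_gatesI:
 assumes "r \<in> {0, 2}"
 shows "s' < s ==> ([], [8, r, s, s', 0], [[14, s']], 2) \<in> set (mem_gates W s)"
  and "s' < s ==> j < W ==>
   ([], [8, r, s, s', Suc j], [[8, r, s, s', j], [7, r, s, j], [15, s', j]], 6) \<in> set (mem_gates W s)"
  and "j < W ==> ([], [9, r, s, 0, j], [], 0) \<in> set (mem_gates W s)"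
  and "s' < s ==> j < W ==>
   ([], [9, r, s, Suc s', j], [[8, r, s, s', W], [16, s', j], [9, r, s, s', j]], 7) \<in> set (mem_gates W s)"
 using assms by (auto simp: mem_gates_def image_iff)

lemma arith_gatesI:
 "([], [10, s, 0], [], 0) \<in> set (arith_gates W s)"
 "([], [11, s, 0], [], 0) \<in> set (arith_gates W s)"
 "([], [12, s, 0], [], 0) \<in> set (arith_gates W s)"
 "j < W ==> ([], [10, s, Suc j], [[10, s, j], [9, 0, s, s, j]], 5) \<in> set (arith_gates W s)"
 "j < W ==> ([], [11, s, Suc j], [[9, 0, s, s, j], [9, 2, s, s, j], [11, s, j]], 8) \<in> set (arith_gates W s)"
 "j < W ==> ([], [12, s, Suc j], [[9, 0, s, s, j], [9, 2, s, s, j], [12, s, j]], 10) \<in> set (arith_gates W s)"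
 by (auto simp: arith_gates_def)

lemma holds_pair: "holds \<alpha> (gs, v, g) \<longleftrightarrow> ((\<forall>g\<in>set gs. \<alpha> g) --> \<alpha> v = opr (snd g) (map \<alpha> (fst g)))"
 by (simp add: holds_def split: prod.split)

locale bounded = machine +
 fixes W t :: nat
 assumes small: "s \<le> t ==> regs (cf s) a < 2 ^ W"
  and args: "fst_arg (ins p l) < 2 ^ W" "snd_arg (ins p l) < 2 ^ W" "dest (ins p l) < 2 ^ W"
begin

lemma ad_less: "s \<le> t ==> take_bit W (ad r s) = ad r s"
 by (simp add: ad_def q_def args small take_bit_nat_eq_self)

lemma vl_less: "s \<le> t ==> take_bit W (vl r s) = vl r s"
 by (simp add: vl_def small take_bit_nat_eq_self)

lemma wa_less: "s \<le> t ==> take_bit W (wa s) = wa s"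
 by (simp add: wa_def vl_less) (simp add: q_def args take_bit_nat_eq_self)

lemma value_gate: "s < t ==> opr (snd (value_gate W (q s) s j)) (map actual (fst (value_gate W (q s) s j))) = bit (wv s) j"
proof (cases "q s")
 case (Sub a b c)
 assume "s < t"
 then have "borrow W (vl 0 s) (vl 2 s) \<longleftrightarrow> vl 0 s < vl 2 s" by (simp add: borrow_def vl_less)
 then show ?thesis using Sub bit_sub[of "vl 2 s" "vl 0 s" j]
  by (cases "vl 0 s < vl 2 s") (auto simp: value_gate_def wv_def vl_def[symmetric])
next
 case (Read a)
 have "bit (of_bool b :: nat) j \<longleftrightarrow> j = 0 & b" "bit (2 :: nat) j \<longleftrightarrow> j = 1" for b
  using bit_exp_iff[of 1 j, where ?'a = nat] by (auto simp: bit_of_bool_iff)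
 then show ?thesis using Read by (auto simp: value_gate_def wv_def rdv)
qed (auto simp: value_gate_def wv_def vl_def[symmetric] bit_add)

lemma jump_gate:
 assumes "s < t"
 shows "opr (snd (jump_gate (length p) W (pos s) (q s) s l)) (map actual (fst (jump_gate (length p) W (pos s) (q s) s l))) =
  (pos (Suc s) = l)"
 using assms by (cases "q s") (auto simp: jump_gate_def pos_Suc vl_less)

lemma actual_gates: "\<forall>g\<in>set (gates p W t). holds actual g"
proof -
 have "\<forall>g\<in>set (init_gates (length p) t). holds actual g"
 proof -
  have "pos 0 = 0" "ip 0 = 0" "outp (cf 0) = []" by (simp_all add: pos_def ip_def cf_0 init_config_def)
  then show ?thesis by (auto simp: init_gates_def holds_def ball_Un)
 qed
 moreover have "\<forall>g\<in>set (mem_gates W s). holds actual g" if "s < t" for s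
  using that by (auto simp: mem_gates_def holds_def ball_Un take_bit_Suc_eq cf_0 init_config_def regs_Suc ad_less wa_less)
 moreover have "\<forall>g\<in>set (arith_gates W s). holds actual g" if "s < t" for s
  using that by (auto simp: arith_gates_def holds_def vl_def[symmetric] take_bit_Suc_pos carry_Suc borrow_Suc)
    (auto simp: carry_def borrow_def)
 moreover have "\<forall>g\<in>set (read_gates t s). holds actual g" for s
  by (auto simp: read_gates_def holds_def)
 moreover have "\<forall>g\<in>set (instr_gates (length p) W t l (ins p l) s). holds actual g" if "s < t" for l s
 proof (cases "pos s = l")
  case True
  then have q: "ins p l = q s" by (simp add: q_def)
  show ?thesis using that True value_gate[OF that] jump_gate[OF that] vl_less[of s 0]
   unfolding q instr_gates_def
   by (auto simp: holds_pair outp_Suc vl_less ip_Suc ad_def wa_def vl_def split: if_splits)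
 next
  case False
  then show ?thesis by (auto simp: instr_gates_def holds_def)
 qed
 ultimately show ?thesis by (simp add: gates_def ball_Un)
qed

text \<open>The gates are deterministic. By induction on the step, with all earlier writes and the
  present position known, they fix in turn the first operand, the second one (whose address may
  depend on the first), the arithmetic, the write and the next position. Within \<open>t\<close>
  steps only the first \<open>t\<close> input bits can be read.\<close>

lemma forced:
 assumes \<alpha>: "\<forall>g\<in>set (gates p W t). holds \<alpha> g"
  and inp: "\<And>i. i < t ==> \<alpha> [2, i] = actual [2, i]" "\<And>i. i < t ==> \<alpha> [3, i] = actual [3, i]"
 shows "\<alpha> [6, t] \<longleftrightarrow> True \<in> set (outp (cf t))"
proof -
 \<comment> \<open>A gate determines its target as soon as its guards hold in the actual run, so it
   is applied only at the actual position and input index.\<close>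
 have det: "\<alpha> v = actual v" if "(gs, v, is, k) \<in> set (gates p W t)" "\<forall>g\<in>set gs. \<alpha> g = actual g & actual g"
  "\<forall>u\<in>set is. \<alpha> u = actual u" for gs v "is" k
 proof -
  have m: "map \<alpha> is = map actual is" using that(3) by simp
  have "holds \<alpha> (gs, v, is, k)" "holds actual (gs, v, is, k)" using that(1) \<alpha> actual_gates by blast+
  then show ?thesis using that(2) m by (simp add: holds_def del: map_eq_conv)
 qed
 have initI: "g \<in> set (gates p W t)" if "g \<in> set (init_gates (length p) t)" for g
  using that by (simp add: gates_def)
 have memI: "g \<in> set (gates p W t)" if "s < t" "g \<in> set (mem_gates W s)" for g s
  using that by (auto simp: gates_def)
 have arithI: "g \<in> set (gates p W t)" if "s < t" "g \<in> set (arith_gates W s)" for g s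
  using that by (auto simp: gates_def)
 have readI: "g \<in> set (gates p W t)" if "s < t" "g \<in> set (read_gates t s)" for g s
  using that by (auto simp: gates_def)
 have instrI: "g \<in> set (gates p W t)" if "s < t" "g \<in> set (instr_gates (length p) W t (pos s) (q s) s)" for g s
 proof -
  have "pos s \<in> set [0..<Suc (length p)]" by (simp add: pos_def less_Suc_eq_le del: upt_Suc)
  then have "g \<in> set (concat (map (%l. instr_gates (length p) W t l (ins p l) s) [0..<Suc (length p)]))"
   using that(2) unfolding q_def set_concat set_map by blast
  then show ?thesis using that(1) by (auto simp: gates_def)
 qed
 let ?ok = "%v. \<alpha> v = actual v"
 have "s \<le> t ==> (\<forall>l\<le>length p. ?ok [4, s, l]) & (\<forall>i\<le>t. ?ok [5, s, i]) & ?ok [6, s] &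
  (\<forall>s'<s. ?ok [14, s'] & (\<forall>j<W. ?ok [15, s', j] & ?ok [16, s', j]))" for s
 proof (induction s)
  case 0
  have "?ok [4, 0, l]" if "l \<le> length p" for l
   by (rule det[OF initI, of "[]" _ "[]" "if l = 0 then 1 else 0"]) (use that in \<open>auto simp: init_gates_def\<close>)
  moreover have "?ok [5, 0, i]" if "i \<le> t" for i
   by (rule det[OF initI, of "[]" _ "[]" "if i = 0 then 1 else 0"]) (use that in \<open>auto simp: init_gates_def\<close>)
  moreover have "?ok [6, 0]"
   by (rule det[OF initI, of "[]" _ "[]" 0]) (auto simp: init_gates_def)
  ultimately show ?case by blast
 next
  case (Suc s)
  then have s: "s < t" by simp
  have IH: "\<forall>l\<le>length p. ?ok [4, s, l]" "\<forall>i\<le>t. ?ok [5, s, i]" "?ok [6, s]"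
   "\<forall>s'<s. ?ok [14, s'] & (\<forall>j<W. ?ok [15, s', j] & ?ok [16, s', j])" using Suc by simp_all
  have g4: "\<alpha> [4, s, pos s] = actual [4, s, pos s] & actual [4, s, pos s]" using IH(1) by (simp add: pos_def)
  have cur: "\<forall>s'\<le>s. \<forall>j<W. ?ok [9, r, s, s', j]" if r: "r \<in> {0, 2}" and ad: "\<forall>j<W. ?ok [7, r, s, j]" for r
  proof -
   have r': "r \<in> set [0, 2]" using r by simp
   have eq: "j \<le> W ==> ?ok [8, r, s, s', j]" if s': "s' < s" for s' j
   proof (induction j)
    case 0
    show ?case by (rule det[OF memI[OF s mem_gatesI(1)[OF r s']]]) (use s' IH(4) in \<open>simp_all del: actual\<close>)
   next
    case (Suc j)
    then have "j < W" by simp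
    then show ?case by (intro det[OF memI[OF s mem_gatesI(2)[OF r s']]])
     (use Suc s' ad IH(4) in \<open>simp_all del: actual\<close>)
   qed
   have "s' \<le> s ==> ?ok [9, r, s, s', j]" if j: "j < W" for s' j
   proof (induction s')
    case 0
    show ?case by (rule det[OF memI[OF s mem_gatesI(3)[OF r j]]]) simp_all
   next
    case (Suc s')
    then have "s' < s" by simp
    then show ?case by (intro det[OF memI[OF s mem_gatesI(4)[OF r _ j]]])
     (use Suc j eq IH(4) in \<open>simp_all del: actual\<close>)
   qed
   then show ?thesis by blast
  qed
  have "?ok [7, 0, s, j]" if "j < W" for j
   by (rule det[OF instrI[OF s], of "[[4, s, pos s]]" _ "[]" "cbit (fst_arg (q s)) j"])
    (use that g4 in \<open>auto simp: instr_gates_def simp del: actual\<close>)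
  then have c0: "?ok [9, 0, s, s, j]" if "j < W" for j using cur[of 0] that by simp
  have "?ok [7, 2, s, j]" if "j < W" for j
   by (rule det[OF instrI[OF s], of "[[4, s, pos s]]" _ "if is_load (q s) then [[9, 0, s, s, j]] else []"
     "if is_load (q s) then 2 else cbit (snd_arg (q s)) j"])
    (use that g4 c0 in \<open>auto simp: instr_gates_def simp del: actual\<close>)
  then have c2: "?ok [9, 2, s, s, j]" if "j < W" for j using cur[of 2] that by simp
  have nz: "j \<le> W ==> ?ok [10, s, j]" for j
  proof (induction j)
   case 0
   show ?case by (rule det[OF arithI[OF s arith_gatesI(1)]]) simp_all
  next
   case (Suc j)
   then have "j < W" by simp
   then show ?case by (intro det[OF arithI[OF s arith_gatesI(4)]]) (use Suc c0 in \<open>simp_all del: actual\<close>)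
  qed
  have cy: "j \<le> W ==> ?ok [11, s, j]" for j
  proof (induction j)
   case 0
   show ?case by (rule det[OF arithI[OF s arith_gatesI(2)]]) simp_all
  next
   case (Suc j)
   then have "j < W" by simp
   then show ?case by (intro det[OF arithI[OF s arith_gatesI(5)]]) (use Suc c0 c2 in \<open>simp_all del: actual\<close>)
  qed
  have bo: "j \<le> W ==> ?ok [12, s, j]" for j
  proof (induction j)
   case 0
   show ?case by (rule det[OF arithI[OF s arith_gatesI(3)]]) simp_all
  next
   case (Suc j)
   then have "j < W" by simp
   then show ?case by (intro det[OF arithI[OF s arith_gatesI(6)]]) (use Suc c0 c2 in \<open>simp_all del: actual\<close>)
  qed
  have i: "ip s < t" using ip_le[of s] s by simp
  have g5: "\<alpha> [5, s, ip s] = actual [5, s, ip s] & actual [5, s, ip s]" using IH(2) i by simp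
  have rd0: "?ok [13, s, 0]"
   by (rule det[OF readI[OF s], of "[[5, s, ip s]]" _ "[[2, ip s]]" 2])
    (use g5 i inp in \<open>auto simp: read_gates_def simp del: actual\<close>)
  have rd2: "?ok [13, s, 2]"
   by (rule det[OF readI[OF s], of "[[5, s, ip s]]" _ "[[3, ip s]]" 3])
    (use g5 i inp in \<open>auto simp: read_gates_def simp del: actual\<close>)
  have "?ok [14, s]"
   by (rule det[OF instrI[OF s], of "[[4, s, pos s]]" _ "[]" "if writes (q s) then 1 else 0"])
    (use g4 in \<open>auto simp: instr_gates_def simp del: actual\<close>)
  moreover have "?ok [15, s, j]" if "j < W" for j
   by (rule det[OF instrI[OF s], of "[[4, s, pos s]]" _ "if is_store (q s) then [[9, 0, s, s, j]] else []"
     "if is_store (q s) then 2 else cbit (dest (q s)) j"])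
    (use that g4 c0 in \<open>auto simp: instr_gates_def simp del: actual\<close>)
  moreover have "?ok [16, s, j]" if "j < W" for j
  proof (rule det[OF instrI[OF s], of "[[4, s, pos s]]" _ "fst (value_gate W (q s) s j)" "snd (value_gate W (q s) s j)"])
   show "\<forall>u\<in>set (fst (value_gate W (q s) s j)). ?ok u"
    using that c0 c2 cy bo rd0 rd2 by (cases "q s") (auto simp: value_gate_def simp del: actual)
  qed (use that g4 in \<open>auto simp: instr_gates_def simp del: actual\<close>)
  moreover have "?ok [4, Suc s, l]" if "l \<le> length p" for l
  proof (rule det[OF instrI[OF s], of "[[4, s, pos s]]" _ "fst (jump_gate (length p) W (pos s) (q s) s l)"
     "snd (jump_gate (length p) W (pos s) (q s) s l)"])
   show "\<forall>u\<in>set (fst (jump_gate (length p) W (pos s) (q s) s l)). ?ok u"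
    using nz by (cases "q s") (auto simp: jump_gate_def simp del: actual)
  qed (use that g4 in \<open>auto simp: instr_gates_def image_iff less_Suc_eq_le simp del: actual upt_Suc\<close>)
  moreover have "?ok [5, Suc s, i]" if "i \<le> t" for i
   by (rule det[OF instrI[OF s], of "[[4, s, pos s]]" _
     "if is_read (q s) then if i = 0 then [] else [[5, s, i - Suc 0]] else [[5, s, i]]"
     "if is_read (q s) & i = 0 then 0 else 2"])
    (use that g4 IH(2) in \<open>auto simp: instr_gates_def image_iff less_Suc_eq_le simp del: actual upt_Suc\<close>)
  moreover have "?ok [6, Suc s]"
   by (rule det[OF instrI[OF s], of "[[4, s, pos s]]" _ "if is_print (q s) then [[6, s], [10, s, W]] else [[6, s]]"
     "if is_print (q s) then 5 else 2"])
    (use g4 IH(3) nz in \<open>auto simp: instr_gates_def simp del: actual\<close>)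
  ultimately show ?case using IH(4) by (simp add: less_Suc_eq del: actual)
 qed
 from this[of t] show ?thesis by simp
qed

end


text \<open>A number is smaller than 2 to its own power, so the sum of all constants is a sufficient
  number of bits. The additional 2 makes room for the value 2 of an exhausted
  \<open>Read\<close>.\<close>

definition prog_width :: "program => nat" where
 "prog_width p = Suc (Suc (\<Sum>q\<leftarrow>p. fst_arg q + snd_arg q + dest q + (case q of Const _ n => n | _ => 0)))"

lemma prog_width:
 assumes "l < length p"
 shows "fst_arg (p ! l) < 2 ^ prog_width p" "snd_arg (p ! l) < 2 ^ prog_width p" "dest (p ! l) < 2 ^ prog_width p"
  "p ! l = Const i n ==> n < 2 ^ prog_width p"
proof -
 let ?f = "%q. fst_arg q + snd_arg q + dest q + (case q of Const _ n => n | _ => 0)"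
 have "?f (p ! l) \<le> sum_list (map ?f p)" using assms by (intro member_le_sum_list) auto
 then have "?f (p ! l) < prog_width p" unfolding prog_width_def by (simp only: less_Suc_eq_le)
 then have *: "?f (p ! l) < 2 ^ prog_width p" using less_exp[of "prog_width p"] by linarith
 show "fst_arg (p ! l) < 2 ^ prog_width p" "snd_arg (p ! l) < 2 ^ prog_width p" "dest (p ! l) < 2 ^ prog_width p"
  using * by linarith+
 show "p ! l = Const i n ==> n < 2 ^ prog_width p" using * by simp
qed

context machine
begin

text \<open>The largest value that a step can create from registers is a sum of two, which adds at
  most one bit.\<close>

lemma regs_less: "regs (cf s) a < 2 ^ (prog_width p + s)"
proof (induction s arbitrary: a)
 case 0
 then show ?case by (simp add: cf_0 init_config_def)
next
 case (Suc s)
 have l: "n < 2 ^ prog_width p ==> n < 2 ^ (prog_width p + Suc s)" "n < 2 ^ (prog_width p + s) ==> n < 2 ^ (prog_width p + Suc s)" for n :: nat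
  using power_increasing[of "prog_width p" "prog_width p + Suc s" "2::nat"]
   power_increasing[of "prog_width p + s" "prog_width p + Suc s" "2::nat"] by simp_all
 have v: "vl r s < 2 ^ (prog_width p + s)" for r unfolding vl_def by (rule Suc.IH)
 have "wv s < 2 ^ (prog_width p + Suc s)"
 proof (cases "q s")
  case (Const i n)
  then have "pos s < length p" "p ! pos s = Const i n" by (auto simp: q_def ins_def split: if_splits)
  then have "n < 2 ^ prog_width p" using prog_width(4) by blast
  then show ?thesis using Const l by (simp add: wv_def)
 next
  case (Read i)
  have "2 ^ Suc (Suc 0) \<le> (2::nat) ^ prog_width p" unfolding prog_width_def by (intro power_increasing) auto
  then have "rdv s < 2 ^ prog_width p" by (auto simp: rdv)
  then show ?thesis using Read l by (simp add: wv_def)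
 next
  case (Add i j k)
  then show ?thesis using v[of 0] v[of 2] by (simp add: wv_def)
 next
  case (Sub i j k)
  then show ?thesis using v[of 0] by (simp add: wv_def)
 qed (use v[of 2] in \<open>auto simp: wv_def\<close>)
 then show ?case using Suc.IH[of a] l(2) by (simp add: regs_Suc del: power_Suc add_Suc_right)
qed

lemma bounded: "bounded p z (prog_width p + t) t"
proof
 fix s a l
 show "regs (cf s) a < 2 ^ (prog_width p + t)" if "s \<le> t"
  using regs_less[of s a] power_increasing[of "prog_width p + s" "prog_width p + t" "2::nat"] that
  by (simp del: power_increasing_iff)
 have "2 ^ prog_width p \<le> (2 :: nat) ^ (prog_width p + t)" by (intro power_increasing) auto
 then show "fst_arg (ins p l) < 2 ^ (prog_width p + t)" "snd_arg (ins p l) < 2 ^ (prog_width p + t)" "dest (ins p l) < 2 ^ (prog_width p + t)"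
  using prog_width(1-3)[of l p] by (auto simp: ins_def intro: less_le_trans)
qed

end

section \<open>The tableau formula and its correctness\<close>

definition input_clauses :: "bool list => nat => nat => nclause list" where
 "input_clauses pre M t = (let n = length pre + M in
   [([3, n], False)] #
   map (%i. [([2, i], nth_def0 False pre i)]) [0..<length pre] @ map (%i. [([3, i], True)]) [0..<length pre] @
   map (%i. [([3, i], True), ([2, i], False)]) [0..<n + t] @ map (%i. [([3, i], True), ([3, Suc i], False)]) [0..<n + t])"

lemma input_clauses_iff:
 "models \<alpha> (input_clauses pre M t) \<longleftrightarrow> \<not> \<alpha> [3, length pre + M] & (\<forall>i<length pre. \<alpha> [2, i] = pre ! i & \<alpha> [3, i]) &
  (\<forall>i<length pre + M + t. (\<alpha> [2, i] --> \<alpha> [3, i]) & (\<alpha> [3, Suc i] --> \<alpha> [3, i]))"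
 by (auto simp: models_def input_clauses_def Let_def ball_Un)

definition tableau :: "program => bool list => nat => nat => nclause list" where
 "tableau p pre M t = input_clauses pre M t @ concat (map gate_clauses (gates p (prog_width p + t) t)) @ [[([6, t], True)]]"

lemma PT_tableau: "PT pre ==> PT M ==> PT t ==> PT (%x. tableau p (pre x) (M x) (t x))"
proof (rule PT_comp3[of "%pre M t. tableau p pre M t"])
 have i: "PT (%x. input_clauses (fst x) (fst (snd x)) (snd (snd x)))" unfolding input_clauses_def by (intro pt)
 have g: "PT (%x :: bool list \<times> nat \<times> nat. gates p (prog_width p + snd (snd x)) (snd (snd x)))" by (intro PT_gates) (intro pt)+
 show "PT (%x. tableau p (fst x) (fst (snd x)) (snd (snd x)))"
  unfolding tableau_def by (intro PT_append i PT_concat PT_map g PT_gate_clauses) (intro pt)+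
qed

text \<open>The variables \<open>[3, i]\<close> form an initial segment whose length is the length
  of the input, so certificates of all lengths up to \<open>M\<close> are covered by one formula.
  The clauses extend to \<open>n + t\<close> in order to settle every position the machine can look
  at.\<close>

lemma tableau_iff:
 "(\<exists>\<alpha>. models \<alpha> (tableau p pre M t)) \<longleftrightarrow>
  (\<exists>w. length w \<le> M & True \<in> set (outp ((step p ^^ t) (init_config (pre @ w)))))"
proof
 assume "\<exists>\<alpha>. models \<alpha> (tableau p pre M t)"
 then obtain \<alpha> where \<alpha>: "models \<alpha> (tableau p pre M t)" by blast
 then have g: "\<forall>g\<in>set (gates p (prog_width p + t) t). holds \<alpha> g"
  using gates_inputs models_gate_clauses[of "gates p (prog_width p + t) t"] by (simp add: tableau_def)
 have i: "\<not> \<alpha> [3, length pre + M]" "\<And>i. i < length pre ==> \<alpha> [2, i] = pre ! i & \<alpha> [3, i]"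
  "\<And>i. i < length pre + M + t ==> \<alpha> [2, i] ==> \<alpha> [3, i]"
  "\<And>i. i < length pre + M + t ==> \<alpha> [3, Suc i] ==> \<alpha> [3, i]"
  using \<alpha> by (simp_all add: tableau_def input_clauses_iff)
 \<comment> \<open>The first absent position, that is, the length of the input read off the
   assignment.\<close>
 define m where "m = (LEAST i. \<not> \<alpha> [3, i])"
 have m: "\<not> \<alpha> [3, m]" "m \<le> length pre + M"
  using i(1) LeastI[of "%i. \<not> \<alpha> [3, i]"] Least_le[of "%i. \<not> \<alpha> [3, i]"] unfolding m_def by blast+
 have "length pre \<le> m" using m(1) i(2) not_le_imp_less by blast
 have less: "\<alpha> [3, j]" if "j < m" for j using not_less_Least that unfolding m_def by blast
 have "d + m \<le> length pre + M + t ==> \<not> \<alpha> [3, d + m]" for d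
  by (induction d) (use m(1) i(4) in auto)
 then have "\<not> \<alpha> [3, j]" if "m \<le> j" "j \<le> length pre + M + t" for j
  using that le_add_diff_inverse2[of m j] by metis
 then have E: "\<alpha> [3, j] \<longleftrightarrow> j < m" if "j < length pre + M + t" for j
  using less[of j] that by (metis less_imp_le not_le)
 define z where "z = map (%i. \<alpha> [2, i]) [0..<m]"
 have "take (length pre) z = pre"
  using \<open>length pre \<le> m\<close> i(2) by (intro nth_equalityI) (auto simp: z_def)
 then have z: "z = pre @ drop (length pre) z" by (metis append_take_drop_id)
 interpret machine p z .
 have "\<alpha> [6, t] \<longleftrightarrow> True \<in> set (outp (cf t))"
 proof (rule bounded.forced[OF bounded g])
  fix j assume "j < t"
  then have j: "j < length pre + M + t" by simp
  show "\<alpha> [3, j] = actual [3, j]" using E[OF j] unfolding actual by (simp add: z_def)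
  show "\<alpha> [2, j] = actual [2, j]" using E[OF j] i(3)[OF j] unfolding actual by (auto simp: z_def)
 qed
 moreover have "\<alpha> [6, t]" using \<alpha> by (simp add: tableau_def models_def ball_Un)
 moreover have "length (drop (length pre) z) \<le> M" using m(2) by (simp add: z_def)
 ultimately show "\<exists>w. length w \<le> M & True \<in> set (outp ((step p ^^ t) (init_config (pre @ w))))"
  unfolding cf_def by (subst (asm) z) blast
next
 assume "\<exists>w. length w \<le> M & True \<in> set (outp ((step p ^^ t) (init_config (pre @ w))))"
 then obtain w where w: "length w \<le> M" "True \<in> set (outp ((step p ^^ t) (init_config (pre @ w))))" by blast
 interpret machine p "pre @ w" .
 have "models actual (concat (map gate_clauses (gates p (prog_width p + t) t)))"
  using gates_inputs models_gate_clauses[of "gates p (prog_width p + t) t"] bounded.actual_gates[OF bounded] by simp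
 moreover have "models actual (input_clauses pre M t)"
  using w(1) by (auto simp: input_clauses_iff nth_append)
 ultimately have "models actual (tableau p pre M t)"
  using w(2) by (simp add: tableau_def) (simp add: models_def cf_def)
 then show "\<exists>\<alpha>. models \<alpha> (tableau p pre M t)" by blast
qed

theorem cook_levin:
 assumes "in_NP A"
 obtains \<Phi> where "PT \<Phi>" "\<And>x. x \<in> A \<longleftrightarrow> (\<exists>\<alpha>. models \<alpha> (\<Phi> x))"
proof -
 obtain V and r :: "nat poly" where V: "polytime_decidable V"
  and A: "\<And>x. x \<in> A \<longleftrightarrow> (\<exists>w. length w \<le> poly r (length x) & enc_pair x w \<in> V)"
  using assms unfolding in_NP_def by blast
 obtain p and s :: "nat poly" where p: "\<And>z. computes_in p z (poly s (length z)) [z \<in> V]"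
  using V unfolding polytime_decidable_def polytime_computable_def by blast
 let ?pre = "%x. concat (map (%b. [True, b]) x) @ [False]"
 let ?M = "%x. poly r (length x)"
 \<comment> \<open>The time bound is evaluated at the longest possible input; halted machines keep
   their output, so it serves for shorter certificates too.\<close>
 let ?t = "%x. poly s (length (?pre x) + ?M x)"
 let ?F = "%x. tableau p (?pre x) (?M x) (?t x)"
 have "PT ?F" by (intro PT_tableau) (intro pt)+
 moreover have "x \<in> A \<longleftrightarrow> (\<exists>\<alpha>. models \<alpha> (?F x))" for x
 proof -
  have "enc_pair x w \<in> V \<longleftrightarrow> True \<in> set (outp ((step p ^^ ?t x) (init_config (?pre x @ w))))"
   if "length w \<le> ?M x" for w
  proof -
   have "computes_in p (enc_pair x w) (?t x) [enc_pair x w \<in> V]"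
    by (rule computes_in_mono[OF p]) (use that in \<open>auto simp: enc_pair_def intro!: poly_nat_mono\<close>)
   then show ?thesis by (auto simp: computes_in_def enc_pair_def)
  qed
  then show ?thesis unfolding tableau_iff A by blast
 qed
 ultimately show ?thesis using that by blast
qed

theorem NP_hard:
 assumes R: "hard_red T R" and A: "in_NP A"
 shows "polytime_reducible A (free_edge_deletion T)"
proof -
 obtain \<Phi> where \<Phi>: "PT \<Phi>" "\<And>x. x \<in> A \<longleftrightarrow> (\<exists>\<alpha>. models \<alpha> (\<Phi> x))" using cook_levin[OF A] by blast
 let ?\<psi> = "%x. split3 (\<Phi> x)"
 \<comment> \<open>Here the number of clauses is a sufficient bound on the occurrences; adding 2
   meets the lower bound in \<open>valid\<close>.\<close>
 let ?I = "%x. (length (cnf_vars (?\<psi> x)), length (?\<psi> x) + 2, to_cnf (?\<psi> x))"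
 have I: "PT ?I" by (intro PT_Pair PT_length PT_cnf_vars PT_split3 PT_add PT_to_cnf PT_const \<Phi>(1))
 have "PT R" using R by (simp add: hard_red_def)
 from PT_enc_ngraph[OF PT_comp[OF this I]] have "PT (%x. enc_ngraph (R (?I x)))" .
 then have "polytime_computable (%x. enc_ngraph (R (?I x)))" by (rule PT_polytime)
 moreover have "x \<in> A \<longleftrightarrow> enc_ngraph (R (?I x)) \<in> free_edge_deletion T" for x
 proof -
  have "x \<in> A \<longleftrightarrow> satisfiable (to_cnf (?\<psi> x))" by (simp add: \<Phi>(2) to_cnf_sat split3_sat)
  also have "\<dots> \<longleftrightarrow> edge_deletable T (gr (fst (R (?I x)))) (snd (R (?I x)))"
  proof -
   have "valid (length (cnf_vars (?\<psi> x))) (length (?\<psi> x) + 2) (to_cnf (?\<psi> x))"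
    by (rule to_cnf_valid) (rule split3_length)
   then show ?thesis using R unfolding hard_red_def by blast
  qed
  also have "\<dots> \<longleftrightarrow> enc_ngraph (R (?I x)) \<in> free_edge_deletion T"
   using enc_ngraph_mem[of "fst (R (?I x))" "snd (R (?I x))" T] by simp
  finally show ?thesis .
 qed
 ultimately show ?thesis unfolding polytime_reducible_def by blast
qed

section \<open>Binary numbers and simulation\<close>

text \<open>Binary numbers, encoded by the list of the positions of their ones.\<close>

datatype bin = Bin (unbin: nat)

lemma bit_le: "bit n j ==> 2 ^ j \<le> (n :: nat)"
 by (metis bit_iff_odd div_less even_zero not_le)

lemma bits_bound: "(\<And>j. bit n j ==> j < m) ==> n < 2 ^ m" for n :: nat
proof -
 assume "\<And>j. bit n j ==> j < m"
 then have "take_bit m n = n" by (intro bit_eqI) (auto simp: bit_take_bit_iff)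
 then show ?thesis by (metis take_bit_nat_less_exp)
qed

lemma filter_upt_eq: "(\<And>j. P j ==> j < a & j < b) ==> filter P [0..<a] = filter P [0..<b]"
proof (induction a b rule: linorder_wlog)
 case (le a b)
 have "[0..<b] = [0..<a] @ [a..<b]" using le(1) by (metis le0 upt_add_eq_append le_Suc_ex add_0)
 moreover have "filter P [a..<b] = []" using le(2) by (fastforce simp: filter_empty_conv)
 ultimately show ?case by simp
qed (metis conj_commute)

definition bits :: "bin => nat list" where
 "bits a = filter (bit (unbin a)) [0..<unbin a]"

lemma set_bits [simp]: "j \<in> set (bits a) \<longleftrightarrow> bit (unbin a) j"
 by (auto simp: bits_def dest: bit_less)

lemma bits_eq: "unbin a < 2 ^ m ==> bits a = filter (bit (unbin a)) [0..<m]"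
proof -
 assume a: "unbin a < 2 ^ m"
 have "j < unbin a & j < m" if j: "bit (unbin a) j" for j
 proof -
  have "2 ^ j < (2::nat) ^ m" using bit_le[OF j] a by linarith
  then show ?thesis using bit_less[OF j] by simp
 qed
 then show ?thesis unfolding bits_def by (rule filter_upt_eq)
qed

instantiation bin :: encodable
begin
definition venc_bin :: "bin => val" where "venc_bin a = venc (bits a)"
instance
proof
 fix a b :: bin
 show "venc a = venc b \<longleftrightarrow> a = b"
 proof
  assume "venc a = venc b"
  then have "bits a = bits b" by (simp add: venc_bin_def)
  then have "bit (unbin a) j = bit (unbin b) j" for j by (metis set_bits)
  then show "a = b" by (auto intro: bit_eqI bin.expand)
 qed simp
qed
end

lemma sz_bin: "unbin a < 2 ^ m ==> sz a \<le> Suc (m * Suc (2 * m + 1))"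
 unfolding venc_bin_def bits_eq by (rule sz_list_le) (auto intro: order_trans[OF length_filter_le])

lemma PT_bits [pt]: "PT f ==> PT (%x. bits (f x))"
 by (erule PT_cast) (simp add: venc_bin_def)

lemma PT_bin: "PT l ==> (\<And>x. l x = bits (g x)) ==> PT g"
 by (erule PT_cast) (simp add: venc_bin_def)

definition badd :: "bin => bin => bin" where "badd a b = Bin (unbin a + unbin b)"
definition bsub :: "bin => bin => bin" where "bsub a b = Bin (unbin a - unbin b)"

text \<open>Solves the ripple recurrence: a signal is present at \<open>j\<close> iff it was
  generated at some \<open>i\<close> and propagated ever since. Bounded quantifiers are available in
  polynomial time, so carries and borrows need no loop.\<close>

lemma chain_iff:
 assumes "\<not> c 0" "\<And>j. c (Suc j) \<longleftrightarrow> g j \<or> h j & c j"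
 shows "c j \<longleftrightarrow> (\<exists>i\<in>set [0..<j]. g i & (\<forall>k\<in>set [0..<j]. i < k --> h k))"
proof (induction j)
 case (Suc j)
 have "(\<exists>i\<in>set [0..<Suc j]. g i & (\<forall>k\<in>set [0..<Suc j]. i < k --> h k)) \<longleftrightarrow>
  g j \<or> h j & (\<exists>i\<in>set [0..<j]. g i & (\<forall>k\<in>set [0..<j]. i < k --> h k))"
  by (auto simp: less_Suc_eq)
 then show ?case using assms(2)[of j] Suc by blast
qed (use assms in simp)

lemma carry_iff: "carry j a b \<longleftrightarrow> (\<exists>i\<in>set [0..<j]. (bit a i & bit b i) & (\<forall>k\<in>set [0..<j]. i < k --> bit a k \<or> bit b k))"
 by (rule chain_iff) (auto simp: carry_Suc, simp add: carry_def)

lemma borrow_iff: "borrow j a b \<longleftrightarrow> (\<exists>i\<in>set [0..<j]. (\<not> bit a i & bit b i) & (\<forall>k\<in>set [0..<j]. i < k --> \<not> bit a k \<or> bit b k))"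
 by (rule chain_iff) (auto simp: borrow_Suc, simp add: borrow_def)

text \<open>A crude length bound: the sum of all \<open>j + 1\<close> over the positions of ones
  exceeds each single position.\<close>

definition blen :: "bin => bin => nat" where
 "blen a b = length (concat (map (%j. replicate (Suc j) ()) (bits a @ bits b)))"

lemma PT_blen: "PT f ==> PT g ==> PT (%x. blen (f x) (g x))"
 by (rule PT_comp2[of blen]) (unfold blen_def, (intro pt | assumption)+)

lemma blen: "unbin a < 2 ^ blen a b" "unbin b < 2 ^ blen a b"
proof -
 have "Suc j \<le> length (concat (map (%j. replicate (Suc j) ()) l))" if "j \<in> set l" for j l
  using that by (induction l) auto
 then have "j < blen a b" if "bit (unbin a) j \<or> bit (unbin b) j" for j
  using that unfolding blen_def by (metis Suc_le_eq Un_iff set_append set_bits)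
 then show "unbin a < 2 ^ blen a b" "unbin b < 2 ^ blen a b" by (auto intro: bits_bound)
qed

lemma PT_badd [pt]: "PT f ==> PT g ==> PT (%x. badd (f x) (g x))"
proof (rule PT_comp2[of badd])
 let ?c = "%p j. \<exists>i\<in>set [0..<j]. (i \<in> set (bits (fst p)) & i \<in> set (bits (snd p))) &
  (\<forall>k\<in>set [0..<j]. i < k --> k \<in> set (bits (fst p)) \<or> k \<in> set (bits (snd p)))"
 have "PT (%p :: bin \<times> bin. filter (%j. (j \<in> set (bits (fst p))) = ((j \<in> set (bits (snd p))) = ?c p j))
   [0..<Suc (blen (fst p) (snd p))])"
  by (intro pt PT_blen)
 then show "PT (%p. badd (fst p) (snd p))"
 proof (rule PT_bin)
  fix p :: "bin \<times> bin"
  have "unbin (badd (fst p) (snd p)) < 2 ^ Suc (blen (fst p) (snd p))"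
   using blen[where a = "fst p" and b = "snd p"] by (simp add: badd_def)
  from bits_eq[OF this]
  show "filter (%j. (j \<in> set (bits (fst p))) = ((j \<in> set (bits (snd p))) = ?c p j))
   [0..<Suc (blen (fst p) (snd p))] = bits (badd (fst p) (snd p))"
   unfolding set_bits carry_iff[symmetric] by (simp add: badd_def bit_add[abs_def] del: upt_Suc)
 qed
qed

lemma PT_bsub [pt]: "PT f ==> PT g ==> PT (%x. bsub (f x) (g x))"
proof (rule PT_comp2[of bsub])
 let ?c = "%p j. \<exists>i\<in>set [0..<j]. (\<not> i \<in> set (bits (fst p)) & i \<in> set (bits (snd p))) &
  (\<forall>k\<in>set [0..<j]. i < k --> \<not> k \<in> set (bits (fst p)) \<or> k \<in> set (bits (snd p)))"
 have "PT (%p :: bin \<times> bin. if ?c p (blen (fst p) (snd p)) then [] else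
   filter (%j. (j \<in> set (bits (fst p))) = ((j \<in> set (bits (snd p))) = ?c p j)) [0..<blen (fst p) (snd p)])"
  by (intro pt PT_blen)
 then show "PT (%p. bsub (fst p) (snd p))"
 proof (rule PT_bin)
  fix p :: "bin \<times> bin"
  let ?m = "blen (fst p) (snd p)"
  have b: "borrow ?m (unbin (fst p)) (unbin (snd p)) \<longleftrightarrow> unbin (fst p) < unbin (snd p)"
   using blen[where a = "fst p" and b = "snd p"] by (simp add: borrow_def take_bit_nat_eq_self)
  have "unbin (bsub (fst p) (snd p)) < 2 ^ ?m" using blen[where a = "fst p" and b = "snd p"] by (simp add: bsub_def)
  from bits_eq[OF this]
  show "(if ?c p ?m then [] else filter (%j. (j \<in> set (bits (fst p))) = ((j \<in> set (bits (snd p))) = ?c p j)) [0..<?m]) =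
   bits (bsub (fst p) (snd p))"
   unfolding set_bits borrow_iff[symmetric] b by (auto simp: bsub_def bit_sub bits_def intro!: filter_cong)
 qed
qed

section \<open>Simulation of a fixed program for a given number of steps\<close>

type_synonym sim = "nat \<times> (bin \<times> bin) list \<times> bool list \<times> bool list"

text \<open>The memory is the history of writes, latest in front; the default 0 is the initial
  content of all registers.\<close>

definition look :: "(bin \<times> bin) list => bin => bin" where
 "look m a = (case filter (%q. fst q = a) m of [] => Bin 0 | q # _ => snd q)"

lemma look_simps [simp]: "look [] a = Bin 0" "look ((a, v) # m) b = (if a = b then v else look m b)"
 by (auto simp: look_def)

lemma PT_look [pt]: "PT m ==> PT a ==> PT (%x. look (m x) (a x))"
 by (rule PT_comp2[of look]) (unfold look_def, (intro pt | assumption)+)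

definition sim_exec :: "instr => sim => sim" where
 "sim_exec q = (%(l, m, z, y). case q of
   Const i n => (Suc l, (Bin i, Bin n) # m, z, y)
  | Add i j k => (Suc l, (Bin i, badd (look m (Bin j)) (look m (Bin k))) # m, z, y)
  | Sub i j k => (Suc l, (Bin i, bsub (look m (Bin j)) (look m (Bin k))) # m, z, y)
  | Load i j => (Suc l, (Bin i, look m (look m (Bin j))) # m, z, y)
  | Store i j => (Suc l, (look m (Bin i), look m (Bin j)) # m, z, y)
  | Jump i l' => (if look m (Bin i) = Bin 0 then Suc l else l', m, z, y)
  | Read i => (case z of [] => (Suc l, (Bin i, Bin 2) # m, z, y) | b # z' => (Suc l, (Bin i, if b then Bin 1 else Bin 0) # m, z', y))
  | Print i => (Suc l, m, z, y @ [\<not> look m (Bin i) = Bin 0]))"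

definition sim_step :: "program => sim => sim" where
 "sim_step p s = (if fst s < length p then sim_exec (p ! fst s) s else s)"

lemma PT_sim_exec: "PT (sim_exec q)"
 by (cases q) (simp_all add: sim_exec_def, (intro pt)+)

text \<open>Dispatch on the program counter: the program is fixed, so this is a finite nest of
  conditionals.\<close>

lemma PT_const_cases:
 fixes L :: nat
 assumes "\<And>l. l < L ==> PT (g l)" "PT d" "PT f"
 shows "PT (%x. if f x < L then g (f x) x else d x)"
 using assms(1)
proof (induction L)
 case (Suc L)
 have "PT (%x. if f x = L then g L x else if f x < L then g (f x) x else d x)"
  using Suc.prems by (intro PT_if[OF PT_eq[OF assms(3) PT_const]] Suc.IH) auto
 moreover have "(if f x = L then g L x else if f x < L then g (f x) x else d x) = (if f x < Suc L then g (f x) x else d x)" for x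
  by auto
 ultimately show ?case by simp
qed (simp add: assms)

lemma PT_sim_step: "PT (sim_step p)"
 unfolding sim_step_def[abs_def] by (rule PT_const_cases) (intro PT_sim_exec pt)+

definition corr :: "sim => config => bool" where
 "corr s c \<longleftrightarrow> fst s = pc c & (\<forall>a. look (fst (snd s)) (Bin a) = Bin (regs c a)) &
   fst (snd (snd s)) = inp c & snd (snd (snd s)) = outp c"

lemma corr_step: "corr s c ==> corr (sim_step p s) (step p c)"
 by (cases s; cases "p ! pc c") (auto simp: corr_def sim_step_def step_def halted_def sim_exec_def badd_def bsub_def split: list.splits)

lemma corr_steps: "corr ((sim_step p ^^ b) (0, [], x, [])) ((step p ^^ b) (init_config x))"
 by (induction b) (auto intro: corr_step, simp add: corr_def init_config_def)

text \<open>The size bounds that make iterating \<open>sim_step\<close> polynomial: per step one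
  more write, one more bit and at most one more output bit.\<close>

definition small :: "program => bool list => nat => sim => bool" where
 "small p x k = (%(l, m, z, y). l \<le> (\<Sum>q\<leftarrow>p. case q of Jump _ l => l | _ => 0) + k & length m \<le> k &
   (\<forall>q\<in>set m. unbin (fst q) < 2 ^ (prog_width p + k) & unbin (snd q) < 2 ^ (prog_width p + k)) &
   sz z \<le> sz x & length y \<le> k)"

lemma look_less: "\<forall>q\<in>set m. unbin (snd q) < 2 ^ w ==> unbin (look m a) < 2 ^ w"
 by (induction m) auto

lemma small_step: "small p x k s ==> small p x (Suc k) (sim_step p s)"
proof -
 assume a: "small p x k s"
 obtain l m z y where s: "s = (l, m, z, y)" by (cases s)
 have lk: "unbin (look m a) < 2 ^ (prog_width p + k)" for a using a by (intro look_less) (auto simp: small_def s)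
 have up: "n < 2 ^ (prog_width p + k) ==> n < 2 * 2 ^ (prog_width p + k)" for n :: nat by simp
 have w: "n < 2 ^ prog_width p ==> n < 2 * 2 ^ (prog_width p + k)" for n :: nat
 proof -
  have "2 ^ prog_width p \<le> (2::nat) ^ (prog_width p + k)" by simp
  then show "n < 2 ^ prog_width p ==> n < 2 * 2 ^ (prog_width p + k)" by linarith
 qed
 have two: "2 < (2::nat) * 2 ^ (prog_width p + k)"
  using one_less_power[of "2::nat" "prog_width p + k"] by (simp add: prog_width_def)
 have m: "\<forall>q\<in>set m. unbin (fst q) < 2 * 2 ^ (prog_width p + k) & unbin (snd q) < 2 * 2 ^ (prog_width p + k)"
  using a up by (auto simp: small_def s)
 show ?thesis
 proof (cases "l < length p")
  case False
  then show ?thesis using a m by (auto simp: sim_step_def small_def s)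
 next
  case True
  note W = prog_width[OF True]
  have j: "l' \<le> (\<Sum>q\<leftarrow>p. case q of Jump _ l => l | _ => 0)" if "p ! l = Jump i l'" for i l'
  proof -
   let ?f = "%q. case q of Jump _ l => l | _ => 0"
   have "?f (p ! l) \<le> sum_list (map ?f p)" using True by (intro member_le_sum_list) auto
   then show ?thesis using that by simp
  qed
  show ?thesis
  proof (cases "p ! l")
   case (Const i n)
   then show ?thesis using a m True W(3) W(4)[OF Const] w by (auto simp: sim_step_def small_def s sim_exec_def)
  next
   case (Add i j k)
   then show ?thesis using a m True W(3) w lk[of "Bin j"] lk[of "Bin k"] by (auto simp: sim_step_def small_def s sim_exec_def badd_def)
  next
   case (Sub i j k)
   then show ?thesis using a m True W(3) w lk[of "Bin j"] by (auto simp: sim_step_def small_def s sim_exec_def bsub_def)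
  next
   case (Load i j)
   then show ?thesis using a m True W(3) w up[OF lk] by (auto simp: sim_step_def small_def s sim_exec_def)
  next
   case (Store i j)
   then show ?thesis using a m True W(3) w up[OF lk] by (auto simp: sim_step_def small_def s sim_exec_def)
  next
   case (Jump i l')
   then show ?thesis using a m True j[OF Jump] by (auto simp: sim_step_def small_def s sim_exec_def)
  next
   case (Read i)
   then show ?thesis using a m True W(3) w two
    by (auto simp: sim_step_def small_def s sim_exec_def split: list.split)
  next
   case (Print i)
   then show ?thesis using a m True by (auto simp: sim_step_def small_def s sim_exec_def)
  qed
 qed
qed

lemma small_steps: "small p x b ((sim_step p ^^ b) (0, [], x, []))"
 by (induction b) (auto intro: small_step, simp add: small_def)

definition simulate :: "program => nat => bool list => sim" where
 "simulate p b x = (sim_step p ^^ b) (0, [], x, [])"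

lemma PT_simulate: "PT b ==> PT x ==> PT (%u. simulate p (b u) (x u))"
proof (rule PT_comp2[of "simulate p"])
 let ?J = "\<Sum>q\<leftarrow>p. case q of Jump _ l => l | _ => 0"
 let ?e = "%u :: nat \<times> bool list. Suc ((prog_width p + fst u) * Suc (2 * (prog_width p + fst u) + 1))"
 let ?B = "%u :: nat \<times> bool list. 2 * (?J + fst u) + 1 + Suc (fst u * Suc (Suc (?e u + ?e u))) + sz (snd u) + Suc (fst u * Suc 3) + 3"
 show "PT (%u. simulate p (fst u) (snd u))" unfolding simulate_def
 proof (rule PT_funpow[where B = ?B])
  show "PT (%u :: (nat \<times> bool list) \<times> sim. sim_step p (snd u))" by (intro PT_comp[OF PT_sim_step] pt)
  fix u :: "nat \<times> bool list" and k assume k: "k \<le> fst u"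
  obtain l m z y where s: "(sim_step p ^^ k) (0, [], snd u, []) = (l, m, z, y)" by (metis prod.exhaust)
  have sm: "l \<le> ?J + k" "length m \<le> k" "sz z \<le> sz (snd u)" "length y \<le> k"
   "\<And>q. q \<in> set m ==> unbin (fst q) < 2 ^ (prog_width p + k) & unbin (snd q) < 2 ^ (prog_width p + k)"
   using small_steps[of p "snd u" k] by (auto simp: s small_def)
  have up: "n < 2 ^ (prog_width p + k) ==> n < 2 ^ (prog_width p + fst u)" for n :: nat
  proof -
   have "2 ^ (prog_width p + k) \<le> (2::nat) ^ (prog_width p + fst u)" using k by simp
   then show "n < 2 ^ (prog_width p + k) ==> n < 2 ^ (prog_width p + fst u)" by linarith
  qed
  have "sz m \<le> Suc (fst u * Suc (Suc (?e u + ?e u)))"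
  proof (rule sz_list_le)
   show "sz q \<le> Suc (?e u + ?e u)" if "q \<in> set m" for q
    using sz_bin[OF up[OF conjunct1[OF sm(5)[OF that]]]] sz_bin[OF up[OF conjunct2[OF sm(5)[OF that]]]]
    by (simp add: venc_prod_def del: mult_Suc mult_Suc_right)
  qed (use sm(2) k in simp)
  moreover have "sz y \<le> Suc (fst u * Suc 3)" by (rule sz_list_le) (use sm(4) k in \<open>auto simp: venc_bool_def\<close>)
  moreover have "sz l \<le> 2 * (?J + fst u) + 1" using sm(1) k by simp
  ultimately show "sz ((sim_step p ^^ k) (0, [], snd u, [])) \<le> ?B u" unfolding s using sm(3) by (simp del: sz_nat mult_Suc mult_Suc_right)
 next
  have f: "pb (%u :: nat \<times> bool list. fst u)" by (rule pb_mono[OF pb_PT[OF PT_fst[OF PT_id]]]) simp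
  show "pb ?B" by (intro pb_add pb_mult pb_Suc pb_const f pb_PT pt)
 qed (intro pt)+
qed

text \<open>The second claim needs no relation between \<open>b\<close> and \<open>t\<close>: a
  halted simulation already shows the final output. This makes answers reliable under any
  budget.\<close>

lemma simulate:
 assumes "computes_in p x t y"
 shows "t \<le> b ==> length p \<le> fst (simulate p b x)"
  and "length p \<le> fst (simulate p b x) ==> snd (snd (snd (simulate p b x))) = y"
proof -
 let ?c = "%b. (step p ^^ b) (init_config x)"
 have c: "fst (simulate p b x) = pc (?c b)" "snd (snd (snd (simulate p b x))) = outp (?c b)"
  using corr_steps[where p = p and b = b and x = x] by (simp_all add: corr_def simulate_def)
 have t: "halted p (?c t)" "outp (?c t) = y" using assms by (simp_all add: computes_in_def)
 show "length p \<le> fst (simulate p b x)" if "t \<le> b"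
  using computes_in_mono[OF assms that] by (simp add: c computes_in_def halted_def)
 assume "length p \<le> fst (simulate p b x)"
 then have "computes_in p x b (outp (?c b))" by (simp add: c computes_in_def halted_def)
 then have "computes_in p x (max b t) (outp (?c b))" by (rule computes_in_mono) simp
 moreover have "computes_in p x (max b t) y" using assms by (rule computes_in_mono) simp
 ultimately show "snd (snd (snd (simulate p b x))) = y" by (simp add: c computes_in_def)
qed

section \<open>Sparsification\<close>

definition sats :: "(nat => bool) => clause list => bool" where
 "sats \<alpha> \<psi> \<longleftrightarrow> (\<forall>C\<in>set \<psi>. \<exists>l\<in>set C. \<alpha> (fst l) = snd l)"

lemma satisfiable_sats: "satisfiable \<psi> \<longleftrightarrow> (\<exists>\<alpha>. sats \<alpha> \<psi>)"
 by (simp add: satisfiable_def sats_def case_prod_beta)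

text \<open>Only clauses minimal under inclusion are kept; a subsumed clause adds nothing to
  satisfiability.\<close>

definition add_clause :: "clause list => clause => clause list" where
 "add_clause \<psi> C = (if \<exists>D\<in>set \<psi>. set D \<subseteq> set C then \<psi> else C # filter (%D. \<not> set C \<subseteq> set D) \<psi>)"

definition reduce :: "clause list => clause list" where
 "reduce \<phi> = foldl add_clause [] (map uniq (filter (%C. length C \<le> 3) \<phi>))"

definition antichain :: "literal set => clause list => bool" where
 "antichain X \<psi> \<longleftrightarrow> distinct \<psi> & (\<forall>C\<in>set \<psi>. distinct C & length C \<le> 3 & set C \<subseteq> X) &
   (\<forall>C\<in>set \<psi>. \<forall>D\<in>set \<psi>. set C \<subseteq> set D --> C = D)"

lemma antichain_add:
 "antichain X \<psi> ==> distinct C ==> length C \<le> 3 ==> set C \<subseteq> X ==> antichain X (add_clause \<psi> C)"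
 unfolding antichain_def add_clause_def by auto

lemma antichain_foldl:
 assumes "antichain X \<psi>" "\<And>C. C \<in> set Cs ==> distinct C & length C \<le> 3 & set C \<subseteq> X"
 shows "antichain X (foldl add_clause \<psi> Cs)"
 using assms
proof (induction Cs arbitrary: \<psi>)
 case (Cons C Cs)
 have "antichain X (add_clause \<psi> C)" using Cons.prems by (intro antichain_add) auto
 then show ?case using Cons.IH Cons.prems(2) by simp
qed simp

lemma antichain_reduce_take:
 "antichain (set (concat \<phi>)) (foldl add_clause [] (take k (map uniq (filter (%C. length C \<le> 3) \<phi>))))"
proof (rule antichain_foldl)
 fix C assume "C \<in> set (take k (map uniq (filter (%C. length C \<le> 3) \<phi>)))"
 then obtain D where D: "C = uniq D" "D \<in> set \<phi>" "length D \<le> 3" by (auto dest!: in_set_takeD)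
 then show "distinct C & length C \<le> 3 & set C \<subseteq> set (concat \<phi>)"
  using uniq(3)[of D] by (auto simp: uniq(1,2))
qed (simp add: antichain_def)

lemma antichain_reduce: "antichain (set (concat \<phi>)) (reduce \<phi>)"
 using antichain_reduce_take[where k = "length \<phi>" and \<phi> = \<phi>] by (simp add: reduce_def)

lemma sats_add: "sats \<alpha> (add_clause \<psi> C) \<longleftrightarrow> sats \<alpha> (C # \<psi>)"
 unfolding sats_def add_clause_def by auto blast+

lemma sats_reduce:
 assumes "\<forall>C\<in>set \<phi>. length C \<le> 3"
 shows "sats \<alpha> (reduce \<phi>) \<longleftrightarrow> sats \<alpha> \<phi>"
proof -
 have "sats \<alpha> (foldl add_clause \<psi> (map uniq \<phi>')) \<longleftrightarrow> sats \<alpha> (\<phi>' @ \<psi>)" for \<psi> \<phi>'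
 proof (induction \<phi>' arbitrary: \<psi>)
  case (Cons C \<phi>')
  have "sats \<alpha> (\<phi>' @ add_clause \<psi> (uniq C)) \<longleftrightarrow> sats \<alpha> \<phi>' & sats \<alpha> (uniq C # \<psi>)"
   using sats_add[of \<alpha> \<psi> "uniq C"] by (auto simp: sats_def)
  also have "\<dots> \<longleftrightarrow> sats \<alpha> ((C # \<phi>') @ \<psi>)" by (auto simp: sats_def uniq)
  finally show ?case using Cons by simp
 qed simp
 moreover have "filter (%C. length C \<le> 3) \<phi> = \<phi>" using assms by (simp add: filter_id_conv)
 ultimately show ?thesis by (simp add: reduce_def)
qed

text \<open>The sparsification lemma of Impagliazzo, Paturi and Zane for clauses of length 3: a sunflower is given by
 its heart \<open>h\<close> and the length \<open>s\<close> of its clauses.\<close>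

definition petals :: "clause list => clause \<times> nat => clause list" where
 "petals \<psi> c = map (filter (%l. \<not> l \<in> set (fst c))) (filter (%C. length C = snd c & set (fst c) \<subseteq> set C) \<psi>)"

text \<open>Petals of length 2 need a much higher number than petals of length 1, because each of
  them raises the potential by 1 only, in contrast to \<open>128 * i ^ 2\<close> for a unit
  petal.\<close>

definition threshold :: "nat => clause \<times> nat => nat" where
 "threshold i c = (if snd c = length (fst c) + 2 then 1024 * i ^ 4 else 64 * i ^ 2)"

text \<open>The order is a priority. A single literal in clauses of length 3 is tried last, when the
  failure of the other two kinds bounds the degrees that the new 2-clauses could create.\<close>

definition hearts :: "clause list => (clause \<times> nat) list" where
 "hearts \<psi> = map (%a. ([a], 2)) (concat \<psi>) @
   concat (map (%a. map (%b. ([a, b], 3)) (filter (%b. \<not> a = b) (concat \<psi>))) (concat \<psi>)) @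
   map (%a. ([a], 3)) (concat \<psi>)"

definition refine :: "clause list => clause list => clause list" where
 "refine \<psi> Ps = Ps @ filter (%D. \<forall>P\<in>set Ps. \<not> set P \<subseteq> set D) \<psi>"

definition branch :: "nat => clause list => clause list list" where
 "branch i \<psi> = (case filter (%c. threshold i c \<le> length (petals \<psi> c)) (hearts \<psi>) of
   [] => [] | c # _ => [refine \<psi> [fst c], refine \<psi> (petals \<psi> c)])"

lemma sats_refine: "sats \<alpha> (refine \<psi> Ps) \<longleftrightarrow> sats \<alpha> (Ps @ \<psi>)"
 unfolding sats_def refine_def by auto blast+

text \<open>An assignment either satisfies the heart or, falsifying all of it, has to satisfy every
  petal.\<close>

lemma sats_branch:
 assumes "branch i \<psi> ~= []"
 shows "sats \<alpha> \<psi> \<longleftrightarrow> (\<exists>\<psi>'\<in>set (branch i \<psi>). sats \<alpha> \<psi>')"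
proof -
 obtain c where b: "branch i \<psi> = [refine \<psi> [fst c], refine \<psi> (petals \<psi> c)]"
  using assms by (auto simp: branch_def split: list.splits)
 have "sats \<alpha> [fst c] \<or> sats \<alpha> (petals \<psi> c)" if "sats \<alpha> \<psi>"
 proof (cases "\<exists>l\<in>set (fst c). \<alpha> (fst l) = snd l")
  case False
  have "\<exists>l\<in>set P. \<alpha> (fst l) = snd l" if P: "P \<in> set (petals \<psi> c)" for P
  proof -
   obtain C where C: "C \<in> set \<psi>" "P = filter (%l. \<not> l \<in> set (fst c)) C" using P by (auto simp: petals_def)
   obtain l where "l \<in> set C" "\<alpha> (fst l) = snd l" using C(1) \<open>sats \<alpha> \<psi>\<close> by (auto simp: sats_def)
   moreover from this have "l \<in> set P" using False C(2) by auto
   ultimately show ?thesis by blast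
  qed
  then show ?thesis by (simp add: sats_def)
 qed (simp add: sats_def)
 then show ?thesis by (auto simp: b sats_refine) (auto simp: sats_def)
qed

section \<open>The potential of a branch\<close>

definition cnt :: "(clause => bool) => clause list => nat" where
 "cnt P \<psi> = length (filter P \<psi>)"

locale sparse =
 fixes X :: "literal set" and F :: "clause list" and i :: nat
 assumes fin: "finite X" and i: "0 < i"
begin

abbreviation "fresh C \<equiv> length C = 2 & set C \<notin> set ` set F"

text \<open>\<open>fresh\<close> clauses are the 2-clauses created by branching. The second
  condition says that every clause of \<open>F\<close> is still implied, which guarantees that a
  newly added clause is not one of \<open>F\<close>.\<close>

definition good :: "clause list => bool" where
 "good \<psi> \<longleftrightarrow> antichain X \<psi> & (\<forall>C\<in>set F. \<exists>D\<in>set \<psi>. set D \<subseteq> set C) &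
   (\<forall>a. cnt (%C. fresh C & a \<in> set C) \<psi> \<le> 128 * i ^ 2)"

text \<open>
 The potential counts unit clauses, each worth two full neighbourhoods of fresh 2-clauses: a new unit clause removes at most
 \<open>128 * i ^ 2\<close> of them.
\<close>

definition pot :: "clause list => nat" where
 "pot \<psi> = 256 * i ^ 2 * cnt (%C. length C = 1) \<psi> + cnt fresh \<psi>"

lemma cnt_mono: "(\<And>C. C \<in> set \<psi> ==> P C ==> Q C) ==> cnt P \<psi> \<le> cnt Q \<psi>"
 unfolding cnt_def by (induction \<psi>) auto

lemma cnt_append: "cnt P (\<psi> @ \<psi>') = cnt P \<psi> + cnt P \<psi>'"
 by (simp add: cnt_def)

lemma cnt_filter: "cnt P (filter Q \<psi>) = cnt (%C. P C & Q C) \<psi>"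
 by (simp add: cnt_def conj_commute)

lemma cnt_split: "cnt P \<psi> = cnt (%C. P C & Q C) \<psi> + cnt (%C. P C & \<not> Q C) \<psi>"
 unfolding cnt_def by (induction \<psi>) auto

lemma cnt_disj: "cnt (%C. P C \<or> Q C) \<psi> \<le> cnt P \<psi> + cnt Q \<psi>"
 unfolding cnt_def by (induction \<psi>) auto

lemma cnt_Bex: "cnt (%C. \<exists>a\<in>set as. P a C) \<psi> \<le> (\<Sum>a\<leftarrow>as. cnt (P a) \<psi>)"
proof (induction as)
 case (Cons a as)
 have "cnt (%C. \<exists>a\<in>set (a # as). P a C) \<psi> \<le> cnt (P a) \<psi> + cnt (%C. \<exists>a\<in>set as. P a C) \<psi>"
  using cnt_disj[of "P a" "%C. \<exists>a\<in>set as. P a C"] by simp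
 then show ?case using Cons by simp
qed (simp add: cnt_def)

lemma sum_list_le: "(\<And>a. a \<in> set as ==> f a \<le> (m::nat)) ==> (\<Sum>a\<leftarrow>as. f a) \<le> length as * m"
 by (induction as) (auto intro: add_mono)

text \<open>A new unit clause is worth \<open>256 * i ^ 2\<close> and subsumes at most
  \<open>128 * i ^ 2\<close> fresh clauses, a net gain of \<open>128 * i ^ 2\<close>. A new 2-clause
  is worth 1 and subsumes neither a unit clause nor another 2-clause.\<close>

lemma refine:
 assumes \<psi>: "good \<psi>" and Ps: "\<And>P. P \<in> set Ps ==> distinct P & length P = s & set P \<subseteq> X" and s: "s = 1 \<or> s = 2"
  and inj: "distinct (map set Ps)" and new: "\<And>P D. P \<in> set Ps ==> D \<in> set \<psi> ==> \<not> set D \<subseteq> set P"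
  and deg: "\<And>a. s = 2 ==> cnt (%C. fresh C & a \<in> set C) \<psi> + cnt (%C. a \<in> set C) Ps \<le> 128 * i ^ 2"
 shows "good (refine \<psi> Ps)" "pot \<psi> + length Ps * (if s = 1 then 128 * i ^ 2 else 1) \<le> pot (refine \<psi> Ps)"
proof -
 have ac: "distinct \<psi>" "\<And>C. C \<in> set \<psi> ==> distinct C & length C \<le> 3 & set C \<subseteq> X"
  "\<And>C D. C \<in> set \<psi> ==> D \<in> set \<psi> ==> set C \<subseteq> set D ==> C = D"
  and cov: "\<And>C. C \<in> set F ==> \<exists>D\<in>set \<psi>. set D \<subseteq> set C"
  and dg: "\<And>a. cnt (%C. fresh C & a \<in> set C) \<psi> \<le> 128 * i ^ 2"
  using \<psi> unfolding good_def antichain_def by blast+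
 have PQ: "P = Q" if "P \<in> set Ps" "Q \<in> set Ps" "set P \<subseteq> set Q" for P Q
 proof -
  have "card (set P) = s" "card (set Q) = s" using Ps that by (simp_all add: distinct_card)
  then have "set P = set Q" using that(3) by (intro card_subset_eq) auto
  then show ?thesis using inj that(1,2) by (auto simp: distinct_map dest: inj_onD)
 qed
 have dPs: "distinct Ps" using inj by (simp add: distinct_map)
 have freshP: "fresh P" if "P \<in> set Ps" "s = 2" for P
 proof -
  \<comment> \<open>If \<open>P\<close> were in \<open>F\<close>, some clause of the present formula
    would be contained in it, contrary to \<open>new\<close>.\<close>
  have "set P \<notin> set ` set F" using cov new[OF that(1)] by force
  then show ?thesis using Ps that by auto
 qed
 have "antichain X (refine \<psi> Ps)"
  unfolding antichain_def refine_def
 proof (intro conjI ballI impI)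
  show "distinct (Ps @ filter (%D. \<forall>P\<in>set Ps. \<not> set P \<subseteq> set D) \<psi>)" using dPs ac(1) by auto
  fix C assume C: "C \<in> set (Ps @ filter (%D. \<forall>P\<in>set Ps. \<not> set P \<subseteq> set D) \<psi>)"
  then show "distinct C" "length C \<le> 3" "set C \<subseteq> X" using ac(2)[of C] Ps[of C] s by auto
  fix D assume "D \<in> set (Ps @ filter (%D. \<forall>P\<in>set Ps. \<not> set P \<subseteq> set D) \<psi>)" "set C \<subseteq> set D"
  then show "C = D" using C new PQ ac(3) by auto
 qed
 moreover have "\<exists>D\<in>set (refine \<psi> Ps). set D \<subseteq> set C" if CF: "C \<in> set F" for C
 proof -
  obtain D where D: "D \<in> set \<psi>" "set D \<subseteq> set C" using cov[OF CF] by blast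
  show ?thesis
  proof (cases "\<exists>P\<in>set Ps. set P \<subseteq> set D")
   case True
   then obtain P where "P \<in> set Ps" "set P \<subseteq> set D" by blast
   then have "P \<in> set (refine \<psi> Ps)" "set P \<subseteq> set C" using D by (auto simp: refine_def)
   then show ?thesis by blast
  next
   case False
   then have "D \<in> set (refine \<psi> Ps)" using D by (simp add: refine_def)
   then show ?thesis using D by blast
  qed
 qed
 moreover have "cnt (%C. fresh C & a \<in> set C) (refine \<psi> Ps) \<le> 128 * i ^ 2" for a
 proof -
  have "cnt (%C. fresh C & a \<in> set C) (refine \<psi> Ps) \<le>
   cnt (%C. fresh C & a \<in> set C) Ps + cnt (%C. fresh C & a \<in> set C) \<psi>"
   unfolding refine_def cnt_append cnt_filter by (intro add_left_mono cnt_mono) auto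
  also have "\<dots> \<le> 128 * i ^ 2"
  proof (cases "s = 1")
   case True
   then have "cnt (%C. fresh C & a \<in> set C) Ps = 0" using Ps by (auto simp: cnt_def filter_empty_conv)
   then show ?thesis using dg[of a] by simp
  next
   case False
   have "cnt (%C. fresh C & a \<in> set C) Ps \<le> cnt (%C. a \<in> set C) Ps" by (intro cnt_mono) auto
   then show ?thesis using deg[of a] s False by simp
  qed
  finally show ?thesis .
 qed
 ultimately show "good (refine \<psi> Ps)" unfolding good_def by blast
 show "pot \<psi> + length Ps * (if s = 1 then 128 * i ^ 2 else 1) \<le> pot (refine \<psi> Ps)"
 proof (cases "s = 1")
  case True
  have nsub: "\<not> set P \<subseteq> set C" if "P \<in> set Ps" "C \<in> set \<psi>" "length C = 1" for P C
  proof
   assume "set P \<subseteq> set C"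
   moreover have "card (set P) = 1" "card (set C) = 1" using Ps ac(2) that True by (simp_all add: distinct_card)
   ultimately have "set P = set C" by (intro card_subset_eq) auto
   then show False using new that by blast
  qed
  have "cnt (%C. length C = 1) Ps = length Ps" using Ps True by (simp add: cnt_def filter_id_conv)
  moreover have "cnt (%C. length C = 1) \<psi> \<le> cnt (%C. length C = 1 & (\<forall>P\<in>set Ps. \<not> set P \<subseteq> set C)) \<psi>"
   using nsub by (intro cnt_mono) auto
  ultimately have u: "length Ps + cnt (%C. length C = 1) \<psi> \<le> cnt (%C. length C = 1) (refine \<psi> Ps)"
   by (simp add: refine_def cnt_append cnt_filter)
  have "cnt (%C. fresh C & \<not> (\<forall>P\<in>set Ps. \<not> set P \<subseteq> set C)) \<psi> \<le> cnt (%C. \<exists>P\<in>set Ps. fresh C & set P \<subseteq> set C) \<psi>"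
   by (intro cnt_mono) auto
  also have "\<dots> \<le> (\<Sum>P\<leftarrow>Ps. cnt (%C. fresh C & set P \<subseteq> set C) \<psi>)" by (rule cnt_Bex)
  also have "\<dots> \<le> length Ps * (128 * i ^ 2)"
  proof (rule sum_list_le)
   fix P assume "P \<in> set Ps"
   then obtain a where "P = [a]" using Ps True by (metis One_nat_def length_0_conv length_Suc_conv)
   then show "cnt (%C. fresh C & set P \<subseteq> set C) \<psi> \<le> 128 * i ^ 2" using dg[of a] by simp
  qed
  finally have "cnt fresh \<psi> \<le> cnt fresh (refine \<psi> Ps) + length Ps * (128 * i ^ 2)"
   using cnt_split[of fresh \<psi> "%C. \<forall>P\<in>set Ps. \<not> set P \<subseteq> set C"]
   unfolding refine_def cnt_append cnt_filter by linarith
  moreover have "256 * i ^ 2 * (length Ps + cnt (%C. length C = 1) \<psi>) \<le> 256 * i ^ 2 * cnt (%C. length C = 1) (refine \<psi> Ps)"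
   using u by (rule mult_le_mono2)
  ultimately show ?thesis using True unfolding pot_def by (simp add: algebra_simps)
 next
  case False
  then have s2: "s = 2" using s by simp
  have card2: "card (set P) = 2" if "P \<in> set Ps" for P using Ps that s2 by (simp add: distinct_card)
  have "cnt fresh Ps = length Ps" using freshP s2 by (simp add: cnt_def filter_id_conv)
  moreover have "cnt fresh \<psi> \<le> cnt (%C. fresh C & (\<forall>P\<in>set Ps. \<not> set P \<subseteq> set C)) \<psi>"
  proof (intro cnt_mono conjI ballI notI)
   fix C P assume C: "C \<in> set \<psi>" "fresh C" "P \<in> set Ps" "set P \<subseteq> set C"
   then have "card (set C) = 2" using ac(2) by (simp add: distinct_card)
   then have "set P = set C" using card2 C by (intro card_subset_eq) auto
   then show False using new C by blast
  qed auto
  moreover have "cnt (%C. length C = 1) \<psi> \<le> cnt (%C. length C = 1 & (\<forall>P\<in>set Ps. \<not> set P \<subseteq> set C)) \<psi>"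
  proof (intro cnt_mono conjI ballI notI)
   fix C P assume C: "C \<in> set \<psi>" "length C = 1" "P \<in> set Ps" "set P \<subseteq> set C"
   then have "card (set P) \<le> card (set C)" by (intro card_mono) auto
   moreover have "card (set C) = 1" using C ac(2) by (simp add: distinct_card)
   ultimately show False using card2 C by simp
  qed auto
  ultimately show ?thesis using False unfolding pot_def refine_def cnt_append cnt_filter
   by (simp add: add_mono mult_le_mono)
 qed
qed

text \<open>There are at most \<open>card X\<close> unit clauses and at most
  \<open>128 * i ^ 2\<close> fresh clauses at each literal: 256 and 128 add up to 384.\<close>

lemma pot_le: "good \<psi> ==> pot \<psi> \<le> 384 * i ^ 2 * card X"
proof -
 assume \<psi>: "good \<psi>"
 have ac: "distinct \<psi>" "\<And>C. C \<in> set \<psi> ==> set C \<subseteq> X"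
  and dg: "\<And>a. cnt (%C. fresh C & a \<in> set C) \<psi> \<le> 128 * i ^ 2"
  using \<psi> unfolding good_def antichain_def by blast+
 have c: "cnt P \<psi> = card {C \<in> set \<psi>. P C}" for P
  unfolding cnt_def using ac(1) by (metis distinct_card distinct_filter set_filter)
 have "{C \<in> set \<psi>. length C = 1} \<subseteq> (%a. [a]) ` X"
 proof
  fix C assume "C \<in> {C \<in> set \<psi>. length C = 1}"
  then obtain a where "C = [a]" "[a] \<in> set \<psi>" by (auto simp: length_Suc_conv)
  then show "C \<in> (%a. [a]) ` X" using ac(2)[of "[a]"] by simp
 qed
 then have u: "cnt (%C. length C = 1) \<psi> \<le> card X" unfolding c using fin by (intro surj_card_le)
 have "{C \<in> set \<psi>. fresh C} \<subseteq> (\<Union>a\<in>X. {C \<in> set \<psi>. fresh C & a \<in> set C})"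
 proof
  fix C assume C: "C \<in> {C \<in> set \<psi>. fresh C}"
  then obtain a where "a \<in> set C" by (cases C) auto
  then show "C \<in> (\<Union>a\<in>X. {C \<in> set \<psi>. fresh C & a \<in> set C})" using C ac(2) by blast
 qed
 then have "cnt fresh \<psi> \<le> card (\<Union>a\<in>X. {C \<in> set \<psi>. fresh C & a \<in> set C})" unfolding c using fin by (intro card_mono) auto
 also have "\<dots> \<le> (\<Sum>a\<in>X. card {C \<in> set \<psi>. fresh C & a \<in> set C})" by (rule card_UN_le[OF fin])
 also have "\<dots> \<le> (\<Sum>a\<in>X. 128 * i ^ 2)" using dg unfolding c by (intro sum_mono)
 finally have "cnt fresh \<psi> \<le> card X * (128 * i ^ 2)" by simp
 moreover have "256 * i ^ 2 * cnt (%C. length C = 1) \<psi> \<le> 256 * i ^ 2 * card X" using u by (rule mult_le_mono2)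
 ultimately have "pot \<psi> \<le> 256 * i ^ 2 * card X + card X * (128 * i ^ 2)" unfolding pot_def by linarith
 then show ?thesis by (simp add: mult.commute mult.left_commute)
qed

lemma petals_conditions:
 assumes \<psi>: "good \<psi>" and c: "c = (h, s)" and h: "distinct h" "h ~= []" "length h < s" and pos: "petals \<psi> c ~= []"
 shows "set h \<subseteq> X" "D \<in> set \<psi> ==> \<not> set D \<subseteq> set h"
  "P \<in> set (petals \<psi> c) ==> distinct P & length P = s - length h & set P \<subseteq> X"
  "distinct (map set (petals \<psi> c))"
  "P \<in> set (petals \<psi> c) ==> D \<in> set \<psi> ==> \<not> set D \<subseteq> set P"
proof -
 have ac: "distinct \<psi>" "\<And>C. C \<in> set \<psi> ==> distinct C & length C \<le> 3 & set C \<subseteq> X"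
  "\<And>C D. C \<in> set \<psi> ==> D \<in> set \<psi> ==> set C \<subseteq> set D ==> C = D"
  using \<psi> unfolding good_def antichain_def by blast+
 obtain C where C: "C \<in> set \<psi>" "length C = s" "set h \<subseteq> set C"
  using pos by (auto simp: petals_def c filter_empty_conv)
 show "set h \<subseteq> X" using C ac(2) by blast
 show "\<not> set D \<subseteq> set h" if D: "D \<in> set \<psi>"
 proof
  assume Dh: "set D \<subseteq> set h"
  then have "D = C" using ac(3) D C by blast
  then have "card (set C) \<le> card (set h)" using Dh by (intro card_mono) auto
  then show False using C ac(2) h by (simp add: distinct_card)
 qed
 have P: "\<exists>C\<in>set \<psi>. P = filter (%l. \<not> l \<in> set h) C & length C = s & set h \<subseteq> set C" if "P \<in> set (petals \<psi> c)" for P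
  using that by (auto simp: petals_def c)
 show "distinct P & length P = s - length h & set P \<subseteq> X" if Pc: "P \<in> set (petals \<psi> c)"
 proof -
  obtain C where C: "C \<in> set \<psi>" "P = filter (%l. \<not> l \<in> set h) C" "length C = s" "set h \<subseteq> set C" using P[OF Pc] by blast
  have "distinct P" using C ac(2) by simp
  moreover have "set P = set C - set h" using C(2) by auto
  moreover have "card (set C - set h) = s - length h" using C ac(2) h by (simp add: card_Diff_subset distinct_card)
  ultimately show ?thesis using C ac(2) by (metis Diff_subset distinct_card subset_trans)
 qed
 show "distinct (map set (petals \<psi> c))"
  unfolding petals_def c fst_conv snd_conv map_map distinct_map
 proof
  show "inj_on (set \<circ> filter (%l. \<not> l \<in> set h)) (set (filter (%C. length C = s & set h \<subseteq> set C) \<psi>))"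
  proof (rule inj_onI)
   fix C D assume a: "C \<in> set (filter (%C. length C = s & set h \<subseteq> set C) \<psi>)" "D \<in> set (filter (%C. length C = s & set h \<subseteq> set C) \<psi>)"
    "(set \<circ> filter (%l. \<not> l \<in> set h)) C = (set \<circ> filter (%l. \<not> l \<in> set h)) D"
   then have "set C \<subseteq> set D" by auto
   then show "C = D" using a ac(3) by auto
  qed
 qed (simp add: ac(1))
 show "\<not> set D \<subseteq> set P" if Pc: "P \<in> set (petals \<psi> c)" and D: "D \<in> set \<psi>"
 proof
  assume DP: "set D \<subseteq> set P"
  obtain C where C: "C \<in> set \<psi>" "P = filter (%l. \<not> l \<in> set h) C" "set h \<subseteq> set C" using P[OF Pc] by blast
  then have "D = C" using ac(3)[OF D C(1)] DP by auto
  then show False using DP C h(2) by (cases h) auto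
 qed
qed

lemma in_pairs:
 assumes "a \<in> set L" "b \<in> set L" "a ~= b"
 shows "([a, b], n) \<in> set (concat (map (%a. map (%b. ([a, b], n)) (filter (%b. \<not> a = b) L)) L))"
proof -
 have *: "x \<in> set (concat (map g L))" if "x \<in> set (g a)" for x and g :: "'a => ('a list \<times> 'b) list"
  using that assms(1) by auto
 show ?thesis by (rule *) (use assms in simp)
qed

text \<open>For a heart with one literal, the heart branch gains \<open>128 * i ^ 2\<close>, and the
  petals gain \<open>1024 * i ^ 4\<close>, as that many 2-clauses or as \<open>64 * i ^ 2\<close>
  unit clauses. For a heart with two literals, the heart gains just 1, which is balanced by
  \<open>64 * i ^ 2\<close> unit petals.\<close>

lemma branch_good:
 assumes \<psi>: "good \<psi>" and b: "branch i \<psi> ~= []"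
 shows "\<exists>\<psi>0 \<psi>1 g0 g1. branch i \<psi> = [\<psi>0, \<psi>1] & good \<psi>0 & good \<psi>1 & pot \<psi> + g0 \<le> pot \<psi>0 & pot \<psi> + g1 \<le> pot \<psi>1 &
  ((g0, g1) = (1, 8192 * i ^ 4) \<or> (g0, g1) = (128 * i ^ 2, 1024 * i ^ 4))"
proof -
 let ?ok = "%c. threshold i c \<le> length (petals \<psi> c)"
 let ?P = "concat (map (%a. map (%b. ([a, b], 3)) (filter (%b. \<not> a = b) (concat \<psi>))) (concat \<psi>))"
 obtain c cs where c: "filter ?ok (hearts \<psi>) = c # cs" using b by (auto simp: branch_def split: list.splits)
 have br: "branch i \<psi> = [refine \<psi> [fst c], refine \<psi> (petals \<psi> c)]" by (simp add: branch_def c)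
 have ok: "?ok c" using c by (metis filter_eq_Cons_iff)
 have th: "0 < threshold i d" for d using i by (simp add: threshold_def)
 have pos: "petals \<psi> c ~= []" using ok th[of c] by auto
 have ac: "\<And>C. C \<in> set \<psi> ==> distinct C & length C \<le> 3 & set C \<subseteq> X"
  using \<psi> unfolding good_def antichain_def by blast
 have hd: "x \<in> set xs" if "xs @ ys = x # zs" "xs ~= []" for x :: "clause \<times> nat" and xs ys zs
  using that by (cases xs) auto
 have cases: "(\<exists>a. c = ([a], 2)) \<or> (\<forall>a\<in>set (concat \<psi>). \<not> ?ok ([a], 2)) &
  ((\<exists>a b. a ~= b & c = ([a, b], 3)) \<or>
   (\<forall>a\<in>set (concat \<psi>). \<forall>b\<in>set (concat \<psi>). a ~= b --> \<not> ?ok ([a, b], 3)) & (\<exists>a. c = ([a], 3)))"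
 proof (cases "filter ?ok (map (%a. ([a], 2)) (concat \<psi>)) = []")
  case False
  then have "c \<in> set (filter ?ok (map (%a. ([a], 2)) (concat \<psi>)))"
   using c unfolding hearts_def filter_append by (rule hd[rotated])
  then have "\<exists>a. c = ([a], 2)" by auto
  then show ?thesis by (rule disjI1)
 next
  case True
  then have A: "\<forall>a\<in>set (concat \<psi>). \<not> ?ok ([a], 2)" by (auto simp: filter_empty_conv)
  show ?thesis
  proof (cases "filter ?ok ?P = []")
   case False
   then have "c \<in> set (filter ?ok ?P)"
    using c unfolding hearts_def filter_append True append_Nil by (rule hd[rotated])
   then have "\<exists>a b. a ~= b & c = ([a, b], 3)" by auto
   then show ?thesis using A by blast
  next
   case F: True
   have "\<forall>a\<in>set (concat \<psi>). \<forall>b\<in>set (concat \<psi>). a ~= b --> \<not> ?ok ([a, b], 3)"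
   proof (intro ballI impI)
    fix a b assume "a \<in> set (concat \<psi>)" "b \<in> set (concat \<psi>)" "a ~= b"
    then have "([a, b], 3) \<in> set ?P" by (rule in_pairs)
    then show "\<not> ?ok ([a, b], 3)" using F unfolding filter_empty_conv by blast
   qed
   moreover have "c \<in> set (filter ?ok (map (%a. ([a], 3)) (concat \<psi>)))"
    using c unfolding hearts_def filter_append True F append_Nil by simp
   then have "\<exists>a. c = ([a], 3)" by auto
   ultimately show ?thesis using A by blast
  qed
 qed
 have lp: "length (petals \<psi> d) = cnt (%C. length C = snd d & set (fst d) \<subseteq> set C) \<psi>" for d
  by (simp add: petals_def cnt_def)
 have le64: "1 \<le> 64 * i ^ 2" using i by simp
 \<comment> \<open>Since no sunflower of 2-clauses with a single heart was available, half of the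
   permitted degree is still free.\<close>
 have two: "cnt (%C. fresh C & a \<in> set C) \<psi> < 64 * i ^ 2" if A: "\<forall>a\<in>set (concat \<psi>). \<not> ?ok ([a], 2)" for a
 proof (cases "a \<in> set (concat \<psi>)")
  case True
  have "cnt (%C. fresh C & a \<in> set C) \<psi> \<le> length (petals \<psi> ([a], 2))" unfolding lp by (intro cnt_mono) auto
  then show ?thesis using A True by (fastforce simp: threshold_def)
 next
  case False
  then have "filter (%C. fresh C & a \<in> set C) \<psi> = []" by (auto simp: filter_empty_conv)
  then show ?thesis using i by (simp add: cnt_def)
 qed
 from cases consider (A) a where "c = ([a], 2)"
  | (C) a b where "\<forall>a\<in>set (concat \<psi>). \<not> ?ok ([a], 2)" "a ~= b" "c = ([a, b], 3)"
  | (B) a where "\<forall>a\<in>set (concat \<psi>). \<not> ?ok ([a], 2)"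
    "\<forall>a\<in>set (concat \<psi>). \<forall>b\<in>set (concat \<psi>). a ~= b --> \<not> ?ok ([a, b], 3)" "c = ([a], 3)" by blast
 then show ?thesis
 proof cases
  case A
  note pc = petals_conditions[OF \<psi> A _ _ _ pos]
  have h: "good (refine \<psi> [[a]])" "pot \<psi> + 128 * i ^ 2 \<le> pot (refine \<psi> [[a]])"
   using refine[OF \<psi>, of "[[a]]" 1] pc(1,2) by auto
  have p: "good (refine \<psi> (petals \<psi> c))" "pot \<psi> + length (petals \<psi> c) * (128 * i ^ 2) \<le> pot (refine \<psi> (petals \<psi> c))"
   using refine[OF \<psi>, of "petals \<psi> c" 1] pc(3-5) by auto
  have "1024 * i ^ 4 \<le> 64 * i ^ 2 * (128 * i ^ 2)" by (simp add: power_numeral_reduce)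
  also have "\<dots> \<le> length (petals \<psi> c) * (128 * i ^ 2)" using ok by (intro mult_le_mono1) (simp add: threshold_def A)
  finally have "pot \<psi> + 1024 * i ^ 4 \<le> pot (refine \<psi> (petals \<psi> c))" using p(2) by linarith
  then show ?thesis
   by (intro exI[of _ "refine \<psi> [[a]]"] exI[of _ "refine \<psi> (petals \<psi> c)"] exI[of _ "128 * i ^ 2"] exI[of _ "1024 * i ^ 4"])
    (use h p(1) in \<open>simp add: br A\<close>)
 next
  case (C a b)
  note pc = petals_conditions[OF \<psi> C(3) _ _ _ pos]
  have h: "good (refine \<psi> [[a, b]])" "pot \<psi> + 1 \<le> pot (refine \<psi> [[a, b]])"
  proof -
   have d: "cnt (%C. fresh C & x \<in> set C) \<psi> + cnt (%C. x \<in> set C) [[a, b]] \<le> 128 * i ^ 2" for x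
    using two[OF C(1), of x] le64 by (auto simp: cnt_def)
   show "good (refine \<psi> [[a, b]])" "pot \<psi> + 1 \<le> pot (refine \<psi> [[a, b]])"
    using refine[OF \<psi>, of "[[a, b]]" 2] pc(1,2) C(2) d by auto
  qed
  have p: "good (refine \<psi> (petals \<psi> c))" "pot \<psi> + length (petals \<psi> c) * (128 * i ^ 2) \<le> pot (refine \<psi> (petals \<psi> c))"
   using refine[OF \<psi>, of "petals \<psi> c" 1] pc(3-5) C(2) by auto
  have "8192 * i ^ 4 = 64 * i ^ 2 * (128 * i ^ 2)" by (simp add: power_numeral_reduce)
  also have "\<dots> \<le> length (petals \<psi> c) * (128 * i ^ 2)" using ok by (intro mult_le_mono1) (simp add: threshold_def C)
  finally have "pot \<psi> + 8192 * i ^ 4 \<le> pot (refine \<psi> (petals \<psi> c))" using p(2) by linarith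
  then show ?thesis
   by (intro exI[of _ "refine \<psi> [[a, b]]"] exI[of _ "refine \<psi> (petals \<psi> c)"] exI[of _ "1"] exI[of _ "8192 * i ^ 4"])
    (use h p(1) in \<open>simp add: br C\<close>)
 next
  case (B a)
  note pc = petals_conditions[OF \<psi> B(3) _ _ _ pos]
  have h: "good (refine \<psi> [[a]])" "pot \<psi> + 128 * i ^ 2 \<le> pot (refine \<psi> [[a]])"
   using refine[OF \<psi>, of "[[a]]" 1] pc(1,2) by auto
  \<comment> \<open>New 2-clauses at \<open>x\<close> come from 3-clauses containing
    \<open>a\<close> and \<open>x\<close>; the heart \<open>[a, x]\<close> had too few petals, so
    they fit into the other half.\<close>
  have d: "cnt (%C. fresh C & x \<in> set C) \<psi> + cnt (%C. x \<in> set C) (petals \<psi> c) \<le> 128 * i ^ 2" for x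
  proof -
   have "cnt (%C. x \<in> set C) (petals \<psi> c) \<le> 64 * i ^ 2"
   proof (cases "x ~= a & x \<in> set (concat \<psi>)")
    case True
    have "cnt (%C. x \<in> set C) (petals \<psi> c) \<le> length (petals \<psi> ([a, x], 3))"
     unfolding lp unfolding petals_def cnt_def filter_map length_map filter_filter comp_def
     by (subst (1 2) cnt_def[symmetric]) (intro cnt_mono, auto simp: B)
    moreover have "a \<in> set (concat \<psi>)" using pos by (auto simp: petals_def B filter_empty_conv)
    then have "length (petals \<psi> ([a, x], 3)) < 64 * i ^ 2" using B(2) True by (fastforce simp: threshold_def)
    ultimately show ?thesis by simp
   next
    case False
    then have "filter (%C. x \<in> set C) (petals \<psi> c) = []" by (auto simp: filter_empty_conv petals_def B)
    then show ?thesis by (simp add: cnt_def)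
   qed
   then show ?thesis using two[OF B(1), of x] by simp
  qed
  have p: "good (refine \<psi> (petals \<psi> c))" "pot \<psi> + length (petals \<psi> c) \<le> pot (refine \<psi> (petals \<psi> c))"
   using refine[OF \<psi>, of "petals \<psi> c" 2] pc(3-5) B d by auto
  have "1024 * i ^ 4 \<le> length (petals \<psi> c)" using ok by (simp add: threshold_def B)
  then have "pot \<psi> + 1024 * i ^ 4 \<le> pot (refine \<psi> (petals \<psi> c))" using p(2) by linarith
  then show ?thesis
   by (intro exI[of _ "refine \<psi> [[a]]"] exI[of _ "refine \<psi> (petals \<psi> c)"] exI[of _ "128 * i ^ 2"] exI[of _ "1024 * i ^ 4"])
    (use h p(1) in \<open>simp add: br B\<close>)
 qed
qed

text \<open>No heart with the single literal \<open>a\<close> reaches its threshold; the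
  inequalities are strict, which leaves room for the unit clause \<open>[a]\<close>.\<close>

lemma unbranched:
 assumes \<psi>: "good \<psi>" and b: "branch i \<psi> = []"
 shows "cnt (%C. a \<in> set C) \<psi> \<le> 64 * i ^ 2 + 1024 * i ^ 4"
proof (cases "a \<in> set (concat \<psi>)")
 case True
 have ac: "distinct \<psi>" "\<And>C. C \<in> set \<psi> ==> distinct C & length C \<le> 3 & set C \<subseteq> X"
  using \<psi> unfolding good_def antichain_def by blast+
 have "([a], 2) \<in> set (hearts \<psi>)" "([a], 3) \<in> set (hearts \<psi>)" using True by (auto simp: hearts_def)
 then have n: "\<not> threshold i ([a], 2) \<le> length (petals \<psi> ([a], 2))" "\<not> threshold i ([a], 3) \<le> length (petals \<psi> ([a], 3))"
  using b by (auto simp: branch_def filter_empty_conv split: list.splits)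
 have "cnt (%C. C = [a]) \<psi> \<le> 1"
  unfolding cnt_def using ac(1) by (induction \<psi>) (auto simp: filter_empty_conv)
 moreover have "cnt (%C. a \<in> set C) \<psi> \<le> cnt (%C. C = [a] \<or> (length C = 2 & a \<in> set C) \<or> (length C = 3 & a \<in> set C)) \<psi>"
 proof (intro cnt_mono)
  fix C assume C: "C \<in> set \<psi>" "a \<in> set C"
  then have "length C = 1 \<or> length C = 2 \<or> length C = 3" using ac(2)[of C] by (cases C) (auto simp: le_Suc_eq numeral_eq_Suc)
  then show "C = [a] \<or> (length C = 2 & a \<in> set C) \<or> (length C = 3 & a \<in> set C)"
   using C by (auto simp: length_Suc_conv)
 qed
 moreover have "cnt (%C. C = [a] \<or> (length C = 2 & a \<in> set C) \<or> (length C = 3 & a \<in> set C)) \<psi> \<le>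
  cnt (%C. C = [a]) \<psi> + (cnt (%C. length C = 2 & a \<in> set C) \<psi> + cnt (%C. length C = 3 & a \<in> set C) \<psi>)"
  using cnt_disj[of "%C. C = [a]" "%C. (length C = 2 & a \<in> set C) \<or> (length C = 3 & a \<in> set C)" \<psi>]
   cnt_disj[of "%C. length C = 2 & a \<in> set C" "%C. length C = 3 & a \<in> set C" \<psi>] by linarith
 ultimately show ?thesis using n by (simp add: threshold_def petals_def cnt_def)
next
 case False
 then have "filter (%C. a \<in> set C) \<psi> = []" by (auto simp: filter_empty_conv)
 then show ?thesis by (simp add: cnt_def)
qed

end


section \<open>The size of the branching tree\<close>

definition sp_step :: "nat => clause list list \<times> clause list list => clause list list \<times> clause list list" where
 "sp_step i s = (case fst s of [] => s | \<psi> # st =>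
   (case branch i \<psi> of [] => (st, \<psi> # snd s) | \<chi> # \<chi>s => (\<chi> # \<chi>s @ st, snd s)))"

text \<open>Follows from \<open>1 + x / 2 \<le> 2 powr x\<close> and
  \<open>1 \<le> (1 - x / 4) * (1 + x / 2)\<close>, the latter being
  \<open>0 \<le> x * (2 - x)\<close>.\<close>

lemma powr_neg_le:
 fixes x :: real
 assumes "0 \<le> x" "x \<le> 2"
 shows "2 powr - x \<le> 1 - x / 4"
proof -
 have l: "(1 / 2 :: real) \<le> ln 2" using ln_le_minus_one[of "1 / 2"] by (simp add: ln_div)
 have "1 + x / 2 \<le> 1 + x * ln 2" using mult_left_mono[OF l assms(1)] by simp
 also have "\<dots> \<le> 2 powr x" using exp_ge_add_one_self[of "x * ln 2"] by (simp add: powr_def mult.commute)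
 finally have a: "1 + x / 2 \<le> 2 powr x" .
 have "0 \<le> x * (2 - x)" using assms by simp
 then have "1 \<le> (1 - x / 4) * (1 + x / 2)" by (simp add: field_simps)
 also have "\<dots> \<le> (1 - x / 4) * 2 powr x" using a assms by (intro mult_left_mono) auto
 finally show ?thesis by (simp add: powr_minus field_simps)
qed

text \<open>The branching inequality: \<open>\<beta>\<close> to the remaining potential bounds the
  number of leaves. In the first case the terms are at most \<open>1 - 1 / (1024 * i ^ 3)\<close>
  and \<open>2 powr - (32 * i)\<close>, in the second \<open>1 - 1 / (8 * i)\<close> and
  \<open>2 powr - (4 * i)\<close>; the exponentially small term fits into the gap.\<close>

lemma weights:
 fixes i :: nat
 assumes i: "0 < i"
 defines "\<beta> \<equiv> 2 powr (1 / (256 * real i ^ 3))"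
 assumes g: "(g0, g1) = (1, 8192 * i ^ 4) \<or> (g0, g1) = (128 * i ^ 2, 1024 * i ^ 4)"
 shows "1 / \<beta> ^ g0 + 1 / \<beta> ^ g1 \<le> 1"
proof -
 have b: "1 / \<beta> ^ g = 2 powr - (real g / (256 * real i ^ 3))" for g
  by (simp add: \<beta>_def powr_minus_divide powr_power)
 have i1: "1 \<le> real i" using i by simp
 have pw: "2 powr - real (k + m * i) * real i ^ m \<le> 1 / 2 ^ k" for k m
 proof -
  have "real i ^ m \<le> (2 ^ i) ^ m" using less_exp[of i] by (intro power_mono) (simp_all add: less_imp_le of_nat_less_numeral_power_cancel_iff)
  also have "\<dots> = 2 ^ (m * i)" by (simp add: power_mult[symmetric] mult.commute)
  finally have "2 ^ k * real i ^ m \<le> 2 ^ (k + m * i)" by (simp add: power_add)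
  then have "real i ^ m / 2 ^ (k + m * i) \<le> 1 / 2 ^ k" by (simp add: field_simps)
  moreover have "2 powr - real (k + m * i) = 1 / 2 ^ (k + m * i)"
   using powr_realpow[of "2 :: real" "k + m * i"] by (simp only: powr_minus_divide)
  ultimately show ?thesis by simp
 qed
 from g show ?thesis
 proof
  assume "(g0, g1) = (1, 8192 * i ^ 4)"
  then have g: "g0 = 1" "g1 = 8192 * i ^ 4" by auto
  have i3: "1 \<le> real i ^ 3" using i1 by simp
  have h: "1 / \<beta> ^ g0 \<le> 1 - 1 / (256 * real i ^ 3) / 4"
   unfolding b g of_nat_1 by (rule powr_neg_le) (use i3 in \<open>auto simp: divide_le_eq\<close>)
  have "1 / \<beta> ^ g1 \<le> 2 powr - (32 * real i)"
   unfolding b g using i by (simp add: field_simps power_numeral_reduce)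
  also have "\<dots> \<le> 2 powr - real (10 + 3 * i)" using i1 by (intro powr_mono) auto
  also have "\<dots> \<le> 1 / (1024 * real i ^ 3)" using pw[of 10 3] i by (simp add: field_simps)
  finally have "1 / \<beta> ^ g1 \<le> 1 / (1024 * real i ^ 3)" .
  then show ?thesis using h by simp
 next
  assume "(g0, g1) = (128 * i ^ 2, 1024 * i ^ 4)"
  then have g: "g0 = 128 * i ^ 2" "g1 = 1024 * i ^ 4" by auto
  have e: "real (128 * i ^ 2) / (256 * real i ^ 3) = 1 / (2 * real i)"
   using i by (simp add: field_simps power_numeral_reduce)
  have h: "1 / \<beta> ^ g0 \<le> 1 - 1 / (2 * real i) / 4"
   unfolding b g e by (rule powr_neg_le) (use i1 in \<open>auto simp: divide_le_eq\<close>)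
  have "1 / \<beta> ^ g1 \<le> 2 powr - (4 * real i)"
   unfolding b g using i by (simp add: field_simps power_numeral_reduce)
  also have "\<dots> \<le> 2 powr - real (3 + 1 * i)" using i1 by (intro powr_mono) auto
  also have "\<dots> \<le> 1 / (8 * real i)" using pw[of 3 1] i by (simp add: field_simps)
  finally have "1 / \<beta> ^ g1 \<le> 1 / (8 * real i)" .
  then show ?thesis using h by simp
 qed
qed

lemma funpow_fixed: "f x = x ==> (f ^^ k) x = x"
 by (induction k) auto

lemma sp_step_halted: "(sp_step i ^^ k) ([], ls) = ([], ls)"
 by (rule funpow_fixed) (simp add: sp_step_def)

context sparse
begin

definition \<beta> :: real where "\<beta> = 2 powr (1 / (256 * real i ^ 3))"

text \<open>A binary tree with \<open>l\<close> leaves has \<open>2 * l - 1\<close> nodes, and each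
  node costs one step of the depth-first search.\<close>

lemma sp_run:
 "good \<psi> ==> \<exists>k ls. (\<forall>st lv. (sp_step i ^^ k) (\<psi> # st, lv) = (st, ls @ lv)) & real k \<le> 2 * \<beta> ^ (384 * i ^ 2 * card X - pot \<psi>) - 1"
proof (induction "384 * i ^ 2 * card X - pot \<psi>" arbitrary: \<psi> rule: less_induct)
 case less
 let ?m = "%\<psi>. 384 * i ^ 2 * card X - pot \<psi>"
 have b1: "1 \<le> \<beta>" unfolding \<beta>_def by (intro ge_one_powr_ge_zero) auto
 show ?case
 proof (cases "branch i \<psi> = []")
  case True
  then have "(sp_step i ^^ 1) (\<psi> # st, lv) = (st, [\<psi>] @ lv)" for st lv by (simp add: sp_step_def)
  moreover have "1 \<le> \<beta> ^ ?m \<psi>" using b1 by simp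
  then have "real 1 \<le> 2 * \<beta> ^ ?m \<psi> - 1" by simp
  ultimately show ?thesis by blast
 next
  case False
  obtain \<psi>0 \<psi>1 g0 g1 where b: "branch i \<psi> = [\<psi>0, \<psi>1]" "good \<psi>0" "good \<psi>1" "pot \<psi> + g0 \<le> pot \<psi>0" "pot \<psi> + g1 \<le> pot \<psi>1"
   "(g0, g1) = (1, 8192 * i ^ 4) \<or> (g0, g1) = (128 * i ^ 2, 1024 * i ^ 4)"
   using branch_good[OF less.prems False] by blast
  have g: "0 < g0" "0 < g1" using b(6) i by auto
  have p: "pot \<psi>0 \<le> 384 * i ^ 2 * card X" "pot \<psi>1 \<le> 384 * i ^ 2 * card X" using b pot_le by blast+
  have "?m \<psi>0 < ?m \<psi>" "?m \<psi>1 < ?m \<psi>" using b(4,5) p g by linarith+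
  then obtain k0 l0 k1 l1 where k: "\<And>st lv. (sp_step i ^^ k0) (\<psi>0 # st, lv) = (st, l0 @ lv)" "real k0 \<le> 2 * \<beta> ^ ?m \<psi>0 - 1"
   "\<And>st lv. (sp_step i ^^ k1) (\<psi>1 # st, lv) = (st, l1 @ lv)" "real k1 \<le> 2 * \<beta> ^ ?m \<psi>1 - 1"
   using less.hyps[of \<psi>0] less.hyps[of \<psi>1] b(2,3) by metis
  have "(sp_step i ^^ (k1 + (k0 + 1))) (\<psi> # st, lv) = (st, (l1 @ l0) @ lv)" for st lv
   unfolding funpow_add comp_def using k b(1) by (simp add: sp_step_def)
  moreover have "real (k1 + (k0 + 1)) \<le> 2 * \<beta> ^ ?m \<psi> - 1"
  proof -
   have c: "\<beta> ^ ?m \<chi> \<le> \<beta> ^ ?m \<psi> * (1 / \<beta> ^ g)" if "pot \<psi> + g \<le> pot \<chi>" "pot \<chi> \<le> 384 * i ^ 2 * card X" for \<chi> g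
   proof -
    have "\<beta> ^ ?m \<chi> * \<beta> ^ g = \<beta> ^ (?m \<chi> + g)" by (simp add: power_add)
    also have "\<dots> \<le> \<beta> ^ ?m \<psi>" using that b1 by (intro power_increasing) auto
    finally show ?thesis using b1 by (simp add: field_simps)
   qed
   have "\<beta> ^ ?m \<psi>0 + \<beta> ^ ?m \<psi>1 \<le> \<beta> ^ ?m \<psi> * (1 / \<beta> ^ g0 + 1 / \<beta> ^ g1)"
    using c[OF b(4) p(1)] c[OF b(5) p(2)] by (simp add: distrib_left)
   also have "\<dots> \<le> \<beta> ^ ?m \<psi> * 1"
    using weights[OF i b(6)] b1 unfolding \<beta>_def by (intro mult_left_mono) auto
   finally show ?thesis using k(2,4) by simp
  qed
  ultimately show ?thesis by blast
 qed
qed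

lemma good_F: "antichain X F ==> good F"
 by (auto simp: good_def cnt_def filter_empty_conv)

text \<open>The exponent is \<open>384 / 256 = 3 / 2\<close> times
  \<open>card X / i\<close>.\<close>

lemma sp_run_F:
 assumes "antichain X F"
 shows "\<exists>k ls. (\<forall>b\<ge>k. (sp_step i ^^ b) ([F], []) = ([], ls)) & real k \<le> 2 * 2 powr (3 / 2 * card X / i)"
proof -
 obtain k ls where k: "\<And>st lv. (sp_step i ^^ k) (F # st, lv) = (st, ls @ lv)" "real k \<le> 2 * \<beta> ^ (384 * i ^ 2 * card X - pot F) - 1"
  using sp_run[OF good_F[OF assms]] by blast
 have "(sp_step i ^^ b) ([F], []) = ([], ls)" if "k \<le> b" for b
 proof -
  have "(sp_step i ^^ b) ([F], []) = (sp_step i ^^ (b - k)) ((sp_step i ^^ k) ([F], []))"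
   using that funpow_add[of "b - k" k "sp_step i"] by simp
  then show ?thesis using k(1)[of "[]" "[]"] by (simp add: sp_step_halted)
 qed
 moreover have "\<beta> ^ (384 * i ^ 2 * card X - pot F) \<le> \<beta> ^ (384 * i ^ 2 * card X)"
  unfolding \<beta>_def by (intro power_increasing ge_one_powr_ge_zero) auto
 moreover have "\<beta> ^ (384 * i ^ 2 * card X) = 2 powr (3 / 2 * card X / i)"
  using i unfolding \<beta>_def by (simp add: powr_power field_simps power_numeral_reduce)
 ultimately show ?thesis using k(2) by (intro exI[of _ k] exI[of _ ls]) auto
qed

lemma sp_inv:
 assumes "antichain X F"
 defines "s \<equiv> %k. (sp_step i ^^ k) ([F], [])"
 shows "(\<forall>\<psi>\<in>set (fst (s k)) \<union> set (snd (s k)). good \<psi>) & (\<forall>\<psi>\<in>set (snd (s k)). branch i \<psi> = []) &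
  (\<forall>\<alpha>. sats \<alpha> F \<longleftrightarrow> (\<exists>\<psi>\<in>set (fst (s k)) \<union> set (snd (s k)). sats \<alpha> \<psi>)) & length (fst (s k)) \<le> k + 1 & length (snd (s k)) \<le> k"
proof (induction k)
 case 0
 then show ?case using good_F[OF assms(1)] by (simp add: s_def)
next
 case (Suc k)
 have sS: "s (Suc k) = sp_step i (s k)" by (simp add: s_def)
 obtain st lv where sk: "s k = (st, lv)" by (cases "s k")
 show ?case
 proof (cases st)
  case Nil
  then show ?thesis using Suc by (simp add: sS sk sp_step_def le_SucI)
 next
  case (Cons \<psi> st')
  show ?thesis
  proof (cases "branch i \<psi> = []")
   case True
   then show ?thesis using Suc by (auto simp: sS sk Cons sp_step_def)
  next
   case False
   have "good \<psi>" using Suc by (simp add: sk Cons)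
   then obtain \<psi>0 \<psi>1 where b: "branch i \<psi> = [\<psi>0, \<psi>1]" "good \<psi>0" "good \<psi>1" using branch_good[OF _ False] by blast
   have sb: "sats \<alpha> \<psi> \<longleftrightarrow> sats \<alpha> \<psi>0 \<or> sats \<alpha> \<psi>1" for \<alpha> using sats_branch[OF False, of \<alpha>] by (simp add: b)
   show ?thesis using Suc b(2,3) sb by (simp add: sS sk Cons sp_step_def b(1))
  qed
 qed
qed

text \<open>\<open>L\<close> is twice the bound of \<open>unbranched\<close>, for the two literals
  of a variable. The 1 in the bound on the length accounts for the empty clause.\<close>

lemma leaf_valid:
 assumes \<psi>: "good \<psi>" and b: "branch i \<psi> = []" and X: "fst ` X \<subseteq> {..<n}" and L: "L = 128 * i ^ 2 + 2048 * i ^ 4"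
 shows "valid n L \<psi>" "length \<psi> \<le> n * L + 1"
proof -
 have ac: "distinct \<psi>" "\<And>C. C \<in> set \<psi> ==> length C \<le> 3 & set C \<subseteq> X"
  using \<psi> unfolding good_def antichain_def by blast+
 have v: "cnt (%C. \<exists>l\<in>set C. fst l = x) \<psi> \<le> L" for x
 proof -
  have "cnt (%C. \<exists>l\<in>set C. fst l = x) \<psi> \<le> cnt (%C. (x, True) \<in> set C \<or> (x, False) \<in> set C) \<psi>"
  proof (rule cnt_mono)
   fix C :: clause assume "\<exists>l\<in>set C. fst l = x"
   then obtain b where "(x, b) \<in> set C" by force
   then show "(x, True) \<in> set C \<or> (x, False) \<in> set C" by (cases b) auto
  qed
  also have "\<dots> \<le> cnt (%C. (x, True) \<in> set C) \<psi> + cnt (%C. (x, False) \<in> set C) \<psi>" by (rule cnt_disj)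
  also have "\<dots> \<le> L" using unbranched[OF \<psi> b, of "(x, True)"] unbranched[OF \<psi> b, of "(x, False)"] by (simp add: L)
  finally show ?thesis .
 qed
 have "1 \<le> i ^ 2" using i by simp
 then have "2 \<le> L" unfolding L by linarith
 moreover have "fst ` set C \<subseteq> {..<n}" if "C \<in> set \<psi>" for C using ac(2)[OF that] X by blast
 ultimately show "valid n L \<psi>" unfolding valid_def using v ac(2) by (simp add: cnt_def)
 have c: "length \<psi> = cnt (%C. C = []) \<psi> + cnt (%C. C ~= []) \<psi>"
  using cnt_split[of "%_. True" \<psi> "%C. C = []"] by (simp add: cnt_def)
 have "cnt (%C. C = []) \<psi> \<le> 1"
  unfolding cnt_def using ac(1) by (induction \<psi>) (auto simp: filter_empty_conv)
 moreover have "cnt (%C. C ~= []) \<psi> \<le> cnt (%C. \<exists>x\<in>set [0..<n]. \<exists>l\<in>set C. fst l = x) \<psi>"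
 proof (rule cnt_mono)
  fix C assume C: "C \<in> set \<psi>" "C ~= []"
  then have "hd C \<in> set C" by simp
  moreover have "fst (hd C) < n" using ac(2)[OF C(1)] X \<open>hd C \<in> set C\<close> by blast
  ultimately show "\<exists>x\<in>set [0..<n]. \<exists>l\<in>set C. fst l = x" by auto
 qed
 moreover have "\<dots> \<le> (\<Sum>x\<leftarrow>[0..<n]. cnt (%C. \<exists>l\<in>set C. fst l = x) \<psi>)" by (rule cnt_Bex)
 moreover have "\<dots> \<le> length [0..<n] * L" using v by (intro sum_list_le)
 ultimately show "length \<psi> \<le> n * L + 1" using c by simp
qed

end

lemma PT_add_clause: "PT f ==> PT g ==> PT (%x. add_clause (f x) (g x))"
 by (rule PT_comp2[of add_clause]) (unfold add_clause_def, (intro pt | assumption)+)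

text \<open>Formulas on the branching stack stay polynomial in the original one because there are
  few distinct clauses of at most three literals.\<close>

lemma sz_antichain:
 assumes "antichain (set (concat \<phi>)) \<psi>"
 shows "sz \<psi> \<le> Suc (4 * Suc (sz \<phi>) ^ 3 * Suc (Suc (3 * Suc (sz \<phi>))))"
proof (rule sz_list_le)
 let ?X = "set (concat \<phi>)"
 have ac: "distinct \<psi>" "\<And>C. C \<in> set \<psi> ==> length C \<le> 3 & set C \<subseteq> ?X"
  using assms unfolding antichain_def by blast+
 have "card ?X \<le> length (concat \<phi>)" by (rule card_length)
 also have "\<dots> \<le> sz \<phi>" using length_less_sz[of "concat \<phi>"] sz_concat[of \<phi>] by linarith
 finally have X: "card ?X \<le> sz \<phi>" .
 have "length \<psi> = card (set \<psi>)" using ac(1) by (simp add: distinct_card)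
 also have "\<dots> \<le> card {C. set C \<subseteq> ?X & length C \<le> 3}" using ac(2) by (intro card_mono finite_lists_length_le) auto
 also have "\<dots> = (\<Sum>j\<le>3. card ?X ^ j)" by (rule card_lists_length_le) simp
 also have "\<dots> \<le> (\<Sum>j\<le>(3::nat). Suc (sz \<phi>) ^ 3)"
 proof (rule sum_mono)
  fix j :: nat assume "j \<in> {..3}"
  have "card ?X ^ j \<le> Suc (sz \<phi>) ^ j" using X by (intro power_mono) auto
  also have "\<dots> \<le> Suc (sz \<phi>) ^ 3" using \<open>j \<in> {..3}\<close> by (intro power_increasing) auto
  finally show "card ?X ^ j \<le> Suc (sz \<phi>) ^ 3" .
 qed
 also have "\<dots> = 4 * Suc (sz \<phi>) ^ 3" by simp
 finally show "length \<psi> \<le> 4 * Suc (sz \<phi>) ^ 3" .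
 fix C assume "C \<in> set \<psi>"
 then have C: "length C \<le> 3" "set C \<subseteq> ?X" using ac(2) by blast+
 show "sz C \<le> Suc (3 * Suc (sz \<phi>))"
 proof (rule sz_list_le[OF C(1)])
  fix l assume "l \<in> set C"
  then obtain D where "l \<in> set D" "D \<in> set \<phi>" using C(2) by auto
  then show "sz l \<le> sz \<phi>" using sz_mem[of l D] sz_mem[of D \<phi>] by linarith
 qed
qed

lemma PT_reduce [pt]: "PT f ==> PT (%x. reduce (f x))"
proof (rule PT_comp[of reduce])
 let ?l = "%\<phi> :: clause list. map uniq (filter (%C. length C \<le> 3) \<phi>)"
 let ?B = "%\<phi> :: clause list. Suc (4 * Suc (sz \<phi>) ^ 3 * Suc (Suc (3 * Suc (sz \<phi>))))"
 show "PT reduce" unfolding reduce_def[abs_def]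
 proof (rule PT_foldl[where B = ?B and g = "%_. add_clause"])
  show "PT (%p :: clause list \<times> clause list \<times> clause. add_clause (fst (snd p)) (snd (snd p)))"
   by (intro PT_add_clause pt)
  show "sz (foldl add_clause [] (take k (?l \<phi>))) \<le> ?B \<phi>" for \<phi> k
   by (rule sz_antichain[OF antichain_reduce_take])
 qed (intro pt pb_Suc pb_mult pb_power pb_const pb_sz)+
qed

lemma PT_petals [pt]: "PT f ==> PT g ==> PT (%x. petals (f x) (g x))"
 by (rule PT_comp2[of petals]) (unfold petals_def, (intro pt | assumption)+)

lemma PT_threshold [pt]: "PT f ==> PT g ==> PT (%x. threshold (f x) (g x))"
 by (rule PT_comp2[of threshold]) (unfold threshold_def, (intro pt | assumption)+)

lemma PT_hearts [pt]: "PT f ==> PT (%x. hearts (f x))"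
 by (rule PT_comp[of hearts]) (unfold hearts_def[abs_def], (intro pt | assumption)+)

lemma PT_refine [pt]: "PT f ==> PT g ==> PT (%x. refine (f x) (g x))"
 by (rule PT_comp2[of refine]) (unfold refine_def, (intro pt | assumption)+)

lemma PT_branch_formula [pt]: "PT f ==> PT g ==> PT (%x. branch (f x) (g x))"
 by (rule PT_comp2[of branch]) (unfold branch_def, (intro pt | assumption)+)

lemma PT_sp_step: "PT f ==> PT g ==> PT (%x. sp_step (f x) (g x))"
 by (rule PT_comp2[of sp_step]) (unfold sp_step_def, (intro pt | assumption)+)

text \<open>The search is cut off after \<open>b\<close> steps and is complete iff the stack is
  empty. The level is shifted by one since it occurs in denominators.\<close>

definition sparsify :: "nat => nat => clause list => clause list list \<times> clause list list" where
 "sparsify b i \<phi> = (sp_step (Suc i) ^^ b) ([reduce \<phi>], [])"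

lemma sparse: "sparse (set (concat \<phi>)) (Suc i)"
 by standard auto

lemma PT_sparsify: "PT b ==> PT i ==> PT \<phi> ==> PT (%x. sparsify (b x) (i x) (\<phi> x))"
proof (rule PT_comp3[of sparsify])
 let ?s = "%x :: nat \<times> nat \<times> clause list. sz (snd (snd x))"
 let ?e = "%x. Suc (4 * Suc (?s x) ^ 3 * Suc (Suc (3 * Suc (?s x))))"
 let ?B = "%x. Suc ((Suc (fst x)) * Suc (?e x)) + Suc (Suc (fst x) * Suc (?e x)) + 1"
 show "PT (%x. sparsify (fst x) (fst (snd x)) (snd (snd x)))" unfolding sparsify_def
 proof (rule PT_funpow[where B = ?B])
  show "PT (%p :: (nat \<times> nat \<times> clause list) \<times> clause list list \<times> clause list list.
    sp_step (Suc (fst (snd (fst p)))) (snd p))" by (intro PT_sp_step pt)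
  fix x :: "nat \<times> nat \<times> clause list" and k assume k: "k \<le> fst x"
  let ?\<phi> = "snd (snd x)"
  interpret sparse "set (concat ?\<phi>)" "reduce ?\<phi>" "Suc (fst (snd x))" by (rule sparse)
  let ?t = "(sp_step (Suc (fst (snd x))) ^^ k) ([reduce ?\<phi>], [])"
  note inv = sp_inv[OF antichain_reduce, of k]
  have e: "sz \<psi> \<le> ?e x" if "\<psi> \<in> set (fst ?t) \<union> set (snd ?t)" for \<psi>
   using inv that unfolding good_def by (intro sz_antichain) blast
  have l: "length (fst ?t) \<le> Suc (fst x)" "length (snd ?t) \<le> Suc (fst x)" using inv k by auto
  have "sz (fst ?t) \<le> Suc (Suc (fst x) * Suc (?e x))" by (rule sz_list_le[OF l(1)]) (rule e, blast)
  moreover have "sz (snd ?t) \<le> Suc (Suc (fst x) * Suc (?e x))" by (rule sz_list_le[OF l(2)]) (rule e, blast)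
  ultimately show "sz ?t \<le> ?B x" by (simp add: venc_prod_def)
 next
  have f: "pb (%u :: nat \<times> nat \<times> clause list. fst u)" by (rule pb_mono[OF pb_PT[OF PT_fst[OF PT_id]]]) simp
  show "pb ?B" by (intro pb_add pb_mult pb_Suc pb_const f pb_PT pt pb_power)
 qed (intro pt)+
qed

section \<open>Reading formulas\<close>

text \<open>All candidates below \<open>b\<close> are tried; as numerals are prefix free, at most
  one of them fits.\<close>

definition read_nat :: "nat => bool list => nat \<times> bool list" where
 "read_nat b bs = (case filter (%m. take (length (enc_nat m)) bs = enc_nat m) [0..<b] of [] => (0, [])
   | m # _ => (m, drop (length (enc_nat m)) bs))"

lemma PT_read_nat [pt]: "PT f ==> PT g ==> PT (%x. read_nat (f x) (g x))"
 by (rule PT_comp2[of read_nat]) (unfold read_nat_def, (intro pt | assumption)+)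

lemma filter_eq_upt: "m < b ==> filter (%x. x = m) [0..<b] = [m]"
 by (induction b) (auto simp: less_Suc_eq filter_empty_conv)

lemma read_nat: "m < b ==> read_nat b (enc_nat m @ r) = (m, r)"
proof -
 assume m: "m < b"
 have "take (length (enc_nat k)) (enc_nat m @ r) = enc_nat k \<longleftrightarrow> k = m" for k
 proof
  assume "take (length (enc_nat k)) (enc_nat m @ r) = enc_nat k"
  then have "enc_nat m @ r = enc_nat k @ drop (length (enc_nat k)) (enc_nat m @ r)"
   by (metis append_take_drop_id)
  then show "k = m" unfolding enc_nat_prefix_free by simp
 qed simp
 then show ?thesis using m by (simp add: read_nat_def filter_eq_upt)
qed

lemma read_nat_size: "fst (read_nat b bs) \<le> b" "sz (snd (read_nat b bs)) \<le> sz bs"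
proof -
 have "fst (read_nat b bs) \<le> b & sz (snd (read_nat b bs)) \<le> sz bs"
 proof (cases "filter (%m. take (length (enc_nat m)) bs = enc_nat m) [0..<b]")
  case (Cons m ms)
  then have "m \<in> set [0..<b]" by (metis filter_is_subset list.set_intros(1) subsetD)
  then show ?thesis using sz_drop by (simp add: read_nat_def Cons)
 qed (simp add: read_nat_def Suc_le_eq)
 then show "fst (read_nat b bs) \<le> b" "sz (snd (read_nat b bs)) \<le> sz bs" by blast+
qed

text \<open>State of the parser: whether it is inside of a clause, the part of this clause read so far,
 the previous clauses and the remaining input.\<close>

type_synonym parser = "bool \<times> clause \<times> clause list \<times> bool list"

definition parse_step :: "nat => parser => parser" where
 "parse_step b s = (case snd (snd (snd s)) of [] => s | c # r =>
   if fst s then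
    if c then (case r of [] => (False, [], fst (snd (snd s)), [])
     | v # r' => (True, fst (snd s) @ [(fst (read_nat b r'), v)], fst (snd (snd s)), snd (read_nat b r')))
    else (False, [], fst (snd (snd s)) @ [fst (snd s)], r)
   else if c then (True, [], fst (snd (snd s)), r) else (False, [], fst (snd (snd s)), []))"

definition parse :: "nat => bool list => nat \<times> clause list" where
 "parse b bs = (fst (read_nat b bs),
   fst (snd (snd ((parse_step b ^^ length bs) (False, [], [], snd (read_nat b bs))))))"

lemma parse_clause:
 assumes "\<forall>l\<in>set C. fst l < b"
 shows "(parse_step b ^^ Suc (length C)) (True, cur, \<phi>, enc_list enc_literal C @ r) = (False, [], \<phi> @ [cur @ C], r)"
 using assms
proof (induction C arbitrary: cur)
 case Nil
 then show ?case by (simp add: enc_list_def parse_step_def)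
next
 case (Cons l C)
 have "parse_step b (True, cur, \<phi>, enc_list enc_literal (l # C) @ r) = (True, cur @ [l], \<phi>, enc_list enc_literal C @ r)"
 proof -
  obtain x v where l: "l = (x, v)" by (cases l)
  then have "x < b" using Cons.prems by simp
  then show ?thesis by (simp add: l enc_list_def enc_literal_def parse_step_def read_nat)
 qed
 then show ?case using Cons.IH[of "cur @ [l]"] Cons.prems by (simp add: funpow_swap1 del: funpow.simps) (simp add: funpow_swap1)
qed

lemma parse_formula:
 assumes "\<forall>C\<in>set \<psi>. \<forall>l\<in>set C. fst l < b"
 shows "\<exists>k\<le>length (enc_list (enc_list enc_literal) \<psi>).
  (parse_step b ^^ k) (False, [], \<phi>, enc_list (enc_list enc_literal) \<psi>) = (False, [], \<phi> @ \<psi>, [])"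
 using assms
proof (induction \<psi> arbitrary: \<phi>)
 case Nil
 then show ?case by (intro exI[of _ 1]) (simp add: enc_list_def parse_step_def)
next
 case (Cons C \<psi>)
 let ?e = "enc_list enc_literal" and ?E = "enc_list (enc_list enc_literal)"
 obtain k where k: "k \<le> length (?E \<psi>)" "(parse_step b ^^ k) (False, [], \<phi> @ [C], ?E \<psi>) = (False, [], (\<phi> @ [C]) @ \<psi>, [])"
  using Cons.IH[of "\<phi> @ [C]"] Cons.prems by auto
 have E: "?E (C # \<psi>) = True # ?e C @ ?E \<psi>" by (simp add: enc_list_def)
 have "(parse_step b ^^ (k + (Suc (length C) + 1))) (False, [], \<phi>, ?E (C # \<psi>)) = (False, [], \<phi> @ C # \<psi>, [])"
 proof -
  have 1: "(parse_step b ^^ 1) (False, [], \<phi>, ?E (C # \<psi>)) = (True, [], \<phi>, ?e C @ ?E \<psi>)"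
   by (simp add: E parse_step_def)
  have 2: "(parse_step b ^^ Suc (length C)) (True, [], \<phi>, ?e C @ ?E \<psi>) = (False, [], \<phi> @ [C], ?E \<psi>)"
   using parse_clause[of C b "[]" \<phi> "?E \<psi>"] Cons.prems by simp
  have "(parse_step b ^^ (k + (Suc (length C) + 1))) (False, [], \<phi>, ?E (C # \<psi>)) =
   (parse_step b ^^ k) ((parse_step b ^^ Suc (length C)) ((parse_step b ^^ 1) (False, [], \<phi>, ?E (C # \<psi>))))"
   by (simp only: funpow_add comp_apply)
  also have "\<dots> = (False, [], \<phi> @ C # \<psi>, [])" by (simp only: 1 2 k(2)) simp
  finally show ?thesis .
 qed
 moreover have "length C < length (?e C)"
  by (simp add: enc_list_def length_concat comp_def) (induction C, auto)
 then have "k + (Suc (length C) + 1) \<le> length (?E (C # \<psi>))" using k(1) by (simp add: E)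
 ultimately show ?case by blast
qed

lemma parse:
 assumes "n < b" "\<forall>C\<in>set \<phi>. \<forall>l\<in>set C. fst l < b"
 shows "parse b (enc_cnf n \<phi>) = (n, \<phi>)"
proof -
 let ?E = "enc_list (enc_list enc_literal) \<phi>"
 have r: "read_nat b (enc_cnf n \<phi>) = (n, ?E)" by (simp add: enc_cnf_def read_nat assms(1))
 obtain k where k: "k \<le> length ?E" "(parse_step b ^^ k) (False, [], [], ?E) = (False, [], \<phi>, [])"
  using parse_formula[OF assms(2), of "[]"] by auto
 then have "k \<le> length (enc_cnf n \<phi>)" by (simp add: enc_cnf_def)
 then have "(parse_step b ^^ length (enc_cnf n \<phi>)) (False, [], [], ?E) =
  (parse_step b ^^ (length (enc_cnf n \<phi>) - k)) (False, [], \<phi>, [])"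
  using k(2) funpow_add[of "length (enc_cnf n \<phi>) - k" k "parse_step b"] by simp
 also have "\<dots> = (False, [], \<phi>, [])" by (rule funpow_fixed) (simp add: parse_step_def)
 finally show ?thesis by (simp add: parse_def r)
qed

text \<open>For a sufficiently large \<open>b\<close>, the parser is a left inverse of both
  encodings.\<close>

lemma enc_cnf_inject: "enc_cnf n \<phi> = enc_cnf m \<psi> ==> n = m & \<phi> = \<psi>"
proof -
 assume e: "enc_cnf n \<phi> = enc_cnf m \<psi>"
 define b where "b = Suc (n + m + (\<Sum>l\<leftarrow>concat (\<phi> @ \<psi>). fst l))"
 have "fst l < b" if "l \<in> set (concat (\<phi> @ \<psi>))" for l
 proof -
  have "fst l \<le> (\<Sum>l\<leftarrow>concat (\<phi> @ \<psi>). fst l)" using that by (intro member_le_sum_list) auto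
  then show ?thesis by (simp add: b_def)
 qed
 then have "\<forall>C\<in>set \<phi>. \<forall>l\<in>set C. fst l < b" "\<forall>C\<in>set \<psi>. \<forall>l\<in>set C. fst l < b" by auto
 moreover have "n < b" "m < b" by (simp_all add: b_def)
 ultimately have "parse b (enc_cnf n \<phi>) = (n, \<phi>)" "parse b (enc_cnf m \<psi>) = (m, \<psi>)"
  by (blast intro: parse)+
 then show ?thesis unfolding e by simp
qed

lemma PT_parse_step: "PT f ==> PT g ==> PT (%x. parse_step (f x) (g x))"
 by (rule PT_comp2[of parse_step]) (unfold parse_step_def, (intro pt | assumption)+)

lemma sz_snoc: "sz (xs @ [a]) = sz xs + Suc (sz a)"
 using sz_append[of xs "[a]"] by simp

lemma parse_step_size: "sz (parse_step b s) \<le> sz s + (2 * b + 20)"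
proof -
 obtain m cur \<phi> r where s: "s = (m, cur, \<phi>, r)" by (cases s)
 show ?thesis
 proof (cases r)
  case (Cons c r')
  then show ?thesis
  proof (cases "m & c & r' ~= []")
   case True
   then obtain v r'' where r': "r' = v # r''" by (cases r') auto
   show ?thesis using True read_nat_size[of b r''] unfolding s Cons r'
    by (auto simp: parse_step_def sz_snoc venc_bool_def venc_prod_def)
  next
   case False
   then show ?thesis unfolding s Cons
    by (auto simp: parse_step_def sz_snoc venc_bool_def split: list.split)
  qed
 qed (simp add: parse_step_def s)
qed

lemma PT_parse [pt]: "PT f ==> PT g ==> PT (%x. parse (f x) (g x))"
proof (rule PT_comp2[of parse])
 let ?i = "%x :: nat \<times> bool list. (False, [] :: clause, [] :: clause list, snd (read_nat (fst x) (snd x)))"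
 have "PT (%x. (parse_step (fst x) ^^ length (snd x)) (?i x))"
 proof (rule PT_funpow[where B = "%x. sz (?i x) + sz (snd x) * (2 * fst x + 20)"])
  show "PT (%p :: (nat \<times> bool list) \<times> parser. parse_step (fst (fst p)) (snd p))" by (intro PT_parse_step pt)
  fix x :: "nat \<times> bool list" and k assume k: "k \<le> length (snd x)"
  have "sz ((parse_step (fst x) ^^ k) (?i x)) \<le> sz (?i x) + k * (2 * fst x + 20)"
  proof (induction k)
   case (Suc k)
   then show ?case using parse_step_size[of "fst x" "(parse_step (fst x) ^^ k) (?i x)"] by simp
  qed simp
  also have "\<dots> \<le> sz (?i x) + sz (snd x) * (2 * fst x + 20)"
   using k length_less_sz[of "snd x"] by (intro add_left_mono mult_le_mono1) simp
  finally show "sz ((parse_step (fst x) ^^ k) (?i x)) \<le> sz (?i x) + sz (snd x) * (2 * fst x + 20)" .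
 next
  have f: "pb (%u :: nat \<times> bool list. fst u)" by (rule pb_mono[OF pb_PT[OF PT_fst[OF PT_id]]]) simp
  show "pb (%x. sz (?i x) + sz (snd x) * (2 * fst x + 20))" by (intro pb_add pb_mult pb_const f pb_PT pt)
 qed (intro pt)+
 then show "PT (%x. parse (fst x) (snd x))" unfolding parse_def by (intro pt)
qed

lemma PT_enc_cnf [pt]: "PT f ==> PT g ==> PT (%x. enc_cnf (f x) (g x))"
 by (rule PT_comp2[of enc_cnf]) (unfold enc_cnf_def enc_list_def enc_literal_def, (intro pt | assumption)+)

text \<open>Clauses are not repeated in \<open>cnf3\<close>, so their number and hence the size are
  polynomial in \<open>n\<close>.\<close>

definition cnf_size :: "nat => nat" where
 "cnf_size n = Suc (4 * Suc (2 * n) ^ 3 * Suc (Suc (3 * Suc (2 * n + 6))))"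

lemma sz_cnf3: "cnf3 n \<phi> ==> sz \<phi> \<le> cnf_size n"
 unfolding cnf_size_def
proof (rule sz_list_le)
 assume \<phi>: "cnf3 n \<phi>"
 let ?X = "{..<n} \<times> (UNIV :: bool set)"
 have C: "length C \<le> 3 & set C \<subseteq> ?X" if "C \<in> set \<phi>" for C
  using \<phi> that by (force simp: cnf3_def)
 have X: "card ?X = 2 * n" by (simp add: card_cartesian_product card_UNIV_bool)
 have "length \<phi> = card (set \<phi>)" using \<phi> by (simp add: distinct_card cnf3_def)
 also have "\<dots> \<le> card {C. set C \<subseteq> ?X & length C \<le> 3}" using C by (intro card_mono finite_lists_length_le) auto
 also have "\<dots> = (\<Sum>j\<le>3. (2 * n) ^ j)" unfolding X[symmetric] by (rule card_lists_length_le) simp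
 also have "\<dots> \<le> (\<Sum>j\<le>(3::nat). Suc (2 * n) ^ 3)"
 proof (rule sum_mono)
  fix j :: nat assume "j \<in> {..3}"
  have "(2 * n) ^ j \<le> Suc (2 * n) ^ j" by (intro power_mono) auto
  also have "\<dots> \<le> Suc (2 * n) ^ 3" using \<open>j \<in> {..3}\<close> by (intro power_increasing) auto
  finally show "(2 * n) ^ j \<le> Suc (2 * n) ^ 3" .
 qed
 also have "\<dots> = 4 * Suc (2 * n) ^ 3" by simp
 finally show "length \<phi> \<le> 4 * Suc (2 * n) ^ 3" .
 fix D assume "D \<in> set \<phi>"
 then have D: "length D \<le> 3" "set D \<subseteq> ?X" using C by blast+
 show "sz D \<le> Suc (3 * Suc (2 * n + 6))"
 proof (rule sz_list_le[OF D(1)])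
  fix l assume "l \<in> set D"
  then have "fst l < n" using D(2) by auto
  then show "sz l \<le> 2 * n + 6" by (simp add: venc_prod_def venc_bool_def)
 qed
qed

section \<open>The exponential time hypothesis\<close>

lemma growth: "0 < (s::real) ==> eventually (%n::nat. 2 * real n + c + 2 * 2 powr (3 * s * n) +
  2 powr (s * n + C) * (real n + 2) ^ e \<le> 2 powr (5 * s * n)) at_top"
 by real_asymp

lemma graph_size_le: "numbered_graph G ==> graph_size G \<le> 2 * length (enc_instance G k)"
proof -
 assume "numbered_graph G"
 then obtain n where n: "verts G = {..<n}" and e: "\<And>e. e \<in> edges G ==> e \<subseteq> {..<n} & card e = 2"
  by (auto simp: numbered_graph_def simple_graph_def)
 have "edges G \<subseteq> (%(u, v). {u, v}) ` ({..<n} \<times> {..<n})"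
  using e by (fastforce simp: card_2_iff)
 then have "card (edges G) \<le> card ({..<n} \<times> {..<n})" by (intro surj_card_le) auto
 then have "card (edges G) \<le> n * n" by simp
 moreover have "n * n \<le> length (enc_instance G k)"
  by (simp add: enc_instance_def enc_graph_def n length_rows del: length_concat)
 moreover have "n \<le> n * n" by (cases n) auto
 ultimately have "n + card (edges G) \<le> 2 * length (enc_instance G k)" by linarith
 then show ?thesis by (simp add: graph_size_def n)
qed

section \<open>From a subexponential algorithm to a decider for formulas\<close>

locale solver =
 fixes T :: "'h graph" and R :: "nat \<times> nat \<times> clause list => ngraph \<times> nat"
  and p :: program and f :: "nat => real" and q :: "nat poly"
 assumes R: "hard_red T R" and f: "f \<in> o(%k. real k)"
  and p: "numbered_graph G ==>
   \<exists>t. real t \<le> 2 powr f k * real (poly q (graph_size G)) & computes_in p (enc_instance G k) t [edge_deletable T G k]"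
begin

definition occs :: "nat => nat" where
 "occs i = 128 * Suc i ^ 2 + 2048 * Suc i ^ 4"

definition runs :: "nat => nat => nat => clause list list => sim list" where
 "runs b i n \<psi>s = map (%\<psi>. simulate p b (enc_ngraph (R (n, occs i, \<psi>)))) \<psi>s"

text \<open>The empty list means undecided: the branching search or one of the simulations did not
  finish within the budget.\<close>

definition attempt :: "nat => nat => nat => clause list => bool list" where
 "attempt b i n \<phi> = (let s = sparsify b i \<phi> in
   if fst s = [] then
    let rs = runs b i n (snd s) in
    if \<forall>r\<in>set rs. length p \<le> fst r then [\<exists>r\<in>set rs. snd (snd (snd r)) = [True]] else []
   else [])"

text \<open>
 All sparsification levels share the budget \<open>b\<close>; the level that suffices depends on \<open>f\<close>, which need not be computable.
\<close>

definition search :: "nat => bool list => bool list" where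
 "search b bs = (let u = parse b bs in
   if enc_cnf (fst u) (snd u) = bs then concat (map (%i. attempt b i (fst u) (snd u)) [0..<b]) else [])"

lemma PT_search: "PT g ==> PT h ==> PT (%x. search (g x) (h x))"
proof (rule PT_comp2[of search])
 have R': "PT R" using R by (simp add: hard_red_def)
 have 1: "PT (%x :: (nat \<times> nat \<times> nat \<times> clause list list) \<times> clause list. R (fst (snd (snd (fst x))), occs (fst (snd (fst x))), snd x))"
  unfolding occs_def by (rule PT_comp[OF R']) (intro pt)
 have r: "PT (%x :: nat \<times> nat \<times> nat \<times> clause list list. runs (fst x) (fst (snd x)) (fst (snd (snd x))) (snd (snd (snd x))))"
  unfolding runs_def by (intro PT_map PT_simulate PT_enc_ngraph 1) (intro pt)+
 have r': "PT (%x. runs (b x) (i x) (n x) (\<psi>s x))" if "PT b" "PT i" "PT n" "PT \<psi>s"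
  for b i n :: "'x :: encodable => nat" and \<psi>s
  using PT_comp[OF r, of "%x. (b x, i x, n x, \<psi>s x)"] that by (simp add: PT_Pair)
 have a: "PT (%x :: nat \<times> nat \<times> nat \<times> clause list. attempt (fst x) (fst (snd x)) (fst (snd (snd x))) (snd (snd (snd x))))"
  unfolding attempt_def by (intro PT_Let PT_sparsify PT_if r') (intro pt r')+
 have a': "PT (%x. attempt (b x) (i x) (n x) (\<psi>s x))" if "PT b" "PT i" "PT n" "PT \<psi>s"
  for b i n :: "'x :: encodable => nat" and \<psi>s
  using PT_comp[OF a, of "%x. (b x, i x, n x, \<psi>s x)"] that by (simp add: PT_Pair)
 show "PT (%x. search (fst x) (snd x))"
  unfolding search_def by (intro PT_Let PT_if PT_concat PT_map a') (intro pt)+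
qed

lemma leaf:
 assumes \<phi>: "cnf3 n \<phi>" and \<psi>: "\<psi> \<in> set (snd (sparsify b i \<phi>))"
 shows "cnf3 n \<psi>" "valid n (occs i) \<psi>" "length \<psi> \<le> n * occs i + 1"
proof -
 interpret sparse "set (concat \<phi>)" "reduce \<phi>" "Suc i" by (rule sparse)
 have g: "good \<psi>" "branch (Suc i) \<psi> = []" using sp_inv[OF antichain_reduce, of b] \<psi> by (auto simp: sparsify_def)
 have X: "fst ` set (concat \<phi>) \<subseteq> {..<n}" using \<phi> by (force simp: cnf3_def)
 show "valid n (occs i) \<psi>" "length \<psi> \<le> n * occs i + 1" using leaf_valid[OF g X occs_def] by blast+
 then have "\<forall>C\<in>set \<psi>. length C \<le> 3 & fst ` set C \<subseteq> {..<n}" unfolding valid_def by blast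
 moreover have "distinct \<psi>" using g(1) unfolding good_def antichain_def by blast
 ultimately show "cnf3 n \<psi>" unfolding cnf3_def by blast
qed

lemma leaf_run:
 assumes \<phi>: "cnf3 n \<phi>" and \<psi>: "\<psi> \<in> set (snd (sparsify b i \<phi>))"
 defines "I \<equiv> R (n, occs i, \<psi>)"
 shows "\<exists>t. real t \<le> 2 powr f (snd I) * real (poly q (2 * length (enc_ngraph I))) &
  computes_in p (enc_ngraph I) t [satisfiable \<psi>]"
proof -
 have s: "satisfiable \<psi> \<longleftrightarrow> edge_deletable T (number (fst I)) (snd I)"
  using R leaf(2)[OF \<phi> \<psi>] unfolding hard_red_def number_deletable I_def by blast
 obtain t where t: "real t \<le> 2 powr f (snd I) * real (poly q (graph_size (number (fst I))))"
  "computes_in p (enc_ngraph I) t [satisfiable \<psi>]"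
  using p[OF numbered, of "snd I" "fst I"] unfolding s enc_ngraph_def by blast
 have "poly q (graph_size (number (fst I))) \<le> poly q (2 * length (enc_ngraph I))"
  unfolding enc_ngraph_def by (intro poly_nat_mono graph_size_le numbered)
 then have "2 powr f (snd I) * real (poly q (graph_size (number (fst I)))) \<le> 2 powr f (snd I) * real (poly q (2 * length (enc_ngraph I)))"
  by (intro mult_left_mono) auto
 then show ?thesis using t by (intro exI[of _ t]) linarith
qed

text \<open>Re-encoding the parsed formula detects a budget too small for parsing. Every other
  answer rests on a finished search and on halted runs, so it is right whatever the budget and the
  level.\<close>

lemma search_sound:
 assumes \<phi>: "cnf3 n \<phi>" and r: "r \<in> set (search b (enc_cnf n \<phi>))"
 shows "r = satisfiable \<phi>"
proof -
 have eq: "enc_cnf (fst (parse b (enc_cnf n \<phi>))) (snd (parse b (enc_cnf n \<phi>))) = enc_cnf n \<phi>"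
  using r by (auto simp: search_def Let_def split: if_splits)
 from enc_cnf_inject[OF eq] have pr: "parse b (enc_cnf n \<phi>) = (n, \<phi>)" by (simp add: prod_eq_iff)
 then obtain i where ri: "r \<in> set (attempt b i n \<phi>)" using r by (auto simp: search_def Let_def)
 let ?s = "sparsify b i \<phi>"
 have a: "fst ?s = []" "\<forall>r\<in>set (runs b i n (snd ?s)). length p \<le> fst r"
  "r \<longleftrightarrow> (\<exists>r\<in>set (runs b i n (snd ?s)). snd (snd (snd r)) = [True])"
  using ri by (simp_all add: attempt_def Let_def split: if_splits)
 have o: "snd (snd (snd (simulate p b (enc_ngraph (R (n, occs i, \<psi>)))))) = [satisfiable \<psi>]" if l: "\<psi> \<in> set (snd ?s)" for \<psi>
 proof -
  obtain t where "computes_in p (enc_ngraph (R (n, occs i, \<psi>))) t [satisfiable \<psi>]"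
   using leaf_run[OF \<phi> l] by blast
  then show ?thesis by (rule simulate(2)) (use a(2) l in \<open>auto simp: runs_def\<close>)
 qed
 have "r \<longleftrightarrow> (\<exists>\<psi>\<in>set (snd ?s). satisfiable \<psi>)" unfolding a(3) runs_def using o by auto
 moreover interpret sparse "set (concat \<phi>)" "reduce \<phi>" "Suc i" by (rule sparse)
 have "sats \<alpha> (reduce \<phi>) \<longleftrightarrow> (\<exists>\<psi>\<in>set (snd ?s). sats \<alpha> \<psi>)" for \<alpha>
  using sp_inv[OF antichain_reduce, of b] a(1) unfolding sparsify_def by simp
 moreover have "sats \<alpha> (reduce \<phi>) \<longleftrightarrow> sats \<alpha> \<phi>" for \<alpha>
  using \<phi> by (intro sats_reduce) (simp add: cnf3_def)
 ultimately show ?thesis unfolding satisfiable_sats by blast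
qed

text \<open>At a fixed level the occurrence bound is constant, so the parameter is at most
  \<open>K * (n + 2)\<close>. As \<open>f\<close> is o(k), its value there is at most
  \<open>s * n\<close> plus a constant.\<close>

lemma leaf_time:
 assumes s: "0 < (s :: real)"
 shows "\<exists>C e. \<forall>n \<phi> b \<psi>. cnf3 n \<phi> --> \<psi> \<in> set (snd (sparsify b i \<phi>)) -->
  (\<exists>t. real t \<le> 2 powr (s * n + C) * (real n + 2) ^ e & computes_in p (enc_ngraph (R (n, occs i, \<psi>))) t [satisfiable \<psi>])"
proof -
 have "PT R" using R by (simp add: hard_red_def)
 from pb_PT[OF PT_enc_ngraph[OF this]] obtain a1 where a1: "\<And>x. sz (enc_ngraph (R x)) \<le> (sz x + 2) ^ a1" unfolding pb_def by blast
 let ?h = "%n :: nat. (2 * n + 1 + (sz (occs i) + cnf_size n + 1) + 1 + 2) ^ a1"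
 have f1: "pb (%n :: nat. n)" by (rule pb_mono[OF pb_sz]) simp
 have "pb (%n. poly q (2 * ?h n))"
 proof (rule pb_mono[OF pb_PT])
  show "PT (%n. poly q (2 * (2 * n + 1 + (sz (occs i) + cnf_size n + 1) + 1 + 2) ^ a1))"
   unfolding cnf_size_def by (intro pt)
 qed simp
 then obtain e where e: "\<And>n. poly q (2 * ?h n) \<le> (sz n + 2) ^ e" unfolding pb_def by blast
 obtain c where c: "\<And>n L \<psi>. valid n L \<psi> ==> snd (R (n, L, \<psi>)) \<le> c * (L + 1) * (n + length \<psi> + 1)"
  using R unfolding hard_red_def by blast
 define K where "K = real (c * (occs i + 1) * (occs i + 1)) + 1"
 have K: "0 < K" by (simp add: K_def add_nonneg_pos)
 have "eventually (%k. norm (f k) \<le> s / K * norm (real k)) at_top"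
  using landau_o.smallD[OF f, of "s / K"] s K by simp
 then obtain k0 where k0: "\<And>k. k0 \<le> k ==> \<bar>f k\<bar> \<le> s / K * real k" by (auto simp: eventually_at_top_linorder)
 \<comment> \<open>Covers the finitely many parameters below \<open>k0\<close>, for which the
   asymptotic bound says nothing.\<close>
 define D where "D = (\<Sum>k<k0. \<bar>f k\<bar>)"
 have fb: "f k \<le> s / K * real k + D" for k
 proof (cases "k0 \<le> k")
  case True
  have "0 \<le> D" unfolding D_def by (intro sum_nonneg) auto
  then show ?thesis using k0[OF True] by linarith
 next
  case False
  then have "\<bar>f k\<bar> \<le> D" unfolding D_def by (intro member_le_sum) auto
  moreover have "0 \<le> s / K * real k" using s K by simp
  ultimately show ?thesis by linarith
 qed
 have "\<exists>t. real t \<le> 2 powr (s * n + (2 * s + D + e)) * (real n + 2) ^ e & computes_in p (enc_ngraph (R (n, occs i, \<psi>))) t [satisfiable \<psi>]"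
  if \<phi>: "cnf3 n \<phi>" and \<psi>: "\<psi> \<in> set (snd (sparsify b i \<phi>))" for n \<phi> b \<psi>
 proof -
  note l = leaf[OF \<phi> \<psi>]
  let ?I = "R (n, occs i, \<psi>)"
  obtain t where t: "real t \<le> 2 powr f (snd ?I) * real (poly q (2 * length (enc_ngraph ?I)))"
   "computes_in p (enc_ngraph ?I) t [satisfiable \<psi>]" using leaf_run[OF \<phi> \<psi>] by blast
  have "length (enc_ngraph ?I) \<le> sz (enc_ngraph ?I)" using length_less_sz less_imp_le by blast
  also have "\<dots> \<le> (sz (n, occs i, \<psi>) + 2) ^ a1" by (rule a1)
  also have "\<dots> \<le> ?h n" using sz_cnf3[OF l(1)] by (intro power_mono) simp_all
  finally have "poly q (2 * length (enc_ngraph ?I)) \<le> poly q (2 * ?h n)" by (intro poly_nat_mono) simp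
  also have "\<dots> \<le> (sz n + 2) ^ e" by (rule e)
  also have "\<dots> \<le> (2 * (n + 2)) ^ e" by (intro power_mono) simp_all
  finally have "real (poly q (2 * length (enc_ngraph ?I))) \<le> real ((2 * (n + 2)) ^ e)" by (rule of_nat_mono)
  also have "\<dots> = 2 powr e * (real n + 2) ^ e" by (simp add: powr_realpow add.commute flip: power_mult_distrib)
  finally have P: "real (poly q (2 * length (enc_ngraph ?I))) \<le> 2 powr e * (real n + 2) ^ e" .
  have "snd ?I \<le> c * (occs i + 1) * (n + length \<psi> + 1)" by (rule c[OF l(2)])
  also have "\<dots> \<le> c * (occs i + 1) * ((occs i + 1) * (n + 2))" using l(3) by (intro mult_le_mono2) (simp add: algebra_simps)
  finally have "real (snd ?I) \<le> real (c * (occs i + 1) * ((occs i + 1) * (n + 2)))" by (rule of_nat_mono)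
  also have "\<dots> \<le> K * (real n + 2)" unfolding K_def by (simp add: algebra_simps)
  finally have k: "real (snd ?I) \<le> K * (real n + 2)" .
  have "f (snd ?I) \<le> s / K * real (snd ?I) + D" by (rule fb)
  also have "\<dots> \<le> s / K * (K * (real n + 2)) + D" using k s K by (intro add_right_mono mult_left_mono) auto
  also have "\<dots> = s * n + (2 * s + D)" using K by (simp add: field_simps)
  finally have F: "2 powr f (snd ?I) \<le> 2 powr (s * n + (2 * s + D))" by simp
  have "real t \<le> 2 powr (s * n + (2 * s + D)) * (2 powr e * (real n + 2) ^ e)"
   using t(1) mult_mono[OF F P] by simp
  also have "\<dots> = 2 powr (s * n + (2 * s + D + e)) * (real n + 2) ^ e" by (simp add: powr_add)
  finally show ?thesis using t(2) by blast
 qed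
 then show ?thesis by blast
qed

definition works :: "nat => nat => bool" where
 "works n b \<longleftrightarrow> (\<forall>\<phi>. cnf3 n \<phi> --> search b (enc_cnf n \<phi>) ~= [])"

text \<open>The summands pay for parsing and for including level \<open>i\<close>, for the branching
  search (with at most \<open>2 * n\<close> literals, its exponent is \<open>3 * s * n\<close>), and
  for the run of the algorithm on a leaf.\<close>

lemma works:
 assumes s: "s = 1 / real (Suc i)"
 shows "\<exists>C e. \<forall>n b. real n + real i + 1 + 2 * 2 powr (3 * s * n) + 2 powr (s * n + C) * (real n + 2) ^ e \<le> real b --> works n b"
proof -
 have "0 < s" by (simp add: s)
 from leaf_time[OF this, of i] obtain C e where Ce: "\<And>n \<phi> b \<psi>. cnf3 n \<phi> ==> \<psi> \<in> set (snd (sparsify b i \<phi>)) ==>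
  (\<exists>t. real t \<le> 2 powr (s * n + C) * (real n + 2) ^ e & computes_in p (enc_ngraph (R (n, occs i, \<psi>))) t [satisfiable \<psi>])"
  by metis
 have "works n b" if b: "real n + real i + 1 + 2 * 2 powr (3 * s * n) + 2 powr (s * n + C) * (real n + 2) ^ e \<le> real b" for n b
  unfolding works_def
 proof (intro allI impI)
  fix \<phi> assume \<phi>: "cnf3 n \<phi>"
  have pos: "0 \<le> 2 * 2 powr (3 * s * n)" "0 \<le> 2 powr (s * n + C) * (real n + 2) ^ e" by simp_all
  then have "real n + real i + 1 \<le> real b" "2 * 2 powr (3 * s * n) \<le> real b" "2 powr (s * n + C) * (real n + 2) ^ e \<le> real b"
   using b by linarith+
  note b = this
  have ni: "n < b" "i < b" using b(1) by linarith+
  have "\<forall>C\<in>set \<phi>. \<forall>l\<in>set C. fst l < b" using \<phi> ni(1) by (fastforce simp: cnf3_def)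
  then have pr: "parse b (enc_cnf n \<phi>) = (n, \<phi>)" using ni(1) by (intro parse)
  interpret sparse "set (concat \<phi>)" "reduce \<phi>" "Suc i" by (rule sparse)
  obtain k ls where k: "\<And>b. k \<le> b ==> (sp_step (Suc i) ^^ b) ([reduce \<phi>], []) = ([], ls)"
   "real k \<le> 2 * 2 powr (3 / 2 * card (set (concat \<phi>)) / Suc i)"
   using sp_run_F[OF antichain_reduce] by blast
  have "set (concat \<phi>) \<subseteq> {..<n} \<times> UNIV" using \<phi> by (force simp: cnf3_def)
  then have "card (set (concat \<phi>)) \<le> card ({..<n} \<times> (UNIV :: bool set))" by (intro card_mono) auto
  then have "card (set (concat \<phi>)) \<le> 2 * n" by (simp add: card_cartesian_product card_UNIV_bool)
  then have "3 / 2 * card (set (concat \<phi>)) / Suc i \<le> 3 / 2 * real (2 * n) / Suc i" by (intro divide_right_mono mult_left_mono) auto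
  also have "\<dots> = 3 * s * n" by (simp add: s)
  finally have "2 powr (3 / 2 * card (set (concat \<phi>)) / Suc i) \<le> 2 powr (3 * s * n)" by simp
  then have "real k \<le> real b" using k(2) b(2) by linarith
  then have sp: "fst (sparsify b i \<phi>) = []" using k(1)[of b] by (simp add: sparsify_def)
  have "length p \<le> fst (simulate p b (enc_ngraph (R (n, occs i, \<psi>))))" if l: "\<psi> \<in> set (snd (sparsify b i \<phi>))" for \<psi>
  proof -
   obtain t where t: "real t \<le> 2 powr (s * n + C) * (real n + 2) ^ e"
    "computes_in p (enc_ngraph (R (n, occs i, \<psi>))) t [satisfiable \<psi>]" using Ce[OF \<phi> l] by blast
   have "t \<le> b" using t(1) b(3) by linarith
   then show ?thesis by (rule simulate(1)[OF t(2)])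
  qed
  then have "attempt b i n \<phi> ~= []" using sp by (simp add: attempt_def Let_def runs_def)
  then show "search b (enc_cnf n \<phi>) ~= []" using ni(2) by (auto simp: search_def pr Let_def)
 qed
 then show ?thesis by blast
qed

text \<open>The machine does not compute this number; it appears only in the analysis.\<close>

definition budget :: "nat => nat" where
 "budget n = (LEAST b. works n b)"

lemma works_budget: "works n (budget n)"
proof -
 obtain C e where Ce: "\<And>n b. real n + real (0::nat) + 1 + 2 * 2 powr (3 * (1::real) * real n) + 2 powr ((1::real) * real n + C) * (real n + 2) ^ e \<le> real b ==> works n b"
  using works[of 1 0] by auto
 obtain b where "real n + real (0::nat) + 1 + 2 * 2 powr (3 * (1::real) * real n) + 2 powr ((1::real) * real n + C) * (real n + 2) ^ e \<le> real b"
  using real_arch_simple by blast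
 then have "works n b" by (rule Ce)
 then show ?thesis unfolding budget_def by (rule LeastI)
qed

lemma budget_growth:
 assumes "0 < \<delta>"
 shows "eventually (%n. log 2 (real (budget n + n + 5)) \<le> \<delta> * real n) at_top"
proof -
 \<comment> \<open>By \<open>growth\<close>, level \<open>i\<close> costs at most
   \<open>2 powr (5 * s * n)\<close> eventually, so \<open>5 * s \<le> \<delta>\<close> is what is
   needed.\<close>
 obtain i where i: "5 / \<delta> < real (Suc i)" using reals_Archimedean2 less_trans[OF _ lessI] of_nat_less_iff by (metis of_nat_Suc less_add_one less_trans)
 define s where "s = 1 / real (Suc i)"
 have s: "0 < s" "5 * s \<le> \<delta>" using i assms by (auto simp: s_def field_simps)
 obtain C e where Ce: "\<And>n b. real n + real i + 1 + 2 * 2 powr (3 * s * n) + 2 powr (s * n + C) * (real n + 2) ^ e \<le> real b ==> works n b"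
  using works[OF s_def] by blast
 have bb: "real (budget n) \<le> real n + real i + 2 + 2 * 2 powr (3 * s * n) + 2 powr (s * n + C) * (real n + 2) ^ e" for n
 proof -
  let ?x = "real n + real i + 1 + 2 * 2 powr (3 * s * n) + 2 powr (s * n + C) * (real n + 2) ^ e"
  have "?x \<le> real (nat \<lceil>?x\<rceil>)" by (rule real_nat_ceiling_ge)
  then have "works n (nat \<lceil>?x\<rceil>)" by (rule Ce)
  then have "budget n \<le> nat \<lceil>?x\<rceil>" unfolding budget_def by (rule Least_le)
  moreover have "0 \<le> ?x" by (simp add: add_nonneg_nonneg)
  then have "real (nat \<lceil>?x\<rceil>) \<le> ?x + 1" using ceiling_correct[of ?x] by linarith
  ultimately show ?thesis by linarith
 qed
 have b: "real (budget n + n + 5) \<le> 2 * real n + (real i + 7) + 2 * 2 powr (3 * s * n) + 2 powr (s * n + C) * (real n + 2) ^ e" for n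
  using bb[of n] by simp
 show ?thesis using growth[OF s(1), of "real i + 7" C e]
 proof eventually_elim
  case (elim n)
  have "real (budget n + n + 5) \<le> 2 powr (5 * s * n)" using b[of n] elim by linarith
  then have "log 2 (budget n + n + 5) \<le> log 2 (2 powr (5 * s * n))" by (subst log_le_cancel_iff) auto
  also have "\<dots> \<le> \<delta> * n" using s(2) by (simp add: mult_right_mono)
  finally show ?case .
 qed
qed

text \<open>Budgets are increased one by one. After \<open>k\<close> rounds the third component is
  the result for the budget \<open>k - 1\<close>, which explains the \<open>Suc m0\<close> rounds
  below.\<close>

definition loop_step :: "nat \<times> bool list \<times> bool list => nat \<times> bool list \<times> bool list" where
 "loop_step s = (Suc (fst s), fst (snd s), search (fst s) (fst (snd s)))"

lemma loop_steps: "(loop_step ^^ k) (0, bs, []) = (k, bs, if k = 0 then [] else search (k - 1) bs)"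
 by (induction k) (auto simp: loop_step_def)

text \<open>At most \<open>budget n + 1\<close> budgets are tried, each in time polynomial in the
  budget and in the length of the formula, and this length is polynomial in \<open>n\<close>. All of
  it is absorbed into one power of \<open>budget n + n + 5\<close>.\<close>

lemma decider: "\<exists>p A. \<forall>n \<phi>. cnf3 n \<phi> --> (\<exists>t \<le> (budget n + n + 5) ^ A. computes_in p (enc_cnf n \<phi>) t [satisfiable \<phi>])"
proof -
 have PTs: "PT (%x :: bool list. (0 :: nat, rev x, [] :: bool list))" by (intro pt)
 have PTc: "PT (%s :: nat \<times> bool list \<times> bool list. snd (snd s) = [])" by (intro pt)
 have PTf: "PT loop_step" unfolding loop_step_def[abs_def] by (intro PT_Pair PT_search pt)
 have PTo: "PT (%s :: nat \<times> bool list \<times> bool list. take 1 (snd (snd s)))" by (intro pt)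
 have PTq: "PT (%u. search (fst u) (snd u))" by (intro PT_search pt)
 have PTe: "PT (%u. enc_cnf (fst u) (snd u))" by (intro pt)
 obtain ci ti a0 where ci: "\<And>x :: bool list. run ci (venc x) (venc (0 :: nat, rev x, [] :: bool list)) (ti x)"
  and a0: "\<And>x. ti x \<le> (sz x + 2) ^ a0" using PTs unfolding PT_def pb_def by blast
 obtain cc tc a1 where cc: "\<And>s :: nat \<times> bool list \<times> bool list. run cc (venc s) (venc (snd (snd s) = [])) (tc s)"
  and a1: "\<And>s. tc s \<le> (sz s + 2) ^ a1" using PTc unfolding PT_def pb_def by blast
 obtain cf tf a2 where cf: "\<And>s. run cf (venc s) (venc (loop_step s)) (tf s)"
  and a2: "\<And>s. tf s \<le> (sz s + 2) ^ a2" using PTf unfolding PT_def pb_def by blast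
 obtain co "to" a4 where co: "\<And>s :: nat \<times> bool list \<times> bool list. run co (venc s) (venc (take 1 (snd (snd s)))) (to s)"
  and a4: "\<And>s. to s \<le> (sz s + 2) ^ a4" using PTo unfolding PT_def pb_def by blast
 obtain a3 where a3: "\<And>u. sz (search (fst u) (snd u)) \<le> (sz u + 2) ^ a3" using pb_PT[OF PTq] unfolding pb_def by blast
 obtain a5 where a5: "\<And>u. sz (enc_cnf (fst u) (snd u)) \<le> (sz u + 2) ^ a5" using pb_PT[OF PTe] unfolding pb_def by blast
 have fs: "pb (%u :: nat \<times> bool list. fst u)" by (rule pb_mono[OF pb_PT[OF PT_fst[OF PT_id]]]) simp
 define S where "S = (%u :: nat \<times> bool list. 2 * fst u + (sz (snd u) + ((2 * fst u + sz (snd u) + 4) ^ a3 + 1)) + 3)"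
 have S: "pb S" unfolding S_def by (intro pb_add pb_mult pb_power pb_const fs pb_PT pt)
 define Tm where "Tm = (%u. (S u + 2) ^ a1 + (S u + 2) ^ a2)"
 have Tm: "pb Tm" unfolding Tm_def by (intro pb_add pb_power pb_const S)
 have "pb (%u. (sz (snd u) + 2) ^ a0 + (fst u * (Tm u + 3) + Tm u + 3) + (S u + 2) ^ a4 + 12 * sz (snd u) + 6 + 7)"
  by (intro pb_add pb_mult pb_power pb_const S Tm fs pb_PT pt)
 then obtain A where A: "\<And>u. (sz (snd u) + 2) ^ a0 + (fst u * (Tm u + 3) + Tm u + 3) + (S u + 2) ^ a4 + 12 * sz (snd u) + 6 + 7 \<le> (sz u + 2) ^ A"
  unfolding pb_def by blast
 have "pb (%n. (2 * n + 1 + cnf_size n + 1 + 2) ^ a5)"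
 proof (rule pb_mono[OF pb_PT])
  show "PT (%n. (2 * n + 1 + cnf_size n + 1 + 2) ^ a5)" unfolding cnf_size_def by (intro pt)
 qed simp
 then obtain a6 where a6: "\<And>n. (2 * n + 1 + cnf_size n + 1 + 2) ^ a5 \<le> (sz n + 2) ^ a6" unfolding pb_def by blast
 let ?c = "Cseq ci (Cseq (Cwhile cc cf) co)"
 have "\<exists>t \<le> (budget n + n + 5) ^ ((2 * a6 + 3) * A). computes_in (io_prog ?c) (enc_cnf n \<phi>) t [satisfiable \<phi>]" if \<phi>: "cnf3 n \<phi>" for n \<phi>
 proof -
  define bs where "bs = enc_cnf n \<phi>"
  define m0 where "m0 = (LEAST b. search b bs ~= [])"
  have b: "search (budget n) bs ~= []" using works_budget \<phi> unfolding works_def bs_def by blast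
  have m0: "search m0 bs ~= []" "m0 \<le> budget n" unfolding m0_def
   using LeastI[of "%b. search b bs ~= []", OF b] Least_le[of "%b. search b bs ~= []", OF b] by blast+
  have less: "search j bs = []" if "j < m0" for j using not_less_Least that unfolding m0_def by blast
  let ?m = "Suc m0" and ?u = "(Suc m0, bs)"
  let ?s = "%k. (loop_step ^^ k) (0, bs, [])"
  have sz: "sz (?s k) \<le> S ?u" if "k \<le> ?m" for k
  proof -
   have "sz (if k = 0 then [] else search (k - 1) bs) \<le> (2 * ?m + sz bs + 4) ^ a3 + 1"
   proof (cases "k = 0")
    case False
    have "sz (search (k - 1) bs) \<le> (sz (k - 1, bs) + 2) ^ a3" using a3[of "(k - 1, bs)"] by simp
    also have "\<dots> \<le> (2 * ?m + sz bs + 4) ^ a3" using that by (intro power_mono) simp_all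
    finally show ?thesis using False by simp
   qed simp
   then show ?thesis using that unfolding loop_steps S_def by simp
  qed
  have w: "run (Cwhile cc cf) (venc (0 :: nat, bs, [] :: bool list)) (venc (?s ?m)) (?m * (Tm ?u + 3) + Tm ?u + 3)"
  proof (rule run_while[OF cc cf])
   show "snd (snd (?s k)) = []" if "k < ?m" for k using that less by (simp add: loop_steps)
   show "snd (snd (?s ?m)) ~= []" unfolding loop_steps using m0(1) by simp
   fix k assume "k \<le> ?m"
   have "(sz (?s k) + 2) ^ a \<le> (S ?u + 2) ^ a" for a using sz[OF \<open>k \<le> ?m\<close>] by (intro power_mono) simp_all
   then show "tc (?s k) + tf (?s k) \<le> Tm ?u" unfolding Tm_def using a1 a2 by (meson add_mono le_trans)
  qed
  \<comment> \<open>Several levels may answer with the same budget; by soundness all answers agree,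
    and one of them is printed.\<close>
  have "take 1 (search m0 bs) = [satisfiable \<phi>]"
   using m0(1) search_sound[OF \<phi>, of _ m0] unfolding bs_def by (cases "search m0 (enc_cnf n \<phi>)") auto
  then have o: "run co (venc (?s ?m)) (venc [satisfiable \<phi>]) (to (?s ?m))" using co[of "?s ?m"] unfolding loop_steps by simp
  have i: "run ci (venc (rev bs)) (venc (0 :: nat, bs, [] :: bool list)) (ti (rev bs))" using ci[of "rev bs"] by simp
  let ?t = "ti (rev bs) + ((?m * (Tm ?u + 3) + Tm ?u + 3) + to (?s ?m))"
  have "run ?c (blist (rev bs)) (blist [satisfiable \<phi>]) ?t"
   using run_seq[OF i run_seq[OF w o]] by (simp only: venc_blist)
  from run_computes_in[OF this] have "computes_in (io_prog ?c) bs (?t + 12 * length bs + 6 * length [satisfiable \<phi>] + 7) [satisfiable \<phi>]" .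
  moreover have "?t + 12 * length bs + 6 * length [satisfiable \<phi>] + 7 \<le> (budget n + n + 5) ^ ((2 * a6 + 3) * A)"
  proof -
   let ?W = "budget n + n + 5"
   have "ti (rev bs) \<le> (sz bs + 2) ^ a0" using a0[of "rev bs"] by simp
   moreover have "to (?s ?m) \<le> (S ?u + 2) ^ a4"
    using a4[of "?s ?m"] power_mono[of "sz (?s ?m) + 2" "S ?u + 2" a4] sz[of ?m] by simp
   moreover have "length bs \<le> sz bs" using length_less_sz[of bs] by simp
   ultimately have "?t + 12 * length bs + 6 * length [satisfiable \<phi>] + 7 \<le>
    (sz (snd ?u) + 2) ^ a0 + (fst ?u * (Tm ?u + 3) + Tm ?u + 3) + (S ?u + 2) ^ a4 + 12 * sz (snd ?u) + 6 + 7"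
    by (simp del: mult_Suc)
   also have "\<dots> \<le> (sz ?u + 2) ^ A" by (rule A)
   also have "\<dots> \<le> (?W ^ (2 * a6 + 3)) ^ A"
   proof (rule power_mono)
    have "sz bs \<le> (sz (n, \<phi>) + 2) ^ a5" using a5[of "(n, \<phi>)"] by (simp add: bs_def)
    also have "\<dots> \<le> (2 * n + 1 + cnf_size n + 1 + 2) ^ a5" using sz_cnf3[OF \<phi>] by (intro power_mono) simp_all
    also have "\<dots> \<le> (sz n + 2) ^ a6" by (rule a6)
    also have "\<dots> \<le> (?W ^ 2) ^ a6" by (intro power_mono) (simp_all add: power2_eq_square algebra_simps)
    finally have "sz bs \<le> ?W ^ (2 * a6)" by (simp only: power_mult)
    also have "\<dots> \<le> ?W ^ (2 * a6 + 2)" by (intro power_increasing) auto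
    finally have 1: "sz bs \<le> ?W ^ (2 * a6 + 2)" .
    have "2 * Suc m0 + 4 \<le> ?W ^ 2" using m0(2) by (simp add: power2_eq_square algebra_simps)
    also have "\<dots> \<le> ?W ^ (2 * a6 + 2)" by (intro power_increasing) auto
    finally have "sz ?u + 2 \<le> 2 * ?W ^ (2 * a6 + 2)" using 1 by simp
    also have "\<dots> \<le> ?W * ?W ^ (2 * a6 + 2)" by (intro mult_le_mono1) simp
    finally show "sz ?u + 2 \<le> ?W ^ (2 * a6 + 3)" by (simp add: numeral_3_eq_3)
   qed simp
   also have "\<dots> = ?W ^ ((2 * a6 + 3) * A)" by (simp only: power_mult)
   finally show ?thesis .
  qed
  ultimately show ?thesis unfolding bs_def by blast
 qed
 then show ?thesis by blast
qed

text \<open>A power of the budget is \<open>2 powr g n\<close>, where \<open>g\<close> is a multiple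
  of its logarithm. By \<open>budget_growth\<close> this logarithm is below every
  \<open>\<delta> * n\<close> eventually, so \<open>g\<close> is o(n).\<close>

theorem not_ETH: "\<not> ETH"
proof -
 obtain p' A where p': "\<And>n \<phi>. cnf3 n \<phi> ==> \<exists>t \<le> (budget n + n + 5) ^ A. computes_in p' (enc_cnf n \<phi>) t [satisfiable \<phi>]"
  using decider by blast
 define g where "g = (%n. real A * log 2 (budget n + n + 5))"
 have "g \<in> o(%n. real n)"
 proof (rule landau_o.smallI)
  fix c :: real assume c: "0 < c"
  have "eventually (%n. log 2 (budget n + n + 5) \<le> c / real (Suc A) * n) at_top" by (rule budget_growth) (use c in simp)
  then show "eventually (%n. norm (g n) \<le> c * norm (real n)) at_top"
  proof eventually_elim
   case (elim n)
   have l: "0 \<le> log 2 (budget n + n + 5)" by (intro zero_le_log_cancel_iff[THEN iffD2]) auto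
   have "g n \<le> real (Suc A) * log 2 (budget n + n + 5)" unfolding g_def using l by (intro mult_right_mono) auto
   also have "\<dots> \<le> real (Suc A) * (c / real (Suc A) * n)" using elim by (intro mult_left_mono) auto
   also have "\<dots> = c * n" by simp
   finally show ?case using l by (simp add: g_def)
  qed
 qed
 moreover have "\<exists>t. real t \<le> 2 powr g n & computes_in p' (enc_cnf n \<phi>) t [satisfiable \<phi>]" if \<phi>: "cnf3 n \<phi>" for n \<phi>
 proof -
  obtain t where t: "t \<le> (budget n + n + 5) ^ A" "computes_in p' (enc_cnf n \<phi>) t [satisfiable \<phi>]" using p'[OF \<phi>] by blast
  have "2 powr g n = (2 powr log 2 (budget n + n + 5)) powr A" unfolding g_def powr_powr by (simp only: mult.commute)
  also have "\<dots> = real (budget n + n + 5) powr A" by (subst powr_log_cancel) auto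
  also have "\<dots> = real ((budget n + n + 5) ^ A)" by (subst powr_realpow) auto
  finally have "real t \<le> 2 powr g n" using t(1) of_nat_mono by fastforce
  then show ?thesis using t(2) by blast
 qed
 ultimately show ?thesis unfolding ETH_def by blast
qed

end

theorem theorem3p7:
  fixes T :: "'a graph"
  assumes "is_tree T" and "card (edges T) \<ge> 2"
  shows "NP_complete (free_edge_deletion T) \<and> (ETH \<longrightarrow> \<not> subexp_solvable T)"
proof -
 obtain R where R: "hard_red T R" using tree_hard assms by blast
 have "simple_graph T" using assms(1) by (simp add: is_tree_def)
 then have "NP_complete (free_edge_deletion T)"
  unfolding NP_complete_def using free_edge_deletion_in_NP NP_hard[OF R] by blast
 moreover have "\<not> ETH" if sub: "subexp_solvable T"
 proof -
  obtain p f and q :: "nat poly" where "f \<in> o(%k. real k)" "\<And>G k. numbered_graph G ==>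
   \<exists>t. real t \<le> 2 powr f k * real (poly q (graph_size G)) & computes_in p (enc_instance G k) t [edge_deletable T G k]"
   using sub unfolding subexp_solvable_def by blast
  then interpret solver T R p f q by unfold_locales (use R in auto)
  show ?thesis by (rule not_ETH)
 qed
 ultimately show ?thesis by blast
qed

end
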